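(* Let $k$ be a field and let $\Lambda$ be a finite-dimensional split indecomposable weakly symmetric $k$-algebra with radical cube zero. Let $S_1,\dots,S_r$ be representatives of the isomorphism classes of simple left $\Lambda$-modules and let $\lambda$ be the spectral radius of the matrix $E=(\dim_k\operatorname{Ext}^1_\Lambda(S_i,S_j))_{1\le i,j\le r}$. If $\lambda<2$, then the only thick subcategories of $\operatorname{mod}\Lambda$ containing $\Lambda$ are $\operatorname{add}\Lambda$ and $\operatorname{mod}\Lambda$.
   Context: $\operatorname{mod}\Lambda$ is the category of finitely generated left $\Lambda$-modules and $\operatorname{add}\Lambda$ its subcategory of projective modules. $\Lambda$ is split if $\Lambda/\operatorname{rad}\Lambda\cong\prod_{i=1}^rM_{n_i}(k)$ as $k$-algebras; weakly symmetric if ${}_\Lambda\Lambda$ is injective and the socle and top of every indecomposable projective left $\Lambda$-module are isomorphic; of radical cube zero if $(\operatorname{rad}\Lambda)^3=0$; indecomposable if it is not a product of two nonzero algebras. The spectral radius is the maximum absolute value of the eigenvalues. A (full, isomorphism-closed) subcategory of $\operatorname{mod}\Lambda$ is thick if it is closed under direct summands and, for every short exact sequence, if two of the three terms belong to it then so does the third. *)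

theory Defs
  imports
    "Jordan_Normal_Form.VS_Connect"
    "Jordan_Normal_Form.Spectral_Radius"
    "HOL-Algebra.Chinese_Remainder"
    "HOL-Algebra.Ideal_Product"
begin

section \<open>Algebras over a field\<close>

text \<open>The ground field is a type \<^typ>\<open>'k\<close> of class \<^class>\<open>field\<close>, seen as the ring record
  \<^term>\<open>class_ring\<close>. The locale \<^locale>\<open>algebra\<close> of the library is restricted to commutative
  algebras, hence the following one. The zero algebra is allowed.\<close>

locale k_algebra = ring \<Lambda> + vectorspace class_ring \<Lambda>
  for \<Lambda> :: "('k::field, 'a) module" (structure) +
  assumes smult_mult_left:
      "\<lbrakk>x \<in> carrier \<Lambda>; y \<in> carrier \<Lambda>\<rbrakk> \<Longrightarrow> (c \<odot> x) \<otimes> y = c \<odot> (x \<otimes> y)"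
    and smult_mult_right:
      "\<lbrakk>x \<in> carrier \<Lambda>; y \<in> carrier \<Lambda>\<rbrakk> \<Longrightarrow> x \<otimes> (c \<odot> y) = c \<odot> (x \<otimes> y)"

definition fd_algebra :: "('k::field, 'a) module \<Rightarrow> bool" where
  "fd_algebra \<Lambda> \<longleftrightarrow> k_algebra \<Lambda> \<and> vectorspace.fin_dim class_ring \<Lambda>"

definition alg_iso :: "('k, 'a) module \<Rightarrow> ('k, 'b) module \<Rightarrow> bool" where
  "alg_iso A B \<longleftrightarrow> (\<exists>h \<in> ring_iso A B. \<forall>c. \<forall>x \<in> carrier A. h (c \<odot>\<^bsub>A\<^esub> x) = c \<odot>\<^bsub>B\<^esub> h x)"

text \<open>The type \<^typ>\<open>('r, 'm) module\<close> extends that of rings, so the next two constructions apply both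
  to algebras and to modules. For a module, the fields \<^const>\<open>mult\<close> and \<^const>\<open>one\<close> are
  meaningless and are ignored everywhere below.\<close>

definition quot_mod :: "('r, 'm) module \<Rightarrow> 'm set \<Rightarrow> ('r, 'm set) module" where
  "quot_mod M N = ring.extend (M Quot N)
     \<lparr> smult = (\<lambda>a X. \<Union>x\<in>X. N +>\<^bsub>M\<^esub> (a \<odot>\<^bsub>M\<^esub> x)) \<rparr>"

definition dsum :: "('r, 'm) module \<Rightarrow> ('r, 'n) module \<Rightarrow> ('r, 'm \<times> 'n) module" where
  "dsum M N = ring.extend (RDirProd M N)
     \<lparr> smult = (\<lambda>a (x, y). (a \<odot>\<^bsub>M\<^esub> x, a \<odot>\<^bsub>N\<^esub> y)) \<rparr>"

text \<open>\<open>M\<^bsub>n\<^sub>1\<^esub>(k) \<times> \<dots> \<times> M\<^bsub>n\<^sub>r\<^esub>(k)\<close> for the list of sizes \<open>[n\<^sub>1, \<dots>, n\<^sub>r]\<close>\<close>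

definition mat_alg_prod :: "nat list \<Rightarrow> ('k::field, 'k mat list) module" where
  "mat_alg_prod ns = ring.extend (RDirProd_list (map (\<lambda>n. ring_mat TYPE('k) n ()) ns))
     \<lparr> smult = (\<lambda>c. map (\<lambda>A. c \<cdot>\<^sub>m A)) \<rparr>"

text \<open>The factors may be sought on the carrier type of \<open>\<Lambda>\<close>: a factor of a product algebra embeds
  into it as a vector space.\<close>

definition indecomposable_alg :: "('k::field, 'a) module \<Rightarrow> bool" where
  "indecomposable_alg \<Lambda> \<longleftrightarrow>
     \<not> (\<exists>(A :: ('k, 'a) module) (B :: ('k, 'a) module). k_algebra A \<and> k_algebra B \<and>
          carrier A \<noteq> {\<zero>\<^bsub>A\<^esub>} \<and> carrier B \<noteq> {\<zero>\<^bsub>B\<^esub>} \<and> alg_iso \<Lambda> (dsum A B))"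


section \<open>Left modules\<close>

text \<open>The locale \<^locale>\<open>Module.module\<close> of the library requires a commutative ring.\<close>

locale left_module = R?: ring R + M?: abelian_group M
  for R :: "('r, 'x) ring_scheme" (structure) and M :: "('r, 'm) module" (structure) +
  assumes lsmult_closed: "\<lbrakk>a \<in> carrier R; x \<in> carrier M\<rbrakk> \<Longrightarrow> a \<odot>\<^bsub>M\<^esub> x \<in> carrier M"
    and lsmult_l_distr: "\<lbrakk>a \<in> carrier R; b \<in> carrier R; x \<in> carrier M\<rbrakk>
      \<Longrightarrow> (a \<oplus>\<^bsub>R\<^esub> b) \<odot>\<^bsub>M\<^esub> x = a \<odot>\<^bsub>M\<^esub> x \<oplus>\<^bsub>M\<^esub> b \<odot>\<^bsub>M\<^esub> x"
    and lsmult_r_distr: "\<lbrakk>a \<in> carrier R; x \<in> carrier M; y \<in> carrier M\<rbrakk>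
      \<Longrightarrow> a \<odot>\<^bsub>M\<^esub> (x \<oplus>\<^bsub>M\<^esub> y) = a \<odot>\<^bsub>M\<^esub> x \<oplus>\<^bsub>M\<^esub> a \<odot>\<^bsub>M\<^esub> y"
    and lsmult_assoc: "\<lbrakk>a \<in> carrier R; b \<in> carrier R; x \<in> carrier M\<rbrakk>
      \<Longrightarrow> (a \<otimes>\<^bsub>R\<^esub> b) \<odot>\<^bsub>M\<^esub> x = a \<odot>\<^bsub>M\<^esub> (b \<odot>\<^bsub>M\<^esub> x)"
    and lsmult_one: "x \<in> carrier M \<Longrightarrow> \<one>\<^bsub>R\<^esub> \<odot>\<^bsub>M\<^esub> x = x"

definition regular :: "('k, 'a) module \<Rightarrow> ('a, 'a) module" where
  "regular \<Lambda> = ring.extend (ring.truncate \<Lambda>) \<lparr> smult = mult \<Lambda> \<rparr>"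

text \<open>Homomorphisms are taken extensional, so that equal homomorphisms are equal functions.\<close>

definition lhom :: "('a, 'x) ring_scheme \<Rightarrow> ('a, 'm) module \<Rightarrow> ('a, 'n) module \<Rightarrow> ('m \<Rightarrow> 'n) set" where
  "lhom R M N = {f \<in> carrier M \<rightarrow>\<^sub>E carrier N.
     (\<forall>x \<in> carrier M. \<forall>y \<in> carrier M. f (x \<oplus>\<^bsub>M\<^esub> y) = f x \<oplus>\<^bsub>N\<^esub> f y) \<and>
     (\<forall>a \<in> carrier R. \<forall>x \<in> carrier M. f (a \<odot>\<^bsub>M\<^esub> x) = a \<odot>\<^bsub>N\<^esub> f x)}"

definition lmod_iso :: "('a, 'x) ring_scheme \<Rightarrow> ('a, 'm) module \<Rightarrow> ('a, 'n) module \<Rightarrow> bool" where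
  "lmod_iso R M N \<longleftrightarrow> (\<exists>f \<in> lhom R M N. bij_betw f (carrier M) (carrier N))"

definition lspan :: "('a, 'x) ring_scheme \<Rightarrow> ('a, 'm) module \<Rightarrow> 'm set \<Rightarrow> 'm set" where
  "lspan R M X = \<Inter>{N. Module.submodule N R M \<and> X \<subseteq> N}"

definition fin_gen :: "('a, 'x) ring_scheme \<Rightarrow> ('a, 'm) module \<Rightarrow> bool" where
  "fin_gen R M \<longleftrightarrow> (\<exists>X \<subseteq> carrier M. finite X \<and> lspan R M X = carrier M)"

definition simple_mod :: "('a, 'x) ring_scheme \<Rightarrow> ('a, 'm) module \<Rightarrow> bool" where
  "simple_mod R M \<longleftrightarrow> carrier M \<noteq> {\<zero>\<^bsub>M\<^esub>} \<and>
     (\<forall>N. Module.submodule N R M \<longrightarrow> N = {\<zero>\<^bsub>M\<^esub>} \<or> N = carrier M)"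

definition maximal_submod :: "('a, 'x) ring_scheme \<Rightarrow> ('a, 'm) module \<Rightarrow> 'm set \<Rightarrow> bool" where
  "maximal_submod R M N \<longleftrightarrow> Module.submodule N R M \<and> N \<noteq> carrier M \<and>
     (\<forall>L. Module.submodule L R M \<and> N \<subseteq> L \<longrightarrow> L = N \<or> L = carrier M)"

text \<open>The intersection with the carrier matters only if there is no maximal submodule.\<close>

definition mod_rad :: "('a, 'x) ring_scheme \<Rightarrow> ('a, 'm) module \<Rightarrow> 'm set" where
  "mod_rad R M = carrier M \<inter> \<Inter>{N. maximal_submod R M N}"

definition mod_top :: "('a, 'x) ring_scheme \<Rightarrow> ('a, 'm) module \<Rightarrow> ('a, 'm set) module" where
  "mod_top R M = quot_mod M (mod_rad R M)"

definition mod_soc :: "('a, 'x) ring_scheme \<Rightarrow> ('a, 'm) module \<Rightarrow> ('a, 'm) module" where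
  "mod_soc R M = M\<lparr>carrier :=
     lspan R M (\<Union>{N. Module.submodule N R M \<and> simple_mod R (M\<lparr>carrier := N\<rparr>)})\<rparr>"

text \<open>The Jacobson radical: the intersection of the maximal left ideals\<close>

definition jrad :: "('k, 'a) module \<Rightarrow> 'a set" where
  "jrad \<Lambda> = mod_rad \<Lambda> (regular \<Lambda>)"


section \<open>The category of finitely generated left modules\<close>

text \<open>Objects are the finitely generated modules whose carrier is any subset of \<^typ>\<open>'k vec\<close>, with
  arbitrary operations. As \<^typ>\<open>'k vec\<close> contains \<^term>\<open>carrier_vec n :: 'k vec set\<close> for all \<open>n\<close>, every finitely
  generated module over a finite-dimensional \<open>k\<close>-algebra, on whatever type, is isomorphic to an object.\<close>

definition modcat :: "('k::field, 'a) module \<Rightarrow> ('a, 'k vec) module set" where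
  "modcat \<Lambda> = {M. left_module \<Lambda> M \<and> fin_gen \<Lambda> M}"

text \<open>Projectivity and injectivity are tested in \<^const>\<open>modcat\<close>. Over a finite-dimensional algebra
  this agrees, for finitely generated modules, with testing against all modules (for injectivity, by
  Baer's criterion).\<close>

definition projective :: "('k::field, 'a) module \<Rightarrow> ('a, 'm) module \<Rightarrow> bool" where
  "projective \<Lambda> P \<longleftrightarrow>
     (\<forall>A \<in> modcat \<Lambda>. \<forall>B \<in> modcat \<Lambda>. \<forall>g \<in> lhom \<Lambda> A B. \<forall>f \<in> lhom \<Lambda> P B.
        g ` carrier A = carrier B \<longrightarrow> (\<exists>h \<in> lhom \<Lambda> P A. \<forall>x \<in> carrier P. g (h x) = f x))"

definition injective :: "('k::field, 'a) module \<Rightarrow> ('a, 'm) module \<Rightarrow> bool" where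
  "injective \<Lambda> I \<longleftrightarrow>
     (\<forall>A \<in> modcat \<Lambda>. \<forall>B \<in> modcat \<Lambda>. \<forall>g \<in> lhom \<Lambda> A B. \<forall>f \<in> lhom \<Lambda> A I.
        inj_on g (carrier A) \<longrightarrow> (\<exists>h \<in> lhom \<Lambda> B I. \<forall>x \<in> carrier A. h (g x) = f x))"

definition addcat :: "('k::field, 'a) module \<Rightarrow> ('a, 'k vec) module set" where
  "addcat \<Lambda> = {P \<in> modcat \<Lambda>. projective \<Lambda> P}"

definition indecomposable_mod :: "('k::field, 'a) module \<Rightarrow> ('a, 'k vec) module \<Rightarrow> bool" where
  "indecomposable_mod \<Lambda> M \<longleftrightarrow> carrier M \<noteq> {\<zero>\<^bsub>M\<^esub>} \<and>
     (\<forall>A \<in> modcat \<Lambda>. \<forall>B \<in> modcat \<Lambda>. lmod_iso \<Lambda> M (dsum A B) \<longrightarrow>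
        carrier A = {\<zero>\<^bsub>A\<^esub>} \<or> carrier B = {\<zero>\<^bsub>B\<^esub>})"

definition short_exact ::
  "('k::field, 'a) module \<Rightarrow> ('a, 'k vec) module \<Rightarrow> ('a, 'k vec) module \<Rightarrow> ('a, 'k vec) module \<Rightarrow> bool" where
  "short_exact \<Lambda> A B C \<longleftrightarrow> (\<exists>f \<in> lhom \<Lambda> A B. \<exists>g \<in> lhom \<Lambda> B C.
     inj_on f (carrier A) \<and> f ` carrier A = {y \<in> carrier B. g y = \<zero>\<^bsub>C\<^esub>} \<and>
     g ` carrier B = carrier C)"

definition thick :: "('k::field, 'a) module \<Rightarrow> ('a, 'k vec) module set \<Rightarrow> bool" where
  "thick \<Lambda> T \<longleftrightarrow> T \<subseteq> modcat \<Lambda> \<and>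
     (\<forall>M \<in> T. \<forall>N \<in> modcat \<Lambda>. lmod_iso \<Lambda> M N \<longrightarrow> N \<in> T) \<and>
     (\<forall>M \<in> T. \<forall>A \<in> modcat \<Lambda>. \<forall>B \<in> modcat \<Lambda>. lmod_iso \<Lambda> M (dsum A B) \<longrightarrow> A \<in> T) \<and>
     (\<forall>A \<in> modcat \<Lambda>. \<forall>B \<in> modcat \<Lambda>. \<forall>C \<in> modcat \<Lambda>. short_exact \<Lambda> A B C \<longrightarrow>
        (A \<in> T \<and> B \<in> T \<longrightarrow> C \<in> T) \<and> (A \<in> T \<and> C \<in> T \<longrightarrow> B \<in> T) \<and> (B \<in> T \<and> C \<in> T \<longrightarrow> A \<in> T))"

text \<open>The regular module lives on another type than the objects of \<^const>\<open>modcat\<close>; for an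
  isomorphism-closed \<open>T\<close> the following says that \<open>T\<close> contains its copies in \<^const>\<open>modcat\<close>.\<close>

definition contains_regular :: "('k::field, 'a) module \<Rightarrow> ('a, 'k vec) module set \<Rightarrow> bool" where
  "contains_regular \<Lambda> T \<longleftrightarrow> (\<exists>M \<in> T. lmod_iso \<Lambda> (regular \<Lambda>) M)"

definition simple_reps :: "('k::field, 'a) module \<Rightarrow> nat \<Rightarrow> (nat \<Rightarrow> ('a, 'k vec) module) \<Rightarrow> bool" where
  "simple_reps \<Lambda> r S \<longleftrightarrow> (\<forall>i<r. S i \<in> modcat \<Lambda> \<and> simple_mod \<Lambda> (S i)) \<and>
     (\<forall>M \<in> modcat \<Lambda>. simple_mod \<Lambda> M \<longrightarrow> (\<exists>!i. i < r \<and> lmod_iso \<Lambda> M (S i)))"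


section \<open>Conditions on the algebra\<close>

definition split_alg :: "('k::field, 'a) module \<Rightarrow> bool" where
  "split_alg \<Lambda> \<longleftrightarrow> (\<exists>ns. (\<forall>n \<in> set ns. 0 < n) \<and>
     alg_iso (quot_mod \<Lambda> (jrad \<Lambda>)) (mat_alg_prod ns :: ('k, 'k mat list) module))"

definition weakly_symmetric :: "('k::field, 'a) module \<Rightarrow> bool" where
  "weakly_symmetric \<Lambda> \<longleftrightarrow> injective \<Lambda> (regular \<Lambda>) \<and>
     (\<forall>P \<in> addcat \<Lambda>. indecomposable_mod \<Lambda> P \<longrightarrow> lmod_iso \<Lambda> (mod_soc \<Lambda> P) (mod_top \<Lambda> P))"

definition radical_cube_zero :: "('k, 'a) module \<Rightarrow> bool" where
  "radical_cube_zero \<Lambda> \<longleftrightarrow>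
     ideal_prod \<Lambda> (ideal_prod \<Lambda> (jrad \<Lambda>) (jrad \<Lambda>)) (jrad \<Lambda>) = {\<zero>\<^bsub>\<Lambda>\<^esub>}"


section \<open>Ext groups\<close>

text \<open>The \<open>k\<close>-vector space of homomorphisms, with \<open>c \<in> k\<close> acting on modules as \<open>c \<cdot> 1 \<in> \<Lambda>\<close>\<close>

definition hom_space ::
  "('k, 'a) module \<Rightarrow> ('a, 'm) module \<Rightarrow> ('a, 'n) module \<Rightarrow> ('k, 'm \<Rightarrow> 'n) module" where
  "hom_space \<Lambda> M N =
     \<lparr> carrier = lhom \<Lambda> M N, mult = undefined, one = undefined,
       zero = (\<lambda>x\<in>carrier M. \<zero>\<^bsub>N\<^esub>),
       add = (\<lambda>f g. \<lambda>x\<in>carrier M. f x \<oplus>\<^bsub>N\<^esub> g x),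
       smult = (\<lambda>c f. \<lambda>x\<in>carrier M. (c \<odot>\<^bsub>\<Lambda>\<^esub> \<one>\<^bsub>\<Lambda>\<^esub>) \<odot>\<^bsub>N\<^esub> f x) \<rparr>"

text \<open>\<open>\<dots> \<rightarrow> P 2 \<rightarrow> P 1 \<rightarrow> P 0 \<rightarrow> M \<rightarrow> 0\<close>, with differentials \<open>d n : P (n + 1) \<rightarrow> P n\<close> and augmentation \<open>e\<close>\<close>

definition proj_resolution ::
  "('k::field, 'a) module \<Rightarrow> ('a, 'k vec) module \<Rightarrow>
   (nat \<Rightarrow> ('a, 'k vec) module) \<Rightarrow> (nat \<Rightarrow> 'k vec \<Rightarrow> 'k vec) \<Rightarrow> ('k vec \<Rightarrow> 'k vec) \<Rightarrow> bool" where
  "proj_resolution \<Lambda> M P d e \<longleftrightarrow>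
     (\<forall>n. P n \<in> addcat \<Lambda> \<and> d n \<in> lhom \<Lambda> (P (Suc n)) (P n)) \<and>
     e \<in> lhom \<Lambda> (P 0) M \<and> e ` carrier (P 0) = carrier M \<and>
     d 0 ` carrier (P (Suc 0)) = {x \<in> carrier (P 0). e x = \<zero>\<^bsub>M\<^esub>} \<and>
     (\<forall>n. d (Suc n) ` carrier (P (Suc (Suc n))) =
        {x \<in> carrier (P (Suc n)). d n x = \<zero>\<^bsub>P n\<^esub>})"

text \<open>The \<open>n\<close>-th cohomology of the complex of homomorphisms from a deleted resolution to \<open>N\<close>\<close>

definition hom_cohomology ::
  "('k::field, 'a) module \<Rightarrow> (nat \<Rightarrow> ('a, 'k vec) module) \<Rightarrow> (nat \<Rightarrow> 'k vec \<Rightarrow> 'k vec) \<Rightarrow>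
   nat \<Rightarrow> ('a, 'k vec) module \<Rightarrow> ('k, ('k vec \<Rightarrow> 'k vec) set) module" where
  "hom_cohomology \<Lambda> P d n N =
     quot_mod
       ((hom_space \<Lambda> (P n) N)\<lparr>carrier :=
          {f \<in> lhom \<Lambda> (P n) N. \<forall>x \<in> carrier (P (Suc n)). f (d n x) = \<zero>\<^bsub>N\<^esub>}\<rparr>)
       (case n of
          0 \<Rightarrow> {\<lambda>x\<in>carrier (P 0). \<zero>\<^bsub>N\<^esub>}
        | Suc m \<Rightarrow> (\<lambda>f. compose (carrier (P n)) f (d m)) ` lhom \<Lambda> (P m) N)"

text \<open>The choice of resolution is immaterial up to isomorphism.\<close>

definition Ext ::
  "('k::field, 'a) module \<Rightarrow> nat \<Rightarrow> ('a, 'k vec) module \<Rightarrow> ('a, 'k vec) module \<Rightarrow>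
   ('k, ('k vec \<Rightarrow> 'k vec) set) module" where
  "Ext \<Lambda> n M N =
     (let (P, d) = (SOME (P, d). \<exists>e. proj_resolution \<Lambda> M P d e) in hom_cohomology \<Lambda> P d n N)"

definition ext_matrix ::
  "('k::field, 'a) module \<Rightarrow> nat \<Rightarrow> (nat \<Rightarrow> ('a, 'k vec) module) \<Rightarrow> complex mat" where
  "ext_matrix \<Lambda> r S =
     mat r r (\<lambda>(i, j). of_nat (vectorspace.dim class_ring (Ext \<Lambda> 1 (S i) (S j))))"

end

theory Submission
  imports Defs
begin

text \<open>Let \<open>T\<close> be a thick subcategory containing \<open>\<Lambda>\<close>. If \<open>T\<close> contains a simple module \<open>S\<close>, it contains the
  socle of the projective cover \<open>P\<close> of \<open>S\<close>, hence all simple subquotients of \<open>P\<close>, and by indecomposability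
  all simple modules, so \<open>T = mod \<Lambda>\<close>.

  Suppose that \<open>T\<close> contains no simple module but some \<open>X\<close> which is not projective. Every module in \<open>T\<close> has
  its socle inside its radical. Let \<open>M\<^sub>0, M\<^sub>1, \<dots>\<close> be the successive syzygies of \<open>X\<close>; they are nonzero, lie in
  \<open>T\<close> and have no projective submodules. If \<open>P \<rightarrow> M\<^sub>n\<close> is the projective cover, it follows that
  \<open>rad M\<^sub>n\<^sub>+\<^sub>1 = soc M\<^sub>n\<^sub>+\<^sub>1 = soc P\<close>, whose composition factors are those of the top of \<open>M\<^sub>n\<close>. With the row vector
  \<open>h(M) = (dim Hom(M, S\<^sub>i))\<^sub>i\<close>, the exact sequence of \<open>M\<^sub>n\<^sub>+\<^sub>1\<close>, \<open>rad P\<close> and \<open>rad M\<^sub>n\<close> gives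
  \<open>h(M\<^sub>n\<^sub>+\<^sub>1) + h(rad M\<^sub>n) \<le> h(M\<^sub>n) E\<close> and thus \<open>h(M\<^sub>n\<^sub>+\<^sub>1) + h(M\<^sub>n\<^sub>-\<^sub>1) \<le> h(M\<^sub>n) E\<close>. As the spectral radius of \<open>E\<close> is less
  than \<open>2\<close>, there is \<open>v \<ge> 0\<close> with \<open>E v \<le> 2 v - 1\<close>, and the nonnegative sequence \<open>a\<^sub>n = h(M\<^sub>n) v\<close> satisfies
  \<open>a\<^sub>n\<^sub>+\<^sub>1 + a\<^sub>n\<^sub>-\<^sub>1 \<le> 2 a\<^sub>n - 1\<close>, which is impossible.\<close>

section \<open>Linear algebra\<close>

text \<open>The recursion rests on one chain of inclusions. For the kernel \<open>K\<close> of a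
  projective cover \<open>P \<rightarrow> M\<close>, self-injectivity and the Fitting decomposition
  give \<open>soc P \<le> K\<close>, since a piece of the socle that embeds into \<open>M\<close>
  would produce a nonzero projective submodule of \<open>M\<close>. Then
  \<open>rad K \<le> rad(rad P) \<le> soc P = soc K \<le> rad K\<close>: the second inclusion is the
  cube-zero condition, the last one the absence of simple modules in \<open>T\<close>. So a map from
  \<open>K\<close> to a simple module kills \<open>rad(rad P)\<close> and extends to
  \<open>rad P\<close>, and \<open>Hom(-, S)\<close> is exact on \<open>K\<close>,
  \<open>rad P\<close>, \<open>rad M\<close>. Weak symmetry enters as
  \<open>soc P \<cong> P / rad P\<close>, which brings the top of \<open>M\<close> back one step
  later. \<open>Hom(rad P, S)\<close> has to be bounded only from above, so one injective map into
  \<open>Ext\<close> suffices and \<open>Ext\<close> is never computed. The weights have to satisfy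
  an inequality only, so a truncated series replaces a Perron eigenvector. Objects of
  \<open>modcat\<close> live on \<open>'k vec\<close>, while the regular module and direct sums live
  on other types. Most lemmas are therefore polymorphic in the carrier type, and
  \<open>copy_exists\<close> leads back to \<open>modcat\<close>.\<close>

definition fin_vs :: "('k::field, 'v) module \<Rightarrow> bool" where
  "fin_vs V \<longleftrightarrow> vectorspace class_ring V \<and> vectorspace.fin_dim class_ring V"

abbreviation vdim :: "('k::field, 'v) module \<Rightarrow> nat" where
  "vdim V \<equiv> vectorspace.dim class_ring V"

abbreviation lin :: "('k::field, 'v) module \<Rightarrow> ('k, 'w) module \<Rightarrow> ('v \<Rightarrow> 'w) \<Rightarrow> bool" where
  "lin V W T \<equiv> linear_map class_ring V W T"

lemma linI:
  assumes "vectorspace class_ring V" "vectorspace class_ring W"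
    and "\<And>x. x \<in> carrier V \<Longrightarrow> T x \<in> carrier W"
    and "\<And>x y. x \<in> carrier V \<Longrightarrow> y \<in> carrier V \<Longrightarrow> T (x \<oplus>\<^bsub>V\<^esub> y) = T x \<oplus>\<^bsub>W\<^esub> T y"
    and "\<And>c x. x \<in> carrier V \<Longrightarrow> T (c \<odot>\<^bsub>V\<^esub> x) = c \<odot>\<^bsub>W\<^esub> T x"
  shows "lin V W T"
  using assms
  by (auto simp: linear_map_def mod_hom_def mod_hom_axioms_def module_hom_def vectorspace_def)

lemma subspaceI:
  assumes "vectorspace class_ring V" "W \<subseteq> carrier V" "\<zero>\<^bsub>V\<^esub> \<in> W"
    and "\<And>x y. x \<in> W \<Longrightarrow> y \<in> W \<Longrightarrow> x \<oplus>\<^bsub>V\<^esub> y \<in> W"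
    and "\<And>c x. x \<in> W \<Longrightarrow> c \<odot>\<^bsub>V\<^esub> x \<in> W"
  shows "subspace class_ring W V"
  using assms by (auto simp: subspace_def LinearCombinations.submodule_def vectorspace_def)

text \<open>An independent subset of \<open>W\<close> stays independent in \<open>V\<close>, so its
  size is bounded by \<open>dim V\<close> and a maximal one exists; it is a basis of
  \<open>W\<close>. The third claim drives all later inductions on dimension.\<close>

lemma fin_vs_subspace:
  assumes V: "fin_vs V" and W: "subspace class_ring W V"
  shows "fin_vs (V\<lparr>carrier := W\<rparr>)" and "vdim (V\<lparr>carrier := W\<rparr>) \<le> vdim V"
    and "vdim (V\<lparr>carrier := W\<rparr>) = vdim V \<Longrightarrow> W = carrier V"
proof -
  interpret V: vectorspace class_ring V using V by (simp add: fin_vs_def)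
  have fd: "V.fin_dim" using V by (simp add: fin_vs_def)
  have sub: "LinearCombinations.submodule class_ring W V" using W by simp
  then have WV: "W \<subseteq> carrier V" by (simp add: LinearCombinations.submodule_def)
  interpret W: vectorspace class_ring "V\<lparr>carrier := W\<rparr>" using V.subspace_is_vs[OF W] .
  have li: "V.lin_indpt A" if "W.lin_indpt A" "A \<subseteq> W" for A
    using V.span_li_not_depend(2)[OF that(2) sub] that by simp
  have bd: "finite A \<and> card A \<le> V.dim" if "A \<subseteq> W \<and> W.lin_indpt A" for A
    using V.li_le_dim[OF fd, of A] li that WV by auto
  have e: "{} \<subseteq> W \<and> W.lin_indpt {}" unfolding W.lin_dep_def by blast
  have "\<exists>A. finite A \<and> maximal A (\<lambda>A. A \<subseteq> W \<and> W.lin_indpt A)"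
    by (rule maximal_exists[where N = V.dim and B = "{}"]) (rule bd, assumption, rule e)
  then obtain A where A: "finite A" "maximal A (\<lambda>A. A \<subseteq> carrier (V\<lparr>carrier := W\<rparr>) \<and> W.lin_indpt A)"
    by auto
  have bas: "W.basis A" using W.max_li_is_basis[OF A(2)] .
  have AW: "A \<subseteq> W" "W.lin_indpt A" using A(2) by (auto simp: maximal_def)
  have "W.fin_dim" using bas A(1) by (auto simp: W.fin_dim_def W.basis_def)
  then show "fin_vs (V\<lparr>carrier := W\<rparr>)" using W.vectorspace_axioms by (simp add: fin_vs_def)
  have dimW: "W.dim = card A" using W.dim_basis[OF A(1) bas] .
  then show "W.dim \<le> V.dim" using bd AW by auto
  assume "W.dim = V.dim"
  then have "V.basis A" using V.dim_li_is_basis[OF fd A(1)] AW WV li dimW by auto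
  then have "carrier V = V.span A" by (simp add: V.basis_def)
  also have "\<dots> \<subseteq> W" using V.span_is_subset[OF AW(1) sub] .
  finally show "W = carrier V" using WV by auto
qed

lemma rank_nullity_vs:
  assumes V: "fin_vs V" and T: "lin V W T"
  shows "fin_vs (W\<lparr>carrier := T ` carrier V\<rparr>)"
    and "vdim (W\<lparr>carrier := T ` carrier V\<rparr>) + vdim (V\<lparr>carrier := {x \<in> carrier V. T x = \<zero>\<^bsub>W\<^esub>}\<rparr>) = vdim V"
proof -
  interpret T: linear_map class_ring V W T using T .
  have fd: "T.V.fin_dim" using V by (simp add: fin_vs_def)
  have im: "T.im = T ` carrier V" by (auto simp: T.im_def)
  have ker: "T.ker = {x \<in> carrier V. T x = \<zero>\<^bsub>W\<^esub>}" by (auto simp: T.ker_def)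
  show "vdim (W\<lparr>carrier := T ` carrier V\<rparr>) + vdim (V\<lparr>carrier := {x \<in> carrier V. T x = \<zero>\<^bsub>W\<^esub>}\<rparr>) = vdim V"
    using T.rank_nullity[OF fd] unfolding im ker .
  have vsi: "vectorspace class_ring (W\<lparr>carrier := T ` carrier V\<rparr>)"
    using T.W.subspace_is_vs[OF T.imT_is_subspace] unfolding im .
  \<comment> \<open>Corestricted to its image the map is surjective, and finite dimensionality
    passes to images.\<close>
  have "lin V (W\<lparr>carrier := T ` carrier V\<rparr>) T"
    by (rule linI) (use vsi T.V.vectorspace_axioms in auto)
  then interpret T': linear_map class_ring V "W\<lparr>carrier := T ` carrier V\<rparr>" T .
  show "fin_vs (W\<lparr>carrier := T ` carrier V\<rparr>)"
    using T'.surj_fin_dim[OF fd] vsi by (simp add: fin_vs_def)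
qed

lemma vdim_zero:
  assumes "vectorspace class_ring V" "carrier V = {\<zero>\<^bsub>V\<^esub>}"
  shows "fin_vs V" "vdim V = 0"
proof -
  interpret V: vectorspace class_ring V by fact
  have "V.gen_set {}" using assms(2) V.span_empty by simp
  then show "fin_vs V" "vdim V = 0"
    using V.gen_ge_dim[of "{}"] V.vectorspace_axioms by (auto simp: fin_vs_def V.fin_dim_def)
qed

lemma vdim_eq_0:
  assumes "fin_vs V" "vdim V = 0"
  shows "carrier V = {\<zero>\<^bsub>V\<^esub>}"
proof -
  interpret V: vectorspace class_ring V using assms(1) by (simp add: fin_vs_def)
  have sub: "subspace class_ring {\<zero>\<^bsub>V\<^esub>} V"
    by (rule subspaceI) (use V.vectorspace_axioms in auto)
  have "vdim (V\<lparr>carrier := {\<zero>\<^bsub>V\<^esub>}\<rparr>) = 0"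
    by (rule vdim_zero) (use V.subspace_is_vs[OF sub] in auto)
  then show ?thesis using fin_vs_subspace(3)[OF assms(1) sub] assms(2) by simp
qed

text \<open>Generators of the kernel together with preimages of generators of the image span
  \<open>V\<close>. Rank and nullity could not be used here, as they presuppose that
  \<open>V\<close> is finite-dimensional.\<close>

lemma fin_vs_extension:
  assumes V: "lin V W T" and W: "fin_vs W"
    and K: "fin_vs (V\<lparr>carrier := {x \<in> carrier V. T x = \<zero>\<^bsub>W\<^esub>}\<rparr>)"
  shows "fin_vs V"
proof -
  interpret V: vectorspace class_ring V using V by (simp add: linear_map_def)
  interpret W: vectorspace class_ring W using V by (simp add: linear_map_def)
  interpret T: linear_map class_ring V W T using V .
  let ?K = "{x \<in> carrier V. T x = \<zero>\<^bsub>W\<^esub>}"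
  have ker: "T.ker = ?K" by (auto simp: T.ker_def)
  have im: "T.im = T ` carrier V" by (auto simp: T.im_def)
  have subK: "LinearCombinations.submodule class_ring ?K V"
    using T.kerT_is_subspace unfolding ker by simp
  interpret K: vectorspace class_ring "V\<lparr>carrier := ?K\<rparr>" using K by (simp add: fin_vs_def)
  obtain A where A: "finite A" "A \<subseteq> ?K" "K.span A = ?K"
    using K by (auto simp: fin_vs_def K.fin_dim_def)
  then have KA: "?K = V.span A" using V.span_li_not_depend(1)[OF A(2) subK] by simp
  have subI: "subspace class_ring (T ` carrier V) W"
    using T.imT_is_subspace unfolding im .
  have fI: "fin_vs (W\<lparr>carrier := T ` carrier V\<rparr>)" using fin_vs_subspace(1)[OF W subI] .
  interpret I: vectorspace class_ring "W\<lparr>carrier := T ` carrier V\<rparr>" using fI by (simp add: fin_vs_def)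
  obtain B where B: "finite B" "B \<subseteq> T ` carrier V" "I.span B = T ` carrier V"
    using fI by (auto simp: fin_vs_def I.fin_dim_def)
  then have IB: "W.span B = T ` carrier V"
    using W.span_li_not_depend(1)[OF B(2)] subI by simp
  obtain C where C: "finite C" "C \<subseteq> carrier V" "B = T ` C"
    using B(1,2) by (meson finite_subset_image)
  have AC: "A \<union> C \<subseteq> carrier V" using A(2) C(2) by auto
  let ?U = "V.span (A \<union> C)"
  have subU: "LinearCombinations.submodule class_ring ?U V"
    using V.span_is_submodule[OF AC] .
  then have U: "?U \<subseteq> carrier V" "\<zero>\<^bsub>V\<^esub> \<in> ?U" "\<And>x y. x \<in> ?U \<Longrightarrow> y \<in> ?U \<Longrightarrow> x \<oplus>\<^bsub>V\<^esub> y \<in> ?U"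
    "\<And>c x. x \<in> ?U \<Longrightarrow> c \<odot>\<^bsub>V\<^esub> x \<in> ?U"
    by (auto simp: LinearCombinations.submodule_def)
  have "subspace class_ring (T ` ?U) W"
  proof (rule subspaceI)
    show "T ` ?U \<subseteq> carrier W" using U(1) by auto
    show "\<zero>\<^bsub>W\<^esub> \<in> T ` ?U" using U(2) by (metis T.T0_is_0 image_eqI)
    show "x \<oplus>\<^bsub>W\<^esub> y \<in> T ` ?U" if "x \<in> T ` ?U" "y \<in> T ` ?U" for x y
    proof -
      from that obtain a b where ab: "a \<in> ?U" "b \<in> ?U" "x = T a" "y = T b" by blast
      then have "x \<oplus>\<^bsub>W\<^esub> y = T (a \<oplus>\<^bsub>V\<^esub> b)" using U(1) by (simp add: T.T_add subsetD)
      then show ?thesis using ab U(3) by auto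
    qed
    show "c \<odot>\<^bsub>W\<^esub> x \<in> T ` ?U" if "x \<in> T ` ?U" for c x
    proof -
      from that obtain a where ab: "a \<in> ?U" "x = T a" by blast
      then have "c \<odot>\<^bsub>W\<^esub> x = T (c \<odot>\<^bsub>V\<^esub> a)" using U(1) by (simp add: subsetD)
      then show ?thesis using ab U(4) by auto
    qed
  qed (rule W.vectorspace_axioms)
  moreover have "B \<subseteq> T ` ?U" using C(3) V.in_own_span[OF AC] by blast
  ultimately have "T ` carrier V \<subseteq> T ` ?U"
    using W.span_is_subset[of B "T ` ?U"] IB by simp
  moreover have "?K \<subseteq> ?U" unfolding KA by (rule V.span_is_monotone) auto
  ultimately have "carrier V \<subseteq> ?U"
  proof (intro subsetI)
    \<comment> \<open>An element \<open>u\<close> of the span has the same image as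
      \<open>v\<close>, so \<open>v - u\<close> lies in the kernel, which is in the span as
      well.\<close>
    fix v assume *: "T ` carrier V \<subseteq> T ` ?U" "?K \<subseteq> ?U" "v \<in> carrier V"
    then obtain u where u: "u \<in> ?U" "T v = T u" by blast
    have uV: "u \<in> carrier V" using u U by auto
    have "T (v \<ominus>\<^bsub>V\<^esub> u) = \<zero>\<^bsub>W\<^esub>" using u(2) uV *(3)
      by (simp add: T.T_minus a_minus_def W.M.r_neg)
    then have "v \<ominus>\<^bsub>V\<^esub> u \<in> ?U" using *(2,3) uV by auto
    then have "(v \<ominus>\<^bsub>V\<^esub> u) \<oplus>\<^bsub>V\<^esub> u \<in> ?U" using U(3) u by auto
    also have "(v \<ominus>\<^bsub>V\<^esub> u) \<oplus>\<^bsub>V\<^esub> u = v" using *(3) uV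
      by (simp add: a_minus_def V.M.a_assoc V.M.l_neg)
    finally show "v \<in> ?U" .
  qed
  then have "V.gen_set (A \<union> C)" using U(1) by auto
  then have "V.fin_dim" using A(1) C(1) AC unfolding V.fin_dim_def by blast
  then show ?thesis using V.vectorspace_axioms by (simp add: fin_vs_def)
qed

lemma fin_vs_inj:
  assumes T: "lin V W T" and W: "fin_vs W" and inj: "inj_on T (carrier V)"
  shows "fin_vs V" and "vdim V \<le> vdim W"
proof -
  interpret V: vectorspace class_ring V using T by (simp add: linear_map_def)
  interpret W: vectorspace class_ring W using T by (simp add: linear_map_def)
  interpret T: linear_map class_ring V W T using T .
  have im: "T.im = T ` carrier V" by (auto simp: T.im_def)
  have K: "{x \<in> carrier V. T x = \<zero>\<^bsub>W\<^esub>} = {\<zero>\<^bsub>V\<^esub>}"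
    using T.inj_imp_Ker0[OF inj] by (simp add: T.ker_def)
  have sub: "subspace class_ring {\<zero>\<^bsub>V\<^esub>} V"
    by (rule subspaceI) (use V.vectorspace_axioms in auto)
  have z: "fin_vs (V\<lparr>carrier := {\<zero>\<^bsub>V\<^esub>}\<rparr>)" "vdim (V\<lparr>carrier := {\<zero>\<^bsub>V\<^esub>}\<rparr>) = 0"
    by (rule vdim_zero; use V.subspace_is_vs[OF sub] in simp)+
  show V: "fin_vs V" by (rule fin_vs_extension[OF T W]) (simp add: K z)
  have "vdim V = vdim (W\<lparr>carrier := T ` carrier V\<rparr>)" using rank_nullity_vs(2)[OF V T] by (simp add: K z)
  also have "\<dots> \<le> vdim W" using fin_vs_subspace(2)[OF W] T.imT_is_subspace im by simp
  finally show "vdim V \<le> vdim W" .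
qed

section \<open>Quotients by subgroups and subspaces\<close>

text \<open>In the last claim the compatibility of the scalar \<open>a\<close> with \<open>N\<close>
  is a premise, so that the rules serve two purposes: quotients of vector spaces over the ground
  field, for \<open>Ext\<close>, and quotients of \<open>\<Lambda>\<close>-modules, for the top of a
  projective module.\<close>

lemma quot_mod:
  assumes M: "abelian_group M" and N: "additive_subgroup N M"
  shows "carrier (quot_mod M N) = (\<lambda>x. N +>\<^bsub>M\<^esub> x) ` carrier M" "\<zero>\<^bsub>quot_mod M N\<^esub> = N"
    and "x \<in> carrier M \<Longrightarrow> y \<in> carrier M \<Longrightarrow> N +>\<^bsub>M\<^esub> x = N +>\<^bsub>M\<^esub> y \<longleftrightarrow> x \<ominus>\<^bsub>M\<^esub> y \<in> N"
    and "x \<in> carrier M \<Longrightarrow> y \<in> carrier M \<Longrightarrow>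
      (N +>\<^bsub>M\<^esub> x) \<oplus>\<^bsub>quot_mod M N\<^esub> (N +>\<^bsub>M\<^esub> y) = N +>\<^bsub>M\<^esub> (x \<oplus>\<^bsub>M\<^esub> y)"
    and "x \<in> carrier M \<Longrightarrow> a \<odot>\<^bsub>M\<^esub> x \<in> carrier M \<Longrightarrow>
      (\<And>n. n \<in> N \<Longrightarrow> a \<odot>\<^bsub>M\<^esub> (n \<oplus>\<^bsub>M\<^esub> x) = a \<odot>\<^bsub>M\<^esub> n \<oplus>\<^bsub>M\<^esub> a \<odot>\<^bsub>M\<^esub> x) \<Longrightarrow>
      (\<And>n. n \<in> N \<Longrightarrow> a \<odot>\<^bsub>M\<^esub> n \<in> N) \<Longrightarrow> a \<odot>\<^bsub>quot_mod M N\<^esub> (N +>\<^bsub>M\<^esub> x) = N +>\<^bsub>M\<^esub> (a \<odot>\<^bsub>M\<^esub> x)"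
proof -
  interpret abelian_subgroup N M by (rule abelian_subgroupI3[OF N M])
  show "carrier (quot_mod M N) = (\<lambda>x. N +>\<^bsub>M\<^esub> x) ` carrier M" "\<zero>\<^bsub>quot_mod M N\<^esub> = N"
    by (auto simp: quot_mod_def ring.defs FactRing_def A_RCOSETS_def')
  show eq: "N +>\<^bsub>M\<^esub> x = N +>\<^bsub>M\<^esub> y \<longleftrightarrow> x \<ominus>\<^bsub>M\<^esub> y \<in> N" if "x \<in> carrier M" "y \<in> carrier M" for x y
  proof
    assume "N +>\<^bsub>M\<^esub> x = N +>\<^bsub>M\<^esub> y"
    then have "x \<in> N +>\<^bsub>M\<^esub> y" using a_rcos_self[OF that(1)] by simp
    then show "x \<ominus>\<^bsub>M\<^esub> y \<in> N" using a_rcos_module[OF that(2,1)] by (simp add: a_minus_def)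
  next
    assume "x \<ominus>\<^bsub>M\<^esub> y \<in> N"
    then have "x \<in> N +>\<^bsub>M\<^esub> y" using a_rcos_module[OF that(2,1)] by (simp add: a_minus_def)
    then show "N +>\<^bsub>M\<^esub> x = N +>\<^bsub>M\<^esub> y" using a_repr_independence[OF _ that(2) a_subgroup] by simp
  qed
  show "(N +>\<^bsub>M\<^esub> x) \<oplus>\<^bsub>quot_mod M N\<^esub> (N +>\<^bsub>M\<^esub> y) = N +>\<^bsub>M\<^esub> (x \<oplus>\<^bsub>M\<^esub> y)" if "x \<in> carrier M" "y \<in> carrier M"
    using a_rcos_sum[OF that] by (simp add: quot_mod_def ring.defs FactRing_def)
  assume x: "x \<in> carrier M" "a \<odot>\<^bsub>M\<^esub> x \<in> carrier M"
    and d: "\<And>n. n \<in> N \<Longrightarrow> a \<odot>\<^bsub>M\<^esub> (n \<oplus>\<^bsub>M\<^esub> x) = a \<odot>\<^bsub>M\<^esub> n \<oplus>\<^bsub>M\<^esub> a \<odot>\<^bsub>M\<^esub> x"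
    and c: "\<And>n. n \<in> N \<Longrightarrow> a \<odot>\<^bsub>M\<^esub> n \<in> N"
  have NM: "n \<in> carrier M" if "n \<in> N" for n using that a_subset by auto
  \<comment> \<open>Scalar multiplication in the quotient is a union over all representatives; it is
    a single coset because all of them give the same one.\<close>
  have "N +>\<^bsub>M\<^esub> (a \<odot>\<^bsub>M\<^esub> y) = N +>\<^bsub>M\<^esub> (a \<odot>\<^bsub>M\<^esub> x)" if "y \<in> N +>\<^bsub>M\<^esub> x" for y
  proof -
    from that obtain n where n: "n \<in> N" "y = n \<oplus>\<^bsub>M\<^esub> x" unfolding a_r_coset_def' by blast
    have "a \<odot>\<^bsub>M\<^esub> n \<in> N" by (rule c[OF n(1)])
    then have "(a \<odot>\<^bsub>M\<^esub> n \<oplus>\<^bsub>M\<^esub> a \<odot>\<^bsub>M\<^esub> x) \<ominus>\<^bsub>M\<^esub> a \<odot>\<^bsub>M\<^esub> x \<in> N"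
      using x(2) NM by (simp add: a_minus_def a_assoc r_neg)
    moreover have "a \<odot>\<^bsub>M\<^esub> n \<oplus>\<^bsub>M\<^esub> a \<odot>\<^bsub>M\<^esub> x \<in> carrier M" using NM[OF c[OF n(1)]] x(2) by simp
    ultimately show ?thesis using eq[OF _ x(2)] d[OF n(1)] n(2) by simp
  qed
  moreover have "x \<in> N +>\<^bsub>M\<^esub> x" by (rule a_rcos_self[OF x(1)])
  ultimately have "(\<Union>y\<in>N +>\<^bsub>M\<^esub> x. N +>\<^bsub>M\<^esub> (a \<odot>\<^bsub>M\<^esub> y)) = N +>\<^bsub>M\<^esub> (a \<odot>\<^bsub>M\<^esub> x)" by blast
  then show "a \<odot>\<^bsub>quot_mod M N\<^esub> (N +>\<^bsub>M\<^esub> x) = N +>\<^bsub>M\<^esub> (a \<odot>\<^bsub>M\<^esub> x)" by (simp add: quot_mod_def ring.defs)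
qed

lemma subspace_mono:
  assumes "subspace class_ring B V" "B \<subseteq> Z" "vectorspace class_ring (V\<lparr>carrier := Z\<rparr>)"
  shows "subspace class_ring B (V\<lparr>carrier := Z\<rparr>)"
  by (rule subspaceI) (use assms in \<open>auto simp: subspace_def LinearCombinations.submodule_def\<close>)

lemma vs_quotient:
  assumes V: "fin_vs V" and B: "subspace class_ring B V"
  shows "fin_vs (quot_mod V B)" "lin V (quot_mod V B) (\<lambda>x. B +>\<^bsub>V\<^esub> x)"
    and "x \<in> carrier V \<Longrightarrow> B +>\<^bsub>V\<^esub> x = \<zero>\<^bsub>quot_mod V B\<^esub> \<longleftrightarrow> x \<in> B"
proof -
  have vsV: "vectorspace class_ring V" using V by (simp add: fin_vs_def)
  have VM: "Module.module class_ring V" using vsV by (simp add: vectorspace_def)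
  have ag: "abelian_group V" by (rule Module.module.axioms(2)[OF VM])
  interpret G: abelian_group V by (rule ag)
  interpret V: vectorspace class_ring V by (rule vsV)
  have B': "B \<subseteq> carrier V" "\<zero>\<^bsub>V\<^esub> \<in> B" "\<And>x y. x \<in> B \<Longrightarrow> y \<in> B \<Longrightarrow> x \<oplus>\<^bsub>V\<^esub> y \<in> B" "\<And>c x. x \<in> B \<Longrightarrow> c \<odot>\<^bsub>V\<^esub> x \<in> B"
    using B by (auto simp: subspace_def LinearCombinations.submodule_def)
  have neg: "\<ominus>\<^bsub>V\<^esub> x \<in> B" if "x \<in> B" for x
    using V.smult_minus_1[of x] B'(4)[OF that] B'(1) that by (metis subsetD)
  have B'': "additive_subgroup B V"
    unfolding additive_subgroup_def
    by (rule subgroup.intro) (use B' neg in \<open>auto simp: a_inv_def[symmetric]\<close>)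
  note q = quot_mod[OF ag B'']
  let ?Q = "quot_mod V B"
  have sm: "c \<odot>\<^bsub>V\<^esub> x \<in> carrier V" if "x \<in> carrier V" for c x
    using Module.module.smult_closed[OF VM, of c x] that by simp
  have rd: "c \<odot>\<^bsub>V\<^esub> (x \<oplus>\<^bsub>V\<^esub> y) = c \<odot>\<^bsub>V\<^esub> x \<oplus>\<^bsub>V\<^esub> c \<odot>\<^bsub>V\<^esub> y" if "x \<in> carrier V" "y \<in> carrier V" for c x y
    using Module.module.smult_r_distr[OF VM, of c x y] that by simp
  have ld: "(c + d) \<odot>\<^bsub>V\<^esub> x = c \<odot>\<^bsub>V\<^esub> x \<oplus>\<^bsub>V\<^esub> d \<odot>\<^bsub>V\<^esub> x" if "x \<in> carrier V" for c d x
    using Module.module.smult_l_distr[OF VM, of c d x] that by simp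
  have as: "(c * d) \<odot>\<^bsub>V\<^esub> x = c \<odot>\<^bsub>V\<^esub> (d \<odot>\<^bsub>V\<^esub> x)" if "x \<in> carrier V" for c d x
    using Module.module.smult_assoc1[OF VM, of c d x] that by simp
  have on: "1 \<odot>\<^bsub>V\<^esub> x = x" if "x \<in> carrier V" for x using Module.module.smult_one[OF VM, of x] that by simp
  have qs: "c \<odot>\<^bsub>?Q\<^esub> (B +>\<^bsub>V\<^esub> x) = B +>\<^bsub>V\<^esub> (c \<odot>\<^bsub>V\<^esub> x)" if "x \<in> carrier V" for c x
    by (rule q(5)) (use that sm rd B' in auto)
  have q0: "B = B +>\<^bsub>V\<^esub> \<zero>\<^bsub>V\<^esub>" using B'(1) by (auto simp: a_r_coset_def' subset_iff)
  have vs: "vectorspace class_ring ?Q"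
  proof (rule vs_criteria)
    show "\<zero>\<^bsub>?Q\<^esub> \<in> carrier ?Q" using q(1,2) q0 by auto
    show "\<forall>v\<in>carrier ?Q. \<exists>n\<in>carrier ?Q. v \<oplus>\<^bsub>?Q\<^esub> n = \<zero>\<^bsub>?Q\<^esub>"
    proof
      fix v assume "v \<in> carrier ?Q"
      then obtain x where x: "x \<in> carrier V" "v = B +>\<^bsub>V\<^esub> x" using q(1) by auto
      then have "v \<oplus>\<^bsub>?Q\<^esub> (B +>\<^bsub>V\<^esub> (\<ominus>\<^bsub>V\<^esub> x)) = \<zero>\<^bsub>?Q\<^esub>"
        using q(4)[of x "\<ominus>\<^bsub>V\<^esub> x"] q(2) q0 G.r_neg by simp
      then show "\<exists>n\<in>carrier ?Q. v \<oplus>\<^bsub>?Q\<^esub> n = \<zero>\<^bsub>?Q\<^esub>" using q(1) x(1) by blast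
    qed
    show "\<forall>v\<in>carrier ?Q. v \<oplus>\<^bsub>?Q\<^esub> \<zero>\<^bsub>?Q\<^esub> = v"
    proof -
      have "\<zero>\<^bsub>?Q\<^esub> = B +>\<^bsub>V\<^esub> \<zero>\<^bsub>V\<^esub>" using q(2) q0 by simp
      then show "\<forall>v\<in>carrier ?Q. v \<oplus>\<^bsub>?Q\<^esub> \<zero>\<^bsub>?Q\<^esub> = v"
        using q(1,4) by auto
    qed
  qed (auto simp: class_field q(1,4) qs sm rd ld as on G.a_ac)
  show lin: "lin V ?Q (\<lambda>x. B +>\<^bsub>V\<^esub> x)"
    by (rule linI[OF V.vectorspace_axioms vs]) (auto simp: q(1,4) qs)
  show "fin_vs ?Q" using rank_nullity_vs(1)[OF V lin] by (simp flip: q(1))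
  show "B +>\<^bsub>V\<^esub> x = \<zero>\<^bsub>?Q\<^esub> \<longleftrightarrow> x \<in> B" if "x \<in> carrier V"
    using q(3)[OF that G.zero_closed] q0 q(2) that G.minus_eq
      by (simp add: a_minus_def) (metis G.minus_equality G.r_zero G.zero_closed)
qed

section \<open>Weights from the spectral radius\<close>

text \<open>The weights are \<open>v = (\<Sum>n<N. 2\<^sup>-\<^sup>n E\<^sup>n 1)\<close>. Telescoping gives
  \<open>E v = 2 (v - 1 + 2\<^sup>-\<^sup>N E\<^sup>N 1)\<close>, and the last term tends to \<open>0\<close>.\<close>

lemma spectral_radius_weights:
  fixes e :: "nat \<Rightarrow> nat \<Rightarrow> nat"
  assumes sr: "spectral_radius (mat r r (\<lambda>(i, j). of_nat (e i j) :: complex)) < 2" and r: "0 < r"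
  obtains v :: "nat \<Rightarrow> real" where "\<And>i. 0 \<le> v i" "\<And>i. i < r \<Longrightarrow> (\<Sum>j<r. e i j * v j) \<le> 2 * v i - 1"
proof -
  define E where "E = mat r r (\<lambda>(i, j). of_nat (e i j) :: complex)"
  have E: "E \<in> carrier_mat r r" by (simp add: E_def)
  define \<rho> where "\<rho> = spectral_radius E"
  have \<rho>: "k \<in> spectrum E \<Longrightarrow> norm k \<le> \<rho>" for k
    using spectral_radius_mem_max(2)[OF E r] by (simp add: \<rho>_def)
  have "\<rho> \<in> norm ` spectrum E" using spectral_radius_mem_max(1)[OF E r] by (simp add: \<rho>_def)
  then have \<rho>0: "0 \<le> \<rho>" by auto
  have \<rho>2: "\<rho> < 2" using sr by (simp add: \<rho>_def E_def)
  \<comment> \<open>Any number strictly between \<open>\<rho>\<close> and \<open>2\<close> would do: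
    \<open>t > \<rho>\<close> makes the powers of \<open>A = E / t\<close> bounded, and
    \<open>t < 2\<close> makes \<open>(t / 2)^n\<close> tend to zero.\<close>
  define t where "t = (\<rho> + 2) / 2"
  have t: "0 < t" "\<rho> < t" "t < 2" using \<rho>0 \<rho>2 by (auto simp: t_def)
  define A where "A = mat r r (\<lambda>(i, j). of_real (e i j / t) :: complex)"
  have A: "A \<in> carrier_mat r r" by (simp add: A_def)
  have EA: "E = of_real t \<cdot>\<^sub>m A" using t(1) by (intro eq_matI) (auto simp: E_def A_def)
  have "norm k < 1" if "k \<in> spectrum A" for k
  proof -
    from that obtain v where v: "v \<in> carrier_vec r" "v \<noteq> 0\<^sub>v r" "A *\<^sub>v v = k \<cdot>\<^sub>v v"
      using A by (auto simp: spectrum_def eigenvalue_def eigenvector_def)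
    have "row A i \<bullet> v = k * v $ i" if "i < r" for i
      using arg_cong[OF v(3), of "\<lambda>w. w $ i"] A v(1) that by simp
    then have "E *\<^sub>v v = (of_real t * k) \<cdot>\<^sub>v v"
      unfolding EA using v(1) A by (intro eq_vecI) (auto simp: row_smult)
    then have "of_real t * k \<in> spectrum E"
      using v E by (auto simp: spectrum_def eigenvalue_def eigenvector_def)
    then have "t * norm k \<le> \<rho>" using \<rho>[of "of_real t * k"] t(1) by (simp add: norm_mult)
    then have "t * norm k < t * 1" using t(2) by simp
    then show ?thesis using t(1) mult_less_cancel_left_pos by blast
  qed
  then have "spectral_radius A < 1" using spectral_radius_mem_max(1)[OF A r] by auto
  \<comment> \<open>One bound for the entries of all powers of \<open>A\<close>; it is read off the
    Jordan normal form.\<close>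
  then obtain c where c: "\<And>k. norm_bound (A ^\<^sub>m k) c"
    using spectral_radius_jnf_norm_bound_less_1_upper_triangular[OF A] by blast
  \<comment> \<open>\<open>F\<close> is \<open>E\<close> acting on real vectors and \<open>G\<close>
    is \<open>A\<close>. The complex matrices are needed for the spectrum only, while the final
    inequality is one between reals.\<close>
  define F where "F = (\<lambda>(x :: nat \<Rightarrow> real) i. \<Sum>j<r. real (e i j) * x j)"
  define G where "G = (\<lambda>x i. F x i / t)"
  have Ak: "A ^\<^sub>m k \<in> carrier_mat r r" for k using A by simp
  have AG: "(A ^\<^sub>m k) *\<^sub>v vec r (\<lambda>i. of_real (x i)) = vec r (\<lambda>i. of_real ((G ^^ k) x i))" for k x
  proof (induction k arbitrary: x)
    case 0
    then show ?case using A by simp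
  next
    case (Suc k)
    have "A *\<^sub>v vec r (\<lambda>i. of_real (x i)) = vec r (\<lambda>i. of_real (G x i))"
      by (rule eq_vecI) (auto simp: A_def G_def F_def scalar_prod_def sum_divide_distrib atLeast0LessThan)
    moreover have "(A ^\<^sub>m Suc k) *\<^sub>v vec r (\<lambda>i. of_real (x i)) = (A ^\<^sub>m k) *\<^sub>v (A *\<^sub>v vec r (\<lambda>i. of_real (x i)))"
      using assoc_mult_mat_vec[OF Ak A, of "vec r (\<lambda>i. of_real (x i))" k] by simp
    ultimately show ?case using Suc.IH[of "G x"] by (simp add: funpow_swap1)
  qed
  have FG: "(F ^^ k) x i = t ^ k * (G ^^ k) x i" for k x i
  proof (induction k arbitrary: i)
    case (Suc k)
    have "(F ^^ Suc k) x i = (\<Sum>j<r. e i j * (t ^ k * (G ^^ k) x j))"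
      by (simp add: F_def[of] Suc.IH[unfolded F_def] F_def)
    also have "\<dots> = t ^ k * F ((G ^^ k) x) i" by (simp add: F_def sum_distrib_left mult_ac)
    also have "\<dots> = t ^ Suc k * (G ^^ Suc k) x i" using t(1) by (simp add: G_def)
    finally show ?case .
  qed simp
  define w where "w = (\<lambda>k. (F ^^ k) (\<lambda>_. 1))"
  have w0: "0 \<le> w k i" for k i
    by (induction k arbitrary: i) (auto simp: w_def F_def intro!: sum_nonneg)
  have wS: "(\<Sum>j<r. e i j * w k j) = w (Suc k) i" for i k by (simp add: w_def F_def)
  have wb: "w k i \<le> real r * c * t ^ k" if i: "i < r" for k i
  proof -
    have "of_real ((G ^^ k) (\<lambda>_. 1) i) = ((A ^\<^sub>m k) *\<^sub>v vec r (\<lambda>i. of_real 1)) $ i"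
      using AG[of k "\<lambda>_. 1"] i by simp
    also have "\<dots> = (\<Sum>j<r. (A ^\<^sub>m k) $$ (i, j))"
      using carrier_matD[OF Ak[of k]] i by (simp add: mult_mat_vec_def scalar_prod_def atLeast0LessThan)
    finally have Gk: "of_real ((G ^^ k) (\<lambda>_. 1) i) = (\<Sum>j<r. (A ^\<^sub>m k) $$ (i, j))" .
    have "norm (of_real ((G ^^ k) (\<lambda>_. 1) i) :: complex) \<le> (\<Sum>j<r. c)"
      unfolding Gk by (rule sum_norm_le) (use carrier_matD[OF Ak[of k]] i c[of k] in \<open>auto simp:
        norm_bound_def\<close>)
    then have "(G ^^ k) (\<lambda>_. 1) i \<le> real r * c" by simp
    then have "t ^ k * (G ^^ k) (\<lambda>_. 1) i \<le> t ^ k * (real r * c)" using t(1) by (intro mult_left_mono) auto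
    then show ?thesis unfolding w_def FG by (simp add: mult_ac)
  qed
  have "(\<lambda>n. real r * c * (t / 2) ^ n) \<longlonglongrightarrow> real r * c * 0"
    by (intro tendsto_mult tendsto_const LIMSEQ_power_zero) (use t in auto)
  then have "\<forall>\<^sub>F n in sequentially. real r * c * (t / 2) ^ n < 1 / 2" by (rule order_tendstoD) simp
  \<comment> \<open>The remainder enters the telescoped sum with a factor \<open>2\<close>. Being at
    most \<open>1 / 2\<close>, it turns \<open>2 v - 2\<close> into at most
    \<open>2 v - 1\<close>.\<close>
  then obtain N where "real r * c * (t / 2) ^ N < 1 / 2" by (auto simp: eventually_sequentially)
  then have N: "w N i / 2 ^ N \<le> 1 / 2" if "i < r" for i
  proof -
    have "w N i / 2 ^ N \<le> (real r * c * t ^ N) / 2 ^ N" using wb[OF that, of N]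
      by (intro divide_right_mono) auto
    also have "\<dots> = real r * c * (t / 2) ^ N" by (simp add: power_divide)
    finally show ?thesis using \<open>real r * c * (t / 2) ^ N < 1 / 2\<close> by linarith
  qed
  define v where "v = (\<lambda>i. \<Sum>n<N. w n i / 2 ^ n)"
  show ?thesis
  proof (rule that)
    show "0 \<le> v i" for i unfolding v_def by (intro sum_nonneg) (simp add: w0)
    fix i assume i: "i < r"
    have "(\<Sum>j<r. e i j * v j) = (\<Sum>n<N. (\<Sum>j<r. e i j * w n j) / 2 ^ n)"
      unfolding v_def sum_distrib_left sum_divide_distrib by (subst sum.swap) simp
    also have "\<dots> = 2 * (\<Sum>n<N. w (Suc n) i / 2 ^ Suc n)"
      by (simp add: wS sum_distrib_left)
    also have "(\<Sum>n<N. w (Suc n) i / 2 ^ Suc n) = v i - w 0 i + w N i / 2 ^ N"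
      unfolding v_def by (induction N) auto
    finally show "(\<Sum>j<r. e i j * v j) \<le> 2 * v i - 1" using N[OF i] by (simp add: w_def)
  qed
qed

text \<open>The second differences are at most \<open>-1\<close>, so the first differences tend to
  minus infinity and finally the sequence itself becomes negative.\<close>

lemma no_nonneg_concave:
  fixes a :: "nat \<Rightarrow> real"
  assumes nonneg: "\<And>n. 0 \<le> a n" and concave: "\<And>n. a (Suc (Suc n)) + a n \<le> 2 * a (Suc n) - 1"
  shows False
proof -
  define d where "d = (\<lambda>n. a (Suc n) - a n)"
  have dS: "d (Suc n) \<le> d n - 1" for n using concave[of n] by (simp add: d_def)
  have d: "d n \<le> d 0 - n" for n
  proof (induction n)
    case (Suc n)
    then show ?case using dS[of n] by simp
  qed simp
  \<comment> \<open>From this \<open>N\<close> on, all first differences are at most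
    \<open>-1\<close>.\<close>
  obtain N :: nat where N: "d 0 + 1 \<le> N" using real_arch_simple by blast
  have "a (N + m) \<le> a N - m" for m
  proof (induction m)
    case (Suc m)
    have "d (N + m) \<le> -1" using d[of "N + m"] N by simp
    then show ?case using Suc by (simp add: d_def)
  qed simp
  moreover obtain m :: nat where "a N < m" using reals_Archimedean2 by blast
  ultimately show False using nonneg[of "N + m"] by (smt (verit))
qed

section \<open>Finite-dimensional algebras and the action of their scalars\<close>

locale fdalg = ring \<Lambda> for \<Lambda> :: "('k::field, 'a) module" (structure) +
  assumes alg: "k_algebra \<Lambda>" and fin: "fin_vs \<Lambda>"
begin

lemma smult_closed_alg: "x \<in> carrier \<Lambda> \<Longrightarrow> c \<odot> x \<in> carrier \<Lambda>"
  and smult_l_distr_alg: "x \<in> carrier \<Lambda> \<Longrightarrow> (c + d) \<odot> x = c \<odot> x \<oplus> d \<odot> x"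
  and smult_r_distr_alg: "x \<in> carrier \<Lambda> \<Longrightarrow> y \<in> carrier \<Lambda> \<Longrightarrow> c \<odot> (x \<oplus> y) = c \<odot> x \<oplus> c \<odot> y"
  and smult_assoc_alg: "x \<in> carrier \<Lambda> \<Longrightarrow> (c * d) \<odot> x = c \<odot> (d \<odot> x)"
  and smult_one_alg: "x \<in> carrier \<Lambda> \<Longrightarrow> 1 \<odot> x = x"
  and smult_mult_l: "x \<in> carrier \<Lambda> \<Longrightarrow> y \<in> carrier \<Lambda> \<Longrightarrow> (c \<odot> x) \<otimes> y = c \<odot> (x \<otimes> y)"
  and smult_mult_r: "x \<in> carrier \<Lambda> \<Longrightarrow> y \<in> carrier \<Lambda> \<Longrightarrow> x \<otimes> (c \<odot> y) = c \<odot> (x \<otimes> y)"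
proof -
  interpret k_algebra \<Lambda> by (rule alg)
  have V: "Module.module class_ring \<Lambda>" ..
  show "x \<in> carrier \<Lambda> \<Longrightarrow> c \<odot> x \<in> carrier \<Lambda>" using Module.module.smult_closed[OF V, of c x] by simp
  show "x \<in> carrier \<Lambda> \<Longrightarrow> (c + d) \<odot> x = c \<odot> x \<oplus> d \<odot> x" using Module.module.smult_l_distr[OF V, of c d x]
    by simp
  show "x \<in> carrier \<Lambda> \<Longrightarrow> y \<in> carrier \<Lambda> \<Longrightarrow> c \<odot> (x \<oplus> y) = c \<odot> x \<oplus> c \<odot> y"
    using Module.module.smult_r_distr[OF V, of c x y] by simp
  show "x \<in> carrier \<Lambda> \<Longrightarrow> (c * d) \<odot> x = c \<odot> (d \<odot> x)" using Module.module.smult_assoc1[OF V, of c d x] by simp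
  show "x \<in> carrier \<Lambda> \<Longrightarrow> 1 \<odot> x = x" using Module.module.smult_one[OF V, of x] by simp
  show "x \<in> carrier \<Lambda> \<Longrightarrow> y \<in> carrier \<Lambda> \<Longrightarrow> (c \<odot> x) \<otimes> y = c \<odot> (x \<otimes> y)"
    by (rule smult_mult_left)
  show "x \<in> carrier \<Lambda> \<Longrightarrow> y \<in> carrier \<Lambda> \<Longrightarrow> x \<otimes> (c \<odot> y) = c \<odot> (x \<otimes> y)"
    by (rule smult_mult_right)
qed

text \<open>The copy of the ground field in the centre of \<open>\<Lambda>\<close>. Through it the
  field acts on every module, in the same way as in \<open>hom_space\<close>.\<close>

definition scal :: "'k \<Rightarrow> 'a" where "scal c = c \<odot> \<one>"

lemma scal_closed [simp]: "scal c \<in> carrier \<Lambda>"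
  by (simp add: scal_def smult_closed_alg)

lemma scal_add: "scal (c + d) = scal c \<oplus> scal d"
  by (simp add: scal_def smult_l_distr_alg)

lemma scal_mult: "scal (c * d) = scal c \<otimes> scal d"
  by (simp add: scal_def smult_assoc_alg smult_mult_l smult_closed_alg)

lemma scal_one: "scal 1 = \<one>"
  by (simp add: scal_def smult_one_alg)

lemma scal_mult_eq: "x \<in> carrier \<Lambda> \<Longrightarrow> scal c \<otimes> x = c \<odot> x" "x \<in> carrier \<Lambda> \<Longrightarrow> x \<otimes> scal c = c \<odot> x"
  by (simp_all add: scal_def smult_mult_l smult_mult_r smult_closed_alg)

lemma scal_commute: "x \<in> carrier \<Lambda> \<Longrightarrow> scal c \<otimes> x = x \<otimes> scal c"
  by (simp add: scal_mult_eq)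


section \<open>Submodules and homomorphisms\<close>

abbreviation lm :: "('a, 'm) module \<Rightarrow> bool" where "lm M \<equiv> left_module \<Lambda> M"
abbreviation smod :: "'m set \<Rightarrow> ('a, 'm) module \<Rightarrow> bool" where "smod N M \<equiv> Module.submodule N \<Lambda> M"
abbreviation sub :: "('a, 'm) module \<Rightarrow> 'm set \<Rightarrow> ('a, 'm) module" where "sub M N \<equiv> M\<lparr>carrier := N\<rparr>"

lemma lmI:
  assumes "\<zero>\<^bsub>M\<^esub> \<in> carrier M"
    and "\<And>x y. x \<in> carrier M \<Longrightarrow> y \<in> carrier M \<Longrightarrow> x \<oplus>\<^bsub>M\<^esub> y \<in> carrier M"
    and "\<And>x y z. x \<in> carrier M \<Longrightarrow> y \<in> carrier M \<Longrightarrow> z \<in> carrier M \<Longrightarrow>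
      (x \<oplus>\<^bsub>M\<^esub> y) \<oplus>\<^bsub>M\<^esub> z = x \<oplus>\<^bsub>M\<^esub> (y \<oplus>\<^bsub>M\<^esub> z)"
    and "\<And>x y. x \<in> carrier M \<Longrightarrow> y \<in> carrier M \<Longrightarrow> x \<oplus>\<^bsub>M\<^esub> y = y \<oplus>\<^bsub>M\<^esub> x"
    and "\<And>x. x \<in> carrier M \<Longrightarrow> \<zero>\<^bsub>M\<^esub> \<oplus>\<^bsub>M\<^esub> x = x"
    and "\<And>x. x \<in> carrier M \<Longrightarrow> \<exists>y\<in>carrier M. y \<oplus>\<^bsub>M\<^esub> x = \<zero>\<^bsub>M\<^esub>"
    and "\<And>a x. a \<in> carrier \<Lambda> \<Longrightarrow> x \<in> carrier M \<Longrightarrow> a \<odot>\<^bsub>M\<^esub> x \<in> carrier M"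
    and "\<And>a b x. a \<in> carrier \<Lambda> \<Longrightarrow> b \<in> carrier \<Lambda> \<Longrightarrow> x \<in> carrier M \<Longrightarrow>
      (a \<oplus> b) \<odot>\<^bsub>M\<^esub> x = a \<odot>\<^bsub>M\<^esub> x \<oplus>\<^bsub>M\<^esub> b \<odot>\<^bsub>M\<^esub> x"
    and "\<And>a x y. a \<in> carrier \<Lambda> \<Longrightarrow> x \<in> carrier M \<Longrightarrow> y \<in> carrier M \<Longrightarrow>
      a \<odot>\<^bsub>M\<^esub> (x \<oplus>\<^bsub>M\<^esub> y) = a \<odot>\<^bsub>M\<^esub> x \<oplus>\<^bsub>M\<^esub> a \<odot>\<^bsub>M\<^esub> y"
    and "\<And>a b x. a \<in> carrier \<Lambda> \<Longrightarrow> b \<in> carrier \<Lambda> \<Longrightarrow> x \<in> carrier M \<Longrightarrow>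
      (a \<otimes> b) \<odot>\<^bsub>M\<^esub> x = a \<odot>\<^bsub>M\<^esub> (b \<odot>\<^bsub>M\<^esub> x)"
    and "\<And>x. x \<in> carrier M \<Longrightarrow> \<one> \<odot>\<^bsub>M\<^esub> x = x"
  shows "lm M"
proof -
  have "abelian_group M" by (rule abelian_groupI) (use assms in auto)
  then show ?thesis
    by (intro left_module.intro left_module_axioms.intro) (use assms ring_axioms in auto)
qed

lemma lm_rules:
  assumes "lm M"
  shows "\<zero>\<^bsub>M\<^esub> \<in> carrier M"
    and "x \<in> carrier M \<Longrightarrow> y \<in> carrier M \<Longrightarrow> x \<oplus>\<^bsub>M\<^esub> y \<in> carrier M"
    and "x \<in> carrier M \<Longrightarrow> y \<in> carrier M \<Longrightarrow> x \<ominus>\<^bsub>M\<^esub> y \<in> carrier M"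
    and "x \<in> carrier M \<Longrightarrow> \<ominus>\<^bsub>M\<^esub> x \<in> carrier M"
    and "a \<in> carrier \<Lambda> \<Longrightarrow> x \<in> carrier M \<Longrightarrow> a \<odot>\<^bsub>M\<^esub> x \<in> carrier M"
    and "a \<in> carrier \<Lambda> \<Longrightarrow> a \<odot>\<^bsub>M\<^esub> \<zero>\<^bsub>M\<^esub> = \<zero>\<^bsub>M\<^esub>"
    and "x \<in> carrier M \<Longrightarrow> \<zero> \<odot>\<^bsub>M\<^esub> x = \<zero>\<^bsub>M\<^esub>"
    and "x \<in> carrier M \<Longrightarrow> (\<ominus> \<one>) \<odot>\<^bsub>M\<^esub> x = \<ominus>\<^bsub>M\<^esub> x"
    and "x \<in> carrier M \<Longrightarrow> y \<in> carrier M \<Longrightarrow> x \<ominus>\<^bsub>M\<^esub> y = x \<oplus>\<^bsub>M\<^esub> (\<ominus> \<one>) \<odot>\<^bsub>M\<^esub> y"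
    and "x \<in> carrier M \<Longrightarrow> y \<in> carrier M \<Longrightarrow> x \<ominus>\<^bsub>M\<^esub> y = \<zero>\<^bsub>M\<^esub> \<longleftrightarrow> x = y"
    and "x \<in> carrier M \<Longrightarrow> y \<in> carrier M \<Longrightarrow> (x \<ominus>\<^bsub>M\<^esub> y) \<oplus>\<^bsub>M\<^esub> y = x"
    and "x \<in> carrier M \<Longrightarrow> y \<in> carrier M \<Longrightarrow> y \<oplus>\<^bsub>M\<^esub> (x \<ominus>\<^bsub>M\<^esub> y) = x"
    and "x \<in> carrier M \<Longrightarrow> x \<ominus>\<^bsub>M\<^esub> \<zero>\<^bsub>M\<^esub> = x"
proof -
  interpret M: left_module \<Lambda> M by fact
  show "\<zero>\<^bsub>M\<^esub> \<in> carrier M" by simp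
  show "x \<in> carrier M \<Longrightarrow> y \<in> carrier M \<Longrightarrow> x \<oplus>\<^bsub>M\<^esub> y \<in> carrier M" by simp
  show "x \<in> carrier M \<Longrightarrow> y \<in> carrier M \<Longrightarrow> x \<ominus>\<^bsub>M\<^esub> y \<in> carrier M" by simp
  show "x \<in> carrier M \<Longrightarrow> \<ominus>\<^bsub>M\<^esub> x \<in> carrier M" by simp
  show "a \<in> carrier \<Lambda> \<Longrightarrow> x \<in> carrier M \<Longrightarrow> a \<odot>\<^bsub>M\<^esub> x \<in> carrier M" by (rule M.lsmult_closed)
  show z: "a \<odot>\<^bsub>M\<^esub> \<zero>\<^bsub>M\<^esub> = \<zero>\<^bsub>M\<^esub>" if "a \<in> carrier \<Lambda>"
  proof -
    have "a \<odot>\<^bsub>M\<^esub> \<zero>\<^bsub>M\<^esub> \<oplus>\<^bsub>M\<^esub> a \<odot>\<^bsub>M\<^esub> \<zero>\<^bsub>M\<^esub> = a \<odot>\<^bsub>M\<^esub> \<zero>\<^bsub>M\<^esub>"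
      using M.lsmult_r_distr[OF that, of "\<zero>\<^bsub>M\<^esub>" "\<zero>\<^bsub>M\<^esub>"] by simp
    then show ?thesis using that by (metis M.M.add.r_cancel_one M.lsmult_closed M.M.zero_closed)
  qed
  show z': "\<zero> \<odot>\<^bsub>M\<^esub> x = \<zero>\<^bsub>M\<^esub>" if "x \<in> carrier M" for x
  proof -
    have "\<zero> \<odot>\<^bsub>M\<^esub> x \<oplus>\<^bsub>M\<^esub> \<zero> \<odot>\<^bsub>M\<^esub> x = \<zero> \<odot>\<^bsub>M\<^esub> x"
      using M.lsmult_l_distr[of \<zero> \<zero> x] that by simp
    then show ?thesis using that by (metis M.M.add.r_cancel_one M.lsmult_closed zero_closed)
  qed
  show n: "(\<ominus> \<one>) \<odot>\<^bsub>M\<^esub> x = \<ominus>\<^bsub>M\<^esub> x" if "x \<in> carrier M" for x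
  proof -
    have "(\<ominus> \<one>) \<odot>\<^bsub>M\<^esub> x \<oplus>\<^bsub>M\<^esub> x = \<zero>\<^bsub>M\<^esub>"
      using M.lsmult_l_distr[of "\<ominus> \<one>" \<one> x] that z'[of x] M.lsmult_one[of x] by (simp add: l_neg)
    then show ?thesis using that M.M.minus_equality[of "(\<ominus> \<one>) \<odot>\<^bsub>M\<^esub> x" x] M.lsmult_closed[of "\<ominus> \<one>" x] by simp
  qed
  show "x \<in> carrier M \<Longrightarrow> y \<in> carrier M \<Longrightarrow> x \<ominus>\<^bsub>M\<^esub> y = x \<oplus>\<^bsub>M\<^esub> (\<ominus> \<one>) \<odot>\<^bsub>M\<^esub> y"
    by (simp add: a_minus_def n)
  show "x \<in> carrier M \<Longrightarrow> y \<in> carrier M \<Longrightarrow> x \<ominus>\<^bsub>M\<^esub> y = \<zero>\<^bsub>M\<^esub> \<longleftrightarrow> x = y"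
    by (metis a_minus_def M.M.minus_equality M.M.minus_minus M.M.r_neg M.M.a_inv_closed)
  show "x \<in> carrier M \<Longrightarrow> y \<in> carrier M \<Longrightarrow> (x \<ominus>\<^bsub>M\<^esub> y) \<oplus>\<^bsub>M\<^esub> y = x"
    by (simp add: a_minus_def M.M.a_assoc M.M.l_neg)
  then show "x \<in> carrier M \<Longrightarrow> y \<in> carrier M \<Longrightarrow> y \<oplus>\<^bsub>M\<^esub> (x \<ominus>\<^bsub>M\<^esub> y) = x"
    by (simp add: M.M.a_comm)
  have "\<ominus>\<^bsub>M\<^esub> \<zero>\<^bsub>M\<^esub> = \<zero>\<^bsub>M\<^esub>" by (rule M.M.minus_equality) simp_all
  then show "x \<in> carrier M \<Longrightarrow> x \<ominus>\<^bsub>M\<^esub> \<zero>\<^bsub>M\<^esub> = x" by (simp add: a_minus_def)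
qed

lemma smodI:
  assumes M: "lm M" and N: "N \<subseteq> carrier M" "\<zero>\<^bsub>M\<^esub> \<in> N"
    and add: "\<And>x y. x \<in> N \<Longrightarrow> y \<in> N \<Longrightarrow> x \<oplus>\<^bsub>M\<^esub> y \<in> N"
    and sm: "\<And>a x. a \<in> carrier \<Lambda> \<Longrightarrow> x \<in> N \<Longrightarrow> a \<odot>\<^bsub>M\<^esub> x \<in> N"
  shows "smod N M"
proof -
  have inv: "\<ominus>\<^bsub>M\<^esub> x \<in> N" if "x \<in> N" for x
    using lm_rules(8)[OF M, of x] sm[of "\<ominus> \<one>" x] that N by auto
  show ?thesis
    by (intro Module.submodule.intro subgroup.intro Module.submodule_axioms.intro)
      (use N add sm inv in \<open>auto simp: a_inv_def\<close>)
qed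

lemma smodD:
  assumes "smod N M"
  shows "N \<subseteq> carrier M" and "x \<in> N \<Longrightarrow> x \<in> carrier M" and "\<zero>\<^bsub>M\<^esub> \<in> N"
    and "x \<in> N \<Longrightarrow> y \<in> N \<Longrightarrow> x \<oplus>\<^bsub>M\<^esub> y \<in> N"
    and "a \<in> carrier \<Lambda> \<Longrightarrow> x \<in> N \<Longrightarrow> a \<odot>\<^bsub>M\<^esub> x \<in> N"
  using assms by (auto simp: Module.submodule_def submodule_axioms_def subgroup_def)

lemma smod_minus: "lm M \<Longrightarrow> smod N M \<Longrightarrow> x \<in> N \<Longrightarrow> y \<in> N \<Longrightarrow> x \<ominus>\<^bsub>M\<^esub> y \<in> N"
  by (simp add: lm_rules(9) smodD)

lemma lm_sub: assumes M: "lm M" and N: "smod N M" shows "lm (sub M N)"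
proof -
  interpret M: left_module \<Lambda> M by fact
  have n: "\<exists>y\<in>N. y \<oplus>\<^bsub>M\<^esub> x = \<zero>\<^bsub>M\<^esub>" if "x \<in> N" for x
    using that smodD(5)[OF N, of "\<ominus> \<one>" x] lm_rules(8)[OF M, of x] M.M.l_neg[of x] smodD(2)[OF N] by auto
  show ?thesis
    by (rule lmI) (use smodD[OF N] n in \<open>auto simp: M.M.a_ac M.lsmult_l_distr M.lsmult_r_distr
      M.lsmult_assoc M.lsmult_one\<close>)
qed

lemma smod_carrier: "lm M \<Longrightarrow> smod (carrier M) M"
  by (rule smodI) (auto simp: lm_rules)

lemma smod_zero: "lm M \<Longrightarrow> smod {\<zero>\<^bsub>M\<^esub>} M"
  by (rule smodI) (auto simp: lm_rules abelian_monoid.l_zero abelian_group.axioms(1) left_module.axioms(2))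

lemma smod_sub_iff:
  assumes "lm M" "smod V M"
  shows "smod U (sub M V) \<longleftrightarrow> smod U M \<and> U \<subseteq> V"
proof (intro iffI conjI)
  assume U: "smod U (sub M V)"
  then show UV: "U \<subseteq> V" using smodD(1) by fastforce
  show "smod U M"
    by (rule smodI[OF assms(1)]) (use smodD(1)[OF assms(2)] UV smodD(3-5)[OF U] in auto)
next
  assume U: "smod U M \<and> U \<subseteq> V"
  then have *: "smod U M" "U \<subseteq> V" by auto
  show "smod U (sub M V)"
    by (rule smodI[OF lm_sub[OF assms]]) (use *(2) smodD(3-5)[OF *(1)] in auto)
qed

lemma smod_Int: "lm M \<Longrightarrow> smod U M \<Longrightarrow> smod V M \<Longrightarrow> smod (U \<inter> V) M"
  by (rule smodI) (auto dest: smodD)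

definition ssum :: "('a, 'm) module \<Rightarrow> 'm set \<Rightarrow> 'm set \<Rightarrow> 'm set" where
  "ssum M U V = {x \<oplus>\<^bsub>M\<^esub> y | x y. x \<in> U \<and> y \<in> V}"

lemma smod_ssum:
  assumes M: "lm M" and U: "smod U M" and V: "smod V M"
  shows "smod (ssum M U V) M" "U \<subseteq> ssum M U V" "V \<subseteq> ssum M U V"
proof -
  interpret M: left_module \<Lambda> M by fact
  show 1: "U \<subseteq> ssum M U V"
  proof
    fix x assume "x \<in> U"
    then have "x = x \<oplus>\<^bsub>M\<^esub> \<zero>\<^bsub>M\<^esub>" "x \<in> U" using smodD(2)[OF U] by auto
    then show "x \<in> ssum M U V" unfolding ssum_def using smodD(3)[OF V] by blast
  qed
  show "V \<subseteq> ssum M U V"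
  proof
    fix x assume "x \<in> V"
    then have "x = \<zero>\<^bsub>M\<^esub> \<oplus>\<^bsub>M\<^esub> x" "x \<in> V" using smodD(2)[OF V] by auto
    then show "x \<in> ssum M U V" unfolding ssum_def using smodD(3)[OF U] by blast
  qed
  show "smod (ssum M U V) M"
  proof (rule smodI[OF M])
    show "ssum M U V \<subseteq> carrier M" using smodD(2)[OF U] smodD(2)[OF V] by (auto simp: ssum_def)
    show "\<zero>\<^bsub>M\<^esub> \<in> ssum M U V" using 1 smodD(3)[OF U] by auto
    fix x y assume "x \<in> ssum M U V" "y \<in> ssum M U V"
    then obtain a b c d where *: "x = a \<oplus>\<^bsub>M\<^esub> b" "y = c \<oplus>\<^bsub>M\<^esub> d" "a \<in> U" "b \<in> V" "c \<in> U" "d \<in> V"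
      unfolding ssum_def by blast
    then have "x \<oplus>\<^bsub>M\<^esub> y = (a \<oplus>\<^bsub>M\<^esub> c) \<oplus>\<^bsub>M\<^esub> (b \<oplus>\<^bsub>M\<^esub> d)"
      using smodD(2)[OF U] smodD(2)[OF V] by (simp add: M.M.a_ac)
    then show "x \<oplus>\<^bsub>M\<^esub> y \<in> ssum M U V" unfolding ssum_def using * smodD(4)[OF U] smodD(4)[OF V] by blast
  next
    fix a x assume a: "a \<in> carrier \<Lambda>" and "x \<in> ssum M U V"
    then obtain u v where *: "x = u \<oplus>\<^bsub>M\<^esub> v" "u \<in> U" "v \<in> V" unfolding ssum_def by blast
    then have "a \<odot>\<^bsub>M\<^esub> x = a \<odot>\<^bsub>M\<^esub> u \<oplus>\<^bsub>M\<^esub> a \<odot>\<^bsub>M\<^esub> v"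
      using a smodD(2)[OF U] smodD(2)[OF V] by (simp add: M.lsmult_r_distr)
    then show "a \<odot>\<^bsub>M\<^esub> x \<in> ssum M U V" unfolding ssum_def using * a smodD(5)[OF U] smodD(5)[OF V] by blast
  qed
qed

text \<open>Unlike membership in \<open>lhom\<close>, this asks for no extensionality, so composites
  and sums need no restriction to the carrier. It also records that both sides are modules.
  \<open>lh_restrict\<close> and \<open>lhomD\<close> translate between the two notions.\<close>

definition lh :: "('a, 'm) module \<Rightarrow> ('a, 'n) module \<Rightarrow> ('m \<Rightarrow> 'n) \<Rightarrow> bool" where
  "lh M N f \<longleftrightarrow> lm M \<and> lm N \<and> (\<forall>x\<in>carrier M. f x \<in> carrier N) \<and>
     (\<forall>x\<in>carrier M. \<forall>y\<in>carrier M. f (x \<oplus>\<^bsub>M\<^esub> y) = f x \<oplus>\<^bsub>N\<^esub> f y) \<and>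
     (\<forall>a\<in>carrier \<Lambda>. \<forall>x\<in>carrier M. f (a \<odot>\<^bsub>M\<^esub> x) = a \<odot>\<^bsub>N\<^esub> f x)"

definition lker :: "('a, 'm) module \<Rightarrow> ('a, 'n) module \<Rightarrow> ('m \<Rightarrow> 'n) \<Rightarrow> 'm set" where
  "lker M N f = {x \<in> carrier M. f x = \<zero>\<^bsub>N\<^esub>}"

lemma lhD:
  assumes "lh M N f"
  shows "lm M" and "lm N" and "x \<in> carrier M \<Longrightarrow> f x \<in> carrier N"
    and "x \<in> carrier M \<Longrightarrow> y \<in> carrier M \<Longrightarrow> f (x \<oplus>\<^bsub>M\<^esub> y) = f x \<oplus>\<^bsub>N\<^esub> f y"
    and "a \<in> carrier \<Lambda> \<Longrightarrow> x \<in> carrier M \<Longrightarrow> f (a \<odot>\<^bsub>M\<^esub> x) = a \<odot>\<^bsub>N\<^esub> f x"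
  using assms by (auto simp: lh_def)

lemma lh_zero: assumes "lh M N f" shows "f \<zero>\<^bsub>M\<^esub> = \<zero>\<^bsub>N\<^esub>"
  using lhD(5)[OF assms, of \<zero> "\<zero>\<^bsub>M\<^esub>"] lm_rules(1,7)[OF lhD(1)[OF assms]] lm_rules(7)[OF lhD(2)[OF assms]]
    lhD(3)[OF assms] by (metis zero_closed)

lemma lh_minus:
  assumes "lh M N f" "x \<in> carrier M" "y \<in> carrier M" shows "f (x \<ominus>\<^bsub>M\<^esub> y) = f x \<ominus>\<^bsub>N\<^esub> f y"
  using assms lhD[OF assms(1)] by (simp add: lm_rules(5) lm_rules(9)[of M] lm_rules(9)[of N] del:
    lm_rules(8))

lemma lhI:
  assumes "lm M" "lm N" "\<And>x. x \<in> carrier M \<Longrightarrow> f x \<in> carrier N"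
    and "\<And>x y. x \<in> carrier M \<Longrightarrow> y \<in> carrier M \<Longrightarrow> f (x \<oplus>\<^bsub>M\<^esub> y) = f x \<oplus>\<^bsub>N\<^esub> f y"
    and "\<And>a x. a \<in> carrier \<Lambda> \<Longrightarrow> x \<in> carrier M \<Longrightarrow> f (a \<odot>\<^bsub>M\<^esub> x) = a \<odot>\<^bsub>N\<^esub> f x"
  shows "lh M N f"
  using assms by (auto simp: lh_def)

lemma lh_cong: "lh M N f \<Longrightarrow> (\<And>x. x \<in> carrier M \<Longrightarrow> g x = f x) \<Longrightarrow> lh M N g"
  by (auto simp: lh_def lm_rules)

lemma lhom_iff: "lm M \<Longrightarrow> lm N \<Longrightarrow> f \<in> lhom \<Lambda> M N \<longleftrightarrow> f \<in> extensional (carrier M) \<and> lh M N f"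
  by (auto simp: lhom_def lh_def PiE_def Pi_def)

lemma lh_restrict: "lh M N f \<Longrightarrow> restrict f (carrier M) \<in> lhom \<Lambda> M N"
  using lh_cong[of M N f "restrict f (carrier M)"] by (simp add: lhom_iff lhD)

lemma lh_id: "lm M \<Longrightarrow> lh M M (\<lambda>x. x)"
  by (simp add: lh_def)

lemma lh_const: "lm M \<Longrightarrow> lm N \<Longrightarrow> lh M N (\<lambda>x. \<zero>\<^bsub>N\<^esub>)"
  by (simp add: lh_def lm_rules abelian_monoid.l_zero abelian_group.axioms(1) left_module.axioms(2))

lemma lh_comp: "lh M N f \<Longrightarrow> lh N P g \<Longrightarrow> lh M P (\<lambda>x. g (f x))"
  by (simp add: lh_def)

lemma lh_add:
  assumes "lh M N f" "lh M N g" shows "lh M N (\<lambda>x. f x \<oplus>\<^bsub>N\<^esub> g x)"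
proof -
  interpret N: left_module \<Lambda> N by (rule lhD(2)[OF assms(1)])
  show ?thesis
    by (rule lhI) (use lhD[OF assms(1)] lhD[OF assms(2)] in \<open>auto simp: N.M.a_ac N.lsmult_r_distr lm_rules\<close>)
qed

lemma lh_diff:
  assumes "lh M N f" "lh M N g" shows "lh M N (\<lambda>x. f x \<ominus>\<^bsub>N\<^esub> g x)"
proof -
  interpret N: left_module \<Lambda> N by (rule lhD(2)[OF assms(1)])
  have "lh N N (\<lambda>x. \<ominus>\<^bsub>N\<^esub> x)"
  proof (rule lhI)
    fix a x assume ax: "a \<in> carrier \<Lambda>" "x \<in> carrier N"
    then have "a \<odot>\<^bsub>N\<^esub> (\<ominus>\<^bsub>N\<^esub> x) \<oplus>\<^bsub>N\<^esub> a \<odot>\<^bsub>N\<^esub> x = \<zero>\<^bsub>N\<^esub>"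
      using N.lsmult_r_distr[of a "\<ominus>\<^bsub>N\<^esub> x" x] by (simp add: N.M.l_neg lm_rules(6)[OF N.left_module_axioms])
    then show "\<ominus>\<^bsub>N\<^esub> (a \<odot>\<^bsub>N\<^esub> x) = a \<odot>\<^bsub>N\<^esub> (\<ominus>\<^bsub>N\<^esub> x)"
      using ax by (intro N.M.minus_equality) (auto intro: N.lsmult_closed)
  qed (auto intro: N.left_module_axioms simp: N.M.minus_add)
  from lh_add[OF assms(1) lh_comp[OF assms(2) this]] show ?thesis
    by (simp add: a_minus_def)
qed

lemma lh_sub_dom: "lh M N f \<Longrightarrow> smod U M \<Longrightarrow> lh (sub M U) N f"
  by (rule lhI) (auto simp: lhD lm_sub smodD)

lemma lh_sub_cod: "lh M N f \<Longrightarrow> smod V N \<Longrightarrow> (\<And>x. x \<in> carrier M \<Longrightarrow> f x \<in> V) \<Longrightarrow> lh M (sub N V) f"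
  by (rule lhI) (auto simp: lhD lm_sub smodD)

lemma lh_incl: "lm M \<Longrightarrow> smod U M \<Longrightarrow> lh (sub M U) M (\<lambda>x. x)"
  by (rule lh_sub_dom[OF lh_id])

lemma lh_cod: "lh M (sub N V) f \<Longrightarrow> lm N \<Longrightarrow> smod V N \<Longrightarrow> lh M N f"
  using lh_comp[OF _ lh_incl] by fastforce

lemma smod_image: assumes f: "lh M N f" and U: "smod U M" shows "smod (f ` U) N"
proof (rule smodI)
  show "lm N" using f by (rule lhD)
  show "f ` U \<subseteq> carrier N" using lhD(3)[OF f] smodD[OF U] by auto
  show "\<zero>\<^bsub>N\<^esub> \<in> f ` U" using lh_zero[OF f] smodD(3)[OF U] by (metis image_eqI)
  fix x y assume "x \<in> f ` U" "y \<in> f ` U"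
  then obtain u v where *: "u \<in> U" "v \<in> U" "x = f u" "y = f v" by auto
  then have "x \<oplus>\<^bsub>N\<^esub> y = f (u \<oplus>\<^bsub>M\<^esub> v)" using lhD(4)[OF f, of u v] smodD(2)[OF U] by simp
  then show "x \<oplus>\<^bsub>N\<^esub> y \<in> f ` U" using * smodD(4)[OF U] by blast
next
  fix a x assume a: "a \<in> carrier \<Lambda>" and "x \<in> f ` U"
  then obtain u where *: "u \<in> U" "x = f u" by auto
  then have "a \<odot>\<^bsub>N\<^esub> x = f (a \<odot>\<^bsub>M\<^esub> u)" using lhD(5)[OF f, of a u] a smodD(2)[OF U] by simp
  then show "a \<odot>\<^bsub>N\<^esub> x \<in> f ` U" using * a smodD(5)[OF U] by blast
qed

lemma smod_range: "lh M N f \<Longrightarrow> smod (f ` carrier M) N"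
  by (rule smod_image) (auto simp: smod_carrier lhD)

lemma smod_vimage: assumes f: "lh M N f" and V: "smod V N" shows "smod {x \<in> carrier M. f x \<in> V} M"
  by (rule smodI[OF lhD(1)[OF f]]) (use smodD[OF V] lhD[OF f] lh_zero[OF f] in \<open>auto simp: lm_rules\<close>)

lemma smod_lker: "lh M N f \<Longrightarrow> smod (lker M N f) M"
  using smod_vimage[OF _ smod_zero, of M N f] by (simp add: lhD lker_def)

lemma lh_inj_iff: assumes f: "lh M N f" shows "inj_on f (carrier M) \<longleftrightarrow> lker M N f = {\<zero>\<^bsub>M\<^esub>}"
proof
  assume inj: "inj_on f (carrier M)"
  have "x = \<zero>\<^bsub>M\<^esub>" if "x \<in> carrier M" "f x = \<zero>\<^bsub>N\<^esub>" for x
    by (rule inj_onD[OF inj]) (simp_all add: that lh_zero[OF f] lm_rules(1)[OF lhD(1)[OF f]])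
  then show "lker M N f = {\<zero>\<^bsub>M\<^esub>}"
    unfolding lker_def using lh_zero[OF f] lm_rules(1)[OF lhD(1)[OF f]] by blast
next
  assume k: "lker M N f = {\<zero>\<^bsub>M\<^esub>}"
  show "inj_on f (carrier M)"
  proof (rule inj_onI)
    fix x y assume *: "x \<in> carrier M" "y \<in> carrier M" "f x = f y"
    then have "x \<ominus>\<^bsub>M\<^esub> y \<in> lker M N f"
      using lh_minus[OF f *(1,2)] lm_rules(3)[OF lhD(1)[OF f] *(1,2)]
        lm_rules(10)[OF lhD(2)[OF f] lhD(3)[OF f *(1)] lhD(3)[OF f *(2)]] *(3) by (simp add: lker_def)
    then show "x = y" using k lm_rules(10)[OF lhD(1)[OF f] *(1,2)] by simp
  qed
qed

lemma inj_onI_lh: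
  assumes f: "lh M N f" and k: "\<And>x. x \<in> carrier M \<Longrightarrow> f x = \<zero>\<^bsub>N\<^esub> \<Longrightarrow> x = \<zero>\<^bsub>M\<^esub>"
  shows "inj_on f (carrier M)"
  unfolding lh_inj_iff[OF f]
proof (intro equalityI subsetI)
  fix x assume "x \<in> lker M N f"
  then show "x \<in> {\<zero>\<^bsub>M\<^esub>}" using k[of x] by (simp add: lker_def)
next
  fix x assume "x \<in> {\<zero>\<^bsub>M\<^esub>}"
  then show "x \<in> lker M N f" using lh_zero[OF f] lm_rules(1)[OF lhD(1)[OF f]] by (simp add: lker_def)
qed

lemma lker_eq:
  assumes f: "lh M N f" and "x \<in> carrier M" "y \<in> carrier M"
  shows "f x = f y \<longleftrightarrow> x \<ominus>\<^bsub>M\<^esub> y \<in> lker M N f"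
  using lh_minus[OF f assms(2,3)] lhD[OF f] assms by (simp add: lker_def lm_rules(3) lm_rules(10)[of N])

text \<open>The homomorphism theorem, without forming a quotient: the factor is defined through
  chosen preimages under \<open>q\<close>, and the inclusion of kernels makes the choice
  immaterial.\<close>

lemma lh_factor:
  assumes q: "lh M Q q" and surj: "q ` carrier M = carrier Q" and f: "lh M N f"
    and ker: "lker M Q q \<subseteq> lker M N f"
  obtains g where "lh Q N g" "\<And>x. x \<in> carrier M \<Longrightarrow> g (q x) = f x"
proof
  define g where "g = (\<lambda>y. f (inv_into (carrier M) q y))"
  show gq: "g (q x) = f x" if x: "x \<in> carrier M" for x
  proof -
    have "q x \<in> q ` carrier M" using x by simp
    then have *: "inv_into (carrier M) q (q x) \<in> carrier M" "q (inv_into (carrier M) q (q x)) = q x"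
      by (rule inv_into_into, rule f_inv_into_f)
    then show ?thesis using x ker lker_eq[OF q *(1) x] lker_eq[OF f *(1) x] by (auto simp: g_def)
  qed
  have ex: "\<exists>x\<in>carrier M. y = q x" if "y \<in> carrier Q" for y using that surj by auto
  show "lh Q N g"
  proof (rule lhI)
    show "lm Q" "lm N" using q f by (auto dest: lhD)
    show "g y \<in> carrier N" if "y \<in> carrier Q" for y using ex[OF that] lhD(3)[OF f] gq by auto
    fix y z assume "y \<in> carrier Q" "z \<in> carrier Q"
    then obtain u v where *: "u \<in> carrier M" "v \<in> carrier M" "y = q u" "z = q v" using ex by blast
    have "g (q (u \<oplus>\<^bsub>M\<^esub> v)) = f (u \<oplus>\<^bsub>M\<^esub> v)" by (rule gq) (rule lm_rules(2)[OF lhD(1)[OF q] *(1,2)])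
    then show "g (y \<oplus>\<^bsub>Q\<^esub> z) = g y \<oplus>\<^bsub>N\<^esub> g z" using * gq lhD(4)[OF q] lhD(4)[OF f] by simp
  next
    fix a y assume a: "a \<in> carrier \<Lambda>" and "y \<in> carrier Q"
    then obtain u where *: "u \<in> carrier M" "y = q u" using ex by blast
    have "g (q (a \<odot>\<^bsub>M\<^esub> u)) = f (a \<odot>\<^bsub>M\<^esub> u)" by (rule gq) (rule lm_rules(5)[OF lhD(1)[OF q] a *(1)])
    then show "g (a \<odot>\<^bsub>Q\<^esub> y) = a \<odot>\<^bsub>N\<^esub> g y" using a * gq lhD(5)[OF q] lhD(5)[OF f] by simp
  qed
qed

lemma lh_inverse:
  assumes f: "lh M N f" and inj: "inj_on f (carrier M)" and surj: "f ` carrier M = carrier N"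
  obtains g where "lh N M g" "\<And>x. x \<in> carrier M \<Longrightarrow> g (f x) = x" "\<And>y. y \<in> carrier N \<Longrightarrow> f (g y) = y"
proof -
  have "lker M N f \<subseteq> lker M M (\<lambda>x. x)"
    using inj lh_inj_iff[OF f] lm_rules(1)[OF lhD(1)[OF f]] by (auto simp: lker_def)
  then obtain g where g: "lh N M g" "\<And>x. x \<in> carrier M \<Longrightarrow> g (f x) = x"
    using lh_factor[OF f surj lh_id[OF lhD(1)[OF f]]] by blast
  moreover have "f (g y) = y" if "y \<in> carrier N" for y using that g(2) surj by force
  ultimately show ?thesis by (rule that)
qed

text \<open>A function on \<open>M\<close> whose fibres are the cosets of a submodule transports the structure of the
  quotient to its image. With representatives this gives quotients on the type of \<open>M\<close>, with injections
  copies on other types.\<close>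

definition im_mod :: "('m \<Rightarrow> 'n) \<Rightarrow> ('a, 'm) module \<Rightarrow> ('a, 'n) module" where
  "im_mod f M = (let g = inv_into (carrier M) f in
     \<lparr> carrier = f ` carrier M, mult = undefined, one = undefined, zero = f \<zero>\<^bsub>M\<^esub>,
       add = (\<lambda>x y. f (g x \<oplus>\<^bsub>M\<^esub> g y)), smult = (\<lambda>a x. f (a \<odot>\<^bsub>M\<^esub> g x)) \<rparr>)"

lemma im_mod:
  assumes M: "lm M" and N: "smod N M"
    and f: "\<And>x y. x \<in> carrier M \<Longrightarrow> y \<in> carrier M \<Longrightarrow> f x = f y \<longleftrightarrow> x \<ominus>\<^bsub>M\<^esub> y \<in> N"
  shows "lh M (im_mod f M) f" and "carrier (im_mod f M) = f ` carrier M" and "lker M (im_mod f M) f = N"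
proof -
  interpret M: left_module \<Lambda> M by fact
  let ?Q = "im_mod f M"
  show c: "carrier ?Q = f ` carrier M" by (simp add: im_mod_def Let_def)
  have z: "\<zero>\<^bsub>?Q\<^esub> = f \<zero>\<^bsub>M\<^esub>" by (simp add: im_mod_def Let_def)
  have inv: "inv_into (carrier M) f (f x) \<in> carrier M" "f (inv_into (carrier M) f (f x)) = f x"
    if "x \<in> carrier M" for x
    using that by (auto intro: inv_into_into f_inv_into_f)
  have a: "f x \<oplus>\<^bsub>?Q\<^esub> f y = f (x \<oplus>\<^bsub>M\<^esub> y)" if x: "x \<in> carrier M" and y: "y \<in> carrier M" for x y
  proof -
    define x' y' where "x' = inv_into (carrier M) f (f x)" and "y' = inv_into (carrier M) f (f y)"
    have *: "x' \<in> carrier M" "y' \<in> carrier M" "x' \<ominus>\<^bsub>M\<^esub> x \<in> N" "y' \<ominus>\<^bsub>M\<^esub> y \<in> N"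
      unfolding x'_def y'_def using inv[OF x] inv[OF y] f x y by auto
    have "(x' \<oplus>\<^bsub>M\<^esub> y') \<ominus>\<^bsub>M\<^esub> (x \<oplus>\<^bsub>M\<^esub> y) = (x' \<ominus>\<^bsub>M\<^esub> x) \<oplus>\<^bsub>M\<^esub> (y' \<ominus>\<^bsub>M\<^esub> y)"
      using x y * by (simp add: a_minus_def M.M.minus_add M.M.a_ac)
    then have "f (x' \<oplus>\<^bsub>M\<^esub> y') = f (x \<oplus>\<^bsub>M\<^esub> y)"
      using f[of "x' \<oplus>\<^bsub>M\<^esub> y'" "x \<oplus>\<^bsub>M\<^esub> y"] * x y smodD(4)[OF N] by simp
    then show ?thesis by (simp add: im_mod_def Let_def x'_def y'_def)
  qed
  have s: "r \<odot>\<^bsub>?Q\<^esub> f x = f (r \<odot>\<^bsub>M\<^esub> x)" if x: "x \<in> carrier M" and r: "r \<in> carrier \<Lambda>" for x r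
  proof -
    define x' where "x' = inv_into (carrier M) f (f x)"
    have *: "x' \<in> carrier M" "x' \<ominus>\<^bsub>M\<^esub> x \<in> N" unfolding x'_def using inv[OF x] f x by auto
    have "lh M M (\<lambda>x. x)" by (rule lh_id[OF M])
    have "r \<odot>\<^bsub>M\<^esub> x' = r \<odot>\<^bsub>M\<^esub> (x' \<ominus>\<^bsub>M\<^esub> x) \<oplus>\<^bsub>M\<^esub> r \<odot>\<^bsub>M\<^esub> x"
      using M.lsmult_r_distr[OF r, of "x' \<ominus>\<^bsub>M\<^esub> x" x] * x lm_rules(11)[OF M] by simp
    then have "r \<odot>\<^bsub>M\<^esub> x' \<ominus>\<^bsub>M\<^esub> r \<odot>\<^bsub>M\<^esub> x = r \<odot>\<^bsub>M\<^esub> (x' \<ominus>\<^bsub>M\<^esub> x)"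
      using r * x by (simp add: a_minus_def M.M.a_assoc M.M.r_neg M.lsmult_closed)
    then have "f (r \<odot>\<^bsub>M\<^esub> x') = f (r \<odot>\<^bsub>M\<^esub> x)"
      using f[of "r \<odot>\<^bsub>M\<^esub> x'" "r \<odot>\<^bsub>M\<^esub> x"] * x r smodD(5)[OF N r] by (simp add: M.lsmult_closed)
    then show ?thesis by (simp add: im_mod_def Let_def x'_def)
  qed
  have "lm ?Q"
  proof (rule lmI)
    fix x assume "x \<in> carrier ?Q"
    then obtain u where u: "u \<in> carrier M" "x = f u" using c by auto
    then have "f (\<ominus>\<^bsub>M\<^esub> u) \<oplus>\<^bsub>?Q\<^esub> x = \<zero>\<^bsub>?Q\<^esub>" using a[of "\<ominus>\<^bsub>M\<^esub> u" u] z M.M.l_neg by simp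
    then show "\<exists>y\<in>carrier ?Q. y \<oplus>\<^bsub>?Q\<^esub> x = \<zero>\<^bsub>?Q\<^esub>" using u c by auto
  qed (auto simp: c z a s M.M.a_ac M.lsmult_l_distr M.lsmult_r_distr M.lsmult_assoc
      M.lsmult_one M.lsmult_closed)
  then show lh: "lh M ?Q f" by (intro lhI M) (auto simp: c a s)
  show "lker M ?Q f = N"
  proof (intro equalityI subsetI)
    fix x assume "x \<in> lker M ?Q f"
    then have "x \<in> carrier M" "f x = f \<zero>\<^bsub>M\<^esub>" by (auto simp: lker_def z)
    then show "x \<in> N" using f[of x "\<zero>\<^bsub>M\<^esub>"] by (simp add: lm_rules(13)[OF M])
  next
    fix x assume "x \<in> N"
    then show "x \<in> lker M ?Q f" using f[of x "\<zero>\<^bsub>M\<^esub>"] smodD(2)[OF N]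
      by (simp add: lker_def z lm_rules(13)[OF M])
  qed
qed

lemma quotient_exists:
  assumes M: "lm (M :: ('a, 'm) module)" and N: "smod N M"
  obtains Q :: "('a, 'm) module" and q where "lh M Q q" "q ` carrier M = carrier Q" "lker M Q q = N"
proof -
  interpret M: left_module \<Lambda> M by fact
  define q where "q = (\<lambda>x. SOME y. y \<in> carrier M \<and> y \<ominus>\<^bsub>M\<^esub> x \<in> N)"
  have q: "q x \<in> carrier M \<and> q x \<ominus>\<^bsub>M\<^esub> x \<in> N" if "x \<in> carrier M" for x
    unfolding q_def by (rule someI[of _ x]) (use that smodD(3)[OF N] in \<open>simp add: a_minus_def M.M.r_neg\<close>)
  have sym: "x \<ominus>\<^bsub>M\<^esub> y \<in> N" if "y \<ominus>\<^bsub>M\<^esub> x \<in> N" "x \<in> carrier M" "y \<in> carrier M" for x y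
  proof -
    have "x \<ominus>\<^bsub>M\<^esub> y = \<ominus>\<^bsub>M\<^esub> (y \<ominus>\<^bsub>M\<^esub> x)" using that by (simp add: a_minus_def M.M.minus_add M.M.a_comm)
    also have "\<dots> = (\<ominus> \<one>) \<odot>\<^bsub>M\<^esub> (y \<ominus>\<^bsub>M\<^esub> x)" using lm_rules(8)[OF M] that by simp
    finally show ?thesis using smodD(5)[OF N _ that(1), of "\<ominus> \<one>"] by simp
  qed
  have tr: "x \<ominus>\<^bsub>M\<^esub> z \<in> N" if "x \<ominus>\<^bsub>M\<^esub> y \<in> N" "y \<ominus>\<^bsub>M\<^esub> z \<in> N" "x \<in> carrier M" "y \<in> carrier M" "z \<in> carrier M"
    for x y z
  proof -
    have "x \<ominus>\<^bsub>M\<^esub> z = (x \<ominus>\<^bsub>M\<^esub> y) \<oplus>\<^bsub>M\<^esub> (y \<ominus>\<^bsub>M\<^esub> z)"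
      using lm_rules(11)[OF M, of x y] that(3-5) by (simp add: a_minus_def M.M.a_assoc[symmetric])
    then show ?thesis using smodD(4)[OF N that(1,2)] by simp
  qed
  have eq: "q x = q y \<longleftrightarrow> x \<ominus>\<^bsub>M\<^esub> y \<in> N" if x: "x \<in> carrier M" and y: "y \<in> carrier M" for x y
  proof
    assume "q x = q y"
    then have "x \<ominus>\<^bsub>M\<^esub> q x \<in> N" "q x \<ominus>\<^bsub>M\<^esub> y \<in> N" using q[OF x] q[OF y] x sym by auto
    then show "x \<ominus>\<^bsub>M\<^esub> y \<in> N" using tr x y q[OF x] by blast
  next
    assume xy: "x \<ominus>\<^bsub>M\<^esub> y \<in> N"
    \<comment> \<open>For congruent \<open>x\<close> and \<open>y\<close> the predicates under
      \<open>SOME\<close> are equivalent, so the same representative is picked.\<close>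
    have "z \<ominus>\<^bsub>M\<^esub> x \<in> N \<longleftrightarrow> z \<ominus>\<^bsub>M\<^esub> y \<in> N" if "z \<in> carrier M" for z
      using tr[OF _ xy that x y] tr[OF _ sym[OF xy y x] that y x] by blast
    then show "q x = q y" unfolding q_def by metis
  qed
  show ?thesis using that[of "im_mod q M" q] im_mod[OF M N eq] by simp
qed

lemma transport:
  assumes M: "lm M" and inj: "inj_on f (carrier M)"
  shows "lh M (im_mod f M) f" and "carrier (im_mod f M) = f ` carrier M"
proof -
  have "f x = f y \<longleftrightarrow> x \<ominus>\<^bsub>M\<^esub> y \<in> {\<zero>\<^bsub>M\<^esub>}" if "x \<in> carrier M" "y \<in> carrier M" for x y
    using that inj lm_rules(10)[OF M that] by (simp add: inj_on_eq_iff)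
  from im_mod[OF M smod_zero[OF M] this] show "lh M (im_mod f M) f" "carrier (im_mod f M) = f ` carrier M"
    by auto
qed

section \<open>Dimension\<close>

text \<open>Restriction of scalars along \<open>scal\<close>: the results on vector spaces reach
  modules only through this record.\<close>

definition kv :: "('a, 'm) module \<Rightarrow> ('k, 'm) module" where
  "kv M = \<lparr> carrier = carrier M, mult = undefined, one = undefined, zero = \<zero>\<^bsub>M\<^esub>, add = add M,
     smult = (\<lambda>c x. scal c \<odot>\<^bsub>M\<^esub> x) \<rparr>"

lemma kv_simps [simp]: "carrier (kv M) = carrier M" "\<zero>\<^bsub>kv M\<^esub> = \<zero>\<^bsub>M\<^esub>" "x \<oplus>\<^bsub>kv M\<^esub> y = x \<oplus>\<^bsub>M\<^esub> y"
  "c \<odot>\<^bsub>kv M\<^esub> x = scal c \<odot>\<^bsub>M\<^esub> x" "(kv M)\<lparr>carrier := N\<rparr> = kv (sub M N)"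
  by (simp_all add: kv_def)

lemma kv_vs: assumes M: "lm M" shows "vectorspace class_ring (kv M)"
proof -
  interpret M: left_module \<Lambda> M by fact
  have n: "\<exists>y\<in>carrier M. x \<oplus>\<^bsub>M\<^esub> y = \<zero>\<^bsub>M\<^esub>" if "x \<in> carrier M" for x
    using that M.M.r_neg by (intro bexI[of _ "\<ominus>\<^bsub>M\<^esub> x"]) auto
  show ?thesis
    by (rule vs_criteria) (use n in \<open>auto simp: class_field M.M.a_ac M.lsmult_closed scal_add scal_mult
      scal_one
        M.lsmult_l_distr M.lsmult_r_distr M.lsmult_assoc M.lsmult_one\<close>)
qed

lemma lh_lin: "lh M N f \<Longrightarrow> lin (kv M) (kv N) f"
  by (rule linI) (auto simp: kv_vs lhD)

lemma smod_subspace: assumes M: "lm M" and N: "smod N M" shows "subspace class_ring N (kv M)"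
  by (rule subspaceI) (use kv_vs[OF M] smodD[OF N] in auto)

text \<open>Finite-dimensional modules on an arbitrary carrier type. On \<open>'k vec\<close> they
  are the objects of \<open>modcat\<close>, by \<open>modcat_iff\<close>.\<close>

definition fm :: "('a, 'm) module \<Rightarrow> bool" where "fm M \<longleftrightarrow> lm M \<and> fin_vs (kv M)"
definition dm :: "('a, 'm) module \<Rightarrow> nat" where "dm M = vdim (kv M)"

lemma fmD: "fm M \<Longrightarrow> lm M" by (simp add: fm_def)

lemma fm_sub:
  assumes M: "fm M" and N: "smod N M"
  shows "fm (sub M N)" "dm (sub M N) \<le> dm M" "dm (sub M N) = dm M \<Longrightarrow> N = carrier M"
  using fin_vs_subspace[of "kv M" N] smod_subspace[OF fmD[OF M] N] M lm_sub[OF fmD[OF M] N]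
  by (auto simp: fm_def dm_def)

lemma fm_inj:
  assumes "lh M N f" "fm N" "inj_on f (carrier M)"
  shows "fm M" "dm M \<le> dm N"
  using fin_vs_inj[OF lh_lin[OF assms(1)]] assms lhD(1)[OF assms(1)] by (auto simp: fm_def dm_def)

lemma dm_rank:
  assumes "lh M N f" "fm M"
  shows "dm (sub N (f ` carrier M)) + dm (sub M (lker M N f)) = dm M"
  using rank_nullity_vs(2)[OF _ lh_lin[OF assms(1)]] assms by (simp add: fm_def dm_def lker_def)

lemma fm_surj:
  assumes "lh M N f" "fm M" "f ` carrier M = carrier N"
  shows "fm N"
  using rank_nullity_vs(1)[OF _ lh_lin[OF assms(1)]] assms lhD(2)[OF assms(1)] by (simp add: fm_def)

lemma dm_surj:
  assumes "lh M N f" "fm M" "f ` carrier M = carrier N"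
  shows "dm N + dm (sub M (lker M N f)) = dm M"
  using dm_rank[OF assms(1,2)] assms(3) by simp

lemma fm_ext:
  assumes "lh M N f" "fm N" "fm (sub M (lker M N f))"
  shows "fm M"
  using fin_vs_extension[OF lh_lin[OF assms(1)]] assms lhD(1)[OF assms(1)] by (simp add: fm_def lker_def)

lemma dm_eq_0:
  assumes "fm M" shows "dm M = 0 \<longleftrightarrow> carrier M = {\<zero>\<^bsub>M\<^esub>}"
  using vdim_eq_0[of "kv M"] vdim_zero(2)[of "kv M"] kv_vs[OF fmD[OF assms]] assms
    by (auto simp: fm_def dm_def)

lemma fm_zero: assumes "lm M" "carrier M = {\<zero>\<^bsub>M\<^esub>}" shows "fm M"
  using vdim_zero(1)[of "kv M"] kv_vs[OF assms(1)] assms by (simp add: fm_def)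

lemma dm_less: assumes "fm M" "smod N M" "N \<noteq> carrier M" shows "dm (sub M N) < dm M"
  using fm_sub[OF assms(1,2)] assms(3) by fastforce

lemma dm_less_surj:
  assumes "lh M N f" "fm M" "f ` carrier M = carrier N" "lker M N f \<noteq> {\<zero>\<^bsub>M\<^esub>}"
  shows "dm N < dm M"
proof -
  have "dm (sub M (lker M N f)) \<noteq> 0"
    using dm_eq_0[OF fm_sub(1)[OF assms(2) smod_lker[OF assms(1)]]] assms(4) by simp
  then show ?thesis using dm_surj[OF assms(1-3)] by simp
qed

text \<open>A finite set that spans over the field also generates over \<open>\<Lambda>\<close>,
  because submodules are subspaces. The last clause provides the coordinates with which
  \<open>copy_exists\<close> encodes a module.\<close>

lemma fm_gen:
  assumes M: "fm M"
  obtains A where "finite A" "A \<subseteq> carrier M" "\<And>N. smod N M \<Longrightarrow> A \<subseteq> N \<Longrightarrow> N = carrier M"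
    "\<And>x. x \<in> carrier M \<Longrightarrow> \<exists>a. x = LinearCombinations.module.lincomb (kv M) a A"
proof -
  interpret V: vectorspace class_ring "kv M" using M kv_vs fmD by blast
  obtain A where A: "finite A" "A \<subseteq> carrier M" "V.span A = carrier M"
    using M by (auto simp: fm_def fin_vs_def V.fin_dim_def)
  show ?thesis
  proof (rule that[OF A(1,2)])
    fix N assume N: "smod N M" "A \<subseteq> N"
    have "V.span A \<subseteq> N" using V.span_is_subset[OF N(2)] smod_subspace[OF fmD[OF M] N(1)] by simp
    then show "N = carrier M" using A(3) smodD(1)[OF N(1)] by auto
  next
    fix x assume "x \<in> carrier M"
    then show "\<exists>a. x = V.lincomb a A" using V.finite_in_span[OF A(1), of x] A by auto
  qed
qed

lemma regular_simps [simp]: "carrier (regular \<Lambda>) = carrier \<Lambda>" "\<zero>\<^bsub>regular \<Lambda>\<^esub> = \<zero>"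
  "x \<oplus>\<^bsub>regular \<Lambda>\<^esub> y = x \<oplus> y" "x \<odot>\<^bsub>regular \<Lambda>\<^esub> y = x \<otimes> y"
  by (simp_all add: regular_def ring.defs)

lemma lm_regular: "lm (regular \<Lambda>)"
  by (rule lmI) (auto simp: a_ac m_assoc l_distr r_distr intro: l_neg)

lemma fm_regular: "fm (regular \<Lambda>)"
proof -
  have "lin (kv (regular \<Lambda>)) \<Lambda> (\<lambda>x. x)"
    by (rule linI) (use kv_vs[OF lm_regular] fin in \<open>auto simp: fin_vs_def scal_mult_eq\<close>)
  from fin_vs_inj(1)[OF this fin] show ?thesis using lm_regular by (simp add: fm_def)
qed

text \<open>Presents cyclic modules as images of the regular module, which brings questions about
  single elements back to left ideals of \<open>\<Lambda>\<close>.\<close>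

lemma lh_orbit: assumes M: "lm M" and x: "x \<in> carrier M" shows "lh (regular \<Lambda>) M (\<lambda>a. a \<odot>\<^bsub>M\<^esub> x)"
proof -
  interpret M: left_module \<Lambda> M by fact
  show ?thesis
    by (rule lhI) (use lm_regular M x in \<open>auto simp: M.lsmult_l_distr M.lsmult_assoc intro:
      M.lsmult_closed\<close>)
qed

lemma lspan_eqI:
  assumes "lm M" "A \<subseteq> carrier M" "\<And>N. smod N M \<Longrightarrow> A \<subseteq> N \<Longrightarrow> N = carrier M"
  shows "lspan \<Lambda> M A = carrier M"
  unfolding lspan_def using assms smod_carrier[OF assms(1)] by blast

lemma smod_lspan:
  assumes M: "lm M" and A: "A \<subseteq> carrier M"
  shows "smod (lspan \<Lambda> M A) M" and "A \<subseteq> lspan \<Lambda> M A"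
    and "\<And>N. smod N M \<Longrightarrow> A \<subseteq> N \<Longrightarrow> lspan \<Lambda> M A \<subseteq> N"
proof -
  show "A \<subseteq> lspan \<Lambda> M A" and "\<And>N. smod N M \<Longrightarrow> A \<subseteq> N \<Longrightarrow> lspan \<Lambda> M A \<subseteq> N"
    by (auto simp: lspan_def)
  show "smod (lspan \<Lambda> M A) M"
  proof (rule smodI[OF M])
    show "lspan \<Lambda> M A \<subseteq> carrier M" using smod_carrier[OF M] A by (auto simp: lspan_def)
  qed (auto simp: lspan_def intro: smodD(3-5))
qed

text \<open>Induction on the generators. Adjoining \<open>x\<close> to a submodule \<open>N\<close>
  adds the layer \<open>(N + \<Lambda> x) / N\<close>, an image of the regular module and so
  finite-dimensional; \<open>fm_ext\<close> joins the layers.\<close>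

lemma fin_gen_imp_fm:
  assumes M: "lm M" and "fin_gen \<Lambda> M"
  shows "fm M"
proof -
  interpret M: left_module \<Lambda> M by fact
  obtain X where X: "X \<subseteq> carrier M" "finite X" "lspan \<Lambda> M X = carrier M"
    using assms(2) by (auto simp: fin_gen_def)
  have "\<exists>N. smod N M \<and> X \<subseteq> N \<and> fm (sub M N)" using X(2,1)
  proof (induction X rule: finite_induct)
    case empty
    have "fm (sub M {\<zero>\<^bsub>M\<^esub>})" by (rule fm_zero) (use lm_sub[OF M smod_zero[OF M]] in auto)
    then show ?case using smod_zero[OF M] by blast
  next
    case (insert x X)
    then obtain N where N: "smod N M" "X \<subseteq> N" "fm (sub M N)" by auto
    have x: "x \<in> carrier M" using insert by auto
    let ?O = "(\<lambda>a. a \<odot>\<^bsub>M\<^esub> x) ` carrier \<Lambda>"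
    have O: "smod ?O M" using smod_range[OF lh_orbit[OF M x]] by simp
    have xO: "x \<in> ?O" using M.lsmult_one[OF x] by (metis image_eqI one_closed)
    let ?L = "ssum M N ?O"
    note L = smod_ssum[OF M N(1) O]
    have NL: "smod N (sub M ?L)" using N(1) L(1,2) by (simp add: smod_sub_iff[OF M])
    obtain Q :: "('a, 'b) module" and q
      where q: "lh (sub M ?L) Q q" "q ` ?L = carrier Q" "lker (sub M ?L) Q q = N"
      using quotient_exists[OF lm_sub[OF M L(1)] NL] by auto
    have o: "lh (regular \<Lambda>) (sub M ?L) (\<lambda>a. a \<odot>\<^bsub>M\<^esub> x)"
      by (rule lh_sub_cod[OF lh_orbit[OF M x] L(1)]) (use L(3) in auto)
    have "carrier Q \<subseteq> (\<lambda>a. q (a \<odot>\<^bsub>M\<^esub> x)) ` carrier \<Lambda>"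
    proof
      fix y assume "y \<in> carrier Q"
      then obtain z where z: "z \<in> ?L" "y = q z" using q(2) by blast
      then obtain n a where na: "n \<in> N" "a \<in> carrier \<Lambda>" "y = q (n \<oplus>\<^bsub>M\<^esub> a \<odot>\<^bsub>M\<^esub> x)"
        unfolding ssum_def by blast
      have mem: "n \<in> ?L" "a \<odot>\<^bsub>M\<^esub> x \<in> ?L" using L(2,3) na by auto
      have "q n = \<zero>\<^bsub>Q\<^esub>" using q(3) na(1) by (auto simp: lker_def)
      then have "y = \<zero>\<^bsub>Q\<^esub> \<oplus>\<^bsub>Q\<^esub> q (a \<odot>\<^bsub>M\<^esub> x)" using lhD(4)[OF q(1), of n] mem na(3) by simp
      also have "\<dots> = q (a \<odot>\<^bsub>M\<^esub> x)"
        using lhD(2,3)[OF q(1)] mem by (simp add: abelian_monoid.l_zero abelian_group.axioms(1)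
          left_module.axioms(2))
      finally show "y \<in> (\<lambda>a. q (a \<odot>\<^bsub>M\<^esub> x)) ` carrier \<Lambda>" using na(2) by blast
    qed
    moreover have "(\<lambda>a. q (a \<odot>\<^bsub>M\<^esub> x)) ` carrier \<Lambda> \<subseteq> carrier Q"
      using lhD(3)[OF lh_comp[OF o q(1)]] by auto
    ultimately have "fm Q" using fm_surj[OF lh_comp[OF o q(1)] fm_regular] by auto
    then have "fm (sub M ?L)" using fm_ext[OF q(1)] q(3) N(3) by simp
    then show ?case using L xO N(2) by blast
  qed
  then obtain N where N: "smod N M" "X \<subseteq> N" "fm (sub M N)" by auto
  then have "N = carrier M" using X(3) smodD(1)[OF N(1)] by (auto simp: lspan_def)
  then show ?thesis using N(3) by simp
qed

lemma modcat_iff: "M \<in> modcat \<Lambda> \<longleftrightarrow> fm M"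
proof
  assume "M \<in> modcat \<Lambda>" then show "fm M" using fin_gen_imp_fm by (auto simp: modcat_def)
next
  assume M: "fm M"
  obtain A where A: "finite A" "A \<subseteq> carrier M" "\<And>N. smod N M \<Longrightarrow> A \<subseteq> N \<Longrightarrow> N = carrier M"
    using fm_gen[OF M] by metis
  have "lspan \<Lambda> M A = carrier M" using lspan_eqI[OF fmD[OF M] A(2,3)] .
  then show "M \<in> modcat \<Lambda>" using A M by (auto simp: modcat_def fin_gen_def fm_def)
qed

definition liso :: "('a, 'm) module \<Rightarrow> ('a, 'n) module \<Rightarrow> ('m \<Rightarrow> 'n) \<Rightarrow> bool" where
  "liso M N f \<longleftrightarrow> lh M N f \<and> bij_betw f (carrier M) (carrier N)"

lemma lmod_iso_iff:
  assumes "lm M" "lm N"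
  shows "lmod_iso \<Lambda> M N \<longleftrightarrow> (\<exists>f. liso M N f)"
proof
  assume "\<exists>f. liso M N f"
  then obtain f where f: "lh M N f" "bij_betw f (carrier M) (carrier N)" by (auto simp: liso_def)
  have "bij_betw (restrict f (carrier M)) (carrier M) (carrier N)"
    using f(2) by (subst bij_betw_cong[where g = f]) auto
  then show "lmod_iso \<Lambda> M N" unfolding lmod_iso_def using lh_restrict[OF f(1)] by blast
next
  assume "lmod_iso \<Lambda> M N"
  then show "\<exists>f. liso M N f" unfolding lmod_iso_def liso_def using lhom_iff[OF assms] by blast
qed

lemma liso_inverse:
  assumes "liso M N f"
  obtains g where "liso N M g" "\<And>x. x \<in> carrier M \<Longrightarrow> g (f x) = x" "\<And>y. y \<in> carrier N \<Longrightarrow> f (g y) = y"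
proof -
  have f: "lh M N f" "inj_on f (carrier M)" "f ` carrier M = carrier N"
    using assms by (auto simp: liso_def bij_betw_def)
  obtain g where g: "lh N M g" "\<And>x. x \<in> carrier M \<Longrightarrow> g (f x) = x" "\<And>y. y \<in> carrier N \<Longrightarrow> f (g y) = y"
    using lh_inverse[OF f] by blast
  have "bij_betw g (carrier N) (carrier M)"
    by (rule bij_betwI[of _ _ _ f]) (use g lhD(3)[OF g(1)] lhD(3)[OF f(1)] in auto)
  then show ?thesis using that g by (auto simp: liso_def)
qed

text \<open>Coordinates over a finite spanning set embed the carrier into \<open>'k vec\<close>, and
  \<open>transport\<close> moves the structure along. In this way modules on other types, such as
  the regular module and direct sums, become objects of \<open>modcat\<close>.\<close>

lemma copy_exists:
  assumes M: "fm M"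
  obtains M' :: "('a, 'k vec) module" and f where "M' \<in> modcat \<Lambda>" "liso M M' f"
proof -
  obtain A where A: "finite A" "A \<subseteq> carrier M"
    "\<And>x. x \<in> carrier M \<Longrightarrow> \<exists>a. x = LinearCombinations.module.lincomb (kv M) a A"
    using fm_gen[OF M] by metis
  interpret V: vectorspace class_ring "kv M" using M kv_vs fmD by blast
  obtain e where e: "bij_betw e {0..<card A} A" using A(1) ex_bij_betw_nat_finite by blast
  \<comment> \<open>Coefficients over a spanning set are not unique. Any fixed choice recovers the
    element from its vector, which is all that injectivity asks.\<close>
  define f where "f = (\<lambda>x. vec (card A) (\<lambda>i. (SOME a. x = V.lincomb a A) (e i)))"
  have "inj_on f (carrier M)"
  proof (rule inj_onI)
    fix x y assume xy: "x \<in> carrier M" "y \<in> carrier M" "f x = f y"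
    define a b where "a = (SOME a. x = V.lincomb a A)" and "b = (SOME a. y = V.lincomb a A)"
    have x: "x = V.lincomb a A" unfolding a_def using A(3)[OF xy(1)] by (rule someI_ex)
    have y: "y = V.lincomb b A" unfolding b_def using A(3)[OF xy(2)] by (rule someI_ex)
    have *: "a (e i) = b (e i)" if "i < card A" for i
      using arg_cong[OF xy(3), of "\<lambda>v. v $ i"] that by (simp add: f_def a_def b_def)
    have "a v = b v" if v: "v \<in> A" for v
    proof -
      have "v \<in> e ` {0..<card A}" using v e by (simp add: bij_betw_def)
      then obtain i where "i < card A" "v = e i" by auto
      then show ?thesis using * by simp
    qed
    then have "V.lincomb a A = V.lincomb b A" by (intro V.lincomb_cong) (use A in auto)
    then show "x = y" using x y by simp
  qed
  from transport[OF fmD[OF M] this] have t: "lh M (im_mod f M) f" "carrier (im_mod f M) = f ` carrier M"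
    by auto
  moreover have "fm (im_mod f M)" using fm_surj[OF t(1) M] t(2) by simp
  ultimately show ?thesis using that[of "im_mod f M" f] \<open>inj_on f (carrier M)\<close>
    by (simp add: modcat_iff liso_def bij_betw_def)
qed

section \<open>Biproducts and retracts\<close>

text \<open>Direct sums by their maps and equations instead of by pairs: the summands and the sum
  may live on any types, and the sum may be a given module of which the summands are
  submodules.\<close>

definition bip :: "('a, 'm) module \<Rightarrow> ('a, 'n) module \<Rightarrow> ('a, 'd) module \<Rightarrow>
    ('m \<Rightarrow> 'd) \<Rightarrow> ('n \<Rightarrow> 'd) \<Rightarrow> ('d \<Rightarrow> 'm) \<Rightarrow> ('d \<Rightarrow> 'n) \<Rightarrow> bool" where
  "bip A B D i j p q \<longleftrightarrow> lh A D i \<and> lh B D j \<and> lh D A p \<and> lh D B q \<and>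
     (\<forall>x\<in>carrier A. p (i x) = x \<and> q (i x) = \<zero>\<^bsub>B\<^esub>) \<and> (\<forall>x\<in>carrier B. q (j x) = x \<and> p (j x) = \<zero>\<^bsub>A\<^esub>) \<and>
     (\<forall>x\<in>carrier D. i (p x) \<oplus>\<^bsub>D\<^esub> j (q x) = x)"

lemma bipD:
  assumes "bip A B D i j p q"
  shows "lh A D i" "lh B D j" "lh D A p" "lh D B q" "x \<in> carrier A \<Longrightarrow> p (i x) = x"
    "x \<in> carrier A \<Longrightarrow> q (i x) = \<zero>\<^bsub>B\<^esub>" "y \<in> carrier B \<Longrightarrow> q (j y) = y" "y \<in> carrier B \<Longrightarrow> p (j y) = \<zero>\<^bsub>A\<^esub>"
    "z \<in> carrier D \<Longrightarrow> i (p z) \<oplus>\<^bsub>D\<^esub> j (q z) = z"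
  using assms by (auto simp: bip_def)

lemma bip_swap: assumes "bip A B D i j p q" shows "bip B A D j i q p"
proof -
  interpret D: left_module \<Lambda> D using bipD(1)[OF assms] by (rule lhD)
  have "j (q x) \<oplus>\<^bsub>D\<^esub> i (p x) = x" if "x \<in> carrier D" for x
    using bipD(9)[OF assms that] lhD(3)[OF bipD(1)[OF assms]] lhD(3)[OF bipD(2)[OF assms]]
      lhD(3)[OF bipD(3)[OF assms]] lhD(3)[OF bipD(4)[OF assms]] that by (simp add: D.M.a_comm)
  then show ?thesis using bipD[OF assms] by (auto simp: bip_def)
qed

lemma dsum_simps [simp]: "carrier (dsum A B) = carrier A \<times> carrier B"
  "\<zero>\<^bsub>dsum A B\<^esub> = (\<zero>\<^bsub>A\<^esub>, \<zero>\<^bsub>B\<^esub>)"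
  "(x, y) \<oplus>\<^bsub>dsum A B\<^esub> (x', y') = (x \<oplus>\<^bsub>A\<^esub> x', y \<oplus>\<^bsub>B\<^esub> y')"
  "a \<odot>\<^bsub>dsum A B\<^esub> (x, y) = (a \<odot>\<^bsub>A\<^esub> x, a \<odot>\<^bsub>B\<^esub> y)"
  by (simp_all add: dsum_def ring.defs RDirProd_def monoid.defs DirProd_def)

lemma lm_dsum: assumes "lm A" "lm B" shows "lm (dsum A B)"
proof -
  interpret A: left_module \<Lambda> A by fact
  interpret B: left_module \<Lambda> B by fact
  show ?thesis
  proof (rule lmI)
    fix x assume "x \<in> carrier (dsum A B)"
    then obtain u v where *: "x = (u, v)" "u \<in> carrier A" "v \<in> carrier B" by auto
    show "\<exists>y\<in>carrier (dsum A B). y \<oplus>\<^bsub>dsum A B\<^esub> x = \<zero>\<^bsub>dsum A B\<^esub>"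
      using * A.M.l_neg B.M.l_neg by (intro bexI[of _ "(\<ominus>\<^bsub>A\<^esub> u, \<ominus>\<^bsub>B\<^esub> v)"]) auto
  qed (auto simp: A.M.a_ac B.M.a_ac A.lsmult_l_distr A.lsmult_r_distr A.lsmult_assoc A.lsmult_one
    A.lsmult_closed
      B.lsmult_l_distr B.lsmult_r_distr B.lsmult_assoc B.lsmult_one B.lsmult_closed)
qed

lemma bip_dsum:
  assumes "lm A" "lm B"
  shows "bip A B (dsum A B) (\<lambda>x. (x, \<zero>\<^bsub>B\<^esub>)) (\<lambda>y. (\<zero>\<^bsub>A\<^esub>, y)) fst snd"
proof -
  interpret A: left_module \<Lambda> A by fact
  interpret B: left_module \<Lambda> B by fact
  note [simp] = assms lm_dsum[OF assms] lm_rules(6)[OF assms(1)] lm_rules(6)[OF assms(2)]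
  show ?thesis unfolding bip_def by (auto intro!: lhI)
qed

lemma fm_dsum: assumes "fm A" "fm B" shows "fm (dsum A B)"
proof -
  have l: "lm A" "lm B" using assms fmD by auto
  note b = bipD[OF bip_dsum[OF l]]
  let ?K = "lker (dsum A B) B snd"
  have "lh (sub (dsum A B) ?K) A fst" by (rule lh_sub_dom[OF b(3) smod_lker[OF b(4)]])
  moreover have "inj_on fst (carrier (sub (dsum A B) ?K))" by (auto simp: lker_def inj_on_def)
  ultimately have "fm (sub (dsum A B) ?K)" using fm_inj(1) assms(1) by blast
  then show ?thesis using fm_ext[OF b(4) assms(2)] by blast
qed

lemma bip_iso:
  assumes b: "bip A B D i j p q" and f: "liso D D' f"
    and g: "liso D' D g" "\<And>x. x \<in> carrier D \<Longrightarrow> g (f x) = x" "\<And>y. y \<in> carrier D' \<Longrightarrow> f (g y) = y"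
  shows "bip A B D' (\<lambda>x. f (i x)) (\<lambda>x. f (j x)) (\<lambda>x. p (g x)) (\<lambda>x. q (g x))"
proof -
  note b = bipD[OF b]
  have f': "lh D D' f" and g': "lh D' D g" using f g by (auto simp: liso_def)
  have "f (i (p (g y))) \<oplus>\<^bsub>D'\<^esub> f (j (q (g y))) = y" if y: "y \<in> carrier D'" for y
  proof -
    have gy: "g y \<in> carrier D" using lhD(3)[OF g' y] .
    have "f (i (p (g y)) \<oplus>\<^bsub>D\<^esub> j (q (g y))) = f (i (p (g y))) \<oplus>\<^bsub>D'\<^esub> f (j (q (g y)))"
      using lhD(4)[OF f'] lhD(3)[OF b(1)] lhD(3)[OF b(2)] lhD(3)[OF b(3)] lhD(3)[OF b(4)] gy by simp
    then show ?thesis using b(9)[OF gy] g(3)[OF y] by simp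
  qed
  then show ?thesis
    unfolding bip_def using lh_comp[OF b(1) f'] lh_comp[OF b(2) f'] lh_comp[OF g' b(3)] lh_comp[OF g' b(4)]
    by (simp add: g(2) lhD(3)[OF b(1)] lhD(3)[OF b(2)] b(5-8))
qed

lemma bip_exists:
  assumes "fm A" "fm B"
  obtains D :: "('a, 'k vec) module" and i j p q where "D \<in> modcat \<Lambda>" "bip A B D i j p q"
proof -
  obtain D :: "('a, 'k vec) module" and f where D: "D \<in> modcat \<Lambda>" "liso (dsum A B) D f"
    using copy_exists[OF fm_dsum[OF assms]] by blast
  obtain g where g: "liso D (dsum A B) g" "\<And>x. x \<in> carrier (dsum A B) \<Longrightarrow> g (f x) = x"
    "\<And>y. y \<in> carrier D \<Longrightarrow> f (g y) = y"
    using liso_inverse[OF D(2)] by blast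
  show ?thesis by (rule that[OF D(1) bip_iso[OF bip_dsum[OF fmD[OF assms(1)] fmD[OF assms(2)]] D(2) g]])
qed

lemma lmod_iso_dsum:
  assumes "lm A" "lm B" "lm M"
  shows "lmod_iso \<Lambda> M (dsum A B) \<longleftrightarrow> (\<exists>i j p q. bip A B M i j p q)"
proof
  assume "lmod_iso \<Lambda> M (dsum A B)"
  then obtain f where f: "liso M (dsum A B) f" using lmod_iso_iff lm_dsum assms by blast
  obtain g where g: "liso (dsum A B) M g" "\<And>x. x \<in> carrier M \<Longrightarrow> g (f x) = x"
    "\<And>y. y \<in> carrier (dsum A B) \<Longrightarrow> f (g y) = y"
    using liso_inverse[OF f] by blast
  show "\<exists>i j p q. bip A B M i j p q" using bip_iso[OF bip_dsum g(1) f g(3,2)] assms by blast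
next
  assume "\<exists>i j p q. bip A B M i j p q"
  then obtain i j p q where b: "bip A B M i j p q" by blast
  note b = bipD[OF b]
  interpret A: left_module \<Lambda> A by fact
  interpret B: left_module \<Lambda> B by fact
  have l: "lh M (dsum A B) (\<lambda>x. (p x, q x))"
    by (rule lhI) (use assms lm_dsum lhD[OF b(3)] lhD[OF b(4)] in auto)
  have "bij_betw (\<lambda>x. (p x, q x)) (carrier M) (carrier (dsum A B))"
  proof (rule bij_betwI[of _ _ _ "\<lambda>(x, y). i x \<oplus>\<^bsub>M\<^esub> j y"])
    show "(\<lambda>x. (p x, q x)) \<in> carrier M \<rightarrow> carrier (dsum A B)" using lhD(3)[OF l] by auto
    show "(\<lambda>(x, y). i x \<oplus>\<^bsub>M\<^esub> j y) \<in> carrier (dsum A B) \<rightarrow> carrier M"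
      using lhD(3)[OF b(1)] lhD(3)[OF b(2)] lm_rules(2)[OF assms(3)] by auto
    show "(case (p x, q x) of (x, y) \<Rightarrow> i x \<oplus>\<^bsub>M\<^esub> j y) = x" if "x \<in> carrier M" for x
      using b(9)[OF that] by simp
    fix z assume "z \<in> carrier (dsum A B)"
    then obtain x y where z: "z = (x, y)" "x \<in> carrier A" "y \<in> carrier B" by auto
    then show "(p (case z of (x, y) \<Rightarrow> i x \<oplus>\<^bsub>M\<^esub> j y), q (case z of (x, y) \<Rightarrow> i x \<oplus>\<^bsub>M\<^esub> j y)) = z"
      using b(5-8) lhD(4)[OF b(3), of "i x" "j y"] lhD(4)[OF b(4), of "i x"
        "j y"] lhD(3)[OF b(1)] lhD(3)[OF b(2)]
      by simp
  qed
  then show "lmod_iso \<Lambda> M (dsum A B)" using l lmod_iso_iff lm_dsum assms unfolding liso_def by blast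
qed

text \<open>The projection to the kernel of \<open>r\<close> is \<open>x - s (r x)\<close>; it is
  the identity there because \<open>r\<close> vanishes.\<close>

lemma bip_retraction:
  assumes s: "lh N M s" and r: "lh M N r" and rs: "\<And>x. x \<in> carrier N \<Longrightarrow> r (s x) = x"
  shows "bip N (sub M (lker M N r)) M s (\<lambda>x. x) r (\<lambda>x. x \<ominus>\<^bsub>M\<^esub> s (r x))"
proof -
  have M: "lm M" and N: "lm N" using s lhD by auto
  let ?K = "lker M N r"
  have K: "smod ?K M" by (rule smod_lker[OF r])
  have sr: "lh M M (\<lambda>x. s (r x))" by (rule lh_comp[OF r s])
  have d: "lh M M (\<lambda>x. x \<ominus>\<^bsub>M\<^esub> s (r x))" by (rule lh_diff[OF lh_id[OF M] sr])
  have "x \<ominus>\<^bsub>M\<^esub> s (r x) \<in> ?K" if x: "x \<in> carrier M" for x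
    using lker_eq[OF r x lhD(3)[OF sr x]] rs lhD(3)[OF r x] by simp
  then have d': "lh M (sub M ?K) (\<lambda>x. x \<ominus>\<^bsub>M\<^esub> s (r x))" by (rule lh_sub_cod[OF d K])
  have z: "x \<ominus>\<^bsub>M\<^esub> s (r x) = x" if "x \<in> ?K" for x
  proof -
    have x: "x \<in> carrier M" "r x = \<zero>\<^bsub>N\<^esub>" using that by (auto simp: lker_def)
    show ?thesis using x lh_zero[OF s] by (simp add: lm_rules(13)[OF M])
  qed
  show ?thesis unfolding bip_def
    using s lh_incl[OF M K] r d' rs z lhD(3)[OF s] lhD(3)[OF r] lhD(3)[OF sr]
      lm_rules(10)[OF M] lm_rules(12)[OF M] by (auto simp: lker_def)
qed

text \<open>Being a direct summand up to isomorphism. Closure under summands is used in this form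
  for projective modules, injective modules and thick subcategories alike.\<close>

definition retr :: "('a, 'm) module \<Rightarrow> ('a, 'n) module \<Rightarrow> bool" where
  "retr N M \<longleftrightarrow> (\<exists>s r. lh N M s \<and> lh M N r \<and> (\<forall>x\<in>carrier N. r (s x) = x))"

lemma retrI: "lh N M s \<Longrightarrow> lh M N r \<Longrightarrow> (\<And>x. x \<in> carrier N \<Longrightarrow> r (s x) = x) \<Longrightarrow> retr N M"
  by (auto simp: retr_def)

lemma retr_trans: assumes "retr L N" "retr N M" shows "retr L M"
proof -
  obtain s r s' r' where *: "lh L N s" "lh N L r" "\<And>x. x \<in> carrier L \<Longrightarrow> r (s x) = x"
    "lh N M s'" "lh M N r'" "\<And>x. x \<in> carrier N \<Longrightarrow> r' (s' x) = x"
    using assms by (auto simp: retr_def)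
  show ?thesis by (rule retrI[OF lh_comp[OF *(1,4)] lh_comp[OF *(5,2)]]) (use * lhD(3)[OF *(1)] in auto)
qed

lemma bip_retr: "bip A B D i j p q \<Longrightarrow> retr A D" "bip A B D i j p q \<Longrightarrow> retr B D"
  by (auto simp: bip_def retr_def)

lemma liso_retr: "liso M N f \<Longrightarrow> retr M N" "liso M N f \<Longrightarrow> retr N M"
  by (metis liso_inverse liso_def retr_def)+

section \<open>Spaces of homomorphisms\<close>

lemma lh_scal:
  assumes f: "lh M N f" shows "lh M N (\<lambda>x. scal c \<odot>\<^bsub>N\<^esub> f x)"
proof -
  interpret N: left_module \<Lambda> N by (rule lhD(2)[OF f])
  show ?thesis
  proof (rule lhI)
    fix a x assume *: "a \<in> carrier \<Lambda>" "x \<in> carrier M"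
    have "scal c \<odot>\<^bsub>N\<^esub> (a \<odot>\<^bsub>N\<^esub> f x) = a \<odot>\<^bsub>N\<^esub> (scal c \<odot>\<^bsub>N\<^esub> f x)"
      using * lhD(3)[OF f] N.lsmult_assoc[symmetric] scal_commute[of a c] by simp
    then show "scal c \<odot>\<^bsub>N\<^esub> f (a \<odot>\<^bsub>M\<^esub> x) = a \<odot>\<^bsub>N\<^esub> (scal c \<odot>\<^bsub>N\<^esub> f x)"
      using * lhD(5)[OF f] by simp
  qed (use lhD[OF f] in \<open>auto simp: N.lsmult_r_distr N.lsmult_closed\<close>)
qed

lemma hom_space_simps [simp]: "carrier (hom_space \<Lambda> M N) = lhom \<Lambda> M N"
  "\<zero>\<^bsub>hom_space \<Lambda> M N\<^esub> = (\<lambda>x\<in>carrier M. \<zero>\<^bsub>N\<^esub>)"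
  "f \<oplus>\<^bsub>hom_space \<Lambda> M N\<^esub> g = (\<lambda>x\<in>carrier M. f x \<oplus>\<^bsub>N\<^esub> g x)"
  "c \<odot>\<^bsub>hom_space \<Lambda> M N\<^esub> f = (\<lambda>x\<in>carrier M. scal c \<odot>\<^bsub>N\<^esub> f x)"
  "hom_space \<Lambda> M N\<lparr>carrier := lhom \<Lambda> M N\<rparr> = hom_space \<Lambda> M N"
  by (simp_all add: hom_space_def scal_def)

lemma lhomD: "f \<in> lhom \<Lambda> M N \<Longrightarrow> lm M \<Longrightarrow> lm N \<Longrightarrow> lh M N f"
  by (simp add: lhom_iff)

lemma lhom_ext: "f \<in> lhom \<Lambda> M N \<Longrightarrow> g \<in> lhom \<Lambda> M N \<Longrightarrow> (\<And>x. x \<in> carrier M \<Longrightarrow> f x = g x) \<Longrightarrow> f = g"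
  by (rule extensionalityI[of _ "carrier M"]) (auto simp: lhom_def PiE_def)

lemma hom_space_vs:
  assumes M: "lm M" and N: "lm N" shows "vectorspace class_ring (hom_space \<Lambda> M N)"
proof -
  interpret N: left_module \<Lambda> N by fact
  have L: "lh M N f" "f \<in> extensional (carrier M)" if "f \<in> lhom \<Lambda> M N" for f
    using that lhom_iff[OF M N] by auto
  have v: "f x \<in> carrier N" if "f \<in> lhom \<Lambda> M N" "x \<in> carrier M" for f x
    using lhD(3)[OF L(1)] that by blast
  have n: "\<exists>g\<in>lhom \<Lambda> M N. (\<lambda>x\<in>carrier M. f x \<oplus>\<^bsub>N\<^esub> g x) = (\<lambda>x\<in>carrier M. \<zero>\<^bsub>N\<^esub>)" if "f \<in> lhom \<Lambda> M N" for f
  proof (intro bexI)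
    show "(\<lambda>x\<in>carrier M. \<zero>\<^bsub>N\<^esub> \<ominus>\<^bsub>N\<^esub> f x) \<in> lhom \<Lambda> M N"
      by (rule lh_restrict[OF lh_diff[OF lh_const[OF M N] L(1)[OF that]]])
    show "(\<lambda>x\<in>carrier M. f x \<oplus>\<^bsub>N\<^esub> (\<lambda>x\<in>carrier M. \<zero>\<^bsub>N\<^esub> \<ominus>\<^bsub>N\<^esub> f x) x) = (\<lambda>x\<in>carrier M. \<zero>\<^bsub>N\<^esub>)"
      by (rule restrict_ext) (simp add: lm_rules(12)[OF N] v[OF that])
  qed
  have e: "(\<lambda>x\<in>carrier M. f x) = f" if "f \<in> lhom \<Lambda> M N" for f
    using L(2)[OF that] by (simp add: extensional_restrict)
  show ?thesis
    by (rule vs_criteria)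
      (use n in \<open>auto intro!: lh_restrict[OF lh_const[OF M N]] lh_restrict[OF lh_add] lh_restrict[OF
        lh_scal] L restrict_ext
        simp: class_field v e N.M.a_ac scal_add scal_mult scal_one
        N.lsmult_l_distr N.lsmult_r_distr N.lsmult_assoc N.lsmult_one N.lsmult_closed cong: restrict_cong\<close>)
qed

text \<open>A homomorphism is determined by its values on a finite generating set \<open>A\<close>.
  The maps that vanish on \<open>A\<close> outside \<open>Z\<close> form a subspace
  \<open>V Z\<close>; evaluation at one more generator has values in \<open>S\<close>, and its
  kernel is the previous subspace. So \<open>V Z\<close> stays finite-dimensional while
  \<open>Z\<close> grows from the empty set to \<open>A\<close>.\<close>

lemma fin_hom_space:
  assumes M: "fm M" and S: "fm S" shows "fin_vs (hom_space \<Lambda> M S)"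
proof -
  have lM: "lm M" and lS: "lm S" using M S fmD by auto
  interpret S: left_module \<Lambda> S by fact
  let ?H = "hom_space \<Lambda> M S"
  interpret H: vectorspace class_ring ?H by (rule hom_space_vs[OF lM lS])
  obtain A where A: "finite A" "A \<subseteq> carrier M" "\<And>N. smod N M \<Longrightarrow> A \<subseteq> N \<Longrightarrow> N = carrier M"
    using fm_gen[OF M] by metis
  define V where "V = (\<lambda>Z. {f \<in> lhom \<Lambda> M S. \<forall>x\<in>A - Z. f x = \<zero>\<^bsub>S\<^esub>})"
  have sub: "subspace class_ring (V Z) ?H" for Z
  proof (rule subspaceI)
    have "(\<lambda>x\<in>carrier M. \<zero>\<^bsub>S\<^esub>) \<in> lhom \<Lambda> M S" by (rule lh_restrict[OF lh_const[OF lM lS]])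
    then show "\<zero>\<^bsub>?H\<^esub> \<in> V Z" using A(2) by (auto simp: V_def)
    fix f g assume "f \<in> V Z" "g \<in> V Z"
    then show "f \<oplus>\<^bsub>?H\<^esub> g \<in> V Z"
      using lh_restrict[OF lh_add[OF lhomD lhomD], OF _ lM lS _ lM lS] A(2) by (auto simp: V_def)
  next
    fix c f assume "f \<in> V Z"
    then show "c \<odot>\<^bsub>?H\<^esub> f \<in> V Z"
      using lh_restrict[OF lh_scal[OF lhomD], OF _ lM lS] A(2) lm_rules(6)[OF lS] by (auto simp: V_def)
  qed (use H.vectorspace_axioms in \<open>auto simp: V_def\<close>)
  have "fin_vs (?H\<lparr>carrier := V Z\<rparr>)" if "finite Z" "Z \<subseteq> A" for Z using that
  proof (induction Z rule: finite_induct)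
    case empty
    have "f = (\<lambda>x\<in>carrier M. \<zero>\<^bsub>S\<^esub>)" if "f \<in> V {}" for f
    proof -
      have f: "f \<in> lhom \<Lambda> M S" "\<forall>x\<in>A. f x = \<zero>\<^bsub>S\<^esub>" using that by (auto simp: V_def)
      have "lker M S f = carrier M"
        by (rule A(3)[OF smod_lker]) (use f lhomD[OF _ lM lS] A(2) in \<open>auto simp: lker_def\<close>)
      then have "f x = \<zero>\<^bsub>S\<^esub>" if "x \<in> carrier M" for x using that by (auto simp: lker_def)
      then show ?thesis using lhom_ext[OF f(1) lh_restrict[OF lh_const[OF lM lS]]] by simp
    qed
    then have "V {} = {\<zero>\<^bsub>?H\<^esub>}" using sub[of "{}"]
      by (auto simp: subspace_def LinearCombinations.submodule_def)
    then show ?case using vdim_zero(1)[of "?H\<lparr>carrier := V {}\<rparr>"] H.subspace_is_vs[OF sub[of "{}"]] by simp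
  next
    case (insert z Z)
    let ?V = "?H\<lparr>carrier := V (insert z Z)\<rparr>"
    have z: "z \<in> carrier M" "z \<in> A" "z \<notin> Z" using insert A(2) by auto
    have "lin ?V (kv S) (\<lambda>f. f z)"
      by (rule linI[OF H.subspace_is_vs[OF sub] kv_vs[OF lS]])
        (use z lhD(3)[OF lhomD[OF _ lM lS]] in \<open>auto simp: V_def\<close>)
    moreover have "{f \<in> carrier ?V. f z = \<zero>\<^bsub>kv S\<^esub>} = V Z" using z by (auto simp: V_def)
    ultimately show ?case
      using fin_vs_extension[of ?V "kv S" "\<lambda>f. f z"] insert S by (simp add: fm_def)
  qed
  from this[OF A(1) subset_refl] have "fin_vs (?H\<lparr>carrier := V A\<rparr>)" .
  moreover have "V A = lhom \<Lambda> M S" by (auto simp: V_def)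
  ultimately show ?thesis by (simp add: hom_space_def)
qed

text \<open>For simple \<open>S\<close> this measures how often \<open>S\<close> occurs in the top
  of \<open>M\<close>, as maps to simple modules kill the radical.\<close>

definition h :: "('a, 'm) module \<Rightarrow> ('a, 'n) module \<Rightarrow> nat" where
  "h M S = vdim (hom_space \<Lambda> M S)"

text \<open>The map that \<open>f\<close> induces on homomorphisms to a fixed module, kept
  extensional so that its values lie in \<open>lhom\<close>.\<close>

definition pre :: "('a, 'm) module \<Rightarrow> ('m \<Rightarrow> 'n) \<Rightarrow> ('n \<Rightarrow> 's) \<Rightarrow> 'm \<Rightarrow> 's" where
  "pre M f g = (\<lambda>x\<in>carrier M. g (f x))"

lemma pre_lin:
  assumes f: "lh M N f" and S: "lm S"
  shows "lin (hom_space \<Lambda> N S) (hom_space \<Lambda> M S) (pre M f)"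
proof (rule linI)
  note l = lhD[OF f]
  show "vectorspace class_ring (hom_space \<Lambda> N S)" "vectorspace class_ring (hom_space \<Lambda> M S)"
    using hom_space_vs l S by auto
  show "pre M f g \<in> carrier (hom_space \<Lambda> M S)" if "g \<in> carrier (hom_space \<Lambda> N S)" for g
    using lh_restrict[OF lh_comp[OF f lhomD]] that l S by (simp add: pre_def)
qed (auto simp: pre_def lhD(3)[OF f] intro: restrict_ext)

lemma pre_inj: "f ` carrier M = carrier N \<Longrightarrow> inj_on (pre M f) (lhom \<Lambda> N S)"
proof (rule inj_onI)
  fix g g' assume s: "f ` carrier M = carrier N" "g \<in> lhom \<Lambda> N S" "g' \<in> lhom \<Lambda> N S" "pre M f g = pre M f g'"
  have "g y = g' y" if y: "y \<in> carrier N" for y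
  proof -
    obtain x where "x \<in> carrier M" "y = f x" using s(1) y by auto
    then show ?thesis using fun_cong[OF s(4), of x] by (simp add: pre_def)
  qed
  then show "g = g'" using lhom_ext s(2,3) by blast
qed

lemma h_surj:
  assumes f: "lh M N f" "f ` carrier M = carrier N" and M: "fm M" and S: "fm S"
  shows "h N S \<le> h M S"
  using fin_vs_inj(2)[OF pre_lin[OF f(1) fmD[OF S]] fin_hom_space[OF M S]] pre_inj[OF f(2), of S]
    by (simp add: h_def)

text \<open>The inequality is left exactness of \<open>Hom(-, S)\<close> together with rank and
  nullity. The premise of the second claim says that restriction to \<open>A\<close> is onto, and
  then no dimension is lost.\<close>

lemma h_exact:
  assumes i: "lh A B i" and p: "lh B C p" "p ` carrier B = carrier C"
    and ex: "i ` carrier A = lker B C p"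
    and A: "fm A" and B: "fm B" and S: "fm S"
  shows "h B S \<le> h A S + h C S"
    and "(\<And>g. lh A S g \<Longrightarrow> \<exists>g'. lh B S g' \<and> (\<forall>x\<in>carrier A. g' (i x) = g x)) \<Longrightarrow> h B S = h A S + h C S"
proof -
  have C: "fm C" by (rule fm_surj[OF p(1) B p(2)])
  have lS: "lm S" using S fmD by auto
  have l: "lm A" "lm B" "lm C" using fmD A B C by auto
  let ?A = "hom_space \<Lambda> A S" and ?B = "hom_space \<Lambda> B S" and ?C = "hom_space \<Lambda> C S"
  note LA = pre_lin[OF i lS] and LC = pre_lin[OF p(1) lS]
  note fA = fin_hom_space[OF A S] and fB = fin_hom_space[OF B S] and fC = fin_hom_space[OF C S]
  let ?K = "{g \<in> lhom \<Lambda> B S. pre A i g = \<zero>\<^bsub>?A\<^esub>}"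
  \<comment> \<open>The maps on \<open>B\<close> that vanish on the image of \<open>A\<close> are
    those that factor through \<open>p\<close>.\<close>
  have "?K = pre B p ` lhom \<Lambda> C S"
  proof (intro equalityI subsetI)
    fix g assume "g \<in> ?K"
    then have g: "g \<in> lhom \<Lambda> B S" "pre A i g = (\<lambda>x\<in>carrier A. \<zero>\<^bsub>S\<^esub>)" by auto
    have lg: "lh B S g" using lhomD[OF g(1)] l lS by blast
    have "g (i x) = \<zero>\<^bsub>S\<^esub>" if "x \<in> carrier A" for x using fun_cong[OF g(2), of x] that by (simp add: pre_def)
    then have "lker B C p \<subseteq> lker B S g" unfolding ex[symmetric] using lhD(3)[OF i] by (auto simp: lker_def)
    then obtain g' where g': "lh C S g'" "\<And>x. x \<in> carrier B \<Longrightarrow> g' (p x) = g x"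
      using lh_factor[OF p lg] by blast
    have "g = pre B p (restrict g' (carrier C))"
      by (rule extensionalityI[of _ "carrier B"]) (use g(1) g' lhD(3)[OF p(1)] in \<open>auto simp: lhom_def
        PiE_def pre_def\<close>)
    then show "g \<in> pre B p ` lhom \<Lambda> C S" using lh_restrict[OF g'(1)] by blast
  next
    fix g assume "g \<in> pre B p ` lhom \<Lambda> C S"
    then obtain g' where g': "g' \<in> lhom \<Lambda> C S" "g = pre B p g'" by blast
    have lg: "lh C S g'" using lhomD[OF g'(1)] l lS by blast
    have "g \<in> lhom \<Lambda> B S" using lh_restrict[OF lh_comp[OF p(1) lg]] g'(2) by (simp add: pre_def)
    moreover have "pre A i g = (\<lambda>x\<in>carrier A. \<zero>\<^bsub>S\<^esub>)"
    proof -
      have "p (i x) = \<zero>\<^bsub>C\<^esub>" if "x \<in> carrier A" for x using ex that by (auto simp: lker_def)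
      then show ?thesis using g'(2) lhD(3)[OF i] lh_zero[OF lg] by (auto simp: pre_def intro: restrict_ext)
    qed
    ultimately show "g \<in> ?K" by simp
  qed
  then have K: "{g \<in> carrier ?B. pre A i g = \<zero>\<^bsub>?A\<^esub>} = pre B p ` carrier ?C" by simp
  have inj: "inj_on (pre B p) (carrier ?C)" using pre_inj[OF p(2), of S] by simp
  interpret LC: linear_map class_ring ?C ?B "pre B p" by (rule LC)
  have "subspace class_ring (pre B p ` carrier ?C) ?B"
    using LC.imT_is_subspace by (simp add: LC.im_def)
  have Kc: "vdim (?B\<lparr>carrier := pre B p ` carrier ?C\<rparr>) = h C S"
  proof -
    have "{g \<in> carrier ?C. pre B p g = \<zero>\<^bsub>?B\<^esub>} = {\<zero>\<^bsub>?C\<^esub>}"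
      using LC.inj_imp_Ker0[OF inj] by (simp add: LC.ker_def)
    moreover have "vdim (?C\<lparr>carrier := {\<zero>\<^bsub>?C\<^esub>}\<rparr>) = 0"
    proof (rule vdim_zero(2))
      have "subspace class_ring {\<zero>\<^bsub>?C\<^esub>} ?C"
        by (rule subspaceI) (use LC.V.vectorspace_axioms LC.T0_is_0 lh_restrict[OF lh_const[OF l(3) lS]]
          lm_rules(6)[OF lS] in
            \<open>auto intro!: restrict_ext simp: abelian_monoid.l_zero[OF abelian_group.axioms(1)[OF
              left_module.axioms(2)[OF lS]]] lm_rules(1)[OF lS]\<close>)
      then show "vectorspace class_ring (?C\<lparr>carrier := {\<zero>\<^bsub>?C\<^esub>}\<rparr>)" by (rule LC.V.subspace_is_vs)
    qed simp
    ultimately show ?thesis using rank_nullity_vs(2)[OF fC LC] by (simp add: h_def)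
  qed
  have main: "vdim (?A\<lparr>carrier := pre A i ` carrier ?B\<rparr>) + h C S = h B S"
    using rank_nullity_vs(2)[OF fB LA] Kc unfolding K by (simp add: h_def)
  interpret LA: linear_map class_ring ?B ?A "pre A i" by (rule LA)
  have sub: "subspace class_ring (pre A i ` carrier ?B) ?A"
    using LA.imT_is_subspace by (simp add: LA.im_def)
  show "h B S \<le> h A S + h C S" using fin_vs_subspace(2)[OF fA sub] main by (simp add: h_def)
  assume ext: "\<And>g. lh A S g \<Longrightarrow> \<exists>g'. lh B S g' \<and> (\<forall>x\<in>carrier A. g' (i x) = g x)"
  have "carrier ?A \<subseteq> pre A i ` carrier ?B"
  proof
    fix g assume g: "g \<in> carrier ?A"
    then have "lh A S g" using lhomD l lS by simp
    then obtain g' where g': "lh B S g'" "\<forall>x\<in>carrier A. g' (i x) = g x" using ext by blast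
    have "g = pre A i (restrict g' (carrier B))"
      by (rule extensionalityI[of _ "carrier A"]) (use g g' lhD(3)[OF i] in \<open>auto simp: lhom_def PiE_def
        pre_def\<close>)
    then show "g \<in> pre A i ` carrier ?B" using lh_restrict[OF g'(1)] by auto
  qed
  moreover have "pre A i ` carrier ?B \<subseteq> carrier ?A" using LA.T_im by auto
  ultimately have "pre A i ` carrier ?B = carrier ?A" by auto
  then show "h B S = h A S + h C S" using main by (simp add: h_def)
qed

text \<open>Under the premise every map on \<open>M\<close> factors through \<open>f\<close>. It
  applies whenever \<open>S\<close> is simple and the kernel lies in the radical: to projective
  covers, and to the map of a projective module onto its socle.\<close>

lemma h_eq:
  assumes f: "lh M N f" "f ` carrier M = carrier N" and M: "fm M" and S: "fm S"
    and k: "\<And>g x. lh M S g \<Longrightarrow> x \<in> lker M N f \<Longrightarrow> g x = \<zero>\<^bsub>S\<^esub>"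
  shows "h N S = h M S"
proof -
  let ?K = "sub M (lker M N f)"
  have K: "fm ?K" by (rule fm_sub(1)[OF M smod_lker[OF f(1)]])
  have i: "lh ?K M (\<lambda>x. x)" by (rule lh_incl[OF fmD[OF M] smod_lker[OF f(1)]])
  have "h M S \<le> h N S"
  proof -
    have N: "fm N" by (rule fm_surj[OF f(1) M f(2)])
    have "lhom \<Lambda> M S \<subseteq> pre M f ` lhom \<Lambda> N S"
    proof
      fix g assume g: "g \<in> lhom \<Lambda> M S"
      have lg: "lh M S g" using lhomD[OF g fmD[OF M] fmD[OF S]] .
      obtain g' where g': "lh N S g'" "\<And>x. x \<in> carrier M \<Longrightarrow> g' (f x) = g x"
        using lh_factor[OF f lg] k[OF lg] by (auto simp: lker_def)
      have "g = pre M f (restrict g' (carrier N))"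
        by (rule extensionalityI[of _ "carrier M"]) (use g g' lhD(3)[OF f(1)] in \<open>auto simp: lhom_def
          PiE_def pre_def\<close>)
      then show "g \<in> pre M f ` lhom \<Lambda> N S" using lh_restrict[OF g'(1)] by blast
    qed
    moreover interpret L: linear_map class_ring "hom_space \<Lambda> N S" "hom_space \<Lambda> M S" "pre M f"
      by (rule pre_lin[OF f(1) fmD[OF S]])
    have "pre M f ` lhom \<Lambda> N S \<subseteq> lhom \<Lambda> M S" using L.T_im by auto
    ultimately have "pre M f ` carrier (hom_space \<Lambda> N S) = carrier (hom_space \<Lambda> M S)" by auto
    then show ?thesis
      using rank_nullity_vs(2)[OF fin_hom_space[OF N S] pre_lin[OF f(1) fmD[OF S]]] by (simp add: h_def)
  qed
  then show ?thesis using h_surj[OF f M S] by simp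
qed

section \<open>Simple modules and the radical\<close>

abbreviation simp_mod :: "('a, 'm) module \<Rightarrow> bool" where "simp_mod S \<equiv> simple_mod \<Lambda> S"
abbreviation maxsub :: "'m set \<Rightarrow> ('a, 'm) module \<Rightarrow> bool" where "maxsub N M \<equiv> maximal_submod \<Lambda> M N"

lemma simple_hom_surj:
  assumes S: "simp_mod S" and f: "lh M S f" and x: "x \<in> carrier M" "f x \<noteq> \<zero>\<^bsub>S\<^esub>"
  shows "f ` carrier M = carrier S"
  using smod_range[OF f] S x by (auto simp: simple_mod_def)

lemma simple_hom_inj:
  assumes S: "simp_mod S" and f: "lh S N f" and x: "x \<in> carrier S" "f x \<noteq> \<zero>\<^bsub>N\<^esub>"
  shows "lker S N f = {\<zero>\<^bsub>S\<^esub>}" "inj_on f (carrier S)"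
proof -
  show "lker S N f = {\<zero>\<^bsub>S\<^esub>}"
    using smod_lker[OF f] S x unfolding simple_mod_def by (auto simp: lker_def)
  then show "inj_on f (carrier S)" using lh_inj_iff[OF f] by simp
qed

lemma simple_nonzero:
  assumes "simp_mod S" "lm S" shows "\<exists>x\<in>carrier S. x \<noteq> \<zero>\<^bsub>S\<^esub>"
  using lm_rules(1)[OF assms(2)] assms(1) unfolding simple_mod_def by blast

lemma maxsub_lker:
  assumes S: "simp_mod S" and f: "lh M S f" "f ` carrier M = carrier S"
  shows "maxsub (lker M S f) M"
proof -
  have M: "lm M" using f lhD by auto
  obtain y where y: "y \<in> carrier S" "y \<noteq> \<zero>\<^bsub>S\<^esub>" using simple_nonzero[OF S lhD(2)[OF f(1)]] by auto
  then have "y \<in> f ` carrier M" using f(2) by simp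
  then have "lker M S f \<noteq> carrier M" using y by (auto simp: lker_def)
  moreover have "L = lker M S f \<or> L = carrier M" if L: "smod L M" "lker M S f \<subseteq> L" for L
  proof -
    have "f ` L = {\<zero>\<^bsub>S\<^esub>} \<or> f ` L = carrier S"
      using smod_image[OF f(1) L(1)] S by (auto simp: simple_mod_def)
    then show ?thesis
    proof
      assume "f ` L = {\<zero>\<^bsub>S\<^esub>}"
      then have "L \<subseteq> lker M S f" using smodD(2)[OF L(1)] by (auto simp: lker_def)
      then show ?thesis using L(2) by auto
    next
      assume s: "f ` L = carrier S"
      have "x \<in> L" if x: "x \<in> carrier M" for x
      proof -
        have "f x \<in> f ` L" using s lhD(3)[OF f(1) x] by simp
        then obtain l where l: "l \<in> L" "f x = f l" by auto
        have lM: "l \<in> carrier M" using smodD(2)[OF L(1) l(1)] .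
        have "x \<ominus>\<^bsub>M\<^esub> l \<in> L" using lker_eq[OF f(1) x lM] l(2) L(2) by auto
        then have "(x \<ominus>\<^bsub>M\<^esub> l) \<oplus>\<^bsub>M\<^esub> l \<in> L" using smodD(4)[OF L(1)] l(1) by auto
        then show ?thesis using lm_rules(11)[OF M x lM] by simp
      qed
      then show ?thesis using smodD(1)[OF L(1)] by auto
    qed
  qed
  ultimately show ?thesis using smod_lker[OF f(1)] by (auto simp: maximal_submod_def)
qed

lemma maxsub_quotient:
  assumes N: "maxsub N M" and q: "lh M Q q" "q ` carrier M = carrier Q" "lker M Q q = N"
  shows "simp_mod Q"
proof -
  have N': "smod N M" "N \<noteq> carrier M" using N by (auto simp: maximal_submod_def)
  have "carrier Q \<noteq> {\<zero>\<^bsub>Q\<^esub>}"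
  proof
    assume "carrier Q = {\<zero>\<^bsub>Q\<^esub>}"
    then have "lker M Q q = carrier M" using lhD(3)[OF q(1)] by (auto simp: lker_def)
    then show False using q(3) N'(2) by simp
  qed
  moreover have "U = {\<zero>\<^bsub>Q\<^esub>} \<or> U = carrier Q" if U: "smod U Q" for U
  proof -
    let ?V = "{x \<in> carrier M. q x \<in> U}"
    have "N \<subseteq> ?V" using q(3) smodD(3)[OF U] by (auto simp: lker_def)
    then have V: "?V = N \<or> ?V = carrier M" using N smod_vimage[OF q(1) U] by (auto simp: maximal_submod_def)
    have "U = q ` ?V"
    proof (intro equalityI subsetI)
      fix u assume u: "u \<in> U"
      then have "u \<in> q ` carrier M" using smodD(2)[OF U] q(2) by auto
      then show "u \<in> q ` ?V" using u by auto
    qed auto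
    moreover have "q ` N = {\<zero>\<^bsub>Q\<^esub>}"
      using q(3) lh_zero[OF q(1)] smodD(3)[OF N'(1)] by (force simp: lker_def)
    ultimately show ?thesis using V q(2) by metis
  qed
  ultimately show ?thesis by (auto simp: simple_mod_def)
qed

text \<open>A submodule of greatest dimension with the given property is maximal for inclusion,
  since a proper inclusion raises the dimension. This replaces the ascending chain condition, and
  \<open>ex_min_dm\<close> the descending one.\<close>

lemma ex_max_dm:
  assumes M: "fm M" and N: "smod N M" "P N"
  obtains L where "smod L M" "P L" "\<And>L'. smod L' M \<Longrightarrow> P L' \<Longrightarrow> L \<subseteq> L' \<Longrightarrow> L' = L"
proof -
  have "\<exists>L. (smod L M \<and> P L) \<and> (\<forall>L'. smod L' M \<and> P L' \<longrightarrow> dm (sub M L') \<le> dm (sub M L))"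
    by (rule ex_has_greatest_nat[of _ N _ "Suc (dm M)"]) (use N fm_sub(2)[OF M] in \<open>auto simp:
      less_Suc_eq_le\<close>)
  then obtain L where L: "smod L M" "P L" "\<And>L'. smod L' M \<Longrightarrow> P L' \<Longrightarrow> dm (sub M L') \<le> dm (sub M L)" by blast
  show ?thesis
  proof (rule that[OF L(1,2)])
    fix L' assume *: "smod L' M" "P L'" "L \<subseteq> L'"
    have "smod L (sub M L')" using smod_sub_iff[OF fmD[OF M] *(1)] L(1) *(3) by simp
    then have "L \<noteq> L' \<Longrightarrow> dm (sub M L) < dm (sub M L')"
      using dm_less[OF fm_sub(1)[OF M *(1)], of L] by simp
    then show "L' = L" using L(3)[OF *(1,2)] by auto
  qed
qed

lemma ex_min_dm:
  assumes M: "fm M" and N: "smod N M" "P N"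
  obtains L where "smod L M" "P L" "\<And>L'. smod L' M \<Longrightarrow> P L' \<Longrightarrow> L' \<subseteq> L \<Longrightarrow> L' = L"
proof -
  have "\<exists>L. (smod L M \<and> P L) \<and> (\<forall>L'. smod L' M \<and> P L' \<longrightarrow> dm (sub M L) \<le> dm (sub M L'))"
    by (rule ex_has_least_nat[of _ N]) (use N in auto)
  then obtain L where L: "smod L M" "P L" "\<And>L'. smod L' M \<Longrightarrow> P L' \<Longrightarrow> dm (sub M L) \<le> dm (sub M L')" by blast
  show ?thesis
  proof (rule that[OF L(1,2)])
    fix L' assume *: "smod L' M" "P L'" "L' \<subseteq> L"
    have "smod L' (sub M L)" using smod_sub_iff[OF fmD[OF M] L(1)] * by simp
    then have "L' \<noteq> L \<Longrightarrow> dm (sub M L') < dm (sub M L)"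
      using dm_less[OF fm_sub(1)[OF M L(1)], of L'] by simp
    then show "L' = L" using L(3)[OF *(1,2)] by auto
  qed
qed

lemma maxsub_exists:
  assumes M: "fm M" and N: "smod N M" "N \<noteq> carrier M"
  obtains L where "maxsub L M" "N \<subseteq> L"
proof -
  obtain L where "smod L M" "N \<subseteq> L \<and> L \<noteq> carrier M"
    "\<And>L'. smod L' M \<Longrightarrow> N \<subseteq> L' \<and> L' \<noteq> carrier M \<Longrightarrow> L \<subseteq> L' \<Longrightarrow> L' = L"
    using ex_max_dm[OF M N(1), of "\<lambda>L. N \<subseteq> L \<and> L \<noteq> carrier M"] N(2) by blast
  then show ?thesis using that[of L] unfolding maximal_submod_def by blast
qed

lemma simple_copy:
  assumes S: "simp_mod S" and f: "liso S S' f"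
  shows "simp_mod S'"
proof -
  have "maxsub {\<zero>\<^bsub>S\<^esub>} S"
    using S smod_zero[OF lhD(1), of S S' f] f by (auto simp: liso_def maximal_submod_def simple_mod_def)
  moreover have "lker S S' f = {\<zero>\<^bsub>S\<^esub>}" using f lh_inj_iff by (auto simp: liso_def bij_betw_def)
  ultimately show ?thesis using maxsub_quotient[of S "{\<zero>\<^bsub>S\<^esub>}" S' f] f by (auto simp: liso_def bij_betw_def)
qed

text \<open>The simple quotient is moved to \<open>'k vec\<close> at once, so that it can be
  compared with the objects of \<open>modcat\<close>.\<close>

lemma maxsub_simple:
  assumes M: "fm M" and L: "maxsub L M"
  obtains S :: "('a, 'k vec) module" and g where "S \<in> modcat \<Lambda>" "simp_mod S" "lh M S g"
    "g ` carrier M = carrier S" "lker M S g = L"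
proof -
  obtain Q :: "('a, 'b) module" and q where q: "lh M Q q" "q ` carrier M = carrier Q" "lker M Q q = L"
    using quotient_exists[OF fmD[OF M], of L] L by (auto simp: maximal_submod_def)
  have Q: "simp_mod Q" "fm Q" using maxsub_quotient[OF L q] fm_surj[OF q(1) M q(2)] by auto
  obtain S :: "('a, 'k vec) module" and f where S: "S \<in> modcat \<Lambda>" "liso Q S f"
    using copy_exists[OF Q(2)] by blast
  have f: "lh Q S f" "inj_on f (carrier Q)" "f ` carrier Q = carrier S" using S(2)
    by (auto simp: liso_def bij_betw_def)
  have "lker M S (\<lambda>x. f (q x)) = L"
    using f(2) lh_inj_iff[OF f(1)] lhD(3)[OF q(1)] q(3) by (auto simp: lker_def)
  moreover have "(\<lambda>x. f (q x)) ` carrier M = carrier S" using f(3) q(2) by (metis image_image)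
  ultimately show ?thesis using that[OF S(1) simple_copy[OF Q(1) S(2)] lh_comp[OF q(1) f(1)]] by blast
qed

lemma simple_quotient_exists:
  assumes M: "fm M" and N: "smod N M" "N \<noteq> carrier M"
  obtains S :: "('a, 'k vec) module" and g where "S \<in> modcat \<Lambda>" "simp_mod S" "lh M S g"
    "g ` carrier M = carrier S" "N \<subseteq> lker M S g"
proof -
  obtain L where L: "maxsub L M" "N \<subseteq> L" using maxsub_exists[OF M N] .
  obtain S :: "('a, 'k vec) module" and g where S: "S \<in> modcat \<Lambda>" "simp_mod S" "lh M S g"
    "g ` carrier M = carrier S" "lker M S g = L" using maxsub_simple[OF M L(1)] .
  show ?thesis by (rule that[OF S(1-4)]) (use S(5) L(2) in simp)
qed

lemma simple_sub_exists:
  assumes M: "fm M" and N: "smod N M" "N \<noteq> {\<zero>\<^bsub>M\<^esub>}"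
  obtains L where "smod L M" "L \<subseteq> N" "simp_mod (sub M L)"
proof -
  obtain L where L: "smod L M" "L \<subseteq> N \<and> L \<noteq> {\<zero>\<^bsub>M\<^esub>}"
    "\<And>L'. smod L' M \<Longrightarrow> L' \<subseteq> N \<and> L' \<noteq> {\<zero>\<^bsub>M\<^esub>} \<Longrightarrow> L' \<subseteq> L \<Longrightarrow> L' = L"
    using ex_min_dm[OF M N(1), of "\<lambda>L. L \<subseteq> N \<and> L \<noteq> {\<zero>\<^bsub>M\<^esub>}"] N(2) by blast
  have "simp_mod (sub M L)" unfolding simple_mod_def
  proof (intro conjI allI impI)
    fix U assume "smod U (sub M L)"
    then have U: "smod U M" "U \<subseteq> L" using smod_sub_iff[OF fmD[OF M] L(1)] by auto
    then show "U = {\<zero>\<^bsub>sub M L\<^esub>} \<or> U = carrier (sub M L)" using L(2) L(3)[of U] by auto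
  qed (use L(2) in simp)
  then show ?thesis using that L by blast
qed

section \<open>The Jacobson radical and its action on modules\<close>

abbreviation J :: "'a set" where "J \<equiv> jrad \<Lambda>"

lemma J_carrier: "a \<in> J \<Longrightarrow> a \<in> carrier \<Lambda>"
  by (auto simp: jrad_def mod_rad_def)

lemma J_smod: "smod J (regular \<Lambda>)"
proof (rule smodI[OF lm_regular])
  have m: "smod N (regular \<Lambda>)" if "maxsub N (regular \<Lambda>)" for N using that by (auto simp: maximal_submod_def)
  show "J \<subseteq> carrier (regular \<Lambda>)" by (auto simp: J_carrier)
  show "\<zero>\<^bsub>regular \<Lambda>\<^esub> \<in> J" using smodD(3)[OF m] by (auto simp: jrad_def mod_rad_def)
  show "x \<oplus>\<^bsub>regular \<Lambda>\<^esub> y \<in> J" if "x \<in> J" "y \<in> J" for x y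
    using smodD(4)[OF m, of _ x y] that by (auto simp: jrad_def mod_rad_def)
  show "a \<odot>\<^bsub>regular \<Lambda>\<^esub> x \<in> J" if "a \<in> carrier \<Lambda>" "x \<in> J" for a x
    using smodD(5)[OF m, of _ a x] that by (auto simp: jrad_def mod_rad_def)
qed

text \<open>The annihilator of a nonzero element of a simple module is a maximal left ideal, and
  \<open>J\<close> lies in all of these.\<close>

lemma J_simple:
  assumes S: "simp_mod S" "lm S" and a: "a \<in> J" and x: "x \<in> carrier S"
  shows "a \<odot>\<^bsub>S\<^esub> x = \<zero>\<^bsub>S\<^esub>"
proof (cases "x = \<zero>\<^bsub>S\<^esub>")
  case True
  then show ?thesis using lm_rules(6)[OF S(2) J_carrier[OF a]] by simp
next
  case False
  have o: "lh (regular \<Lambda>) S (\<lambda>a. a \<odot>\<^bsub>S\<^esub> x)" by (rule lh_orbit[OF S(2) x])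
  have "(\<lambda>a. a \<odot>\<^bsub>S\<^esub> x) ` carrier (regular \<Lambda>) = carrier S"
    by (rule simple_hom_surj[OF S(1) o, of \<one>]) (use False left_module.lsmult_one[OF S(2) x] in auto)
  from maxsub_lker[OF S(1) o this] have "a \<in> lker (regular \<Lambda>) S (\<lambda>a. a \<odot>\<^bsub>S\<^esub> x)"
    using a by (auto simp: jrad_def mod_rad_def)
  then show ?thesis by (simp add: lker_def)
qed

text \<open>For products \<open>a \<otimes> r\<close>: a maximal left ideal is the kernel of a map
  \<open>g\<close> to a simple module, and \<open>g (a r) = a g(r)\<close> vanishes by
  \<open>J_simple\<close>. Thus \<open>J\<close> is two-sided although it is defined by left
  ideals.\<close>

lemma J_mult:
  assumes a: "a \<in> J" and r: "r \<in> carrier \<Lambda>"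
  shows "r \<otimes> a \<in> J" "a \<otimes> r \<in> J"
proof -
  show "r \<otimes> a \<in> J" using smodD(5)[OF J_smod r a] by simp
  have "a \<otimes> r \<in> N" if N: "maxsub N (regular \<Lambda>)" for N
  proof -
    obtain S :: "('a, 'k vec) module" and g
      where S: "simp_mod S" "lh (regular \<Lambda>) S g" "lker (regular \<Lambda>) S g = N"
      using maxsub_simple[OF fm_regular N] by metis
    have "g (a \<otimes> r) = a \<odot>\<^bsub>S\<^esub> g r" using lhD(5)[OF S(2) J_carrier[OF a], of r] r by simp
    also have "\<dots> = \<zero>\<^bsub>S\<^esub>" by (rule J_simple[OF S(1) lhD(2)[OF S(2)] a]) (use lhD(3)[OF S(2)] r in auto)
    finally show ?thesis using S(3) J_carrier[OF a] r by (auto simp: lker_def)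
  qed
  then show "a \<otimes> r \<in> J" using J_carrier[OF a] r by (auto simp: jrad_def mod_rad_def)
qed

text \<open>The submodule \<open>J M\<close>. For finite-dimensional \<open>M\<close> it is the
  radical, by \<open>mod_rad_eq_rj\<close>, but in this form its behaviour under homomorphisms is
  immediate.\<close>

definition rj :: "('a, 'm) module \<Rightarrow> 'm set" where
  "rj M = lspan \<Lambda> M {a \<odot>\<^bsub>M\<^esub> x | a x. a \<in> J \<and> x \<in> carrier M}"

text \<open>The annihilator of \<open>J\<close> in \<open>M\<close>, which is the socle by
  \<open>soc_eq_sz\<close>. The equation \<open>sz M = carrier M\<close> serves as the notion of a
  semisimple module.\<close>

definition sz :: "('a, 'm) module \<Rightarrow> 'm set" where
  "sz M = {x \<in> carrier M. \<forall>a\<in>J. a \<odot>\<^bsub>M\<^esub> x = \<zero>\<^bsub>M\<^esub>}"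

lemma rj:
  assumes M: "lm M"
  shows "smod (rj M) M" "a \<in> J \<Longrightarrow> x \<in> carrier M \<Longrightarrow> a \<odot>\<^bsub>M\<^esub> x \<in> rj M"
    "smod N M \<Longrightarrow> (\<And>a x. a \<in> J \<Longrightarrow> x \<in> carrier M \<Longrightarrow> a \<odot>\<^bsub>M\<^esub> x \<in> N) \<Longrightarrow> rj M \<subseteq> N"
proof -
  let ?A = "{a \<odot>\<^bsub>M\<^esub> x | a x. a \<in> J \<and> x \<in> carrier M}"
  have A: "?A \<subseteq> carrier M" using lm_rules(5)[OF M] J_carrier by auto
  show "smod (rj M) M" unfolding rj_def by (rule smod_lspan(1)[OF M A])
  show "a \<in> J \<Longrightarrow> x \<in> carrier M \<Longrightarrow> a \<odot>\<^bsub>M\<^esub> x \<in> rj M"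
    unfolding rj_def using smod_lspan(2)[OF M A] by blast
  show "rj M \<subseteq> N" if "smod N M" "\<And>a x. a \<in> J \<Longrightarrow> x \<in> carrier M \<Longrightarrow> a \<odot>\<^bsub>M\<^esub> x \<in> N"
    unfolding rj_def by (rule smod_lspan(3)[OF M A that(1)]) (use that(2) in blast)
qed

text \<open>Closure under scalars comes from \<open>a (r x) = (a r) x\<close> and from
  \<open>J\<close> being a right ideal.\<close>

lemma smod_ann: assumes M: "lm M" and V: "smod V M" shows "smod {x \<in> carrier M. \<forall>a\<in>J. a \<odot>\<^bsub>M\<^esub> x \<in> V} M"
proof -
  interpret M: left_module \<Lambda> M by fact
  show ?thesis
  proof (rule smodI[OF M])
    fix r x assume rx: "r \<in> carrier \<Lambda>" "x \<in> {x \<in> carrier M. \<forall>a\<in>J. a \<odot>\<^bsub>M\<^esub> x \<in> V}"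
    have "a \<odot>\<^bsub>M\<^esub> (r \<odot>\<^bsub>M\<^esub> x) \<in> V" if a: "a \<in> J" for a
      using M.lsmult_assoc[of a r x] rx J_carrier[OF a] J_mult(2)[OF a rx(1)] by auto
    then show "r \<odot>\<^bsub>M\<^esub> x \<in> {x \<in> carrier M. \<forall>a\<in>J. a \<odot>\<^bsub>M\<^esub> x \<in> V}" using rx M.lsmult_closed by auto
  qed (use lm_rules(6)[OF M] J_carrier smodD[OF V] in \<open>auto simp: M.lsmult_r_distr\<close>)
qed

lemma smod_sz: assumes M: "lm M" shows "smod (sz M) M"
  using smod_ann[OF M smod_zero[OF M]] by (simp add: sz_def)

lemma rj_image:
  assumes f: "lh M N f" and x: "x \<in> rj M" shows "f x \<in> rj N"
proof -
  have l: "lm M" "lm N" using f lhD by auto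
  have "rj M \<subseteq> {x \<in> carrier M. f x \<in> rj N}"
    by (rule rj(3)[OF l(1) smod_vimage[OF f rj(1)[OF l(2)]]])
      (use lhD[OF f] rj(2)[OF l(2)] J_carrier lm_rules(5)[OF l(1)] in auto)
  then show ?thesis using x by auto
qed

lemma rj_image_surj:
  assumes f: "lh M N f" "f ` carrier M = carrier N" shows "f ` rj M = rj N"
proof -
  have l: "lm M" "lm N" using f lhD by auto
  have "rj N \<subseteq> f ` rj M"
  proof (rule rj(3)[OF l(2) smod_image[OF f(1) rj(1)[OF l(1)]]])
    fix a y assume a: "a \<in> J" "y \<in> carrier N"
    then obtain x where x: "x \<in> carrier M" "y = f x" using f(2) by auto
    then have "a \<odot>\<^bsub>N\<^esub> y = f (a \<odot>\<^bsub>M\<^esub> x)" using lhD(5)[OF f(1) J_carrier[OF a(1)]] by simp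
    then show "a \<odot>\<^bsub>N\<^esub> y \<in> f ` rj M" using rj(2)[OF l(1) a(1) x(1)] by simp
  qed
  then show ?thesis using rj_image[OF f(1)] by auto
qed

lemma sz_image: assumes f: "lh M N f" and x: "x \<in> sz M" shows "f x \<in> sz N"
proof -
  have "a \<odot>\<^bsub>N\<^esub> f x = \<zero>\<^bsub>N\<^esub>" if "a \<in> J" for a
    using lhD(5)[OF f J_carrier[OF that], of x] x that lh_zero[OF f] by (auto simp: sz_def)
  then show ?thesis using lhD(3)[OF f] x by (auto simp: sz_def)
qed

lemma rj_sub:
  assumes "lm M" "smod N M" shows "rj (sub M N) \<subseteq> rj M" "rj (sub M N) \<subseteq> N"
  using rj_image[OF lh_incl[OF assms]] smodD(1)[OF rj(1)[OF lm_sub[OF assms]]] by auto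

lemma sz_sub: assumes "smod N M" shows "sz (sub M N) = N \<inter> sz M"
  using smodD(1)[OF assms] by (auto simp: sz_def)

lemma sz_full: assumes M: "lm M" shows "sz M = carrier M \<longleftrightarrow> rj M = {\<zero>\<^bsub>M\<^esub>}"
proof
  assume s: "sz M = carrier M"
  have "rj M \<subseteq> {\<zero>\<^bsub>M\<^esub>}" by (rule rj(3)[OF M smod_zero[OF M]]) (use s in \<open>auto simp: sz_def\<close>)
  then show "rj M = {\<zero>\<^bsub>M\<^esub>}" using smodD(3)[OF rj(1)[OF M]] by auto
next
  assume "rj M = {\<zero>\<^bsub>M\<^esub>}"
  then show "sz M = carrier M" using rj(2)[OF M] by (auto simp: sz_def)
qed

lemma sz_simple: assumes "simp_mod S" "lm S" shows "sz S = carrier S"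
  using J_simple[OF assms] by (auto simp: sz_def)

lemma rj_simple_hom:
  assumes "simp_mod S" "lh M S g" "x \<in> rj M" shows "g x = \<zero>\<^bsub>S\<^esub>"
  using rj_image[OF assms(2,3)] sz_full[OF lhD(2)[OF assms(2)]] sz_simple[OF assms(1) lhD(2)[OF assms(2)]]
    by simp

section \<open>Semisimple modules\<close>

text \<open>Spelled like the carrier in \<open>mod_soc\<close>, so that the socle in the hypothesis
  of weak symmetry is recognised by unfolding.\<close>

definition soc :: "('a, 'm) module \<Rightarrow> 'm set" where
  "soc M = lspan \<Lambda> M (\<Union>{N. smod N M \<and> simp_mod (sub M N)})"

lemma soc:
  assumes M: "lm M"
  shows "smod (soc M) M" "smod N M \<Longrightarrow> simp_mod (sub M N) \<Longrightarrow> N \<subseteq> soc M"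
    "smod U M \<Longrightarrow> (\<And>N. smod N M \<Longrightarrow> simp_mod (sub M N) \<Longrightarrow> N \<subseteq> U) \<Longrightarrow> soc M \<subseteq> U"
proof -
  have A: "\<Union>{N. smod N M \<and> simp_mod (sub M N)} \<subseteq> carrier M" by (auto dest: smodD(2))
  show "smod (soc M) M" unfolding soc_def by (rule smod_lspan(1)[OF M A])
  show "smod N M \<Longrightarrow> simp_mod (sub M N) \<Longrightarrow> N \<subseteq> soc M" unfolding soc_def using smod_lspan(2)[OF M A] by blast
  show "smod U M \<Longrightarrow> (\<And>N. smod N M \<Longrightarrow> simp_mod (sub M N) \<Longrightarrow> N \<subseteq> U) \<Longrightarrow> soc M \<subseteq> U"
    unfolding soc_def by (rule smod_lspan(3)[OF M A]) auto
qed

text \<open>A simple submodule is mapped either to zero or isomorphically onto a simple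
  submodule.\<close>

lemma soc_image:
  assumes f: "lh M N f" and x: "x \<in> soc M" shows "f x \<in> soc N"
proof -
  have l: "lm M" "lm N" using f lhD by auto
  have "soc M \<subseteq> {x \<in> carrier M. f x \<in> soc N}"
  proof (rule soc(3)[OF l(1) smod_vimage[OF f soc(1)[OF l(2)]]])
    fix U assume U: "smod U M" "simp_mod (sub M U)"
    note fU = lh_sub_dom[OF f U(1)]
    have "f x \<in> soc N" if x: "x \<in> U" for x
    proof (cases "\<exists>u\<in>U. f u \<noteq> \<zero>\<^bsub>N\<^esub>")
      case True
      then have "inj_on f U" using simple_hom_inj(2)[OF U(2) fU] by auto
      moreover have "lh (sub M U) (sub N (f ` U)) f"
        by (rule lh_sub_cod[OF fU smod_image[OF f U(1)]]) auto
      ultimately have "simp_mod (sub N (f ` U))"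
        using simple_copy[OF U(2), of "sub N (f ` U)" f] by (auto simp: liso_def bij_betw_def)
      then show ?thesis using soc(2)[OF l(2) smod_image[OF f U(1)]] x by auto
    next
      case False
      then show ?thesis using x smodD(3)[OF soc(1)[OF l(2)]] by auto
    qed
    then show "U \<subseteq> {x \<in> carrier M. f x \<in> soc N}" using smodD(2)[OF U(1)] by auto
  qed
  then show ?thesis using x by auto
qed

text \<open>The second assumption says that the radical is zero. Induction on dimension: a maximal
  submodule \<open>L\<close> that misses an element of a simple submodule \<open>S\<close> satisfies
  \<open>S + L = A\<close>, and \<open>L\<close> inherits the assumption because maximal submodules
  of \<open>A\<close> are kernels of maps to simple modules, which restrict to
  \<open>L\<close>.\<close>

lemma soc_full_of_rad_zero:
  assumes "fm A" and "\<And>x. x \<in> carrier A \<Longrightarrow> x \<noteq> \<zero>\<^bsub>A\<^esub> \<Longrightarrow> \<exists>N. maxsub N A \<and> x \<notin> N"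
  shows "soc A = carrier A"
  using assms
proof (induction "dm A" arbitrary: A rule: less_induct)
  case less
  note A = less.prems(1) and lA = fmD[OF less.prems(1)]
  show ?case
  proof (cases "carrier A = {\<zero>\<^bsub>A\<^esub>}")
    case True
    then show ?thesis using smodD(1,3)[OF soc(1)[OF lA]] by auto
  next
    case False
    obtain S where S: "smod S A" "simp_mod (sub A S)"
      using simple_sub_exists[OF A smod_carrier[OF lA] False] by blast
    obtain x where x: "x \<in> S" "x \<noteq> \<zero>\<^bsub>A\<^esub>" using simple_nonzero[OF S(2) lm_sub[OF lA S(1)]] by auto
    obtain L where L: "maxsub L A" "x \<notin> L" using less.prems(2)[OF smodD(2)[OF S(1) x(1)] x(2)] by auto
    have sL: "smod L A" "L \<noteq> carrier A" using L(1) by (auto simp: maximal_submod_def)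
    have "ssum A S L = L \<or> ssum A S L = carrier A"
      using L(1) smod_ssum[OF lA S(1) sL(1)] by (auto simp: maximal_submod_def)
    then have sum: "ssum A S L = carrier A" using smod_ssum(2)[OF lA S(1) sL(1)] x(1) L(2) by auto
    have "soc (sub A L) = carrier (sub A L)"
    proof (rule less.hyps)
      show "dm (sub A L) < dm A" using dm_less[OF A sL] .
      show "fm (sub A L)" using fm_sub(1)[OF A sL(1)] .
      fix y assume y: "y \<in> carrier (sub A L)" "y \<noteq> \<zero>\<^bsub>sub A L\<^esub>"
      then obtain N where N: "maxsub N A" "y \<notin> N" using less.prems(2)[of y] smodD(2)[OF sL(1)] by auto
      obtain T :: "('a, 'k vec) module" and g where T: "simp_mod T" "lh A T g" "lker A T g = N"
        using maxsub_simple[OF A N(1)] by metis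
      have gy: "g y \<noteq> \<zero>\<^bsub>T\<^esub>" using T(3) N(2) y smodD(2)[OF sL(1)] by (auto simp: lker_def)
      note gL = lh_sub_dom[OF T(2) sL(1)]
      have "maxsub (lker (sub A L) T g) (sub A L)"
        by (rule maxsub_lker[OF T(1) gL simple_hom_surj[OF T(1) gL y(1) gy]])
      then show "\<exists>N. maxsub N (sub A L) \<and> y \<notin> N" using gy by (auto simp: lker_def)
    qed
    then have "L \<subseteq> soc A" using soc_image[OF lh_incl[OF lA sL(1)]] by auto
    moreover have "S \<subseteq> soc A" using soc(2)[OF lA S] .
    ultimately have "ssum A S L \<subseteq> soc A" using smodD(4)[OF soc(1)[OF lA]] by (auto simp: ssum_def)
    then show ?thesis using sum smodD(1)[OF soc(1)[OF lA]] by auto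
  qed
qed

text \<open>The algebra \<open>\<Lambda> / J\<close> has zero radical as a left module, so it is its
  own socle. If \<open>J\<close> kills \<open>M\<close>, each element of \<open>M\<close> is the
  image of the unit under a map from \<open>\<Lambda> / J\<close>, and such maps send socle to
  socle.\<close>

lemma soc_full:
  assumes M: "lm M" and s: "sz M = carrier M"
  shows "soc M = carrier M"
proof -
  obtain A :: "('a, 'a) module" and q
    where q: "lh (regular \<Lambda>) A q" "q ` carrier \<Lambda> = carrier A" "lker (regular \<Lambda>) A q = J"
    using quotient_exists[OF lm_regular J_smod] by auto
  have A: "fm A" using fm_surj[OF q(1) fm_regular] q(2) by simp
  have "soc A = carrier A"
  proof (rule soc_full_of_rad_zero[OF A])
    fix y assume y: "y \<in> carrier A" "y \<noteq> \<zero>\<^bsub>A\<^esub>"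
    then obtain a where a: "a \<in> carrier \<Lambda>" "y = q a" using q(2) by auto
    then have "a \<notin> J" using q(3) y by (auto simp: lker_def)
    then obtain N where N: "maxsub N (regular \<Lambda>)" "a \<notin> N" using a(1) by (auto simp: jrad_def mod_rad_def)
    obtain T :: "('a, 'k vec) module" and g
      where T: "simp_mod T" "lh (regular \<Lambda>) T g" "lker (regular \<Lambda>) T g = N"
      using maxsub_simple[OF fm_regular N(1)] by metis
    have "J \<subseteq> N" using N(1) by (auto simp: jrad_def mod_rad_def)
    then obtain g' where g': "lh A T g'" "\<And>x. x \<in> carrier \<Lambda> \<Longrightarrow> g' (q x) = g x"
      using lh_factor[OF q(1) _ T(2)] q T(3) by auto
    have gy: "g' y \<noteq> \<zero>\<^bsub>T\<^esub>" using g'(2)[OF a(1)] a T(3) N(2) by (auto simp: lker_def)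
    have "maxsub (lker A T g') A"
      by (rule maxsub_lker[OF T(1) g'(1) simple_hom_surj[OF T(1) g'(1) y(1) gy]])
    then show "\<exists>N. maxsub N A \<and> y \<notin> N" using gy by (auto simp: lker_def)
  qed
  moreover have "x \<in> soc M" if x: "x \<in> carrier M" for x
  proof -
    have "lker (regular \<Lambda>) A q \<subseteq> lker (regular \<Lambda>) M (\<lambda>a. a \<odot>\<^bsub>M\<^esub> x)"
      using q(3) s x J_carrier by (auto simp: lker_def sz_def)
    then obtain g' where g': "lh A M g'" "\<And>a. a \<in> carrier \<Lambda> \<Longrightarrow> g' (q a) = a \<odot>\<^bsub>M\<^esub> x"
      using lh_factor[OF q(1) _ lh_orbit[OF M x]] q(2) by auto
    have "g' (q \<one>) = x" using g'(2) left_module.lsmult_one[OF M x] by simp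
    moreover have "q \<one> \<in> soc A" using \<open>soc A = carrier A\<close> lhD(3)[OF q(1)] by simp
    ultimately show ?thesis using soc_image[OF g'(1)] by metis
  qed
  ultimately show ?thesis using smodD(1)[OF soc(1)[OF M]] by auto
qed

lemma soc_eq_sz: assumes M: "lm M" shows "soc M = sz M"
proof (rule equalityI)
  show "soc M \<subseteq> sz M"
  proof (rule soc(3)[OF M smod_sz[OF M]])
    fix N assume N: "smod N M" "simp_mod (sub M N)"
    show "N \<subseteq> sz M" using sz_simple[OF N(2) lm_sub[OF M N(1)]] sz_sub[OF N(1)] by auto
  qed
  have "soc (sub M (sz M)) = sz M"
    using soc_full[OF lm_sub[OF M smod_sz[OF M]]] sz_sub[OF smod_sz[OF M]] by simp
  then show "sz M \<subseteq> soc M" using soc_image[OF lh_incl[OF M smod_sz[OF M]]] by auto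
qed

text \<open>\<open>N\<close> maps isomorphically onto the quotient by \<open>L\<close>; the
  retraction is the quotient map followed by the inverse of this isomorphism.\<close>

lemma complement_retraction:
  assumes M: "lm M" and N: "smod N M" and L: "smod L M" and i: "N \<inter> L = {\<zero>\<^bsub>M\<^esub>}"
    and s: "ssum M N L = carrier M"
  obtains r where "lh M (sub M N) r" "\<And>x. x \<in> N \<Longrightarrow> r x = x" "lker M (sub M N) r = L"
proof -
  obtain Q :: "('a, 'b) module" and q where q: "lh M Q q" "q ` carrier M = carrier Q" "lker M Q q = L"
    using quotient_exists[OF M L] by blast
  have qN: "lh (sub M N) Q q" by (rule lh_sub_dom[OF q(1) N])
  have "lker (sub M N) Q q = N \<inter> L" using q(3) smodD(2)[OF N] by (auto simp: lker_def)
  then have inj: "inj_on q (carrier (sub M N))" using lh_inj_iff[OF qN] i by simp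
  have surj: "q ` carrier (sub M N) = carrier Q"
  proof (rule equalityI)
    show "q ` carrier (sub M N) \<subseteq> carrier Q" using lhD(3)[OF qN] by auto
    show "carrier Q \<subseteq> q ` carrier (sub M N)"
    proof
      fix y assume "y \<in> carrier Q"
      then obtain x where "x \<in> ssum M N L" "y = q x" using q(2) s by auto
      then obtain n l where nl: "n \<in> N" "l \<in> L" "y = q (n \<oplus>\<^bsub>M\<^esub> l)" unfolding ssum_def by blast
      then have "q l = \<zero>\<^bsub>Q\<^esub>" "n \<in> carrier M" "l \<in> carrier M" using q(3) smodD(2)[OF N] smodD(2)[OF L]
        by (auto simp: lker_def)
      then have "y = q n"
        using nl(3) lhD(4)[OF q(1), of n l] lhD(3)[OF q(1), of n] lhD(2)[OF q(1)]
        by (simp add: abelian_monoid.r_zero abelian_group.axioms(1) left_module.axioms(2))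
      then show "y \<in> q ` carrier (sub M N)" using nl(1) by simp
    qed
  qed
  obtain g where g: "lh Q (sub M N) g" "\<And>x. x \<in> N \<Longrightarrow> g (q x) = x" "\<And>y. y \<in> carrier Q \<Longrightarrow> q (g y) = y"
    using lh_inverse[OF qN inj surj] by auto
  have "g (q x) = \<zero>\<^bsub>M\<^esub> \<longleftrightarrow> q x = \<zero>\<^bsub>Q\<^esub>" if "x \<in> carrier M" for x
    using g(3)[of "q x"] lhD(3)[OF q(1) that] lh_zero[OF g(1)] lh_zero[OF qN] by auto
  then have "lker M (sub M N) (\<lambda>x. g (q x)) = L" using q(3) by (auto simp: lker_def)
  then show ?thesis using that[OF lh_comp[OF q(1) g(1)]] g(2) by blast
qed

text \<open>A submodule \<open>L\<close> maximal among those that meet \<open>N\<close> in zero is a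
  complement. Otherwise some simple submodule is not contained in \<open>N + L\<close>, meets this
  sum in zero, and can be added to \<open>L\<close>.\<close>

lemma semisimple_retraction:
  assumes M: "fm M" and ss: "sz M = carrier M" and N: "smod N M"
  obtains r where "lh M (sub M N) r" "\<And>x. x \<in> N \<Longrightarrow> r x = x"
proof -
  note lM = fmD[OF M]
  interpret M: left_module \<Lambda> M by (rule lM)
  obtain L where L: "smod L M" "N \<inter> L = {\<zero>\<^bsub>M\<^esub>}"
    and max: "\<And>L'. smod L' M \<Longrightarrow> N \<inter> L' = {\<zero>\<^bsub>M\<^esub>} \<Longrightarrow> L \<subseteq> L' \<Longrightarrow> L' = L"
    using ex_max_dm[OF M smod_zero[OF lM], of "\<lambda>L. N \<inter> L = {\<zero>\<^bsub>M\<^esub>}"] smodD(3)[OF N] by auto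
  note NL = smod_ssum[OF lM N L(1)]
  have "ssum M N L = carrier M"
  proof (rule ccontr)
    assume ne: "ssum M N L \<noteq> carrier M"
    have "\<not> soc M \<subseteq> ssum M N L" using soc_full[OF lM ss] ne smodD(1)[OF NL(1)] by auto
    then obtain S where S: "smod S M" "simp_mod (sub M S)" "\<not> S \<subseteq> ssum M N L"
      using soc(3)[OF lM NL(1)] by blast
    have "smod (S \<inter> ssum M N L) (sub M S)"
      using smod_sub_iff[OF lM S(1)] smod_Int[OF lM S(1) NL(1)] by auto
    then have "S \<inter> ssum M N L = {\<zero>\<^bsub>M\<^esub>} \<or> S \<inter> ssum M N L = S"
      using S(2) unfolding simple_mod_def by auto
    then have SZ: "S \<inter> ssum M N L = {\<zero>\<^bsub>M\<^esub>}" using S(3) by auto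
    note LS = smod_ssum[OF lM L(1) S(1)]
    have "N \<inter> ssum M L S \<subseteq> {\<zero>\<^bsub>M\<^esub>}"
    proof
      fix n assume "n \<in> N \<inter> ssum M L S"
      then obtain l s where ls: "n \<in> N" "l \<in> L" "s \<in> S" "n = l \<oplus>\<^bsub>M\<^esub> s" by (auto simp: ssum_def)
      have c: "n \<in> carrier M" "l \<in> carrier M" "s \<in> carrier M"
        using ls smodD(2)[OF N] smodD(2)[OF L(1)] smodD(2)[OF S(1)] by auto
      have "n \<ominus>\<^bsub>M\<^esub> l = s \<oplus>\<^bsub>M\<^esub> l \<ominus>\<^bsub>M\<^esub> l" using ls(4) c by (simp add: M.M.a_comm)
      also have "\<dots> = s" using c by (simp add: a_minus_def M.M.a_assoc M.M.r_neg)
      finally have "n \<ominus>\<^bsub>M\<^esub> l = s" .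
      moreover have "n \<ominus>\<^bsub>M\<^esub> l \<in> ssum M N L"
        using smod_minus[OF lM NL(1)] NL(2,3) ls(1,2) by blast
      ultimately have "s = \<zero>\<^bsub>M\<^esub>" using SZ ls(3) by auto
      then have "n = l" using ls(4) c by simp
      then show "n \<in> {\<zero>\<^bsub>M\<^esub>}" using L(2) ls(1,2) by auto
    qed
    then have "N \<inter> ssum M L S = {\<zero>\<^bsub>M\<^esub>}" using smodD(3)[OF N] smodD(3)[OF LS(1)] by auto
    from max[OF LS(1) this LS(2)] have "S \<subseteq> L" using LS(3) by simp
    then show False using S(3) NL(3) by auto
  qed
  from complement_retraction[OF lM N L this] show ?thesis using that by metis
qed

text \<open>In the semisimple quotient by \<open>J M\<close> the cyclic submodule generated by the
  image of \<open>x\<close> is a summand. A simple quotient of this submodule therefore extends to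
  all of \<open>M\<close>, and it does not kill the generator.\<close>

lemma radical_separation:
  assumes M: "fm M" and x: "x \<in> carrier M" "x \<notin> rj M"
  obtains S :: "('a, 'k vec) module" and g where "S \<in> modcat \<Lambda>" "simp_mod S" "lh M S g" "g x \<noteq> \<zero>\<^bsub>S\<^esub>"
proof -
  note lM = fmD[OF M]
  obtain Q :: "('a, 'b) module" and q where q: "lh M Q q" "q ` carrier M = carrier Q" "lker M Q q = rj M"
    using quotient_exists[OF lM rj(1)[OF lM]] by blast
  have Q: "fm Q" using fm_surj[OF q(1) M q(2)] .
  note lQ = fmD[OF Q]
  have "rj Q = q ` rj M" using rj_image_surj[OF q(1,2)] by simp
  also have "\<dots> = {\<zero>\<^bsub>Q\<^esub>}" using q(3) smodD(3)[OF rj(1)[OF lM]] by (force simp: lker_def)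
  finally have ss: "sz Q = carrier Q" using sz_full[OF lQ] by simp
  define y where "y = q x"
  have y: "y \<in> carrier Q" "y \<noteq> \<zero>\<^bsub>Q\<^esub>" using x q(3) lhD(3)[OF q(1)] by (auto simp: y_def lker_def)
  let ?N = "(\<lambda>a. a \<odot>\<^bsub>Q\<^esub> y) ` carrier \<Lambda>"
  have N: "smod ?N Q" using smod_range[OF lh_orbit[OF lQ y(1)]] by simp
  have yN: "y \<in> ?N" using left_module.lsmult_one[OF lQ y(1)] by (metis image_eqI one_closed)
  have fN: "fm (sub Q ?N)" using fm_sub(1)[OF Q N] .
  have ne: "{\<zero>\<^bsub>sub Q ?N\<^esub>} \<noteq> carrier (sub Q ?N)" using yN y(2) by auto
  obtain S :: "('a, 'k vec) module" and g where S: "S \<in> modcat \<Lambda>" "simp_mod S" "lh (sub Q ?N) S g"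
    "g ` carrier (sub Q ?N) = carrier S" by (rule simple_quotient_exists[OF fN smod_zero[OF fmD[OF fN]] ne])
  have gy: "g y \<noteq> \<zero>\<^bsub>S\<^esub>"
  proof
    assume g0: "g y = \<zero>\<^bsub>S\<^esub>"
    have "g (a \<odot>\<^bsub>Q\<^esub> y) = \<zero>\<^bsub>S\<^esub>" if "a \<in> carrier \<Lambda>" for a
      using lhD(5)[OF S(3) that, of y] yN g0 lm_rules(6)[OF lhD(2)[OF S(3)] that] by simp
    then have "carrier S \<subseteq> {\<zero>\<^bsub>S\<^esub>}" using S(4) by auto
    then show False using simple_nonzero[OF S(2) lhD(2)[OF S(3)]] by auto
  qed
  obtain r where r: "lh Q (sub Q ?N) r" "\<And>x. x \<in> ?N \<Longrightarrow> r x = x"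
    using semisimple_retraction[OF Q ss N] by blast
  have "g (r (q x)) \<noteq> \<zero>\<^bsub>S\<^esub>" using r(2)[OF yN] gy by (simp add: y_def)
  then show ?thesis using that[OF S(1,2) lh_comp[OF q(1) lh_comp[OF r(1) S(3)]]] by blast
qed

text \<open>One inclusion is \<open>radical_separation\<close>, the other holds because maps to
  simple modules kill \<open>J M\<close>. It is needed to read \<open>mod_top\<close> in the
  definition of weak symmetry.\<close>

lemma mod_rad_eq_rj: assumes M: "fm M" shows "mod_rad \<Lambda> M = rj M"
proof (intro equalityI subsetI)
  fix x assume x: "x \<in> mod_rad \<Lambda> M"
  show "x \<in> rj M"
  proof (rule ccontr)
    assume n: "x \<notin> rj M"
    have xM: "x \<in> carrier M" using x by (auto simp: mod_rad_def)
    obtain S :: "('a, 'k vec) module" and g where S: "S \<in> modcat \<Lambda>" "simp_mod S" "lh M S g" "g x \<noteq> \<zero>\<^bsub>S\<^esub>"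
      using radical_separation[OF M xM n] by blast
    have "maxsub (lker M S g) M" by (rule maxsub_lker[OF S(2,3) simple_hom_surj[OF S(2,3) xM S(4)]])
    then have "x \<in> lker M S g" using x by (auto simp: mod_rad_def)
    then show False using S(4) by (simp add: lker_def)
  qed
next
  fix x assume x: "x \<in> rj M"
  have "x \<in> N" if N: "maxsub N M" for N
  proof -
    obtain S :: "('a, 'k vec) module" and g where S: "simp_mod S" "lh M S g" "lker M S g = N"
      using maxsub_simple[OF M N] by metis
    have "g x = \<zero>\<^bsub>S\<^esub>" by (rule rj_simple_hom[OF S(1,2) x])
    then show ?thesis using S(3) x smodD(2)[OF rj(1)[OF fmD[OF M]]] by (auto simp: lker_def)
  qed
  then show "x \<in> mod_rad \<Lambda> M" using x smodD(2)[OF rj(1)[OF fmD[OF M]]] by (auto simp: mod_rad_def)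
qed

section \<open>Projective and injective modules\<close>

lemma sub_sub [simp]: "sub (sub M U) V = sub M V" by simp

lemma liso_lh:
  assumes "liso M N f" shows "lh M N f" "inj_on f (carrier M)" "f ` carrier M = carrier N"
  using assms by (auto simp: liso_def bij_betw_def)

text \<open>\<open>projective\<close> tests against modules on \<open>'k vec\<close> only.
  Conjugating with copies of \<open>A\<close> and \<open>B\<close> frees the lifting property from
  the carrier type; \<open>injective_extend\<close> does the same for injective modules.\<close>

lemma projective_lift:
  assumes P: "projective \<Lambda> P" and A: "fm A" and g: "lh A B g" "g ` carrier A = carrier B" and f: "lh P B f"
  obtains h where "lh P A h" "\<And>x. x \<in> carrier P \<Longrightarrow> g (h x) = f x"
proof -
  have B: "fm B" using fm_surj[OF g(1) A g(2)] .
  obtain A' :: "('a, 'k vec) module" and a where A': "A' \<in> modcat \<Lambda>" "liso A A' a" using copy_exists[OF A] .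
  obtain a' where a': "liso A' A a'" "\<And>x. x \<in> carrier A \<Longrightarrow> a' (a x) = x" "\<And>y. y \<in> carrier A' \<Longrightarrow> a (a' y) = y"
    using liso_inverse[OF A'(2)] by blast
  obtain B' :: "('a, 'k vec) module" and b where B': "B' \<in> modcat \<Lambda>" "liso B B' b" using copy_exists[OF B] .
  let ?g = "restrict (\<lambda>x. b (g (a' x))) (carrier A')" and ?f = "restrict (\<lambda>x. b (f x)) (carrier P)"
  note la = liso_lh[OF a'(1)] and lb = liso_lh[OF B'(2)]
  have g': "?g \<in> lhom \<Lambda> A' B'" by (rule lh_restrict[OF lh_comp[OF la(1) lh_comp[OF g(1) lb(1)]]])
  have f': "?f \<in> lhom \<Lambda> P B'" by (rule lh_restrict[OF lh_comp[OF f lb(1)]])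
  have "(\<lambda>x. b (g (a' x))) ` carrier A' = b ` g ` a' ` carrier A'" by (simp add: image_image)
  then have s: "?g ` carrier A' = carrier B'" using la(3) lb(3) g(2) by simp
  obtain h where h: "h \<in> lhom \<Lambda> P A'" "\<And>x. x \<in> carrier P \<Longrightarrow> ?g (h x) = ?f x"
    using P[unfolded projective_def, rule_format, OF A'(1) B'(1) g' f' s] by blast
  have lh: "lh P A' h" using lhomD[OF h(1) lhD(1)[OF f]] A'(1) by (simp add: modcat_iff fmD)
  show ?thesis
  proof (rule that[OF lh_comp[OF lh la(1)]])
    fix x assume x: "x \<in> carrier P"
    have "b (g (a' (h x))) = b (f x)" using h(2)[OF x] lhD(3)[OF lh x] x by simp
    then show "g (a' (h x)) = f x"
      using inj_onD[OF lb(2)] lhD(3)[OF g(1)] lhD(3)[OF la(1)] lhD(3)[OF lh x] lhD(3)[OF f x] by blast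
  qed
qed

lemma projectiveI:
  assumes P: "lm P" and
    lift: "\<And>(A :: ('a, 'k vec) module) (B :: ('a, 'k vec) module) g f. fm A \<Longrightarrow> lh A B g \<Longrightarrow>
      g ` carrier A = carrier B \<Longrightarrow> lh P B f \<Longrightarrow>
      \<exists>h. lh P A h \<and> (\<forall>x\<in>carrier P. g (h x) = f x)"
  shows "projective \<Lambda> P"
  unfolding projective_def
proof (intro ballI impI)
  fix A B :: "('a, 'k vec) module" and g f
  assume *: "A \<in> modcat \<Lambda>" "B \<in> modcat \<Lambda>" "g \<in> lhom \<Lambda> A B" "f \<in> lhom \<Lambda> P B" "g ` carrier A = carrier B"
  then have A: "fm A" and l: "lm A" "lm B" by (auto simp: modcat_iff fmD)
  obtain h where h: "lh P A h" "\<forall>x\<in>carrier P. g (h x) = f x"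
    using lift[OF A lhomD[OF *(3) l] *(5) lhomD[OF *(4) P l(2)]] by blast
  then show "\<exists>h\<in>lhom \<Lambda> P A. \<forall>x\<in>carrier P. g (h x) = f x"
    by (intro bexI[OF _ lh_restrict[OF h(1)]]) auto
qed

lemma injective_extend:
  assumes I: "injective \<Lambda> I" and B: "fm B" and g: "lh A B g" "inj_on g (carrier A)" and f: "lh A I f"
  obtains h where "lh B I h" "\<And>x. x \<in> carrier A \<Longrightarrow> h (g x) = f x"
proof -
  have A: "fm A" using fm_inj(1)[OF g(1) B g(2)] .
  obtain A' :: "('a, 'k vec) module" and a where A': "A' \<in> modcat \<Lambda>" "liso A A' a" using copy_exists[OF A] .
  obtain a' where a': "liso A' A a'" "\<And>x. x \<in> carrier A \<Longrightarrow> a' (a x) = x" "\<And>y. y \<in> carrier A' \<Longrightarrow> a (a' y) = y"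
    using liso_inverse[OF A'(2)] by blast
  obtain B' :: "('a, 'k vec) module" and b where B': "B' \<in> modcat \<Lambda>" "liso B B' b" using copy_exists[OF B] .
  let ?g = "restrict (\<lambda>x. b (g (a' x))) (carrier A')" and ?f = "restrict (\<lambda>x. f (a' x)) (carrier A')"
  note la = liso_lh[OF a'(1)] and lb = liso_lh[OF B'(2)] and la' = liso_lh[OF A'(2)]
  have g': "?g \<in> lhom \<Lambda> A' B'" by (rule lh_restrict[OF lh_comp[OF la(1) lh_comp[OF g(1) lb(1)]]])
  have f': "?f \<in> lhom \<Lambda> A' I" by (rule lh_restrict[OF lh_comp[OF la(1) f]])
  have i: "inj_on ?g (carrier A')"
  proof (rule inj_onI)
    fix x y assume *: "x \<in> carrier A'" "y \<in> carrier A'" "?g x = ?g y"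
    then have "b (g (a' x)) = b (g (a' y))" by simp
    then have "g (a' x) = g (a' y)"
      using inj_onD[OF lb(2)] lhD(3)[OF g(1)] lhD(3)[OF la(1)] *(1,2) by blast
    then have "a' x = a' y" using inj_onD[OF g(2)] lhD(3)[OF la(1)] *(1,2) by blast
    then show "x = y" using inj_onD[OF la(2)] *(1,2) by blast
  qed
  obtain h where h: "h \<in> lhom \<Lambda> B' I" "\<And>x. x \<in> carrier A' \<Longrightarrow> h (?g x) = ?f x"
    using I[unfolded injective_def, rule_format, OF A'(1) B'(1) g' f' i] by blast
  have lh: "lh B' I h" using lhomD[OF h(1) _ lhD(2)[OF f]] B'(1) by (simp add: modcat_iff fmD)
  show ?thesis
  proof (rule that[OF lh_comp[OF lb(1) lh]])
    fix x assume x: "x \<in> carrier A"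
    then show "h (b (g x)) = f x" using h(2)[of "a x"] lhD(3)[OF la'(1) x] a'(2)[OF x] by simp
  qed
qed

lemma injectiveI:
  assumes I: "lm I" and
    lift: "\<And>(A :: ('a, 'k vec) module) (B :: ('a, 'k vec) module) g f. fm B \<Longrightarrow> lh A B g \<Longrightarrow>
      inj_on g (carrier A) \<Longrightarrow> lh A I f \<Longrightarrow>
      \<exists>h. lh B I h \<and> (\<forall>x\<in>carrier A. h (g x) = f x)"
  shows "injective \<Lambda> I"
  unfolding injective_def
proof (intro ballI impI)
  fix A B :: "('a, 'k vec) module" and g f
  assume *: "A \<in> modcat \<Lambda>" "B \<in> modcat \<Lambda>" "g \<in> lhom \<Lambda> A B" "f \<in> lhom \<Lambda> A I" "inj_on g (carrier A)"
  then have B: "fm B" and l: "lm A" "lm B" by (auto simp: modcat_iff fmD)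
  have g: "lh A B g" by (rule lhomD[OF *(3) l])
  obtain h where h: "lh B I h" "\<forall>x\<in>carrier A. h (g x) = f x"
    using lift[OF B g *(5) lhomD[OF *(4) l(1) I]] by blast
  then show "\<exists>h\<in>lhom \<Lambda> B I. \<forall>x\<in>carrier A. h (g x) = f x"
    by (intro bexI[OF _ lh_restrict[OF h(1)]]) (use lhD(3)[OF g] in auto)
qed

lemma projective_retr:
  assumes P: "projective \<Lambda> P" and r: "retr N P" shows "projective \<Lambda> N"
proof -
  obtain s r where *: "lh N P s" "lh P N r" "\<And>x. x \<in> carrier N \<Longrightarrow> r (s x) = x" using r
    by (auto simp: retr_def)
  show ?thesis
  proof (rule projectiveI[OF lhD(1)[OF *(1)]])
    fix A B :: "('a, 'k vec) module"
      and g f assume A: "fm A" "lh A B g" "g ` carrier A = carrier B" "lh N B f"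
    obtain h where h: "lh P A h" "\<And>x. x \<in> carrier P \<Longrightarrow> g (h x) = f (r x)"
      using projective_lift[OF P A(1-3) lh_comp[OF *(2) A(4)]] by blast
    have "g (h (s x)) = f x" if "x \<in> carrier N" for x
      using h(2) *(3) lhD(3)[OF *(1)] that by simp
    then show "\<exists>h. lh N A h \<and> (\<forall>x\<in>carrier N. g (h x) = f x)"
      using lh_comp[OF *(1) h(1)] by blast
  qed
qed

lemma injective_retr:
  assumes P: "injective \<Lambda> P" and r: "retr N P" shows "injective \<Lambda> N"
proof -
  obtain s r where *: "lh N P s" "lh P N r" "\<And>x. x \<in> carrier N \<Longrightarrow> r (s x) = x" using r
    by (auto simp: retr_def)
  show ?thesis
  proof (rule injectiveI[OF lhD(1)[OF *(1)]])
    fix A B :: "('a, 'k vec) module" and g f assume A: "fm B" "lh A B g" "inj_on g (carrier A)" "lh A N f"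
    obtain h where h: "lh B P h" "\<And>x. x \<in> carrier A \<Longrightarrow> h (g x) = s (f x)"
      using injective_extend[OF P A(1-3) lh_comp[OF A(4) *(1)]] by blast
    have "r (h (g x)) = f x" if "x \<in> carrier A" for x
      using h(2) *(3) lhD(3)[OF A(4)] that by simp
    then show "\<exists>h. lh B N h \<and> (\<forall>x\<in>carrier A. h (g x) = f x)"
      using lh_comp[OF h(1) *(2)] by blast
  qed
qed

lemma projective_bip:
  assumes P: "projective \<Lambda> P" "projective \<Lambda> Q" and b: "bip P Q D i j p q" shows "projective \<Lambda> D"
proof (rule projectiveI[OF lhD(2)[OF bipD(1)[OF b]]])
  note b = bipD[OF b]
  fix A B :: "('a, 'k vec) module" and g f assume A: "fm A" "lh A B g" "g ` carrier A = carrier B"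
    "lh D B f"
  obtain h where h: "lh P A h" "\<And>x. x \<in> carrier P \<Longrightarrow> g (h x) = f (i x)"
    using projective_lift[OF P(1) A(1-3) lh_comp[OF b(1) A(4)]] by blast
  obtain h' where h': "lh Q A h'" "\<And>x. x \<in> carrier Q \<Longrightarrow> g (h' x) = f (j x)"
    using projective_lift[OF P(2) A(1-3) lh_comp[OF b(2) A(4)]] by blast
  have "lh D A (\<lambda>x. h (p x) \<oplus>\<^bsub>A\<^esub> h' (q x))" by (rule lh_add[OF lh_comp[OF b(3) h(1)] lh_comp[OF b(4) h'(1)]])
  moreover have "g (h (p x) \<oplus>\<^bsub>A\<^esub> h' (q x)) = f x" if x: "x \<in> carrier D" for x
  proof -
    have "g (h (p x) \<oplus>\<^bsub>A\<^esub> h' (q x)) = f (i (p x)) \<oplus>\<^bsub>B\<^esub> f (j (q x))"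
      using x lhD(4)[OF A(2)] lhD(3)[OF h(1)] lhD(3)[OF h'(1)] lhD(3)[OF b(3)] lhD(3)[OF b(4)] h(2) h'(2)
        by simp
    also have "\<dots> = f (i (p x) \<oplus>\<^bsub>D\<^esub> j (q x))"
      using x lhD(4)[OF A(4)] lhD(3)[OF b(1)] lhD(3)[OF b(2)] lhD(3)[OF b(3)] lhD(3)[OF b(4)] by simp
    finally show ?thesis using b(9)[OF x] by simp
  qed
  ultimately show "\<exists>h. lh D A h \<and> (\<forall>x\<in>carrier D. g (h x) = f x)" by blast
qed

lemma injective_bip:
  assumes P: "injective \<Lambda> P" "injective \<Lambda> Q" and b: "bip P Q D i j p q" shows "injective \<Lambda> D"
proof (rule injectiveI[OF lhD(2)[OF bipD(1)[OF b]]])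
  note b = bipD[OF b]
  fix A B :: "('a, 'k vec) module" and g f assume A: "fm B" "lh A B g" "inj_on g (carrier A)" "lh A D f"
  obtain h where h: "lh B P h" "\<And>x. x \<in> carrier A \<Longrightarrow> h (g x) = p (f x)"
    using injective_extend[OF P(1) A(1-3) lh_comp[OF A(4) b(3)]] by blast
  obtain h' where h': "lh B Q h'" "\<And>x. x \<in> carrier A \<Longrightarrow> h' (g x) = q (f x)"
    using injective_extend[OF P(2) A(1-3) lh_comp[OF A(4) b(4)]] by blast
  have "i (h (g x)) \<oplus>\<^bsub>D\<^esub> j (h' (g x)) = f x" if "x \<in> carrier A" for x
    using h(2) h'(2) b(9) lhD(3)[OF A(4)] that by simp
  moreover have "lh B D (\<lambda>x. i (h x) \<oplus>\<^bsub>D\<^esub> j (h' x))"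
    by (rule lh_add[OF lh_comp[OF h(1) b(1)] lh_comp[OF h'(1) b(2)]])
  ultimately show "\<exists>h. lh B D h \<and> (\<forall>x\<in>carrier A. h (g x) = f x)" by blast
qed

lemma projective_regular: "projective \<Lambda> (regular \<Lambda>)"
proof (rule projectiveI[OF lm_regular])
  fix A B :: "('a, 'k vec) module" and g f assume A: "fm A" "lh A B g" "g ` carrier A = carrier B"
    "lh (regular \<Lambda>) B f"
  have "f \<one> \<in> g ` carrier A" using A(3) lhD(3)[OF A(4)] by simp
  then obtain a where a: "a \<in> carrier A" "f \<one> = g a" by auto
  have "g (x \<odot>\<^bsub>A\<^esub> a) = f x" if x: "x \<in> carrier \<Lambda>" for x
    using lhD(5)[OF A(2) x a(1)] a(2) lhD(5)[OF A(4) x, of \<one>] x by simp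
  then show "\<exists>h. lh (regular \<Lambda>) A h \<and> (\<forall>x\<in>carrier (regular \<Lambda>). g (h x) = f x)"
    using lh_orbit[OF fmD[OF A(1)] a(1)] by auto
qed

lemma addcat_iff: "P \<in> addcat \<Lambda> \<longleftrightarrow> fm P \<and> projective \<Lambda> P"
  by (simp add: addcat_def modcat_iff)

lemma addcat_retr: "P \<in> addcat \<Lambda> \<Longrightarrow> fm N \<Longrightarrow> retr N P \<Longrightarrow> N \<in> addcat \<Lambda>"
  using projective_retr by (auto simp: addcat_iff)

lemma retr_sub:
  assumes M: "lm M" "smod N M" and r: "lh M (sub M N) r" "\<And>x. x \<in> N \<Longrightarrow> r x = x"
  shows "retr (sub M N) M"
  by (rule retrI[OF lh_incl[OF M] r(1)]) (use r(2) in simp)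

lemma injective_sub_retraction:
  assumes M: "fm M" "smod N M" and I: "injective \<Lambda> (sub M N)"
  obtains r where "lh M (sub M N) r" "\<And>x. x \<in> N \<Longrightarrow> r x = x"
proof -
  have "inj_on (\<lambda>x. x) (carrier (sub M N))" by (simp add: inj_on_def)
  then show ?thesis
    using injective_extend[OF I M(1) lh_incl[OF fmD[OF M(1)] M(2)] _ lh_id[OF lm_sub[OF fmD[OF M(1)] M(2)]]]
      that
    by auto
qed

section \<open>Thick subcategories\<close>

lemma short_exact_iff:
  assumes "lm A" "lm B" "lm C"
  shows "short_exact \<Lambda> A B C \<longleftrightarrow> (\<exists>f g. lh A B f \<and> lh B C g \<and> inj_on f (carrier A) \<and>
     f ` carrier A = lker B C g \<and> g ` carrier B = carrier C)"
proof
  assume "short_exact \<Lambda> A B C"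
  then show "\<exists>f g. lh A B f \<and> lh B C g \<and> inj_on f (carrier A) \<and> f ` carrier A = lker B C g \<and>
    g ` carrier B = carrier C"
    unfolding short_exact_def lker_def using lhomD assms by blast
next
  assume "\<exists>f g. lh A B f \<and> lh B C g \<and> inj_on f (carrier A) \<and> f ` carrier A = lker B C g \<and>
    g ` carrier B = carrier C"
  then obtain f g where fg: "lh A B f" "lh B C g" "inj_on f (carrier A)" "f ` carrier A = lker B C g"
    "g ` carrier B = carrier C" by blast
  let ?f = "restrict f (carrier A)" and ?g = "restrict g (carrier B)"
  have "?f ` carrier A = {y \<in> carrier B. ?g y = \<zero>\<^bsub>C\<^esub>}" using fg(4) by (auto simp: lker_def)
  moreover have "?g ` carrier B = carrier C" "inj_on ?f (carrier A)" using fg(3,5) by simp_all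
  ultimately show "short_exact \<Lambda> A B C"
    unfolding short_exact_def using lh_restrict[OF fg(1)] lh_restrict[OF fg(2)] by blast
qed

context
  fixes T assumes T: "thick \<Lambda> T"
begin

lemma thick_fm: "M \<in> T \<Longrightarrow> fm M"
  using T[unfolded thick_def, THEN conjunct1] by (auto simp: modcat_iff)

text \<open>In this order: isomorphic copies, summands, and the three cases of two out of three,
  which yield \<open>C\<close>, \<open>B\<close> and \<open>A\<close>.\<close>

lemmas thickD = T[unfolded thick_def modcat_iff, THEN conjunct2, THEN conjunct1, rule_format]
  T[unfolded thick_def modcat_iff, THEN conjunct2, THEN conjunct2, THEN conjunct1, rule_format]
  T[unfolded thick_def modcat_iff, THEN conjunct2, THEN conjunct2, THEN conjunct2, rule_format, THEN
    conjunct1, rule_format, OF _ _ _ _ conjI]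
  T[unfolded thick_def modcat_iff, THEN conjunct2, THEN conjunct2, THEN conjunct2, rule_format, THEN
    conjunct2, THEN conjunct1, rule_format, OF _ _ _ _ conjI]
  T[unfolded thick_def modcat_iff, THEN conjunct2, THEN conjunct2, THEN conjunct2, rule_format, THEN
    conjunct2, THEN conjunct2, rule_format, OF _ _ _ _ conjI]

lemma thick_liso: "M \<in> T \<Longrightarrow> liso M N f \<Longrightarrow> N \<in> T"
proof -
  assume M: "M \<in> T" and f: "liso M N f"
  have fN: "fm N" using fm_surj[OF liso_lh(1)[OF f] thick_fm[OF M] liso_lh(3)[OF f]] .
  have "lmod_iso \<Lambda> M N" using lmod_iso_iff[OF fmD[OF thick_fm[OF M]] fmD[OF fN]] f by blast
  then show "N \<in> T" by (rule thickD(1)[OF M modcat_iff[THEN iffD2, OF fN]])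
qed

lemma thick_bip:
  fixes B :: "('a, 'k vec) module"
  assumes M: "M \<in> T" and b: "bip A B M i j p q"
  shows "A \<in> T"
proof -
  have "inj_on i (carrier A)" by (rule inj_on_inverseI[of _ p]) (use bipD(5)[OF b] in auto)
  then have A: "fm A" by (rule fm_inj(1)[OF bipD(1)[OF b] thick_fm[OF M]])
  have "inj_on j (carrier B)" by (rule inj_on_inverseI[of _ q]) (use bipD(7)[OF b] in auto)
  then have B: "fm B" by (rule fm_inj(1)[OF bipD(2)[OF b] thick_fm[OF M]])
  have "lmod_iso \<Lambda> M (dsum A B)" using lmod_iso_dsum[OF fmD[OF A] fmD[OF B] fmD[OF thick_fm[OF M]]] b
    by blast
  then show "A \<in> T" by (rule thickD(2)[OF M modcat_iff[THEN iffD2, OF A] modcat_iff[THEN iffD2, OF B]])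
qed

lemma thick_retr: "M \<in> T \<Longrightarrow> retr N M \<Longrightarrow> N \<in> T"
  using thick_bip bip_retraction unfolding retr_def by meson

lemma thick_exact:
  assumes "lh A B f" "lh B C g" "inj_on f (carrier A)" "f ` carrier A = lker B C g"
    "g ` carrier B = carrier C" "fm B"
  shows "A \<in> T \<Longrightarrow> B \<in> T \<Longrightarrow> C \<in> T" "A \<in> T \<Longrightarrow> C \<in> T \<Longrightarrow> B \<in> T" "B \<in> T \<Longrightarrow> C \<in> T \<Longrightarrow> A \<in> T"
proof -
  have A: "fm A" using fm_inj(1)[OF assms(1,6,3)] .
  have C: "fm C" using fm_surj[OF assms(2,6,5)] .
  have se: "short_exact \<Lambda> A B C"
    using short_exact_iff[OF fmD[OF A] fmD[OF assms(6)] fmD[OF C]] assms by blast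
  note m = A[folded modcat_iff] assms(6)[folded modcat_iff] C[folded modcat_iff]
  then show "A \<in> T \<Longrightarrow> B \<in> T \<Longrightarrow> C \<in> T" "A \<in> T \<Longrightarrow> C \<in> T \<Longrightarrow> B \<in> T" "B \<in> T \<Longrightarrow> C \<in> T \<Longrightarrow> A \<in> T"
    using thickD(3-5)[OF m se] by blast+
qed

lemma thick_kernel:
  assumes g: "lh B C g" "g ` carrier B = carrier C" and B: "fm B"
  shows "sub B (lker B C g) \<in> T \<Longrightarrow> B \<in> T \<Longrightarrow> C \<in> T" "sub B (lker B C g) \<in> T \<Longrightarrow> C \<in> T \<Longrightarrow> B \<in> T"
    "B \<in> T \<Longrightarrow> C \<in> T \<Longrightarrow> sub B (lker B C g) \<in> T"
  using thick_exact[OF lh_incl[OF fmD[OF B] smod_lker[OF g(1)]] g(1) _ _ g(2) B] by (auto simp: inj_on_def)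

lemma thick_zero: "M \<in> T \<Longrightarrow> lm N \<Longrightarrow> carrier N = {\<zero>\<^bsub>N\<^esub>} \<Longrightarrow> N \<in> T"
  by (rule thick_retr, assumption, rule retrI[OF lh_const lh_const]) (auto dest: thick_fm fmD)

end

section \<open>The Fitting decomposition\<close>

lemma lh_funpow: "lh P P g \<Longrightarrow> lh P P (g ^^ n)"
proof (induction n)
  case 0
  then show ?case using lh_id[OF lhD(1)[OF 0]] by (simp add: id_def)
next
  case (Suc n)
  then show ?case using lh_comp[of P P "g ^^ n" P g] by (simp add: comp_def)
qed

text \<open>Where the dimension of the image of a power of \<open>g\<close> is least, this power
  permutes its image. Its inverse there, after the power itself, retracts \<open>P\<close> onto the
  image.\<close>

lemma fitting:
  assumes P: "fm P" and g: "lh P P g"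
  obtains n r where "inj_on (g ^^ Suc n) ((g ^^ Suc n) ` carrier P)"
    "lh P (sub P ((g ^^ Suc n) ` carrier P)) r" "\<And>y. y \<in> (g ^^ Suc n) ` carrier P \<Longrightarrow> r y = y"
proof -
  \<comment> \<open>Only positive powers are compared. The applications rely on an exponent of the
    form \<open>Suc n\<close>, for instance to know that the image lies in the image of
    \<open>g\<close>.\<close>
  define d where "d = (\<lambda>n. dm (sub P ((g ^^ Suc n) ` carrier P)))"
  obtain n where n: "\<And>m. d n \<le> d m" using ex_has_least_nat[of "\<lambda>_. True" 0 d] by auto
  define f where "f = g ^^ Suc n"
  have f: "lh P P f" unfolding f_def by (rule lh_funpow[OF g])
  let ?U = "f ` carrier P"
  have U: "smod ?U P" by (rule smod_range[OF f])
  let ?Q = "sub P ?U"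
  have Q: "fm ?Q" by (rule fm_sub(1)[OF P U])
  have fQ: "lh ?Q ?Q f" by (rule lh_sub_cod[OF lh_sub_dom[OF f U] U]) (use smodD(2)[OF U] in auto)
  \<comment> \<open>Applying \<open>f\<close> twice is again one of the compared powers, so the
    image of \<open>f\<close> does not shrink under \<open>f\<close>.\<close>
  have "f (f x) = (g ^^ (Suc n + Suc n)) x" for x by (simp only: f_def funpow_add o_apply)
  moreover have "Suc n + Suc n = Suc (Suc (n + n))" by simp
  ultimately have "f ` ?U = (g ^^ Suc (Suc (n + n))) ` carrier P" by (simp only: image_image)
  then have "dm ?Q \<le> dm (sub P (f ` ?U))" using n[of "Suc (n + n)"] by (simp add: d_def f_def)
  moreover have "dm (sub ?Q (f ` ?U)) + dm (sub ?Q (lker ?Q ?Q f)) = dm ?Q"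
    using dm_rank[OF fQ Q] by simp
  ultimately have 0: "dm (sub ?Q (lker ?Q ?Q f)) = 0" "dm (sub ?Q (f ` ?U)) = dm ?Q" by auto
  have "lker ?Q ?Q f = {\<zero>\<^bsub>?Q\<^esub>}" using dm_eq_0[OF fm_sub(1)[OF Q smod_lker[OF fQ]]] 0(1) by simp
  then have inj: "inj_on f (carrier ?Q)" using lh_inj_iff[OF fQ] by simp
  have "smod (f ` ?U) ?Q" using smod_range[OF fQ] by simp
  from fm_sub(3)[OF Q this 0(2)] have surj: "f ` carrier ?Q = carrier ?Q" by simp
  obtain h where h: "lh ?Q ?Q h" "\<And>x. x \<in> carrier ?Q \<Longrightarrow> h (f x) = x"
    using lh_inverse[OF fQ inj surj] by blast
  have "lh P ?Q (\<lambda>x. h (f x))" by (rule lh_comp[OF lh_sub_cod[OF f U] h(1)]) auto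
  then show ?thesis using that[of n "\<lambda>x. h (f x)"] inj h(2) by (simp add: f_def)
qed

lemma smod_additive_subgroup: "lm M \<Longrightarrow> smod N M \<Longrightarrow> additive_subgroup N M"
  by (simp add: additive_subgroup_def Module.submodule_def)

lemma bip_exact:
  assumes b: "bip A B D i j p q"
  shows "inj_on i (carrier A)" "i ` carrier A = lker D B q" "q ` carrier D = carrier B"
proof -
  note b' = bipD[OF b]
  show "inj_on i (carrier A)" by (rule inj_on_inverseI[of _ p]) (use b'(5) in auto)
  show "i ` carrier A = lker D B q"
  proof (intro equalityI subsetI)
    fix x assume "x \<in> lker D B q"
    then have x: "x \<in> carrier D" "q x = \<zero>\<^bsub>B\<^esub>" by (auto simp: lker_def)
    have "x = i (p x) \<oplus>\<^bsub>D\<^esub> \<zero>\<^bsub>D\<^esub>" using b'(9)[OF x(1)] x(2) lh_zero[OF b'(2)] by simp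
    also have "\<dots> = i (p x)" using lhD(3)[OF b'(1) lhD(3)[OF b'(3) x(1)]] left_module.axioms(2)[OF lhD(2)[OF
      b'(1)]]
      by (simp add: abelian_monoid.r_zero abelian_group.axioms(1))
    finally show "x \<in> i ` carrier A" using lhD(3)[OF b'(3) x(1)] by blast
  qed (use b'(6) lhD(3)[OF b'(1)] in \<open>auto simp: lker_def\<close>)
  show "q ` carrier D = carrier B"
  proof (intro equalityI subsetI)
    fix y assume "y \<in> carrier B"
    then show "y \<in> q ` carrier D" using b'(7)[of y] lhD(3)[OF b'(2)] by (metis image_eqI)
  qed (use lhD(3)[OF b'(4)] in auto)
qed

section \<open>Decompositions of the algebra into ideals\<close>

lemma dsum_ring_simps [simp]: "(x, y) \<otimes>\<^bsub>dsum A B\<^esub> (x', y') = (x \<otimes>\<^bsub>A\<^esub> x', y \<otimes>\<^bsub>B\<^esub> y')"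
  "\<one>\<^bsub>dsum A B\<^esub> = (\<one>\<^bsub>A\<^esub>, \<one>\<^bsub>B\<^esub>)"
  by (simp_all add: dsum_def ring.defs RDirProd_def monoid.defs DirProd_def)

text \<open>The unit differs from that of \<open>\<Lambda>\<close>, so this is not a subalgebra; all
  operations are inherited.\<close>

lemma corner_algebra:
  assumes A: "smod A (regular \<Lambda>)" and e: "e \<in> A"
    and one: "\<And>x. x \<in> A \<Longrightarrow> x \<otimes> e = x" "\<And>x. x \<in> A \<Longrightarrow> e \<otimes> x = x"
  shows "k_algebra (\<Lambda>\<lparr>carrier := A, one := e\<rparr>)"
proof -
  let ?A = "\<Lambda>\<lparr>carrier := A, one := e\<rparr>"
  have c: "x \<in> carrier \<Lambda>" if "x \<in> A" for x using smodD(2)[OF A that] by simp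
  have z: "\<zero> \<in> A" using smodD(3)[OF A] by simp
  have a: "x \<oplus> y \<in> A" if "x \<in> A" "y \<in> A" for x y using smodD(4)[OF A that] by simp
  have m: "r \<otimes> x \<in> A" if "r \<in> carrier \<Lambda>" "x \<in> A" for r x using smodD(5)[OF A that] by simp
  have n: "\<exists>y\<in>A. y \<oplus> x = \<zero>" if "x \<in> A" for x
    using that m[of "\<ominus> \<one>" x] c[of x] l_neg[of x] by (intro bexI[of _ "\<ominus> x"]) (auto simp: l_minus)
  have n': "\<exists>y\<in>A. x \<oplus> y = \<zero>" if "x \<in> A" for x
    using n[OF that] a_comm c that by metis
  have k: "r \<odot> x \<in> A" if "x \<in> A" for r x
    using m[of "scal r" x] that scal_mult_eq(1)[OF c[OF that]] by simp
  have "ring ?A"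
  proof (rule ringI)
    show "abelian_group ?A" by (rule abelian_groupI) (use a z n in \<open>auto simp: a_ac c\<close>)
    show "monoid ?A" by (rule monoidI) (use m e one in \<open>auto simp: m_assoc c\<close>)
  qed (auto simp: l_distr r_distr c)
  moreover have "vectorspace class_ring ?A"
    by (rule vs_criteria) (use z a n' k in \<open>auto simp: class_field a_ac c smult_l_distr_alg
      smult_r_distr_alg smult_assoc_alg smult_one_alg\<close>)
  ultimately show ?thesis
    by (simp add: k_algebra_def k_algebra_axioms_def smult_mult_l smult_mult_r c)
qed

text \<open>Products of elements of \<open>A\<close> and \<open>B\<close>, in either order, lie in
  \<open>A \<inter> B = 0\<close>. Hence in \<open>1 = e + f\<close> the components are units of
  \<open>A\<close> and \<open>B\<close>, and \<open>x \<mapsto> (x e, x f)\<close> is an isomorphism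
  to the product of two algebras on the type of \<open>\<Lambda>\<close>, as
  \<open>indecomposable_alg\<close> wants them.\<close>

lemma indecomposable_ideals:
  assumes ind: "indecomposable_alg \<Lambda>"
    and A: "smod A (regular \<Lambda>)" "\<And>x r. x \<in> A \<Longrightarrow> r \<in> carrier \<Lambda> \<Longrightarrow> x \<otimes> r \<in> A"
    and B: "smod B (regular \<Lambda>)" "\<And>x r. x \<in> B \<Longrightarrow> r \<in> carrier \<Lambda> \<Longrightarrow> x \<otimes> r \<in> B"
    and i: "A \<inter> B = {\<zero>}" and s: "ssum (regular \<Lambda>) A B = carrier \<Lambda>"
  shows "A = {\<zero>} \<or> B = {\<zero>}"
proof -
  have cA: "x \<in> carrier \<Lambda>" if "x \<in> A" for x using smodD(2)[OF A(1) that] by simp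
  have cB: "x \<in> carrier \<Lambda>" if "x \<in> B" for x using smodD(2)[OF B(1) that] by simp
  have mA: "r \<otimes> x \<in> A" if "r \<in> carrier \<Lambda>" "x \<in> A" for r x using smodD(5)[OF A(1) that] by simp
  have mB: "r \<otimes> x \<in> B" if "r \<in> carrier \<Lambda>" "x \<in> B" for r x using smodD(5)[OF B(1) that] by simp
  have "\<one> \<in> ssum (regular \<Lambda>) A B" using s by simp
  then obtain e f where ef: "e \<in> A" "f \<in> B" "\<one> = e \<oplus> f" by (auto simp: ssum_def)
  note c = cA[OF ef(1)] cB[OF ef(2)]
  have AB: "x \<otimes> y = \<zero>" "y \<otimes> x = \<zero>" if "x \<in> A" "y \<in> B" for x y
    using A(2)[OF that(1) cB[OF that(2)]] mB[OF cA[OF that(1)] that(2)]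
      B(2)[OF that(2) cA[OF that(1)]] mA[OF cB[OF that(2)] that(1)] i by auto
  have oA: "x \<otimes> e = x" "e \<otimes> x = x" if "x \<in> A" for x
  proof -
    have "x \<otimes> (e \<oplus> f) = x" "(e \<oplus> f) \<otimes> x = x" using ef(3)[symmetric] cA[OF that] by simp_all
    then show "x \<otimes> e = x" "e \<otimes> x = x"
      using AB[OF that ef(2)] c cA[OF that] by (simp_all add: r_distr l_distr)
  qed
  have oB: "x \<otimes> f = x" "f \<otimes> x = x" if "x \<in> B" for x
  proof -
    have "x \<otimes> (e \<oplus> f) = x" "(e \<oplus> f) \<otimes> x = x" using ef(3)[symmetric] cB[OF that] by simp_all
    then show "x \<otimes> f = x" "f \<otimes> x = x"
      using AB[OF ef(1) that] c cB[OF that] by (simp_all add: r_distr l_distr)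
  qed
  let ?A = "\<Lambda>\<lparr>carrier := A, one := e\<rparr>" and ?B = "\<Lambda>\<lparr>carrier := B, one := f\<rparr>"
  define h where "h = (\<lambda>x. (x \<otimes> e, x \<otimes> f))"
  have hc: "x \<otimes> e \<in> A" "x \<otimes> f \<in> B" if "x \<in> carrier \<Lambda>" for x using mA mB ef that by auto
  have hm: "(x \<otimes> e) \<otimes> (y \<otimes> e) = (x \<otimes> y) \<otimes> e" "(x \<otimes> f) \<otimes> (y \<otimes> f) = (x \<otimes> y) \<otimes> f"
    if "x \<in> carrier \<Lambda>" "y \<in> carrier \<Lambda>" for x y
    using oA(2)[OF hc(1)[OF that(2)]] oB(2)[OF hc(2)[OF that(2)]] that c by (simp_all add: m_assoc)
  have dec: "x \<otimes> e \<oplus> x \<otimes> f = x" if "x \<in> carrier \<Lambda>" for x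
    using ef(3)[symmetric] r_distr[OF c that] that by simp
  have "bij_betw h (carrier \<Lambda>) (carrier (dsum ?A ?B))"
  proof (rule bij_betwI[of _ _ _ "\<lambda>(x, y). x \<oplus> y"])
    show "h \<in> carrier \<Lambda> \<rightarrow> carrier (dsum ?A ?B)" using hc by (auto simp: h_def)
    show "(\<lambda>(x, y). x \<oplus> y) \<in> carrier (dsum ?A ?B) \<rightarrow> carrier \<Lambda>" using cA cB by auto
    show "(case h x of (x, y) \<Rightarrow> x \<oplus> y) = x" if "x \<in> carrier \<Lambda>" for x using dec[OF that] by (simp add: h_def)
    fix z assume "z \<in> carrier (dsum ?A ?B)"
    then obtain x y where z: "z = (x, y)" "x \<in> A" "y \<in> B" by auto
    have "(x \<oplus> y) \<otimes> e = x" "(x \<oplus> y) \<otimes> f = y"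
      using oA[OF z(2)] oB[OF z(3)] AB[OF ef(1) z(3)] AB[OF z(2) ef(2)] c cA[OF z(2)] cB[OF z(3)]
      by (simp_all add: l_distr)
    then show "h (case z of (x, y) \<Rightarrow> x \<oplus> y) = z" using z(1) by (simp add: h_def)
  qed
  moreover have "h \<in> ring_hom \<Lambda> (dsum ?A ?B)"
    by (rule ring_hom_memI) (use hc hm c oA oB in \<open>auto simp: h_def l_distr\<close>)
  moreover have "\<forall>c. \<forall>x \<in> carrier \<Lambda>. h (c \<odot> x) = c \<odot>\<^bsub>dsum ?A ?B\<^esub> h x"
  proof (intro allI ballI)
    fix r x assume "x \<in> carrier \<Lambda>"
    then show "h (r \<odot> x) = r \<odot>\<^bsub>dsum ?A ?B\<^esub> h x"
      using c by (simp add: h_def smult_mult_l dsum_def ring.defs)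
  qed
  ultimately have iso: "alg_iso \<Lambda> (dsum ?A ?B)" unfolding alg_iso_def ring_iso_def by blast
  have "k_algebra ?A" "k_algebra ?B"
    using corner_algebra[OF A(1) ef(1)] corner_algebra[OF B(1) ef(2)] oA oB by blast+
  then have "carrier ?A = {\<zero>\<^bsub>?A\<^esub>} \<or> carrier ?B = {\<zero>\<^bsub>?B\<^esub>}"
    using ind iso unfolding indecomposable_alg_def by blast
  then show ?thesis by simp
qed

section \<open>Simple subquotients\<close>

text \<open>For simple \<open>S\<close> and \<open>M\<close> of finite length this is being a
  composition factor, expressed without composition series.\<close>

definition subquot :: "('a, 's) module \<Rightarrow> ('a, 'm) module \<Rightarrow> bool" where
  "subquot S M \<longleftrightarrow> (\<exists>U g. smod U M \<and> lh (sub M U) S g \<and> g ` U = carrier S)"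

text \<open>Either \<open>g\<close> is nonzero, hence onto, on the part of \<open>U\<close> inside
  the kernel of \<open>p\<close>, or it kills this part and descends to the image of
  \<open>U\<close> in \<open>C\<close>.\<close>

lemma subquot_layer:
  assumes S: "simp_mod S" and p: "lh M C p" "p ` carrier M = carrier C" and s: "subquot S M"
  shows "subquot S (sub M (lker M C p)) \<or> subquot S C"
proof -
  have M: "lm M" using p lhD by auto
  let ?K = "lker M C p"
  have K: "smod ?K M" by (rule smod_lker[OF p(1)])
  obtain U g where U: "smod U M" "lh (sub M U) S g" "g ` U = carrier S" using s by (auto simp: subquot_def)
  have UK: "smod (U \<inter> ?K) M" by (rule smod_Int[OF M U(1) K])
  show ?thesis
  proof (cases "\<exists>x\<in>U \<inter> ?K. g x \<noteq> \<zero>\<^bsub>S\<^esub>")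
    case True
    then obtain x where x: "x \<in> U \<inter> ?K" "g x \<noteq> \<zero>\<^bsub>S\<^esub>" by auto
    have "lh (sub M (U \<inter> ?K)) S g"
      using lh_sub_dom[OF U(2), of "U \<inter> ?K"] smod_sub_iff[OF M U(1)] UK by simp
    from simple_hom_surj[OF S this] x have "g ` (U \<inter> ?K) = carrier S" by simp
    then have "subquot S (sub M ?K)"
      unfolding subquot_def using \<open>lh (sub M (U \<inter> ?K)) S g\<close> smod_sub_iff[OF M K] UK
      by (intro exI[of _ "U \<inter> ?K"] exI[of _ g]) auto
    then show ?thesis by simp
  next
    case False
    have V: "smod (p ` U) C" by (rule smod_image[OF p(1) U(1)])
    have pU: "lh (sub M U) (sub C (p ` U)) p" by (rule lh_sub_cod[OF lh_sub_dom[OF p(1) U(1)] V]) auto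
    have "lker (sub M U) (sub C (p ` U)) p \<subseteq> lker (sub M U) S g"
      using False smodD(2)[OF U(1)] by (auto simp: lker_def)
    then obtain g' where g': "lh (sub C (p ` U)) S g'" "\<And>x. x \<in> U \<Longrightarrow> g' (p x) = g x"
      using lh_factor[OF pU _ U(2)] by auto
    have "g' ` p ` U = g ` U" unfolding image_image by (rule image_cong) (use g'(2) in auto)
    then have "subquot S C" unfolding subquot_def using V g'(1) U(3) by auto
    then show ?thesis by simp
  qed
qed

lemma subquot_surj:
  assumes f: "lh M N f" "f ` carrier M = carrier N" and s: "subquot S N"
  shows "subquot S M"
proof -
  obtain U g where U: "smod U N" "lh (sub N U) S g" "g ` U = carrier S" using s by (auto simp: subquot_def)
  let ?V = "{x \<in> carrier M. f x \<in> U}"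
  have V: "smod ?V M" by (rule smod_vimage[OF f(1) U(1)])
  have fV: "lh (sub M ?V) (sub N U) f" by (rule lh_sub_cod[OF lh_sub_dom[OF f(1) V] U(1)]) auto
  have "f ` ?V = U"
  proof (intro equalityI subsetI)
    fix u assume u: "u \<in> U"
    then have "u \<in> f ` carrier M" using f(2) smodD(2)[OF U(1)] by auto
    then show "u \<in> f ` ?V" using u by auto
  qed auto
  then have "(\<lambda>x. g (f x)) ` ?V = carrier S" using U(3) by (metis image_image)
  then show ?thesis unfolding subquot_def using V lh_comp[OF fV U(2)] by blast
qed

lemma simple_liso:
  assumes S: "simp_mod S" "simp_mod S'" and f: "lh S S' f" "x \<in> carrier S" "f x \<noteq> \<zero>\<^bsub>S'\<^esub>"
  shows "liso S S' f"
  using simple_hom_surj[OF S(2) f] simple_hom_inj(2)[OF S(1) f] f(1) by (simp add: liso_def bij_betw_def)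

lemma semisimple_quotient:
  assumes M: "lm (M :: ('a, 'm) module)"
  obtains Q :: "('a, 'm) module" and q
    where "lh M Q q" "q ` carrier M = carrier Q" "lker M Q q = rj M" "sz Q = carrier Q"
proof -
  obtain Q :: "('a, 'm) module" and q where q: "lh M Q q" "q ` carrier M = carrier Q" "lker M Q q = rj M"
    using quotient_exists[OF M rj(1)[OF M]] .
  have "rj Q = q ` rj M" using rj_image_surj[OF q(1,2)] by simp
  also have "\<dots> = {\<zero>\<^bsub>Q\<^esub>}"
    using q(3) smodD(3)[OF rj(1)[OF M]] lh_zero[OF q(1)] by (force simp: lker_def)
  finally have "sz Q = carrier Q" using sz_full[OF lhD(2)[OF q(1)]] by simp
  then show ?thesis using that q by blast
qed

lemma sub_sz_semisimple: assumes M: "lm M" and U: "smod U M" "U \<subseteq> sz M"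
  shows "sz (sub M U) = carrier (sub M U)"
  using sz_sub[OF U(1)] U(2) by auto

section \<open>Counting homomorphisms into simple modules\<close>

lemma h_zero:
  assumes M: "fm M" "carrier M = {\<zero>\<^bsub>M\<^esub>}" and S: "fm S" shows "h M S = 0"
proof -
  have "lhom \<Lambda> M S = {\<lambda>x\<in>carrier M. \<zero>\<^bsub>S\<^esub>}"
  proof (intro equalityI subsetI)
    fix f assume f: "f \<in> lhom \<Lambda> M S"
    have lf: "lh M S f" by (rule lhomD[OF f fmD[OF M(1)] fmD[OF S]])
    have "f = (\<lambda>x\<in>carrier M. \<zero>\<^bsub>S\<^esub>)"
      by (rule lhom_ext[OF f lh_restrict[OF lh_const[OF fmD[OF M(1)] fmD[OF S]]]]) (use M(2) lh_zero[OF lf]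
        in auto)
    then show "f \<in> {\<lambda>x\<in>carrier M. \<zero>\<^bsub>S\<^esub>}" by simp
  next
    fix f assume "f \<in> {\<lambda>x\<in>carrier M. \<zero>\<^bsub>S\<^esub>}"
    then show "f \<in> lhom \<Lambda> M S" using lh_restrict[OF lh_const[OF fmD[OF M(1)] fmD[OF S]]] by simp
  qed
  then show ?thesis unfolding h_def using vdim_zero(2)[OF hom_space_vs[OF fmD[OF M(1)] fmD[OF S]]] by simp
qed

lemma h_pos:
  assumes M: "fm M" and S: "fm S" and g: "lh M S g" and x: "x \<in> carrier M" "g x \<noteq> \<zero>\<^bsub>S\<^esub>"
  shows "1 \<le> h M S"
proof (rule ccontr)
  assume "\<not> 1 \<le> h M S"
  then have "vdim (hom_space \<Lambda> M S) = 0" by (simp add: h_def)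
  then have "lhom \<Lambda> M S = {\<lambda>x\<in>carrier M. \<zero>\<^bsub>S\<^esub>}" using vdim_eq_0[OF fin_hom_space[OF M S]] by simp
  then have "restrict g (carrier M) = (\<lambda>x\<in>carrier M. \<zero>\<^bsub>S\<^esub>)" using lh_restrict[OF g] by simp
  from fun_cong[OF this, of x] show False using x by simp
qed

text \<open>The premise says that \<open>g\<close> factors through the image of \<open>N\<close> in
  the semisimple quotient of \<open>B\<close> by its radical, and this image is a summand
  there.\<close>

lemma extend_to_simple:
  assumes B: "fm (B :: ('a, 'm) module)" and N: "smod N B" and g: "lh (sub B N) S g"
    and k: "\<And>x. x \<in> N \<Longrightarrow> x \<in> rj B \<Longrightarrow> g x = \<zero>\<^bsub>S\<^esub>"
  shows "\<exists>g'. lh B S g' \<and> (\<forall>x\<in>N. g' x = g x)"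
proof -
  obtain Q :: "('a, 'm) module" and q
    where q: "lh B Q q" "q ` carrier B = carrier Q" "lker B Q q = rj B" "sz Q = carrier Q"
    by (rule semisimple_quotient[OF fmD[OF B]])
  have fQ: "fm Q" by (rule fm_surj[OF q(1) B q(2)])
  have N': "smod (q ` N) Q" by (rule smod_image[OF q(1) N])
  have qN: "lh (sub B N) (sub Q (q ` N)) q"
    by (rule lh_sub_cod[OF lh_sub_dom[OF q(1) N] N']) auto
  have ker: "lker (sub B N) (sub Q (q ` N)) q \<subseteq> lker (sub B N) S g"
  proof
    fix x assume "x \<in> lker (sub B N) (sub Q (q ` N)) q"
    then have x: "x \<in> N" "q x = \<zero>\<^bsub>Q\<^esub>" by (simp_all add: lker_def)
    then have "x \<in> lker B Q q" using smodD(2)[OF N x(1)] by (simp add: lker_def)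
    then have "g x = \<zero>\<^bsub>S\<^esub>" using k[OF x(1)] unfolding q(3) by blast
    then show "x \<in> lker (sub B N) S g" using x(1) by (simp add: lker_def)
  qed
  obtain g1 where g1: "lh (sub Q (q ` N)) S g1" "\<And>x. x \<in> carrier (sub B N) \<Longrightarrow> g1 (q x) = g x"
    by (rule lh_factor[OF qN _ g ker]) auto
  obtain r where r: "lh Q (sub Q (q ` N)) r" "\<And>x. x \<in> q ` N \<Longrightarrow> r x = x"
    using semisimple_retraction[OF fQ q(4) N'] by blast
  have "lh B S (\<lambda>x. g1 (r (q x)))" by (rule lh_comp[OF lh_comp[OF q(1) r(1)] g1(1)])
  moreover have "g1 (r (q x)) = g x" if "x \<in> N" for x using r(2)[of "q x"] g1(2)[of x] that by simp
  ultimately show ?thesis by blast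
qed

text \<open>A socle element outside the radical is detected by a map to some simple
  \<open>S\<close>. Then a simple submodule maps isomorphically onto \<open>S\<close>, so
  \<open>S\<close> is a summand of \<open>X\<close> and belongs to \<open>T\<close>.\<close>

lemma sz_le_rj:
  assumes T: "thick \<Lambda> T" and X: "X \<in> T"
    and none: "\<And>S. S \<in> modcat \<Lambda> \<Longrightarrow> simp_mod S \<Longrightarrow> S \<notin> T"
  shows "sz X \<subseteq> rj X"
proof
  fix x assume x: "x \<in> sz X"
  have fX: "fm X" by (rule thick_fm[OF T X])
  note lX = fmD[OF fX]
  have xX: "x \<in> carrier X" using x by (simp add: sz_def)
  show "x \<in> rj X"
  proof (rule ccontr)
    assume "x \<notin> rj X"
    from radical_separation[OF fX xX this] obtain S :: "('a, 'k vec) module" and g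
      where S: "S \<in> modcat \<Lambda>" "simp_mod S" "lh X S g" "g x \<noteq> \<zero>\<^bsub>S\<^esub>" .
    obtain N where N: "smod N X" "simp_mod (sub X N)" "\<not> N \<subseteq> lker X S g"
    proof -
      have "\<not> soc X \<subseteq> lker X S g" using x S(4) unfolding soc_eq_sz[OF lX] by (auto simp: lker_def)
      then have "\<not> (\<forall>N. smod N X \<longrightarrow> simp_mod (sub X N) \<longrightarrow> N \<subseteq> lker X S g)"
        using soc(3)[OF lX smod_lker[OF S(3)]] by blast
      then show ?thesis using that by blast
    qed
    obtain y where y: "y \<in> N" "g y \<noteq> \<zero>\<^bsub>S\<^esub>" using N(3) smodD(2)[OF N(1)] by (auto simp: lker_def)
    have "liso (sub X N) S g"
      by (rule simple_liso[OF N(2) S(2) lh_sub_dom[OF S(3) N(1)], of y]) (use y in auto)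
    from liso_inverse[OF this] obtain s where s: "liso S (sub X N) s"
      "\<And>y. y \<in> carrier S \<Longrightarrow> g (s y) = y" by blast
    have "retr S X" by (rule retrI[OF lh_cod[OF liso_lh(1)[OF s(1)] lX N(1)] S(3) s(2)])
    then have "S \<in> T" by (rule thick_retr[OF T X])
    then show False using none[OF S(1,2)] by simp
  qed
qed

end

section \<open>Weakly symmetric algebras with radical cube zero\<close>

locale wsalg = fdalg \<Lambda> for \<Lambda> :: "('k::field, 'a) module" (structure) +
  assumes ws: "weakly_symmetric \<Lambda>" and cube: "radical_cube_zero \<Lambda>"
begin

section \<open>Projective covers\<close>

lemma J_cube: assumes "a \<in> J" "b \<in> J" "c \<in> J" shows "a \<otimes> b \<otimes> c = \<zero>"
proof -
  have "a \<otimes> b \<otimes> c \<in> ideal_prod \<Lambda> (ideal_prod \<Lambda> J J) J"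
    by (intro ideal_prod.prod assms)
  then show ?thesis using cube by (simp add: radical_cube_zero_def)
qed

text \<open>\<open>J (J M)\<close> is killed by \<open>J\<close> because triple products in
  \<open>J\<close> vanish. It is enough to treat generators: the elements that \<open>J\<close>
  moves into \<open>sz M\<close> form a submodule.\<close>

lemma rj_rj_sz: assumes M: "lm M" shows "rj (sub M (rj M)) \<subseteq> sz M"
proof -
  interpret M: left_module \<Lambda> M by (rule M)
  note R = rj(1)[OF M]
  let ?V = "{x \<in> carrier M. \<forall>a\<in>J. a \<odot>\<^bsub>M\<^esub> x \<in> sz M}"
  have "rj M \<subseteq> ?V"
  proof (rule rj(3)[OF M smod_ann[OF M smod_sz[OF M]]])
    fix c x assume c: "c \<in> J" and x: "x \<in> carrier M"
    have cx: "c \<odot>\<^bsub>M\<^esub> x \<in> carrier M" using M.lsmult_closed J_carrier c x by blast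
    have "b \<odot>\<^bsub>M\<^esub> (c \<odot>\<^bsub>M\<^esub> x) \<in> sz M" if b: "b \<in> J" for b
    proof -
      have "a \<odot>\<^bsub>M\<^esub> (b \<odot>\<^bsub>M\<^esub> (c \<odot>\<^bsub>M\<^esub> x)) = \<zero>\<^bsub>M\<^esub>" if a: "a \<in> J" for a
      proof -
        have "a \<odot>\<^bsub>M\<^esub> (b \<odot>\<^bsub>M\<^esub> (c \<odot>\<^bsub>M\<^esub> x)) = (a \<otimes> b \<otimes> c) \<odot>\<^bsub>M\<^esub> x"
          using J_carrier[OF a] J_carrier[OF b] J_carrier[OF c] x
            by (simp add: M.lsmult_assoc M.lsmult_closed)
        then show ?thesis using J_cube[OF a b c] lm_rules(7)[OF M x] by simp
      qed
      then show ?thesis using M.lsmult_closed[OF J_carrier[OF b] cx] by (simp add: sz_def)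
    qed
    then show "c \<odot>\<^bsub>M\<^esub> x \<in> ?V" using cx by simp
  qed
  then have "rj (sub M (rj M)) \<subseteq> sz (sub M (rj M)) \<union> sz M"
  proof -
    assume V: "rj M \<subseteq> ?V"
    have s: "smod (rj M \<inter> sz M) (sub M (rj M))"
      using smod_sub_iff[OF M R] smod_Int[OF M R smod_sz[OF M]] by auto
    have "rj (sub M (rj M)) \<subseteq> rj M \<inter> sz M"
      by (rule rj(3)[OF lm_sub[OF M R] s]) (use V smodD(5)[OF R J_carrier] in auto)
    then show ?thesis by blast
  qed
  then show ?thesis using sz_sub[OF R] by auto
qed

text \<open>From \<open>M = J M\<close> follows \<open>M = J (J M)\<close>, which lies in the socle,
  so that \<open>J M = 0\<close>. This is Nakayama's lemma for nilpotent \<open>J\<close>.\<close>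

lemma rj_full: assumes M: "lm M" and full: "rj M = carrier M" shows "carrier M = {\<zero>\<^bsub>M\<^esub>}"
proof -
  have "sub M (rj M) = M" using full by simp
  then have "carrier M \<subseteq> sz M" using rj_rj_sz[OF M] full by simp
  then have "sz M = carrier M" by (auto simp: sz_def)
  then show ?thesis using sz_full[OF M] full by simp
qed

lemma nakayama:
  assumes M: "lm M" and N: "smod N M" and s: "\<And>x. x \<in> carrier M \<Longrightarrow> \<exists>n\<in>N. x \<ominus>\<^bsub>M\<^esub> n \<in> rj M"
  shows "N = carrier M"
proof -
  obtain Q :: "('a, 'b) module" and q where q: "lh M Q q" "q ` carrier M = carrier Q" "lker M Q q = N"
    using quotient_exists[OF M N] .
  have "carrier Q \<subseteq> rj Q"
  proof
    fix y assume "y \<in> carrier Q"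
    then obtain x where x: "x \<in> carrier M" "y = q x" using q(2) by auto
    obtain n where n: "n \<in> N" "x \<ominus>\<^bsub>M\<^esub> n \<in> rj M" using s[OF x(1)] by auto
    have nM: "n \<in> carrier M" using smodD(2)[OF N n(1)] .
    have "q n = \<zero>\<^bsub>Q\<^esub>" using q(3) n(1) by (auto simp: lker_def)
    then have "q (x \<ominus>\<^bsub>M\<^esub> n) = y"
      using lh_minus[OF q(1) x(1) nM] x lm_rules(13)[OF lhD(2)[OF q(1)] lhD(3)[OF q(1) x(1)]] by simp
    then show "y \<in> rj Q" using rj_image[OF q(1) n(2)] by simp
  qed
  then have "rj Q = carrier Q" using smodD(1)[OF rj(1)[OF lhD(2)[OF q(1)]]] by auto
  then have "carrier Q = {\<zero>\<^bsub>Q\<^esub>}" by (rule rj_full[OF lhD(2)[OF q(1)]])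
  then have "lker M Q q = carrier M" using lhD(3)[OF q(1)] by (auto simp: lker_def)
  then show ?thesis using q(3) by simp
qed

text \<open>Covers are essential: the image of \<open>u\<close> is everything modulo the kernel of
  \<open>p\<close>, hence modulo the radical, and \<open>nakayama\<close> applies.\<close>

lemma cover_surj:
  assumes p: "lh P M p" "lker P M p \<subseteq> rj P" and u: "lh N P u"
    and s: "(\<lambda>x. p (u x)) ` carrier N = p ` carrier P"
  shows "u ` carrier N = carrier P"
proof (rule nakayama[OF lhD(1)[OF p(1)] smod_range[OF u]])
  fix x assume x: "x \<in> carrier P"
  then have "p x \<in> (\<lambda>x. p (u x)) ` carrier N" using s by simp
  then obtain y where y: "y \<in> carrier N" "p x = p (u y)" by auto
  have "x \<ominus>\<^bsub>P\<^esub> u y \<in> lker P M p" using lker_eq[OF p(1) x lhD(3)[OF u y(1)]] y(2) by simp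
  then show "\<exists>n\<in>u ` carrier N. x \<ominus>\<^bsub>P\<^esub> n \<in> rj P" using p(2) y(1) by blast
qed

text \<open>An auxiliary notion: the properties that the regular module passes on to finite direct
  sums and their summands. \<open>addcat_good\<close> then shows that every projective module is
  injective and lies in each thick subcategory that contains the regular module.\<close>

definition good :: "('a, 'k vec) module \<Rightarrow> bool" where
  "good P \<longleftrightarrow> fm P \<and> projective \<Lambda> P \<and> injective \<Lambda> P \<and>
     (\<forall>T. thick \<Lambda> T \<longrightarrow> contains_regular \<Lambda> T \<longrightarrow> P \<in> T)"

lemma injective_regular: "injective \<Lambda> (regular \<Lambda>)"
  using ws by (simp add: weakly_symmetric_def)

lemma good_regular:
  obtains R f where "good R" "liso (regular \<Lambda>) R f"
proof -
  obtain R :: "('a, 'k vec) module" and f where R: "R \<in> modcat \<Lambda>" "liso (regular \<Lambda>) R f"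
    using copy_exists[OF fm_regular] by blast
  have r: "retr R (regular \<Lambda>)" by (rule liso_retr(2)[OF R(2)])
  have "R \<in> T" if T: "thick \<Lambda> T" and c: "contains_regular \<Lambda> T" for T
  proof -
    obtain M where M: "M \<in> T" "lmod_iso \<Lambda> (regular \<Lambda>) M" using c by (auto simp: contains_regular_def)
    then obtain g where g: "liso (regular \<Lambda>) M g"
      using lmod_iso_iff[OF lm_regular fmD[OF thick_fm[OF T M(1)]]] by blast
    have "retr R M" by (rule retr_trans[OF r liso_retr(1)[OF g]])
    then show ?thesis by (rule thick_retr[OF T M(1)])
  qed
  then have "good R"
    using R(1) projective_retr[OF projective_regular r] injective_retr[OF injective_regular r]
    by (simp add: good_def modcat_iff)
  then show ?thesis using that R(2) by blast
qed

lemma good_bip: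
  assumes A: "good A" and B: "good B" and b: "bip A B D i j p q" and D: "fm D"
  shows "good D"
proof -
  note b' = bipD[OF b]
  have "D \<in> T" if T: "thick \<Lambda> T" "contains_regular \<Lambda> T" for T
  proof (rule thick_exact(2)[OF T(1) b'(1,4) bip_exact[OF b] D])
    show "A \<in> T" "B \<in> T" using A B T by (auto simp: good_def)
  qed
  then show ?thesis
    using projective_bip[OF _ _ b] injective_bip[OF _ _ b] A B D by (simp add: good_def)
qed

text \<open>One copy of the regular module for each element of a finite generating set. The
  induction starts with the zero map on one further copy.\<close>

lemma good_cover:
  assumes M: "fm M"
  obtains P p where "good P" "lh P M p" "p ` carrier P = carrier M"
proof -
  note lM = fmD[OF M]
  interpret M: left_module \<Lambda> M by (rule lM)
  obtain A where A: "finite A" "A \<subseteq> carrier M" "\<And>N. smod N M \<Longrightarrow> A \<subseteq> N \<Longrightarrow> N = carrier M"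
    using fm_gen[OF M] by metis
  obtain R f where R: "good R" "liso (regular \<Lambda>) R f" using good_regular .
  obtain f' where f': "liso R (regular \<Lambda>) f'" "\<And>x. x \<in> carrier (regular \<Lambda>) \<Longrightarrow> f' (f x) = x"
    "\<And>y. y \<in> carrier R \<Longrightarrow> f (f' y) = y"
    by (rule liso_inverse[OF R(2)]) blast
  have fR: "fm R" using R(1) by (simp add: good_def)
  have "\<exists>P p. good P \<and> lh P M p \<and> X \<subseteq> p ` carrier P" if "finite X" "X \<subseteq> carrier M" for X
    using that
  proof (induction X rule: finite_induct)
    case empty
    show ?case using R(1) lh_const[OF fmD[OF fR] lM] by blast
  next
    case (insert x X)
    then obtain P p where P: "good P" "lh P M p" "X \<subseteq> p ` carrier P" by auto
    have fP: "fm P" using P(1) by (simp add: good_def)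
    obtain D :: "('a, 'k vec) module" and i j u v where D: "D \<in> modcat \<Lambda>" "bip R P D i j u v"
      using bip_exists[OF fR fP] by blast
    note b = bipD[OF D(2)]
    have x: "x \<in> carrier M" using insert by auto
    define o' where "o' = (\<lambda>y. f' y \<odot>\<^bsub>M\<^esub> x)"
    have o': "lh R M o'" unfolding o'_def by (rule lh_comp[OF liso_lh(1)[OF f'(1)] lh_orbit[OF lM x]])
    define g where "g = (\<lambda>d. o' (u d) \<oplus>\<^bsub>M\<^esub> p (v d))"
    have g: "lh D M g" unfolding g_def by (rule lh_add[OF lh_comp[OF b(3) o'] lh_comp[OF b(4) P(2)]])
    have f1: "f \<one> \<in> carrier R" using lhD(3)[OF liso_lh(1)[OF R(2)]] by simp
    have "g (i (f \<one>)) = o' (f \<one>)" using b(5,6)[OF f1] lh_zero[OF P(2)] lhD(3)[OF o' f1] by (simp add: g_def)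
    also have "\<dots> = x" using f'(2)[of \<one>] M.lsmult_one[OF x] by (simp add: o'_def)
    finally have "x \<in> g ` carrier D" using lhD(3)[OF b(1) f1] by (metis image_eqI)
    moreover have "X \<subseteq> g ` carrier D"
    proof
      fix z assume "z \<in> X"
      then obtain y where y: "y \<in> carrier P" "z = p y" using P(3) by auto
      have "g (j y) = z" using b(7,8)[OF y(1)] lh_zero[OF o'] lhD(3)[OF P(2) y(1)] y(2) by (simp add: g_def)
      then show "z \<in> g ` carrier D" using lhD(3)[OF b(2) y(1)] by (metis image_eqI)
    qed
    moreover have "good D" by (rule good_bip[OF R(1) P(1) D(2)]) (use D(1) in \<open>simp add: modcat_iff\<close>)
    ultimately show ?case using g by blast
  qed
  from this[OF A(1,2)] obtain P p where P: "good P" "lh P M p" "A \<subseteq> p ` carrier P" by blast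
  then show ?thesis using that A(3)[OF smod_range[OF P(2)] P(3)] by blast
qed

lemma projective_section:
  assumes P: "projective \<Lambda> P" and M: "fm M" and p: "lh M P p" "p ` carrier M = carrier P"
  obtains s where "lh P M s" "\<And>x. x \<in> carrier P \<Longrightarrow> p (s x) = x"
  using projective_lift[OF P M p lh_id[OF lhD(2)[OF p(1)]]] by blast

lemma addcat_good: assumes "P \<in> addcat \<Lambda>" shows "good P"
proof -
  have P: "fm P" "projective \<Lambda> P" using assms by (auto simp: addcat_iff)
  obtain F p where F: "good F" "lh F P p" "p ` carrier F = carrier P" using good_cover[OF P(1)] .
  obtain s where s: "lh P F s" "\<And>x. x \<in> carrier P \<Longrightarrow> p (s x) = x"
    using projective_section[OF P(2) _ F(2,3)] F(1) by (auto simp: good_def)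
  have r: "retr P F" by (rule retrI[OF s(1) F(2) s(2)])
  show ?thesis
    unfolding good_def using P F(1) injective_retr[OF _ r] thick_retr[OF _ _ r] by (auto simp: good_def)
qed

lemma addcatD: "P \<in> addcat \<Lambda> \<Longrightarrow> fm P" "P \<in> addcat \<Lambda> \<Longrightarrow> projective \<Lambda> P" "P \<in> addcat \<Lambda> \<Longrightarrow> injective \<Lambda> P"
  "P \<in> addcat \<Lambda> \<Longrightarrow> thick \<Lambda> T \<Longrightarrow> contains_regular \<Lambda> T \<Longrightarrow> P \<in> T"
  using addcat_good by (auto simp: good_def)

lemma projective_sub_retraction:
  assumes M: "fm M" and Q: "smod Q M" "sub M Q \<in> addcat \<Lambda>"
  obtains r where "lh M (sub M Q) r" "\<And>x. x \<in> Q \<Longrightarrow> r x = x"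
  using injective_sub_retraction[OF M Q(1) addcatD(3)[OF Q(2)]] by blast

lemma addcat_fitting:
  assumes P: "P \<in> addcat \<Lambda>" and g: "lh P P g"
  obtains n where "sub P ((g ^^ Suc n) ` carrier P) \<in> addcat \<Lambda>" "smod ((g ^^ Suc n) ` carrier P) P"
    "inj_on (g ^^ Suc n) ((g ^^ Suc n) ` carrier P)"
proof -
  obtain n r where n: "inj_on (g ^^ Suc n) ((g ^^ Suc n) ` carrier P)"
    "lh P (sub P ((g ^^ Suc n) ` carrier P)) r" "\<And>y. y \<in> (g ^^ Suc n) ` carrier P \<Longrightarrow> r y = y"
    using fitting[OF addcatD(1)[OF P] g] by blast
  note s = smod_range[OF lh_funpow[OF g, of "Suc n"]]
  have "sub P ((g ^^ Suc n) ` carrier P) \<in> addcat \<Lambda>"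
    by (rule addcat_retr[OF P fm_sub(1)[OF addcatD(1)[OF P] s] retr_sub[OF fmD[OF addcatD(1)[OF P]] s
      n(2,3)]])
  then show ?thesis using that s n(1) by blast
qed

text \<open>A projective module of least dimension that maps onto \<open>M\<close> is a cover. If
  the kernel is not in the radical, some maximal submodule \<open>L\<close> of \<open>P\<close>
  still maps onto \<open>M\<close>. Lifting \<open>p\<close> through \<open>L\<close> gives an
  endomorphism of \<open>P\<close> with image in \<open>L\<close>, and its Fitting summand is a
  smaller projective module that maps onto \<open>M\<close>.\<close>

lemma projective_cover_exists:
  assumes M: "fm M"
  obtains P p where "P \<in> addcat \<Lambda>" "lh P M p" "p ` carrier P = carrier M" "lker P M p \<subseteq> rj P"
proof -
  let ?C = "\<lambda>P. P \<in> addcat \<Lambda> \<and> (\<exists>p. lh P M p \<and> p ` carrier P = carrier M)"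
  obtain F f where F: "good F" "lh F M f" "f ` carrier F = carrier M" using good_cover[OF M] .
  have "?C F" using F by (auto simp: addcat_iff good_def)
  then obtain P where P: "?C P" "\<And>P'. ?C P' \<Longrightarrow> dm P \<le> dm P'" using ex_has_least_nat[of ?C F dm] by blast
  then obtain p where p: "P \<in> addcat \<Lambda>" "lh P M p" "p ` carrier P = carrier M" by blast
  note fP = addcatD(1)[OF p(1)]
  note lP = fmD[OF fP]
  have "lker P M p \<subseteq> rj P"
  proof (rule ccontr)
    assume "\<not> lker P M p \<subseteq> rj P"
    then obtain x where x: "x \<in> lker P M p" "x \<notin> rj P" by auto
    have xP: "x \<in> carrier P" using x(1) by (simp add: lker_def)
    obtain S :: "('a, 'k vec) module" and g where S: "simp_mod S" "lh P S g" "g x \<noteq> \<zero>\<^bsub>S\<^esub>"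
      using radical_separation[OF fP xP x(2)] by metis
    let ?L = "lker P S g" and ?K = "lker P M p"
    have L: "maxsub ?L P" by (rule maxsub_lker[OF S(1,2) simple_hom_surj[OF S(1,2) xP S(3)]])
    have sL: "smod ?L P" "?L \<noteq> carrier P" using L by (auto simp: maximal_submod_def)
    have sK: "smod ?K P" by (rule smod_lker[OF p(2)])
    have "ssum P ?K ?L = carrier P"
      using L smod_ssum[OF lP sK sL(1)] x(1) S(3) by (auto simp: maximal_submod_def lker_def)
    then have surj: "p ` ?L = carrier M"
    proof (intro equalityI subsetI)
      fix m assume s: "ssum P ?K ?L = carrier P" and "m \<in> carrier M"
      then obtain y where "y \<in> ssum P ?K ?L" "m = p y" using p(3) by auto
      then obtain k l where kl: "k \<in> ?K" "l \<in> ?L" "m = p (k \<oplus>\<^bsub>P\<^esub> l)" unfolding ssum_def by blast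
      then have "m = \<zero>\<^bsub>M\<^esub> \<oplus>\<^bsub>M\<^esub> p l" using lhD(4)[OF p(2)] by (auto simp: lker_def)
      also have "\<dots> = p l" using lhD(3)[OF p(2)] kl(2) left_module.axioms(2)[OF fmD[OF M]]
        by (simp add: abelian_monoid.l_zero abelian_group.axioms(1) lker_def)
      finally show "m \<in> p ` ?L" using kl(2) by blast
    qed (use lhD(3)[OF p(2)] in \<open>auto simp: lker_def\<close>)
    obtain u where u: "lh P (sub P ?L) u" "\<And>x. x \<in> carrier P \<Longrightarrow> p (u x) = p x"
      using projective_lift[OF addcatD(2)[OF p(1)] fm_sub(1)[OF fP sL(1)] lh_sub_dom[OF p(2) sL(1)] _ p(2)]
        surj by auto
    have uP: "lh P P u" by (rule lh_cod[OF u(1) lP sL(1)])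
    obtain n where n: "sub P ((u ^^ Suc n) ` carrier P) \<in> addcat \<Lambda>" "smod ((u ^^ Suc n) ` carrier P) P"
      using addcat_fitting[OF p(1) uP] .
    let ?U = "(u ^^ Suc n) ` carrier P"
    have pu: "p ((u ^^ m) x) = p x" if "x \<in> carrier P" for m x
      using that u(2) lhD(3)[OF lh_funpow[OF uP]] by (induction m) auto
    have "p ` ?U = (\<lambda>x. p ((u ^^ Suc n) x)) ` carrier P" by (simp only: image_image)
    also have "\<dots> = p ` carrier P" by (rule image_cong[OF refl]) (rule pu)
    finally have "?C (sub P ?U)" using n(1) lh_sub_dom[OF p(2) n(2)] p(3) by auto
    then have "dm P \<le> dm (sub P ?U)" using P(2) by blast
    moreover have "?U \<subseteq> ?L" using lhD(3)[OF u(1)] lhD(3)[OF lh_funpow[OF uP, of n]] by auto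
    then have "?U \<noteq> carrier P" using sL(2) smodD(1)[OF sL(1)] by auto
    then have "dm (sub P ?U) < dm P" by (rule dm_less[OF fP n(2)])
    ultimately show False by simp
  qed
  then show ?thesis using that p by blast
qed

section \<open>Socles and tops of projective modules\<close>

text \<open>\<open>t\<close> is the quotient map to the top followed by the inverse of the
  isomorphism from weak symmetry. As \<open>mod_top\<close> consists of cosets, \<open>t\<close> is
  computed from the coset rules of \<open>quot_mod\<close> and not as a composite of module
  maps.\<close>

lemma indecomposable_soc_top:
  assumes P: "P \<in> addcat \<Lambda>" and i: "indecomposable_mod \<Lambda> P"
  obtains t where "lh P (sub P (sz P)) t" "t ` carrier P = sz P" "lker P (sub P (sz P)) t = rj P"
proof -
  note fP = addcatD(1)[OF P]
  note lP = fmD[OF fP]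
  interpret P: left_module \<Lambda> P by (rule lP)
  let ?N = "rj P" and ?Q = "quot_mod P (rj P)"
  note N = rj(1)[OF lP]
  note q = quot_mod[OF left_module.axioms(2)[OF lP] smod_additive_subgroup[OF lP N]]
  have qs: "a \<odot>\<^bsub>?Q\<^esub> (?N +>\<^bsub>P\<^esub> x) = ?N +>\<^bsub>P\<^esub> (a \<odot>\<^bsub>P\<^esub> x)" if "a \<in> carrier \<Lambda>" "x \<in> carrier P" for a x
    by (rule q(5)) (use that smodD(2,5)[OF N] in \<open>auto intro: P.lsmult_closed P.lsmult_r_distr\<close>)
  have "lmod_iso \<Lambda> (mod_soc \<Lambda> P) (mod_top \<Lambda> P)" using ws P i by (simp add: weakly_symmetric_def)
  moreover have "mod_soc \<Lambda> P = sub P (sz P)"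
    unfolding mod_soc_def soc_eq_sz[OF lP, symmetric] soc_def ..
  moreover have "mod_top \<Lambda> P = ?Q" by (simp add: mod_top_def mod_rad_eq_rj[OF fP])
  ultimately obtain f where f: "f \<in> lhom \<Lambda> (sub P (sz P)) ?Q" "bij_betw f (sz P) (carrier ?Q)"
    by (auto simp: lmod_iso_def)
  note Z = smod_sz[OF lP]
  have fa: "f (x \<oplus>\<^bsub>P\<^esub> y) = f x \<oplus>\<^bsub>?Q\<^esub> f y" if "x \<in> sz P" "y \<in> sz P" for x y
    using f(1) that by (simp add: lhom_def)
  have fs: "f (a \<odot>\<^bsub>P\<^esub> x) = a \<odot>\<^bsub>?Q\<^esub> f x" if "a \<in> carrier \<Lambda>" "x \<in> sz P" for a x
    using f(1) that by (simp add: lhom_def)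
  have inj: "inj_on f (sz P)" and surj: "f ` sz P = carrier ?Q" using f(2) by (auto simp: bij_betw_def)
  define t where "t = (\<lambda>x. inv_into (sz P) f (?N +>\<^bsub>P\<^esub> x))"
  have t: "t x \<in> sz P" "f (t x) = ?N +>\<^bsub>P\<^esub> x" if "x \<in> carrier P" for x
  proof -
    have "?N +>\<^bsub>P\<^esub> x \<in> f ` sz P" using surj q(1) that by auto
    then show "t x \<in> sz P" "f (t x) = ?N +>\<^bsub>P\<^esub> x" unfolding t_def by (rule inv_into_into, rule f_inv_into_f)
  qed
  have tI: "t x = y" if "x \<in> carrier P" "y \<in> sz P" "f y = ?N +>\<^bsub>P\<^esub> x" for x y
    by (rule inj_onD[OF inj]) (use t[OF that(1)] that in auto)
  have lt: "lh P (sub P (sz P)) t"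
  proof (rule lhI[OF lP lm_sub[OF lP Z]])
    fix x y assume xy: "x \<in> carrier P" "y \<in> carrier P"
    show "t x \<in> carrier (sub P (sz P))" using t(1) xy by simp
    have "t (x \<oplus>\<^bsub>P\<^esub> y) = t x \<oplus>\<^bsub>P\<^esub> t y"
      by (rule tI) (use xy t smodD(4)[OF Z] fa q(4) in auto)
    then show "t (x \<oplus>\<^bsub>P\<^esub> y) = t x \<oplus>\<^bsub>sub P (sz P)\<^esub> t y" by simp
  next
    fix a x assume ax: "a \<in> carrier \<Lambda>" "x \<in> carrier P"
    have "t (a \<odot>\<^bsub>P\<^esub> x) = a \<odot>\<^bsub>P\<^esub> t x"
      by (rule tI) (use ax t smodD(5)[OF Z] fs qs in \<open>auto intro: P.lsmult_closed\<close>)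
    then show "t (a \<odot>\<^bsub>P\<^esub> x) = a \<odot>\<^bsub>sub P (sz P)\<^esub> t x" by simp
  qed
  show ?thesis
  proof (rule that[OF lt])
    show "t ` carrier P = sz P"
    proof (intro equalityI subsetI)
      fix y assume y: "y \<in> sz P"
      then have "f y \<in> carrier ?Q" using surj by auto
      then obtain x where "x \<in> carrier P" "f y = ?N +>\<^bsub>P\<^esub> x" using q(1) by auto
      then show "y \<in> t ` carrier P" using tI[of x y] y by blast
    qed (use t(1) in auto)
    have "t x = \<zero>\<^bsub>P\<^esub> \<longleftrightarrow> x \<in> ?N" if x: "x \<in> carrier P" for x
    proof -
      have t0: "t \<zero>\<^bsub>P\<^esub> = \<zero>\<^bsub>P\<^esub>" using lh_zero[OF lt] by simp
      have "t x = t \<zero>\<^bsub>P\<^esub> \<longleftrightarrow> ?N +>\<^bsub>P\<^esub> x = ?N +>\<^bsub>P\<^esub> \<zero>\<^bsub>P\<^esub>"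
        using t(2)[OF x] t(2)[OF P.M.zero_closed] tI[OF x t(1)[OF P.M.zero_closed]] by metis
      also have "\<dots> \<longleftrightarrow> x \<in> ?N" using q(3)[OF x P.M.zero_closed] lm_rules(13)[OF lP x] by simp
      finally show ?thesis using t0 by simp
    qed
    then show "lker P (sub P (sz P)) t = rj P" using smodD(2)[OF N] by (auto simp: lker_def)
  qed
qed

text \<open>Weak symmetry speaks of indecomposable projective modules only. Socle and radical are
  compatible with biproducts, so the maps of two summands combine, and induction on dimension covers
  all projective modules. In effect the socle is isomorphic to the top.\<close>

lemma soc_top:
  assumes "P \<in> addcat \<Lambda>"
  obtains t where "lh P (sub P (sz P)) t" "t ` carrier P = sz P" "lker P (sub P (sz P)) t = rj P"
  using assms
proof (induction "dm P" arbitrary: P thesis rule: less_induct)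
  case less
  note P = less.prems(2)
  note fP = addcatD(1)[OF P]
  note lP = fmD[OF fP]
  interpret P: left_module \<Lambda> P by (rule lP)
  note Z = smod_sz[OF lP]
  let ?D = "\<lambda>A B. A \<in> modcat \<Lambda> \<and> B \<in> modcat \<Lambda> \<and>
      lmod_iso \<Lambda> P (dsum A B) \<and> carrier A \<noteq> {\<zero>\<^bsub>A\<^esub>} \<and> carrier B \<noteq> {\<zero>\<^bsub>B\<^esub>}"
  have "indecomposable_mod \<Lambda> P" if nz: "carrier P \<noteq> {\<zero>\<^bsub>P\<^esub>}" and no: "\<nexists>A B. ?D A B"
    unfolding indecomposable_mod_def
  proof (intro conjI ballI impI)
    show "carrier P \<noteq> {\<zero>\<^bsub>P\<^esub>}" by (rule nz)
    fix A B :: "('a, 'k vec) module"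
    assume "A \<in> modcat \<Lambda>" "B \<in> modcat \<Lambda>" "lmod_iso \<Lambda> P (dsum A B)"
    moreover have "\<not> ?D A B" using no by iprover
    ultimately show "carrier A = {\<zero>\<^bsub>A\<^esub>} \<or> carrier B = {\<zero>\<^bsub>B\<^esub>}" by argo
  qed
  then have "carrier P = {\<zero>\<^bsub>P\<^esub>} \<or> indecomposable_mod \<Lambda> P \<or> (\<exists>A B. ?D A B)"
    by argo
  then consider (zero) "carrier P = {\<zero>\<^bsub>P\<^esub>}" | (ind) "indecomposable_mod \<Lambda> P"
    | (dec) A B where "A \<in> modcat \<Lambda>" "B \<in> modcat \<Lambda>" "lmod_iso \<Lambda> P (dsum A B)"
      "carrier A \<noteq> {\<zero>\<^bsub>A\<^esub>}" "carrier B \<noteq> {\<zero>\<^bsub>B\<^esub>}"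
    by (elim disjE exE conjE)
  then show ?case
  proof cases
    case zero
    have r: "rj P = {\<zero>\<^bsub>P\<^esub>}" and z: "sz P = {\<zero>\<^bsub>P\<^esub>}"
      using smodD(1,3)[OF rj(1)[OF lP]] smodD(1,3)[OF Z] zero by auto
    have "lh P (sub P (sz P)) (\<lambda>x. x)" by (rule lh_sub_cod[OF lh_id[OF lP] Z]) (use zero z in simp)
    then show ?thesis by (rule less.prems(1)) (use zero r z in \<open>auto simp: lker_def\<close>)
  next
    case ind
    then show ?thesis using indecomposable_soc_top[OF P] less.prems(1) by blast
  next
    case dec
    have AB: "fm A" "fm B" using dec by (auto simp: modcat_iff)
    obtain i j p q where bb: "bip A B P i j p q"
      using lmod_iso_dsum[OF fmD[OF AB(1)] fmD[OF AB(2)] lP] dec(3) by blast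
    note b = bipD[OF bb]
    have pj: "p ` carrier P = carrier A" by (rule bip_exact(3)[OF bip_swap[OF bb]])
    have qj: "q ` carrier P = carrier B" by (rule bip_exact(3)[OF bb])
    obtain y where y: "y \<in> carrier B" "y \<noteq> \<zero>\<^bsub>B\<^esub>" using dec(5) lm_rules(1)[OF fmD[OF AB(2)]] by blast
    have "j y \<in> lker P A p" "j y \<noteq> \<zero>\<^bsub>P\<^esub>"
      using b(7,8)[OF y(1)] lhD(3)[OF b(2) y(1)] y(2) lh_zero[OF b(4)] by (auto simp: lker_def)
    then have dA: "dm A < dm P" using dm_less_surj[OF b(3) fP pj] by auto
    obtain x where x: "x \<in> carrier A" "x \<noteq> \<zero>\<^bsub>A\<^esub>" using dec(4) lm_rules(1)[OF fmD[OF AB(1)]] by blast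
    have "i x \<in> lker P B q" "i x \<noteq> \<zero>\<^bsub>P\<^esub>"
      using b(5,6)[OF x(1)] lhD(3)[OF b(1) x(1)] x(2) lh_zero[OF b(3)] by (auto simp: lker_def)
    then have dB: "dm B < dm P" using dm_less_surj[OF b(4) fP qj] by auto
    have PA: "A \<in> addcat \<Lambda>" "B \<in> addcat \<Lambda>"
      using addcat_retr[OF P AB(1) bip_retr(1)[OF bb]] addcat_retr[OF P AB(2) bip_retr(2)[OF bb]] by auto
    obtain ta where ta: "lh A (sub A (sz A)) ta" "ta ` carrier A = sz A" "lker A (sub A (sz A)) ta = rj A"
      using less.hyps[OF dA _ PA(1)] by blast
    obtain tb where tb: "lh B (sub B (sz B)) tb" "tb ` carrier B = sz B" "lker B (sub B (sz B)) tb = rj B"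
      using less.hyps[OF dB _ PA(2)] by blast
    have ta': "lh A A ta" by (rule lh_cod[OF ta(1) fmD[OF AB(1)] smod_sz[OF fmD[OF AB(1)]]])
    have tb': "lh B B tb" by (rule lh_cod[OF tb(1) fmD[OF AB(2)] smod_sz[OF fmD[OF AB(2)]]])
    define t where "t = (\<lambda>x. i (ta (p x)) \<oplus>\<^bsub>P\<^esub> j (tb (q x)))"
    have t: "lh P P t" unfolding t_def
      by (rule lh_add[OF lh_comp[OF b(3) lh_comp[OF ta' b(1)]] lh_comp[OF b(4) lh_comp[OF tb' b(2)]]])
    have tsz: "t x \<in> sz P" if "x \<in> carrier P" for x
    proof -
      have "ta (p x) \<in> sz A" "tb (q x) \<in> sz B"
        using ta(2) tb(2) lhD(3)[OF b(3) that] lhD(3)[OF b(4) that] by blast+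
      then show ?thesis unfolding t_def using smodD(4)[OF Z] sz_image[OF b(1)] sz_image[OF b(2)] by blast
    qed
    have pt: "p (t x) = ta (p x)" "q (t x) = tb (q x)" if "x \<in> carrier P" for x
    proof -
      have m: "ta (p x) \<in> carrier A" "tb (q x) \<in> carrier B"
        using lhD(3)[OF ta' lhD(3)[OF b(3) that]] lhD(3)[OF tb' lhD(3)[OF b(4) that]] .
      interpret A: left_module \<Lambda> A by (rule fmD[OF AB(1)])
      interpret B: left_module \<Lambda> B by (rule fmD[OF AB(2)])
      show "p (t x) = ta (p x)" "q (t x) = tb (q x)"
        using lhD(4)[OF b(3) lhD(3)[OF b(1) m(1)] lhD(3)[OF b(2) m(2)]]
          lhD(4)[OF b(4) lhD(3)[OF b(1) m(1)] lhD(3)[OF b(2) m(2)]] b(5,6)[OF m(1)] b(7,8)[OF m(2)] m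
        by (simp_all add: t_def)
    qed
    have t': "lh P (sub P (sz P)) t" by (rule lh_sub_cod[OF t Z tsz])
    moreover have "t ` carrier P = sz P"
    proof (intro equalityI subsetI)
      fix y assume y: "y \<in> sz P"
      have yP: "y \<in> carrier P" using smodD(2)[OF Z y] .
      have "p y \<in> sz A" "q y \<in> sz B" using sz_image[OF b(3) y] sz_image[OF b(4) y] by auto
      then obtain u v where uv: "u \<in> carrier A" "p y = ta u" "v \<in> carrier B" "q y = tb v" using ta(2) tb(2)
        by blast
      let ?x = "i u \<oplus>\<^bsub>P\<^esub> j v"
      have m: "i u \<in> carrier P" "j v \<in> carrier P" using lhD(3)[OF b(1) uv(1)] lhD(3)[OF b(2) uv(3)] .
      interpret A: left_module \<Lambda> A by (rule fmD[OF AB(1)])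
      interpret B: left_module \<Lambda> B by (rule fmD[OF AB(2)])
      have "p ?x = u" "q ?x = v"
        using lhD(4)[OF b(3) m] lhD(4)[OF b(4) m] b(5,6)[OF uv(1)] b(7,8)[OF uv(3)] uv(1,3) by simp_all
      then have "t ?x = y" using uv(2,4) b(9)[OF yP] by (simp add: t_def)
      then show "y \<in> t ` carrier P" using P.M.a_closed[OF m] by blast
    qed (use tsz in auto)
    moreover have "lker P (sub P (sz P)) t = rj P"
    proof (intro equalityI subsetI)
      fix x assume "x \<in> lker P (sub P (sz P)) t"
      then have x: "x \<in> carrier P" "t x = \<zero>\<^bsub>P\<^esub>" by (auto simp: lker_def)
      have m: "p x \<in> carrier A" "q x \<in> carrier B" using lhD(3)[OF b(3) x(1)] lhD(3)[OF b(4) x(1)] .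
      have "ta (p x) = \<zero>\<^bsub>A\<^esub>" "tb (q x) = \<zero>\<^bsub>B\<^esub>" using pt[OF x(1)] x(2) lh_zero[OF b(3)] lh_zero[OF b(4)] by auto
      then have "p x \<in> rj A" "q x \<in> rj B" using ta(3) tb(3) m by (auto simp: lker_def)
      then have "i (p x) \<oplus>\<^bsub>P\<^esub> j (q x) \<in> rj P"
        using rj_image[OF b(1)] rj_image[OF b(2)] smodD(4)[OF rj(1)[OF lP]] by blast
      then show "x \<in> rj P" using b(9)[OF x(1)] by simp
    next
      fix x assume x: "x \<in> rj P"
      have xP: "x \<in> carrier P" using smodD(2)[OF rj(1)[OF lP] x] .
      have "p x \<in> rj A" "q x \<in> rj B" using rj_image[OF b(3) x] rj_image[OF b(4) x] .
      then have "ta (p x) = \<zero>\<^bsub>A\<^esub>" "tb (q x) = \<zero>\<^bsub>B\<^esub>" using ta(3) tb(3) by (auto simp: lker_def)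
      then have "t x = \<zero>\<^bsub>P\<^esub>" using lh_zero[OF b(1)] lh_zero[OF b(2)] by (simp add: t_def)
      then show "x \<in> lker P (sub P (sz P)) t" using xP by (simp add: lker_def)
    qed
    ultimately show ?thesis by (rule less.prems(1))
  qed
qed

section \<open>The projective modules as a thick subcategory\<close>

lemma contains_regular_addcat: "contains_regular \<Lambda> (addcat \<Lambda>)"
proof -
  obtain R f where R: "good R" "liso (regular \<Lambda>) R f" using good_regular .
  have fR: "fm R" using R(1) by (simp add: good_def)
  have "lmod_iso \<Lambda> (regular \<Lambda>) R" using lmod_iso_iff[OF lm_regular fmD[OF fR]] R(2) by blast
  then show ?thesis using R(1) by (auto simp: contains_regular_def addcat_iff good_def)
qed

text \<open>Sequences that end in a projective module split, and so do sequences that start with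
  one, because projective modules are injective.\<close>

lemma thick_addcat: "thick \<Lambda> (addcat \<Lambda>)"
  unfolding thick_def
proof (intro conjI ballI impI)
  show "addcat \<Lambda> \<subseteq> modcat \<Lambda>" by (auto simp: addcat_def)
next
  fix M N :: "('a, 'k vec) module" assume *: "M \<in> addcat \<Lambda>" "N \<in> modcat \<Lambda>" "lmod_iso \<Lambda> M N"
  have N: "fm N" using *(2) by (simp add: modcat_iff)
  obtain f where "liso M N f" using lmod_iso_iff[OF fmD[OF addcatD(1)[OF *(1)]] fmD[OF N]] *(3) by blast
  then show "N \<in> addcat \<Lambda>" using addcat_retr[OF *(1) N] liso_retr(2) by blast
next
  fix M A B :: "('a, 'k vec) module"
  assume *: "M \<in> addcat \<Lambda>" "A \<in> modcat \<Lambda>" "B \<in> modcat \<Lambda>" "lmod_iso \<Lambda> M (dsum A B)"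
  have AB: "fm A" "fm B" using *(2,3) by (simp_all add: modcat_iff)
  obtain i j p q where "bip A B M i j p q"
    using lmod_iso_dsum[OF fmD[OF AB(1)] fmD[OF AB(2)] fmD[OF addcatD(1)[OF *(1)]]] *(4) by blast
  then show "A \<in> addcat \<Lambda>" using addcat_retr[OF *(1) AB(1)] bip_retr(1) by blast
next
  fix A B C :: "('a, 'k vec) module"
  assume *: "A \<in> modcat \<Lambda>" "B \<in> modcat \<Lambda>" "C \<in> modcat \<Lambda>" "short_exact \<Lambda> A B C"
  have A: "fm A" and B: "fm B" and C: "fm C" using * by (auto simp: modcat_iff)
  obtain f g where fg: "lh A B f" "lh B C g" "inj_on f (carrier A)" "f ` carrier A = lker B C g"
    "g ` carrier B = carrier C"
    using short_exact_iff[OF fmD[OF A] fmD[OF B] fmD[OF C]] *(4) by blast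
  let ?K = "sub B (lker B C g)"
  have K: "smod (lker B C g) B" by (rule smod_lker[OF fg(2)])
  have fK: "fm ?K" by (rule fm_sub(1)[OF B K])
  have iso: "liso A ?K f" unfolding liso_def
    using lh_sub_cod[OF fg(1) K] fg(3,4) by (auto simp: bij_betw_def)
  show "C \<in> addcat \<Lambda>" if "A \<in> addcat \<Lambda> \<and> B \<in> addcat \<Lambda>"
  proof -
    have AB: "A \<in> addcat \<Lambda>" "B \<in> addcat \<Lambda>" using that by auto
    \<comment> \<open>Injectivity of \<open>A\<close> gives a retraction \<open>h\<close> of
      \<open>f\<close>. The map \<open>x - f (h x)\<close> kills the image of \<open>A\<close>, so
      it descends to a section of \<open>g\<close>.\<close>
    obtain h where h: "lh B A h" "\<And>x. x \<in> carrier A \<Longrightarrow> h (f x) = x"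
      using injective_extend[OF addcatD(3)[OF AB(1)] B fg(1,3) lh_id[OF fmD[OF A]]] by blast
    have d: "lh B B (\<lambda>x. x \<ominus>\<^bsub>B\<^esub> f (h x))"
      by (rule lh_diff[OF lh_id[OF fmD[OF B]] lh_comp[OF h(1) fg(1)]])
    have "lker B C g \<subseteq> lker B B (\<lambda>x. x \<ominus>\<^bsub>B\<^esub> f (h x))"
    proof
      fix x assume x: "x \<in> lker B C g"
      then obtain y where y: "y \<in> carrier A" "x = f y" using fg(4) by auto
      have "x \<in> carrier B" using x by (simp add: lker_def)
      then show "x \<in> lker B B (\<lambda>x. x \<ominus>\<^bsub>B\<^esub> f (h x))"
        using y h(2)[OF y(1)] lm_rules(10)[OF fmD[OF B], of x x] by (simp add: lker_def)
    qed
    then obtain s where s: "lh C B s" "\<And>x. x \<in> carrier B \<Longrightarrow> s (g x) = x \<ominus>\<^bsub>B\<^esub> f (h x)"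
      using lh_factor[OF fg(2,5) d] by blast
    have "g (s y) = y" if "y \<in> carrier C" for y
    proof -
      from that obtain x where x: "x \<in> carrier B" "y = g x" using fg(5) by blast
      have fh: "f (h x) \<in> carrier B" "g (f (h x)) = \<zero>\<^bsub>C\<^esub>"
        using lhD(3)[OF fg(1) lhD(3)[OF h(1) x(1)]] fg(4) lhD(3)[OF h(1) x(1)] by (auto simp: lker_def)
      show ?thesis using s(2)[OF x(1)] x lh_minus[OF fg(2) x(1) fh(1)] fh(2)
          lm_rules(13)[OF fmD[OF C] lhD(3)[OF fg(2) x(1)]] by simp
    qed
    then have "retr C B" by (rule retrI[OF s(1) fg(2)])
    then show ?thesis by (rule addcat_retr[OF AB(2) C])
  qed
  show "B \<in> addcat \<Lambda>" if "A \<in> addcat \<Lambda> \<and> C \<in> addcat \<Lambda>"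
  proof -
    have AC: "A \<in> addcat \<Lambda>" "C \<in> addcat \<Lambda>" using that by auto
    obtain s where s: "lh C B s" "\<And>x. x \<in> carrier C \<Longrightarrow> g (s x) = x"
      using projective_section[OF addcatD(2)[OF AC(2)] B fg(2,5)] by blast
    have "?K \<in> addcat \<Lambda>" by (rule addcat_retr[OF AC(1) fK liso_retr(2)[OF iso]])
    then show ?thesis
      using projective_bip[OF _ _ bip_retraction[OF s(1) fg(2) s(2)]] AC(2) B by (simp add: addcat_iff)
  qed
  show "A \<in> addcat \<Lambda>" if "B \<in> addcat \<Lambda> \<and> C \<in> addcat \<Lambda>"
  proof -
    have BC: "B \<in> addcat \<Lambda>" "C \<in> addcat \<Lambda>" using that by auto
    obtain s where s: "lh C B s" "\<And>x. x \<in> carrier C \<Longrightarrow> g (s x) = x"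
      using projective_section[OF addcatD(2)[OF BC(2)] B fg(2,5)] by blast
    have "retr ?K B" using bip_retr(2)[OF bip_retraction[OF s(1) fg(2) s(2)]] by blast
    from retr_trans[OF liso_retr(1)[OF iso] this] show ?thesis by (rule addcat_retr[OF BC(1) A])
  qed
qed

text \<open>\<open>S\<close> and the socle of \<open>P\<close> are both quotients of
  \<open>P\<close> by its radical, the latter by \<open>soc_top\<close>. Thus a thick subcategory
  that contains \<open>S\<close> contains the socle of its cover.\<close>

lemma cover_simple:
  assumes S: "simp_mod S" and P: "P \<in> addcat \<Lambda>"
    and p: "lh P S p" "p ` carrier P = carrier S" "lker P S p \<subseteq> rj P"
  shows "lker P S p = rj P" and "\<exists>f. liso S (sub P (sz P)) f"
proof -
  show k: "lker P S p = rj P"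
    using p(3) rj_simple_hom[OF S p(1)] smodD(2)[OF rj(1)[OF lhD(1)[OF p(1)]]] by (auto simp: lker_def)
  obtain t where t: "lh P (sub P (sz P)) t" "t ` carrier P = sz P" "lker P (sub P (sz P)) t = rj P"
    using soc_top[OF P] .
  obtain f where f: "lh S (sub P (sz P)) f" "\<And>x. x \<in> carrier P \<Longrightarrow> f (p x) = t x"
    using lh_factor[OF p(1,2) t(1)] k t(3) by auto
  have "f ` carrier S = f ` p ` carrier P" using p(2) by simp
  also have "\<dots> = t ` carrier P" unfolding image_image by (rule image_cong) (use f(2) in auto)
  finally have surj: "f ` carrier S = sz P" using t(2) by simp
  have "lker S (sub P (sz P)) f \<subseteq> {\<zero>\<^bsub>S\<^esub>}"
  proof
    fix y assume "y \<in> lker S (sub P (sz P)) f"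
    then have y: "y \<in> carrier S" "f y = \<zero>\<^bsub>P\<^esub>" by (auto simp: lker_def)
    then obtain x where x: "x \<in> carrier P" "y = p x" using p(2) by auto
    then have "x \<in> lker P (sub P (sz P)) t" using f(2) y by (simp add: lker_def)
    then show "y \<in> {\<zero>\<^bsub>S\<^esub>}" using t(3) k x by (auto simp: lker_def)
  qed
  moreover have "\<zero>\<^bsub>S\<^esub> \<in> lker S (sub P (sz P)) f" by (rule smodD(3)[OF smod_lker[OF f(1)]])
  ultimately have "lker S (sub P (sz P)) f = {\<zero>\<^bsub>S\<^esub>}" by auto
  then have "liso S (sub P (sz P)) f" using lh_inj_iff[OF f(1)] surj f(1)
    by (simp add: liso_def bij_betw_def)
  then show "\<exists>f. liso S (sub P (sz P)) f" by blast
qed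

section \<open>Thick subcategories containing a simple module\<close>

text \<open>The trace of a class of modules in \<open>\<Lambda>\<close>. A union of images suffices
  in place of their sum, since the classes used are closed under biproducts.\<close>

definition trace :: "(('a, 'k vec) module \<Rightarrow> bool) \<Rightarrow> 'a set" where
  "trace \<Psi> = {y. \<exists>Q f. \<Psi> Q \<and> lh Q (regular \<Lambda>) f \<and> y \<in> f ` carrier Q}"

text \<open>A sum of two elements lies in the image of a biproduct, and right multiplication by
  \<open>r\<close> is an endomorphism of the left module \<open>\<Lambda>\<close>. The module
  \<open>Q0\<close> accounts for the zero element.\<close>

lemma trace:
  assumes fm: "\<And>Q. \<Psi> Q \<Longrightarrow> fm Q" and ex: "\<Psi> Q0"
    and cl: "\<And>A B D i j p q. \<Psi> A \<Longrightarrow> \<Psi> B \<Longrightarrow> bip A B D i j p q \<Longrightarrow> fm D \<Longrightarrow> \<Psi> D"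
  shows "smod (trace \<Psi>) (regular \<Lambda>)" "x \<in> trace \<Psi> \<Longrightarrow> r \<in> carrier \<Lambda> \<Longrightarrow> x \<otimes> r \<in> trace \<Psi>"
proof -
  show "smod (trace \<Psi>) (regular \<Lambda>)"
  proof (rule smodI[OF lm_regular])
    show "trace \<Psi> \<subseteq> carrier (regular \<Lambda>)" using lhD(3) by (fastforce simp: trace_def)
    have "lh Q0 (regular \<Lambda>) (\<lambda>x. \<zero>\<^bsub>regular \<Lambda>\<^esub>)" by (rule lh_const[OF fmD[OF fm[OF ex]] lm_regular])
    moreover have "\<zero>\<^bsub>regular \<Lambda>\<^esub> \<in> (\<lambda>x. \<zero>\<^bsub>regular \<Lambda>\<^esub>) ` carrier Q0"
      using lm_rules(1)[OF fmD[OF fm[OF ex]]] by blast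
    ultimately show "\<zero>\<^bsub>regular \<Lambda>\<^esub> \<in> trace \<Psi>" unfolding trace_def using ex by blast
    fix x y assume "x \<in> trace \<Psi>" "y \<in> trace \<Psi>"
    then obtain A f B g where *: "\<Psi> A" "lh A (regular \<Lambda>) f" "x \<in> f ` carrier A" "\<Psi> B" "lh B (regular \<Lambda>) g"
      "y \<in> g ` carrier B"
      by (auto simp: trace_def)
    then obtain a b where ab: "a \<in> carrier A" "x = f a" "b \<in> carrier B" "y = g b" by auto
    obtain D :: "('a, 'k vec) module" and i j p q where D: "D \<in> modcat \<Lambda>" "bip A B D i j p q"
      using bip_exists[OF fm[OF *(1)] fm[OF *(4)]] by blast
    note b = bipD[OF D(2)]
    have DD: "fm D" using D(1) by (simp add: modcat_iff)
    interpret A: left_module \<Lambda> A by (rule fmD[OF fm[OF *(1)]])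
    interpret B: left_module \<Lambda> B by (rule fmD[OF fm[OF *(4)]])
    let ?z = "i a \<oplus>\<^bsub>D\<^esub> j b"
    have m: "i a \<in> carrier D" "j b \<in> carrier D" using lhD(3)[OF b(1) ab(1)] lhD(3)[OF b(2) ab(3)] .
    have "p ?z = a" "q ?z = b"
      using lhD(4)[OF b(3) m] lhD(4)[OF b(4) m] b(5,6)[OF ab(1)] b(7,8)[OF ab(3)] ab(1,3) by simp_all
    then have "x \<oplus>\<^bsub>regular \<Lambda>\<^esub> y = f (p ?z) \<oplus>\<^bsub>regular \<Lambda>\<^esub> g (q ?z)" using ab by simp
    then have "x \<oplus>\<^bsub>regular \<Lambda>\<^esub> y \<in> (\<lambda>z. f (p z) \<oplus>\<^bsub>regular \<Lambda>\<^esub> g (q z)) ` carrier D"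
      using lm_rules(2)[OF fmD[OF DD] m] by blast
    then show "x \<oplus>\<^bsub>regular \<Lambda>\<^esub> y \<in> trace \<Psi>"
      unfolding trace_def using cl[OF *(1,4) D(2) DD] lh_add[OF lh_comp[OF b(3) *(2)] lh_comp[OF b(4) *(5)]]
        by blast
  next
    fix a x assume a: "a \<in> carrier \<Lambda>" and "x \<in> trace \<Psi>"
    then obtain A f y where *: "\<Psi> A" "lh A (regular \<Lambda>) f" "x = f y" "y \<in> carrier A"
      by (auto simp: trace_def)
    have "a \<odot>\<^bsub>regular \<Lambda>\<^esub> x = f (a \<odot>\<^bsub>A\<^esub> y)" using lhD(5)[OF *(2) a *(4)] *(3) by simp
    then show "a \<odot>\<^bsub>regular \<Lambda>\<^esub> x \<in> trace \<Psi>"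
      unfolding trace_def using * lm_rules(5)[OF fmD[OF fm[OF *(1)]] a *(4)] by blast
  qed
  assume "x \<in> trace \<Psi>" and r: "r \<in> carrier \<Lambda>"
  then obtain A f y where *: "\<Psi> A" "lh A (regular \<Lambda>) f" "x = f y" "y \<in> carrier A" by (auto simp: trace_def)
  have "lh (regular \<Lambda>) (regular \<Lambda>) (\<lambda>a. a \<otimes> r)" using lh_orbit[OF lm_regular, of r] r by simp
  from lh_comp[OF *(2) this] show "x \<otimes> r \<in> trace \<Psi>" unfolding trace_def using * by blast
qed

context
  fixes T assumes T: "thick \<Lambda> T" and reg: "contains_regular \<Lambda> T"
begin

text \<open>In a semisimple module all submodules are summands, which puts \<open>U\<close> and the
  kernel of \<open>g\<close> into \<open>T\<close>; two out of three gives \<open>S\<close>.\<close>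

lemma semisimple_subquot:
  assumes X: "X \<in> T" "sz X = carrier X" and S: "subquot S X"
  shows "S \<in> T"
proof -
  note fX = thick_fm[OF T X(1)]
  note lX = fmD[OF fX]
  obtain U g where U: "smod U X" "lh (sub X U) S g" "g ` U = carrier S" using S by (auto simp: subquot_def)
  obtain r where r: "lh X (sub X U) r" "\<And>x. x \<in> U \<Longrightarrow> r x = x" using semisimple_retraction[OF fX X(2) U(1)]
    by blast
  have UT: "sub X U \<in> T" by (rule thick_retr[OF T X(1) retr_sub[OF lX U(1) r]])
  note fU = thick_fm[OF T UT]
  have "U \<subseteq> sz X" using X(2) smodD(1)[OF U(1)] by simp
  note ssU = sub_sz_semisimple[OF lX U(1) this]
  let ?K = "lker (sub X U) S g"
  have K: "smod ?K (sub X U)" by (rule smod_lker[OF U(2)])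
  obtain r' where r': "lh (sub X U) (sub (sub X U) ?K) r'" "\<And>x. x \<in> ?K \<Longrightarrow> r' x = x"
    using semisimple_retraction[OF fU ssU K] by blast
  have "sub (sub X U) ?K \<in> T" by (rule thick_retr[OF T UT retr_sub[OF fmD[OF fU] K r']])
  then show ?thesis using thick_kernel(1)[OF T U(2) _ fU _ UT] U(3) by simp
qed

lemma semisimple_sub:
  assumes X: "X \<in> T" "sz X = carrier X" and U: "smod U X"
  shows "sub X U \<in> T"
  using semisimple_subquot[OF X] U lh_id[OF lm_sub[OF fmD[OF thick_fm[OF T X(1)]] U]] unfolding subquot_def
    by fastforce

text \<open>By the next two predicates, all simple subquotients of a projective module belong to \<open>T\<close>, or none
  does: since socle and top agree, the layers of such a module in \<open>T\<close> can be split off inside \<open>T\<close>.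
  The traces in \<open>\<Lambda>\<close> of the two classes of projective modules are complementary two-sided ideals.\<close>

definition all_in :: "('a, 'k vec) module \<Rightarrow> bool" where
  "all_in Q \<longleftrightarrow> Q \<in> addcat \<Lambda> \<and> sub Q (sz Q) \<in> T"

definition none_in :: "('a, 'k vec) module \<Rightarrow> bool" where
  "none_in Q \<longleftrightarrow> Q \<in> addcat \<Lambda> \<and> (\<forall>S\<in>T. simp_mod S \<longrightarrow> (\<forall>g. lh Q S g \<longrightarrow> (\<forall>x\<in>carrier Q. g x = \<zero>\<^bsub>S\<^esub>)))"

text \<open>All layers of \<open>Q\<close> are reached inside \<open>T\<close>: the radical is the
  kernel of the map \<open>t\<close> onto the socle, \<open>rad(rad Q)\<close> is a submodule of the
  socle, and the middle layer \<open>C\<close> is the quotient of these two. A simple subquotient of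
  \<open>Q\<close> already occurs in one of the layers.\<close>

lemma all_in_subquot:
  assumes Q: "all_in Q" and S: "simp_mod S" "subquot S Q"
  shows "S \<in> T"
proof -
  have QA: "Q \<in> addcat \<Lambda>" and ZT: "sub Q (sz Q) \<in> T" using Q by (auto simp: all_in_def)
  note QT = addcatD(4)[OF QA T reg]
  note fQ = addcatD(1)[OF QA]
  note lQ = fmD[OF fQ]
  have ssZ: "sz (sub Q (sz Q)) = carrier (sub Q (sz Q))"
    by (rule sub_sz_semisimple[OF lQ smod_sz[OF lQ] subset_refl])
  obtain t where t: "lh Q (sub Q (sz Q)) t" "t ` carrier Q = sz Q" "lker Q (sub Q (sz Q)) t = rj Q"
    using soc_top[OF QA] .
  have t2: "t ` carrier Q = carrier (sub Q (sz Q))" using t(2) by simp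
  let ?R = "sub Q (rj Q)"
  have RT: "?R \<in> T" using thick_kernel(3)[OF T t(1) t2 fQ QT ZT] t(3) by simp
  note fR = thick_fm[OF T RT]
  note lR = fmD[OF fR]
  obtain C :: "('a, 'k vec) module" and q
    where q: "lh ?R C q" "q ` carrier ?R = carrier C" "lker ?R C q = rj ?R" "sz C = carrier C"
    using semisimple_quotient[OF lR] .
  have RR: "smod (rj ?R) Q" "rj ?R \<subseteq> sz Q"
    using rj(1)[OF lR] smod_sub_iff[OF lQ rj(1)[OF lQ]] rj_rj_sz[OF lQ] by auto
  have "smod (rj ?R) (sub Q (sz Q))" using RR smod_sub_iff[OF lQ smod_sz[OF lQ]] by simp
  from semisimple_sub[OF ZT ssZ this] have RRT: "sub Q (rj ?R) \<in> T" by simp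
  have ssRR: "sz (sub Q (rj ?R)) = carrier (sub Q (rj ?R))" by (rule sub_sz_semisimple[OF lQ RR])
  have CT: "C \<in> T" using thick_kernel(1)[OF T q(1,2) fR _ RT] q(3) RRT by simp
  consider "subquot S ?R" | "subquot S (sub Q (sz Q))" using subquot_layer[OF S(1) t(1) t2 S(2)] t(3)
    by auto
  then show ?thesis
  proof cases
    case 1
    then consider "subquot S (sub Q (rj ?R))" | "subquot S C" using subquot_layer[OF S(1) q(1,2)] q(3)
      by auto
    then show ?thesis using semisimple_subquot[OF RRT ssRR] semisimple_subquot[OF CT q(4)] by cases auto
  next
    case 2
    then show ?thesis by (rule semisimple_subquot[OF ZT ssZ])
  qed
qed

lemma cover_all_in:
  assumes "simp_mod S" "S \<in> T" "P \<in> addcat \<Lambda>" "lh P S p" "p ` carrier P = carrier S" "lker P S p \<subseteq> rj P"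
  shows "all_in P"
  using cover_simple(2)[OF assms(1,3-6)] thick_liso[OF T assms(2)] assms(3) by (auto simp: all_in_def)

text \<open>A map from the cover to another simple module factors through \<open>S\<close>. If
  nonzero it is an isomorphism on \<open>S\<close>, which would bring \<open>S\<close> into
  \<open>T\<close>.\<close>

lemma cover_none_in:
  assumes "simp_mod S" "S \<notin> T" "P \<in> addcat \<Lambda>" "lh P S p" "p ` carrier P = carrier S" "lker P S p \<subseteq> rj P"
  shows "none_in P"
proof -
  have "g x = \<zero>\<^bsub>S'\<^esub>" if S': "S' \<in> T" "simp_mod S'" and g: "lh P S' g" and x: "x \<in> carrier P" for S' g x
  proof (rule ccontr)
    assume gx: "g x \<noteq> \<zero>\<^bsub>S'\<^esub>"
    have "lker P S p \<subseteq> lker P S' g"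
      using assms(6) rj_simple_hom[OF S'(2) g] by (auto simp: lker_def)
    then obtain f where f: "lh S S' f" "\<And>x. x \<in> carrier P \<Longrightarrow> f (p x) = g x" using lh_factor[OF assms(4,5) g]
      by blast
    have "liso S S' f" by (rule simple_liso[OF assms(1) S'(2) f(1) lhD(3)[OF assms(4) x]]) (use f(2)[OF x]
      gx in simp)
    then obtain f' where "liso S' S f'" using liso_inverse by blast
    then show False using thick_liso[OF T S'(1)] assms(2) by blast
  qed
  then show ?thesis using assms(3) by (auto simp: none_in_def)
qed

text \<open>\<open>none_in\<close> only restricts the top of \<open>Q\<close>. Suppose that
  \<open>S\<close> occurs deeper: its cover \<open>P\<close> maps to \<open>Q\<close> with nonzero
  image, and a simple submodule \<open>L\<close> of this image belongs to \<open>T\<close>, as all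
  simple subquotients of \<open>P\<close> do. But \<open>L\<close> lies in the socle of
  \<open>Q\<close>, of which it is a summand, and through \<open>soc_top\<close> it is a quotient of
  \<open>Q\<close>.\<close>

lemma none_in_subquot:
  assumes Q: "none_in Q" and S: "simp_mod S" "S \<in> T"
  shows "\<not> subquot S Q"
proof
  assume "subquot S Q"
  then obtain U g where U: "smod U Q" "lh (sub Q U) S g" "g ` U = carrier S" by (auto simp: subquot_def)
  have QA: "Q \<in> addcat \<Lambda>" using Q by (auto simp: none_in_def)
  note fQ = addcatD(1)[OF QA]
  note lQ = fmD[OF fQ]
  obtain P p where P: "P \<in> addcat \<Lambda>" "lh P S p" "p ` carrier P = carrier S" "lker P S p \<subseteq> rj P"
    using projective_cover_exists[OF thick_fm[OF T S(2)]] .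
  have all_in: "all_in P" by (rule cover_all_in[OF S P])
  obtain f where f: "lh P (sub Q U) f" "\<And>x. x \<in> carrier P \<Longrightarrow> g (f x) = p x"
    using projective_lift[OF addcatD(2)[OF P(1)] fm_sub(1)[OF fQ U(1)] U(2) _ P(2)] U(3) by auto
  have fQQ: "lh P Q f" by (rule lh_cod[OF f(1) lQ U(1)])
  have I: "smod (f ` carrier P) Q" by (rule smod_range[OF fQQ])
  have "f ` carrier P \<noteq> {\<zero>\<^bsub>Q\<^esub>}"
  proof
    assume f0: "f ` carrier P = {\<zero>\<^bsub>Q\<^esub>}"
    have "p x = \<zero>\<^bsub>S\<^esub>" if "x \<in> carrier P" for x
    proof -
      have "f x = \<zero>\<^bsub>Q\<^esub>" using f0 that by blast
      then show ?thesis using f(2)[OF that] lh_zero[OF U(2)] by simp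
    qed
    then show False using P(3) simple_nonzero[OF S(1) lhD(2)[OF P(2)]] by auto
  qed
  then obtain L where L: "smod L Q" "L \<subseteq> f ` carrier P" "simp_mod (sub Q L)"
    using simple_sub_exists[OF fQ I] by blast
  have lL: "lm (sub Q L)" by (rule lm_sub[OF lQ L(1)])
  have "lh P (sub Q (f ` carrier P)) f" by (rule lh_sub_cod[OF fQQ I]) auto
  moreover have "subquot (sub Q L) (sub Q (f ` carrier P))"
    unfolding subquot_def using smod_sub_iff[OF lQ I] L(1,2) lh_id[OF lL]
    by (intro exI[of _ L] exI[of _ "\<lambda>x. x"]) auto
  ultimately have "subquot (sub Q L) P" by (intro subquot_surj[of P "sub Q (f ` carrier P)" f]) auto
  then have LT: "sub Q L \<in> T" by (rule all_in_subquot[OF all_in L(3)])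
  have LZ: "L \<subseteq> sz Q" using sz_simple[OF L(3) lL] sz_sub[OF L(1)] by auto
  obtain t where t: "lh Q (sub Q (sz Q)) t" "t ` carrier Q = sz Q" "lker Q (sub Q (sz Q)) t = rj Q"
    using soc_top[OF QA] .
  have ssZ: "sz (sub Q (sz Q)) = carrier (sub Q (sz Q))"
    by (rule sub_sz_semisimple[OF lQ smod_sz[OF lQ] subset_refl])
  have "smod L (sub Q (sz Q))" using smod_sub_iff[OF lQ smod_sz[OF lQ]] L(1) LZ by simp
  then obtain r where r: "lh (sub Q (sz Q)) (sub Q L) r" "\<And>x. x \<in> L \<Longrightarrow> r x = x"
    using semisimple_retraction[OF fm_sub(1)[OF fQ smod_sz[OF lQ]] ssZ, of L] by auto
  obtain y where y: "y \<in> L" "y \<noteq> \<zero>\<^bsub>Q\<^esub>" using simple_nonzero[OF L(3) lL] by auto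
  then obtain x where x: "x \<in> carrier Q" "y = t x" using LZ t(2) by auto
  have "r (t x) = \<zero>\<^bsub>sub Q L\<^esub>"
    using Q LT L(3) lh_comp[OF t(1) r(1)] x(1) unfolding none_in_def by blast
  then show False using r(2)[OF y(1)] x(2) y(2) by simp
qed

lemma all_in_bip:
  assumes "all_in A" "all_in B" "bip A B D i j p q" "fm D"
  shows "all_in D"
proof -
  note b = bipD[OF assms(3)]
  have l: "lm A" "lm B" "lm D" using lhD(1,2)[OF b(1)] lhD(1)[OF b(2)] by auto
  have A: "A \<in> addcat \<Lambda>" "sub A (sz A) \<in> T" and B: "B \<in> addcat \<Lambda>" "sub B (sz B) \<in> T"
    using assms by (auto simp: all_in_def)
  have D: "D \<in> addcat \<Lambda>" using projective_bip[OF _ _ assms(3)] A(1) B(1) assms(4) by (simp add: addcat_iff)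
  note Z = smod_sz[OF l(1)] smod_sz[OF l(2)] smod_sz[OF l(3)]
  have "bip (sub A (sz A)) (sub B (sz B)) (sub D (sz D)) i j p q"
    unfolding bip_def
    using lh_sub_cod[OF lh_sub_dom[OF b(1) Z(1)] Z(3)] lh_sub_cod[OF lh_sub_dom[OF b(2) Z(2)] Z(3)]
      lh_sub_cod[OF lh_sub_dom[OF b(3) Z(3)] Z(1)] lh_sub_cod[OF lh_sub_dom[OF b(4) Z(3)] Z(2)]
      sz_image[OF b(1)] sz_image[OF b(2)] sz_image[OF b(3)] sz_image[OF b(4)] b(5-9) smodD(2)[OF Z(1)]
        smodD(2)[OF Z(2)] smodD(2)[OF Z(3)]
    by simp
  note b' = bipD[OF this] and e = bip_exact[OF this]
  have "sub D (sz D) \<in> T"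
    by (rule thick_exact(2)[OF T b'(1,4) e(1,2,3) fm_sub(1)[OF assms(4) Z(3)] A(2) B(2)])
  then show ?thesis using D by (simp add: all_in_def)
qed

lemma none_in_bip:
  assumes "none_in A" "none_in B" "bip A B D i j p q" "fm D"
  shows "none_in D"
proof -
  note b = bipD[OF assms(3)]
  have D: "D \<in> addcat \<Lambda>" using projective_bip[OF _ _ assms(3)] assms by (simp add: addcat_iff none_in_def)
  have "g x = \<zero>\<^bsub>S\<^esub>" if S: "S \<in> T" "simp_mod S" and g: "lh D S g" and x: "x \<in> carrier D" for S g x
  proof -
    have m: "p x \<in> carrier A" "q x \<in> carrier B" using lhD(3)[OF b(3) x] lhD(3)[OF b(4) x] .
    have "g (i (p x)) = \<zero>\<^bsub>S\<^esub>" "g (j (q x)) = \<zero>\<^bsub>S\<^esub>"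
      using assms(1,2) S lh_comp[OF b(1) g] lh_comp[OF b(2) g] m unfolding none_in_def by blast+
    then have "g x = \<zero>\<^bsub>S\<^esub> \<oplus>\<^bsub>S\<^esub> \<zero>\<^bsub>S\<^esub>"
      using lhD(4)[OF g lhD(3)[OF b(1) m(1)] lhD(3)[OF b(2) m(2)]] b(9)[OF x] by simp
    also have "\<dots> = \<zero>\<^bsub>S\<^esub>" using lm_rules(1)[OF lhD(2)[OF g]] left_module.axioms(2)[OF lhD(2)[OF g]]
      by (simp add: abelian_monoid.l_zero abelian_group.axioms(1))
    finally show ?thesis .
  qed
  then show ?thesis using D by (auto simp: none_in_def)
qed

text \<open>The zero module has both properties; it serves as the member of each class that
  \<open>trace\<close> asks for.\<close>

lemma zero_phi_none_in: "\<exists>Z. all_in Z \<and> none_in Z"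
proof -
  obtain R f where R: "good R" "liso (regular \<Lambda>) R f" using good_regular .
  have RT: "R \<in> T" and fR: "fm R" using R(1) T reg by (auto simp: good_def)
  have RA: "R \<in> addcat \<Lambda>" using R(1) by (simp add: good_def addcat_iff)
  note lR = fmD[OF fR]
  let ?Z = "sub R {\<zero>\<^bsub>R\<^esub>}"
  have lZ: "lm ?Z" by (rule lm_sub[OF lR smod_zero[OF lR]])
  have c: "carrier ?Z = {\<zero>\<^bsub>?Z\<^esub>}" by simp
  have ZA: "?Z \<in> addcat \<Lambda>"
    by (rule addcat_retr[OF RA fm_zero[OF lZ c] retrI[OF lh_const[OF lZ lR] lh_const[OF lR lZ]]]) auto
  have "sz ?Z = {\<zero>\<^bsub>R\<^esub>}" using smodD(1,3)[OF smod_sz[OF lZ]] by auto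
  then have "sub ?Z (sz ?Z) \<in> T" using thick_zero[OF T RT lZ c] by simp
  then have "all_in ?Z" using ZA by (simp add: all_in_def)
  moreover have "none_in ?Z" unfolding none_in_def using ZA lh_zero by fastforce
  ultimately show ?thesis by blast
qed

text \<open>A simple left ideal lies in every image that it meets in a nonzero element, so a single
  member of the class suffices.\<close>

lemma simple_in_trace:
  assumes L: "smod L (regular \<Lambda>)" "simp_mod (sub (regular \<Lambda>) L)" "L \<subseteq> trace \<Psi>"
    and c: "liso (sub (regular \<Lambda>) L) S c"
  obtains Q where "\<Psi> Q" "subquot S Q"
proof -
  note lL = lm_sub[OF lm_regular L(1)]
  obtain z where z: "z \<in> L" "z \<noteq> \<zero>" using simple_nonzero[OF L(2) lL] by auto
  then obtain Q f where Q: "\<Psi> Q" "lh Q (regular \<Lambda>) f" "z \<in> f ` carrier Q" using L(3)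
    by (auto simp: trace_def)
  have I: "smod (f ` carrier Q) (regular \<Lambda>)" by (rule smod_range[OF Q(2)])
  have "smod (L \<inter> f ` carrier Q) (sub (regular \<Lambda>) L)"
    using smod_sub_iff[OF lm_regular L(1)] smod_Int[OF lm_regular L(1) I] by auto
  then have "L \<inter> f ` carrier Q = {\<zero>} \<or> L \<inter> f ` carrier Q = L"
    using L(2) unfolding simple_mod_def by auto
  then have LI: "L \<subseteq> f ` carrier Q" using z Q(3) by auto
  let ?U = "{x \<in> carrier Q. f x \<in> L}"
  have U: "smod ?U Q" by (rule smod_vimage[OF Q(2) L(1)])
  have fU: "lh (sub Q ?U) (sub (regular \<Lambda>) L) f" by (rule lh_sub_cod[OF lh_sub_dom[OF Q(2) U] L(1)]) auto
  have "f ` ?U = L" using LI by auto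
  then have "(\<lambda>x. c (f x)) ` ?U = carrier S" using liso_lh(3)[OF c] by (simp add: image_image[symmetric])
  then have "subquot S Q" unfolding subquot_def using U lh_comp[OF fU liso_lh(1)[OF c]] by blast
  then show ?thesis using that Q(1) by blast
qed

text \<open>A simple left ideal in the intersection would occur in a member of each class, hence be
  both in \<open>T\<close> and outside. If the sum were proper, some map from
  \<open>\<Lambda>\<close> onto a simple \<open>S\<close> would kill it; but the cover of
  \<open>S\<close> is in one of the classes, and it maps to \<open>\<Lambda>\<close> over
  \<open>S\<close>.\<close>

lemma trace_decomposition:
  shows "trace all_in \<inter> trace none_in = {\<zero>}" "ssum (regular \<Lambda>) (trace all_in) (trace none_in) = carrier \<Lambda>"
    "smod (trace all_in) (regular \<Lambda>)" "smod (trace none_in) (regular \<Lambda>)"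
    "x \<in> trace all_in \<Longrightarrow> r \<in> carrier \<Lambda> \<Longrightarrow> x \<otimes> r \<in> trace all_in"
    "x \<in> trace none_in \<Longrightarrow> r \<in> carrier \<Lambda> \<Longrightarrow> x \<otimes> r \<in> trace none_in"
proof -
  obtain Z where Z: "all_in Z" "none_in Z" using zero_phi_none_in by blast
  have f: "all_in Q \<Longrightarrow> fm Q" "none_in Q \<Longrightarrow> fm Q" for Q by (auto simp: all_in_def none_in_def addcat_iff)
  note A = trace[of all_in, OF f(1) Z(1) all_in_bip] and B = trace[of none_in, OF f(2) Z(2) none_in_bip]
  show sA: "smod (trace all_in) (regular \<Lambda>)" and sB: "smod (trace none_in) (regular \<Lambda>)"
    by (rule A(1) B(1); assumption)+
  show "x \<in> trace all_in \<Longrightarrow> r \<in> carrier \<Lambda> \<Longrightarrow> x \<otimes> r \<in> trace all_in" by (rule A(2))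
  show "x \<in> trace none_in \<Longrightarrow> r \<in> carrier \<Lambda> \<Longrightarrow> x \<otimes> r \<in> trace none_in" by (rule B(2))
  have sI: "smod (trace all_in \<inter> trace none_in) (regular \<Lambda>)" by (rule smod_Int[OF lm_regular sA sB])
  show "trace all_in \<inter> trace none_in = {\<zero>}"
  proof (rule ccontr)
    assume "trace all_in \<inter> trace none_in \<noteq> {\<zero>}"
    then obtain L where L: "smod L (regular \<Lambda>)" "L \<subseteq> trace all_in \<inter> trace none_in"
      "simp_mod (sub (regular \<Lambda>) L)"
      using simple_sub_exists[OF fm_regular sI] by auto
    obtain S :: "('a, 'k vec) module" and c where S: "S \<in> modcat \<Lambda>" "liso (sub (regular \<Lambda>) L) S c"
      using copy_exists[OF fm_sub(1)[OF fm_regular L(1)]] by blast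
    have sS: "simp_mod S" by (rule simple_copy[OF L(3) S(2)])
    obtain Q where Q: "all_in Q" "subquot S Q" using simple_in_trace[OF L(1,3) _ S(2)] L(2) by blast
    obtain Q' where Q': "none_in Q'" "subquot S Q'" using simple_in_trace[OF L(1,3) _ S(2)] L(2) by blast
    show False using none_in_subquot[OF Q'(1) sS all_in_subquot[OF Q(1) sS Q(2)]] Q'(2) by blast
  qed
  note s = smod_ssum[OF lm_regular sA sB]
  show "ssum (regular \<Lambda>) (trace all_in) (trace none_in) = carrier \<Lambda>"
  proof (rule ccontr)
    assume "ssum (regular \<Lambda>) (trace all_in) (trace none_in) \<noteq> carrier \<Lambda>"
    then have ne: "ssum (regular \<Lambda>) (trace all_in) (trace none_in) \<noteq> carrier (regular \<Lambda>)" by simp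
    obtain S :: "('a, 'k vec) module" and g where S: "S \<in> modcat \<Lambda>" "simp_mod S" "lh (regular \<Lambda>) S g"
      "g ` carrier (regular \<Lambda>) = carrier S" "ssum (regular \<Lambda>) (trace all_in) (trace none_in) \<subseteq> lker (regular
        \<Lambda>) S g"
      by (rule simple_quotient_exists[OF fm_regular s(1) ne])
    have fS: "fm S" using S(1) by (simp add: modcat_iff)
    obtain P p where P: "P \<in> addcat \<Lambda>" "lh P S p" "p ` carrier P = carrier S" "lker P S p \<subseteq> rj P"
      using projective_cover_exists[OF fS] .
    obtain f where f: "lh P (regular \<Lambda>) f" "\<And>x. x \<in> carrier P \<Longrightarrow> g (f x) = p x"
      using projective_lift[OF addcatD(2)[OF P(1)] fm_regular S(3,4) P(2)] by blast
    have "f ` carrier P \<subseteq> trace all_in \<or> f ` carrier P \<subseteq> trace none_in"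
      using cover_all_in[OF S(2) _ P] cover_none_in[OF S(2) _ P] f(1) unfolding trace_def by blast
    then have "f ` carrier P \<subseteq> lker (regular \<Lambda>) S g" using S(5) s(2,3) by blast
    then have "p x = \<zero>\<^bsub>S\<^esub>" if "x \<in> carrier P" for x using f(2)[OF that] that by (auto simp: lker_def)
    then show False using P(3) simple_nonzero[OF S(2) fmD[OF fS]] by auto
  qed
qed

text \<open>A simple module in \<open>T\<close> makes the first trace ideal nonzero, one outside
  \<open>T\<close> the second. Indecomposability forbids both at once.\<close>

lemma all_simples:
  assumes ind: "indecomposable_alg \<Lambda>" and S0: "S0 \<in> T" "simp_mod S0" and S: "S \<in> modcat \<Lambda>" "simp_mod S"
  shows "S \<in> T"
proof (rule ccontr)
  assume nT: "S \<notin> T"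
  \<comment> \<open>The map from \<open>P\<close> onto \<open>S\<close> lifts along an orbit map
    from \<open>\<Lambda>\<close> onto \<open>S\<close>; the lift is nonzero, so the trace
    is.\<close>
  have nz: "\<exists>y\<in>trace \<Psi>. y \<noteq> \<zero>" if S: "fm S" "simp_mod S"
    and P: "P \<in> addcat \<Lambda>" "lh P S p" "p ` carrier P = carrier S" "\<Psi> P" for S P p \<Psi>
  proof -
    obtain x where x: "x \<in> carrier S" "x \<noteq> \<zero>\<^bsub>S\<^esub>" using simple_nonzero[OF S(2) fmD[OF S(1)]] by auto
    have o: "lh (regular \<Lambda>) S (\<lambda>a. a \<odot>\<^bsub>S\<^esub> x)" by (rule lh_orbit[OF fmD[OF S(1)] x(1)])
    have os: "(\<lambda>a. a \<odot>\<^bsub>S\<^esub> x) ` carrier (regular \<Lambda>) = carrier S"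
      by (rule simple_hom_surj[OF S(2) o, of \<one>]) (use x left_module.lsmult_one[OF fmD[OF S(1)] x(1)] in
        auto)
    obtain f where f: "lh P (regular \<Lambda>) f" "\<And>y. y \<in> carrier P \<Longrightarrow> f y \<odot>\<^bsub>S\<^esub> x = p y"
      using projective_lift[OF addcatD(2)[OF P(1)] fm_regular o os P(2)] by blast
    obtain y where y: "y \<in> carrier P" "x = p y" using P(3) x(1) by auto
    then have "f y \<noteq> \<zero>" using f(2)[OF y(1)] x(2) lm_rules(7)[OF fmD[OF S(1)] x(1)] by auto
    then show ?thesis using f(1) P(4) y(1) unfolding trace_def by blast
  qed
  have fS: "fm S" using S(1) by (simp add: modcat_iff)
  obtain P p where P: "P \<in> addcat \<Lambda>" "lh P S p" "p ` carrier P = carrier S" "lker P S p \<subseteq> rj P"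
    using projective_cover_exists[OF fS] .
  note f0 = thick_fm[OF T S0(1)]
  obtain P0 p0 where P0: "P0 \<in> addcat \<Lambda>" "lh P0 S0 p0" "p0 ` carrier P0 = carrier S0"
    "lker P0 S0 p0 \<subseteq> rj P0"
    using projective_cover_exists[OF f0] .
  have "\<exists>y\<in>trace all_in. y \<noteq> \<zero>" by (rule nz[of S0 P0 p0 all_in, OF f0 S0(2) P0(1-3) cover_all_in[OF S0(2,1)
    P0]])
  moreover have "\<exists>y\<in>trace none_in. y \<noteq> \<zero>"
    by (rule nz[of S P p none_in, OF fS S(2) P(1-3) cover_none_in[OF S(2) nT P]])
  moreover have "trace all_in = {\<zero>} \<or> trace none_in = {\<zero>}"
    by (rule indecomposable_ideals[OF ind trace_decomposition(3) trace_decomposition(5)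
      trace_decomposition(4)
          trace_decomposition(6) trace_decomposition(1) trace_decomposition(2)])
  ultimately show False by auto
qed

lemma full_of_simples:
  assumes S: "\<And>S. S \<in> modcat \<Lambda> \<Longrightarrow> simp_mod S \<Longrightarrow> S \<in> T" and M: "M \<in> modcat \<Lambda>"
  shows "M \<in> T"
proof -
  have fM: "fm M" using M by (simp add: modcat_iff)
  then show ?thesis
  proof (induction "dm M" arbitrary: M rule: less_induct)
    case less
    note lM = fmD[OF less.prems]
    show ?case
    proof (cases "carrier M = {\<zero>\<^bsub>M\<^esub>}")
      case True
      obtain R where "R \<in> T" using reg by (auto simp: contains_regular_def)
      then show ?thesis using thick_zero[OF T _ lM True] by blast
    next
      case False
      then have ne: "{\<zero>\<^bsub>M\<^esub>} \<noteq> carrier M" by simp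
      obtain N :: "('a, 'k vec) module" and g
        where N: "N \<in> modcat \<Lambda>" "simp_mod N" "lh M N g" "g ` carrier M = carrier N"
        by (rule simple_quotient_exists[OF less.prems smod_zero[OF lM] ne])
      note K = smod_lker[OF N(3)]
      have "lker M N g \<noteq> carrier M" using maxsub_lker[OF N(2,3,4)] by (simp add: maximal_submod_def)
      then have "sub M (lker M N g) \<in> T"
        by (intro less.hyps dm_less[OF less.prems K] fm_sub(1)[OF less.prems K])
      then show ?thesis using thick_kernel(2)[OF T N(3,4) less.prems] S[OF N(1,2)] by blast
    qed
  qed
qed

end

section \<open>The first extension group\<close>

text \<open>\<open>Ext\<close> picks a resolution with \<open>SOME\<close>, so anything said about
  \<open>Ext\<close> requires that there is one.\<close>

lemma proj_resolution_exists:
  assumes M: "M \<in> modcat \<Lambda>"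
  shows "\<exists>P d e. proj_resolution \<Lambda> M P d e"
proof -
  have "\<exists>X. fst X \<in> addcat \<Lambda> \<and> lh (fst X) N (snd X) \<and> snd X ` carrier (fst X) = carrier N" if "fm N"
    for N :: "('a, 'k vec) module"
  proof -
    from projective_cover_exists[OF that] obtain P p
      where "P \<in> addcat \<Lambda>" "lh P N p" "p ` carrier P = carrier N" by metis
    then show ?thesis by (intro exI[of _ "(P, p)"]) simp
  qed
  then have "\<forall>N :: ('a, 'k vec) module. \<exists>X. fm N \<longrightarrow>
      fst X \<in> addcat \<Lambda> \<and> lh (fst X) N (snd X) \<and> snd X ` carrier (fst X) = carrier N" by blast
  from choice[OF this] obtain X :: "('a, 'k vec) module \<Rightarrow> ('a, 'k vec) module \<times> ('k vec \<Rightarrow> 'k vec)"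
    where X: "\<And>N. fm N \<longrightarrow>
      fst (X N) \<in> addcat \<Lambda> \<and> lh (fst (X N)) N (snd (X N)) \<and>
        snd (X N) ` carrier (fst (X N)) = carrier N" by blast
  define R where "R = (\<lambda>N. fst (X N))"
  define c where "c = (\<lambda>N. snd (X N))"
  have C: "R N \<in> addcat \<Lambda>" "lh (R N) N (c N)" "c N ` carrier (R N) = carrier N" if "fm N" for N
    using X[rule_format, OF that] by (simp_all add: R_def c_def)
  \<comment> \<open>The successive kernels of chosen covers. The differentials are the covers of
    \<open>K (Suc n)\<close> followed by the inclusion into the previous projective module.\<close>
  define K where "K = (\<lambda>n. ((\<lambda>N. sub (R N) (lker (R N) N (c N))) ^^ n) M)"
  have K0: "K 0 = M" and KS: "K (Suc n) = sub (R (K n)) (lker (R (K n)) (K n) (c (K n)))" for n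
    by (simp_all add: K_def)
  have fK: "fm (K n)" for n
  proof (induction n)
    case 0
    then show ?case using M by (simp add: K0 modcat_iff)
  next
    case (Suc n)
    show ?case unfolding KS by (rule fm_sub(1)[OF addcatD(1)[OF C(1)[OF Suc]] smod_lker[OF C(2)[OF Suc]]])
  qed
  define P where "P = (\<lambda>n. R (K n))"
  define d where "d = (\<lambda>n. restrict (c (K (Suc n))) (carrier (P (Suc n))))"
  define e where "e = restrict (c M) (carrier (P 0))"
  have cd: "lh (P (Suc n)) (P n) (c (K (Suc n)))" for n
  proof -
    have "lh (P (Suc n)) (sub (P n) (lker (P n) (K n) (c (K n)))) (c (K (Suc n)))"
      using C(2)[OF fK[of "Suc n"]] by (simp add: P_def KS[of n])
    then show ?thesis
      by (rule lh_cod) (use C[OF fK[of n]] smod_lker lhD(1) in \<open>auto simp: P_def\<close>)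
  qed
  have im: "c (K (Suc n)) ` carrier (P (Suc n)) = lker (P n) (K n) (c (K n))" for n
    using C(3)[OF fK[of "Suc n"]] by (simp add: P_def KS[of n])
  have "proj_resolution \<Lambda> M P d e"
    unfolding proj_resolution_def
  proof (intro conjI allI)
    show "P n \<in> addcat \<Lambda>" for n using C(1)[OF fK] by (simp add: P_def)
    show "d n \<in> lhom \<Lambda> (P (Suc n)) (P n)" for n unfolding d_def by (rule lh_restrict[OF cd])
    show "e \<in> lhom \<Lambda> (P 0) M" unfolding e_def
      by (rule lh_restrict) (use C(2)[OF fK[of 0]] in \<open>simp add: P_def K0\<close>)
    show "e ` carrier (P 0) = carrier M" using C(3)[OF fK[of 0]] by (simp add: e_def P_def K0)
    show "d 0 ` carrier (P (Suc 0)) = {x \<in> carrier (P 0). e x = \<zero>\<^bsub>M\<^esub>}"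
      using im[of 0] by (auto simp: d_def e_def lker_def K0)
    fix n
    have "c (K (Suc n)) x = \<zero>\<^bsub>K (Suc n)\<^esub> \<longleftrightarrow> d n x = \<zero>\<^bsub>P n\<^esub>" if "x \<in> carrier (P (Suc n))" for x
      using that by (simp add: d_def KS[of n] P_def)
    then show "d (Suc n) ` carrier (P (Suc (Suc n))) = {x \<in> carrier (P (Suc n)). d n x = \<zero>\<^bsub>P n\<^esub>}"
      using im[of "Suc n"] by (simp add: fun_cong[OF d_def, of "Suc n"] lker_def conj_commute cong:
        conj_cong)
  qed
  then show ?thesis by blast
qed

text \<open>Composition with the lift \<open>R 1 \<rightarrow> rad P\<close> of the first differential embeds \<open>Hom(rad P, S)\<close> into
  \<open>Ext\<close>: if the composite is a coboundary, it extends along the surjective endomorphism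
  \<open>P \<rightarrow> R 0 \<rightarrow> P\<close>, and maps into \<open>S\<close> vanish on radicals.\<close>

lemma h_rj_le_Ext:
  assumes M: "M \<in> modcat \<Lambda>" and S: "S \<in> modcat \<Lambda>" "simp_mod S"
    and P: "P \<in> addcat \<Lambda>" "lh P M p" "p ` carrier P = carrier M" "lker P M p = rj P"
  shows "h (sub P (rj P)) S \<le> vdim (Ext \<Lambda> 1 M S)"
proof -
  obtain R d e where R: "proj_resolution \<Lambda> M R d e" and E: "Ext \<Lambda> 1 M S = hom_cohomology \<Lambda> R d 1 S"
  proof -
    \<comment> \<open>The resolution picked by \<open>SOME\<close> is arbitrary and in general not
      minimal; it has to be compared with the cover \<open>P\<close> by maps in both
      directions.\<close>
    define X where "X = (SOME (P, d). \<exists>e. proj_resolution \<Lambda> M P d e)"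
    have "\<exists>X. case X of (P, d) \<Rightarrow> \<exists>e. proj_resolution \<Lambda> M P d e"
      using proj_resolution_exists[OF M] by simp
    then have X: "case X of (P, d) \<Rightarrow> \<exists>e. proj_resolution \<Lambda> M P d e"
      unfolding X_def by (rule someI_ex)
    obtain P' d' where X': "X = (P', d')" by (cases X)
    from X obtain e' where "proj_resolution \<Lambda> M P' d' e'" unfolding X' by auto
    moreover have "Ext \<Lambda> 1 M S = hom_cohomology \<Lambda> P' d' 1 S"
      unfolding Ext_def X_def[symmetric] X' by simp
    ultimately show ?thesis by (rule that)
  qed
  have fM: "fm M" and fS: "fm S" using M S(1) by (simp_all add: modcat_iff)
  have RA: "R n \<in> addcat \<Lambda>" for n using R by (simp add: proj_resolution_def)
  note fR = addcatD(1)[OF RA]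
  have ld: "lh (R (Suc n)) (R n) (d n)" for n
    using R lhomD[OF _ fmD[OF fR] fmD[OF fR]] by (simp add: proj_resolution_def)
  have le: "lh (R 0) M e" and es: "e ` carrier (R 0) = carrier M"
    and d0: "d 0 ` carrier (R (Suc 0)) = lker (R 0) M e"
    and d1: "d (Suc 0) ` carrier (R (Suc (Suc 0))) = lker (R (Suc 0)) (R 0) (d 0)"
    using R lhomD[OF _ fmD[OF fR] fmD[OF fM]] by (auto simp: proj_resolution_def lker_def)
  \<comment> \<open>Cochains \<open>?H\<close>, cocycles \<open>?Z\<close> and coboundaries
    \<open>?B\<close> in degree one.\<close>
  let ?H = "hom_space \<Lambda> (R (Suc 0)) S"
  let ?Z = "{f \<in> lhom \<Lambda> (R (Suc 0)) S. \<forall>x\<in>carrier (R (Suc (Suc 0))). f (d (Suc 0) x) = \<zero>\<^bsub>S\<^esub>}"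
  let ?B = "pre (R (Suc 0)) (d 0) ` lhom \<Lambda> (R 0) S"
  let ?V = "?H\<lparr>carrier := ?Z\<rparr>"
  have EQ: "Ext \<Lambda> 1 M S = quot_mod ?V ?B"
    unfolding E by (simp add: hom_cohomology_def pre_def compose_def)
  interpret H: vectorspace class_ring ?H by (rule hom_space_vs[OF fmD[OF fR] fmD[OF fS]])
  interpret L1: linear_map class_ring ?H "hom_space \<Lambda> (R (Suc (Suc 0))) S"
    "pre (R (Suc (Suc 0))) (d (Suc 0))"
    by (rule pre_lin[OF ld fmD[OF fS]])
  interpret L0: linear_map class_ring "hom_space \<Lambda> (R 0) S" ?H "pre (R (Suc 0)) (d 0)"
    by (rule pre_lin[OF ld fmD[OF fS]])
  have "L1.ker = ?Z"
  proof (intro equalityI subsetI)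
    fix f assume "f \<in> L1.ker"
    then have f: "f \<in> lhom \<Lambda> (R (Suc 0)) S" "pre (R (Suc (Suc 0))) (d (Suc 0)) f = (\<lambda>x\<in>carrier (R (Suc (Suc
      0))). \<zero>\<^bsub>S\<^esub>)"
      by (auto simp: L1.ker_def)
    have "f (d (Suc 0) x) = \<zero>\<^bsub>S\<^esub>" if "x \<in> carrier (R (Suc (Suc 0)))" for x
      using fun_cong[OF f(2), of x] that by (simp add: pre_def)
    then show "f \<in> ?Z" using f(1) by simp
  qed (auto simp: L1.ker_def pre_def intro: restrict_ext)
  then have subZ: "subspace class_ring ?Z ?H" using L1.kerT_is_subspace by simp
  have V: "fin_vs ?V" by (rule fin_vs_subspace(1)[OF fin_hom_space[OF fR fS] subZ])
  have Bim: "L0.im = ?B" by (auto simp: L0.im_def)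
  have subB: "subspace class_ring ?B ?H" using L0.imT_is_subspace unfolding Bim .
  have dd: "d 0 (d (Suc 0) x) = \<zero>\<^bsub>R 0\<^esub>" if "x \<in> carrier (R (Suc (Suc 0)))" for x
    using d1 that by (auto simp: lker_def)
  have BZ: "?B \<subseteq> ?Z"
  proof
    fix f assume "f \<in> ?B"
    then obtain u where u: "u \<in> lhom \<Lambda> (R 0) S" "f = pre (R (Suc 0)) (d 0) u" by blast
    have lu: "lh (R 0) S u" by (rule lhomD[OF u(1) fmD[OF fR] fmD[OF fS]])
    have "f \<in> lhom \<Lambda> (R (Suc 0)) S" using lh_restrict[OF lh_comp[OF ld lu]] u(2) by (simp add: pre_def)
    moreover have "f (d (Suc 0) x) = \<zero>\<^bsub>S\<^esub>" if "x \<in> carrier (R (Suc (Suc 0)))" for x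
      using u(2) dd[OF that] lhD(3)[OF ld that] lh_zero[OF lu] by (simp add: pre_def)
    ultimately show "f \<in> ?Z" by simp
  qed
  have subBV: "subspace class_ring ?B ?V"
    by (rule subspace_mono[OF subB BZ]) (use V in \<open>simp add: fin_vs_def\<close>)
  note q = vs_quotient[OF V subBV]
  \<comment> \<open>The comparison maps \<open>\<psi>\<close> and \<open>\<phi>\<close> between
    \<open>R 0\<close> and \<open>P\<close> both lie over the identity of \<open>M\<close>.\<close>
  obtain \<psi> where \<psi>: "lh (R 0) P \<psi>" "\<And>x. x \<in> carrier (R 0) \<Longrightarrow> p (\<psi> x) = e x"
    using projective_lift[OF addcatD(2)[OF RA] addcatD(1)[OF P(1)] P(2,3) le] by blast
  obtain \<phi> where \<phi>: "lh P (R 0) \<phi>" "\<And>x. x \<in> carrier P \<Longrightarrow> e (\<phi> x) = p x"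
    using projective_lift[OF addcatD(2)[OF P(1)] fR le es P(2)] by blast
  note lP = fmD[OF addcatD(1)[OF P(1)]]
  note RJ = rj(1)[OF lP]
  let ?J = "sub P (rj P)"
  have fJ: "fm ?J" by (rule fm_sub(1)[OF addcatD(1)[OF P(1)] RJ])
  define g where "g = (\<lambda>x. \<psi> (d 0 x))"
  have "g x \<in> rj P" if x: "x \<in> carrier (R (Suc 0))" for x
  proof -
    have "d 0 x \<in> lker (R 0) M e" using d0 x by blast
    then have "d 0 x \<in> carrier (R 0)" "e (d 0 x) = \<zero>\<^bsub>M\<^esub>" by (simp_all add: lker_def)
    then have "\<psi> (d 0 x) \<in> lker P M p" using \<psi>(2) lhD(3)[OF \<psi>(1)] by (simp add: lker_def)
    then show ?thesis using P(4) by (simp add: g_def)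
  qed
  then have lg: "lh (R (Suc 0)) ?J g"
    using lh_sub_cod[OF lh_comp[OF ld \<psi>(1)] RJ] by (simp add: g_def)
  have preZ: "pre (R (Suc 0)) g f \<in> ?Z" if f: "f \<in> lhom \<Lambda> ?J S" for f
  proof -
    have lf: "lh ?J S f" by (rule lhomD[OF f fmD[OF fJ] fmD[OF fS]])
    have "pre (R (Suc 0)) g f (d (Suc 0) x) = \<zero>\<^bsub>S\<^esub>" if "x \<in> carrier (R (Suc (Suc 0)))" for x
      using dd[OF that] lhD(3)[OF ld that] lh_zero[OF \<psi>(1)] lh_zero[OF lf] by (simp add: pre_def g_def)
    moreover have "pre (R (Suc 0)) g f \<in> lhom \<Lambda> (R (Suc 0)) S"
      using lh_restrict[OF lh_comp[OF lg lf]] by (simp add: pre_def)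
    ultimately show ?thesis by simp
  qed
  interpret Lg: linear_map class_ring "hom_space \<Lambda> ?J S" ?H "pre (R (Suc 0)) g"
    by (rule pre_lin[OF lg fmD[OF fS]])
  interpret Lq: linear_map class_ring ?V "quot_mod ?V ?B" "\<lambda>x. ?B +>\<^bsub>?V\<^esub> x" by (rule q(2))
  let ?T = "\<lambda>f. ?B +>\<^bsub>?V\<^esub> pre (R (Suc 0)) g f"
  have T: "lin (hom_space \<Lambda> ?J S) (quot_mod ?V ?B) ?T"
  proof (rule linI)
    show "vectorspace class_ring (hom_space \<Lambda> ?J S)" by (rule hom_space_vs[OF fmD[OF fJ] fmD[OF fS]])
    show "vectorspace class_ring (quot_mod ?V ?B)" using q(1) by (simp add: fin_vs_def)
    fix f assume f: "f \<in> carrier (hom_space \<Lambda> ?J S)"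
    then have fz: "pre (R (Suc 0)) g f \<in> carrier ?V" using preZ by simp
    show "?T f \<in> carrier (quot_mod ?V ?B)" by (rule Lq.T_im[OF fz])
    show "?T (c \<odot>\<^bsub>hom_space \<Lambda> ?J S\<^esub> f) = c \<odot>\<^bsub>quot_mod ?V ?B\<^esub> ?T f" for c
      using Lg.T_smult[of c f] Lq.T_smult[of c, OF _ fz] f by simp
    fix f' assume f': "f' \<in> carrier (hom_space \<Lambda> ?J S)"
    then have fz': "pre (R (Suc 0)) g f' \<in> carrier ?V" using preZ by simp
    show "?T (f \<oplus>\<^bsub>hom_space \<Lambda> ?J S\<^esub> f') = ?T f \<oplus>\<^bsub>quot_mod ?V ?B\<^esub> ?T f'"
      using Lg.T_add[OF f f'] Lq.T_add[OF fz fz'] by simp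
  qed
  have "inj_on ?T (carrier (hom_space \<Lambda> ?J S))"
  proof -
    interpret LT: linear_map class_ring "hom_space \<Lambda> ?J S" "quot_mod ?V ?B" ?T by (rule T)
    have "f = \<zero>\<^bsub>hom_space \<Lambda> ?J S\<^esub>" if f: "f \<in> lhom \<Lambda> ?J S" "?T f = \<zero>\<^bsub>quot_mod ?V ?B\<^esub>" for f
    proof -
      have lf: "lh ?J S f" by (rule lhomD[OF f(1) fmD[OF fJ] fmD[OF fS]])
      have "pre (R (Suc 0)) g f \<in> ?B" using q(3)[of "pre (R (Suc 0)) g f"] preZ[OF f(1)] f(2) by simp
      then obtain u where u: "u \<in> lhom \<Lambda> (R 0) S" "pre (R (Suc 0)) g f = pre (R (Suc 0)) (d 0) u" by blast
      have lu: "lh (R 0) S u" by (rule lhomD[OF u(1) fmD[OF fR] fmD[OF fS]])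
      have fu: "f (\<psi> (d 0 x)) = u (d 0 x)" if "x \<in> carrier (R (Suc 0))" for x
        using fun_cong[OF u(2), of x] that by (simp add: pre_def g_def)
      \<comment> \<open>\<open>p \<theta> = p\<close>, and \<open>p\<close> is a cover, so
        \<open>\<theta>\<close> is onto, also on radicals. It is therefore enough that
        \<open>f\<close> vanishes on elements \<open>\<theta> x\<close>.\<close>
      define \<theta> where "\<theta> = (\<lambda>x. \<psi> (\<phi> x))"
      have l\<theta>: "lh P P \<theta>" unfolding \<theta>_def by (rule lh_comp[OF \<phi>(1) \<psi>(1)])
      have p\<theta>: "p (\<theta> x) = p x" if "x \<in> carrier P" for x
        using \<psi>(2)[OF lhD(3)[OF \<phi>(1) that]] \<phi>(2)[OF that] by (simp add: \<theta>_def)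
      have "\<theta> ` carrier P = carrier P"
        by (rule cover_surj[OF P(2) _ l\<theta>]) (use P(4) p\<theta> in \<open>auto cong: image_cong\<close>)
      from rj_image_surj[OF l\<theta> this] have \<theta>J: "\<theta> ` rj P = rj P" .
      have "f y = \<zero>\<^bsub>S\<^esub>" if y: "y \<in> rj P" for y
      proof -
        have "y \<in> \<theta> ` rj P" using y \<theta>J by simp
        then obtain x where x: "x \<in> rj P" "y = \<theta> x" by blast
        have xP: "x \<in> carrier P" using smodD(2)[OF RJ x(1)] .
        have "x \<in> lker P M p" using x(1) P(4) by simp
        then have "\<phi> x \<in> lker (R 0) M e" using \<phi>(2)[OF xP] lhD(3)[OF \<phi>(1) xP] by (simp add: lker_def)
        then obtain z where z: "z \<in> carrier (R (Suc 0))" "\<phi> x = d 0 z" using d0 by blast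
        have "f y = u (\<phi> x)" using fu[OF z(1)] z(2) x(2) by (simp add: \<theta>_def)
        also have "\<dots> = \<zero>\<^bsub>S\<^esub>" by (rule rj_simple_hom[OF S(2) lh_comp[OF \<phi>(1) lu] x(1)])
        finally show ?thesis .
      qed
      then have "f x = (\<lambda>x\<in>carrier ?J. \<zero>\<^bsub>S\<^esub>) x" if "x \<in> carrier ?J" for x using that by simp
      then show ?thesis using lhom_ext[OF f(1) lh_restrict[OF lh_const[OF fmD[OF fJ] fmD[OF fS]]]] by simp
    qed
    then have "LT.ker \<subseteq> {\<zero>\<^bsub>hom_space \<Lambda> ?J S\<^esub>}" unfolding LT.ker_def by auto
    moreover have "\<zero>\<^bsub>hom_space \<Lambda> ?J S\<^esub> \<in> LT.ker"
      using LT.kerT_is_subspace by (simp add: subspace_def LinearCombinations.submodule_def)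
    ultimately have "LT.ker = {\<zero>\<^bsub>hom_space \<Lambda> ?J S\<^esub>}" by auto
    then show ?thesis by (intro LT.Ke0_imp_inj) simp
  qed
  from fin_vs_inj(2)[OF T q(1) this] show ?thesis unfolding h_def EQ .
qed

section \<open>Modules without projective summands\<close>

text \<open>Projective modules are injective, so projective submodules are the same as projective
  summands; the form with submodules avoids carrying a complement.\<close>

definition proj_free :: "('a, 'k vec) module \<Rightarrow> bool" where
  "proj_free M \<longleftrightarrow> (\<forall>Q. smod Q M \<longrightarrow> sub M Q \<in> addcat \<Lambda> \<longrightarrow> Q = {\<zero>\<^bsub>M\<^esub>})"

text \<open>A projective submodule \<open>Q\<close> is a summand of \<open>P\<close>. As it lies in
  the radical of \<open>P\<close>, the retraction shows that it is its own radical, hence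
  zero.\<close>

lemma kernel_proj_free:
  assumes P: "P \<in> addcat \<Lambda>" and K: "smod K P" "K \<subseteq> rj P"
  shows "proj_free (sub P K)"
  unfolding proj_free_def
proof (intro allI impI)
  fix Q assume Q: "smod Q (sub P K)" "sub (sub P K) Q \<in> addcat \<Lambda>"
  note fP = addcatD(1)[OF P]
  have QP: "smod Q P" "Q \<subseteq> K" using Q(1) smod_sub_iff[OF fmD[OF fP] K(1)] by simp_all
  have QA: "sub P Q \<in> addcat \<Lambda>" using Q(2) by simp
  from projective_sub_retraction[OF fP QP(1) QA] obtain r where r: "lh P (sub P Q) r" "\<And>x. x \<in> Q \<Longrightarrow> r x = x"
    by blast
  have "x \<in> rj (sub P Q)" if x: "x \<in> Q" for x
    using rj_image[OF r(1), of x] x QP(2) K(2) r(2)[OF x] by auto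
  moreover have "rj (sub P Q) \<subseteq> Q" by (rule rj_sub(2)[OF fmD[OF fP] QP(1)])
  ultimately have "rj (sub P Q) = carrier (sub P Q)" by auto
  from rj_full[OF fmD[OF addcatD(1)[OF QA]] this] show "Q = {\<zero>\<^bsub>sub P K\<^esub>}" by simp
qed

text \<open>A complement \<open>L\<close> of the kernel in the socle of \<open>P\<close> embeds into \<open>M\<close>. As \<open>P\<close> is injective, the
  inclusion of \<open>L\<close> extends to a map \<open>M \<rightarrow> P\<close>, and the Fitting summand of \<open>P \<rightarrow> M \<rightarrow> P\<close> contains \<open>L\<close> and
  embeds into \<open>M\<close> as a projective submodule.\<close>

lemma sz_le_kernel:
  assumes P: "P \<in> addcat \<Lambda>" and p: "lh P M p" and M: "fm M" "proj_free M"
  shows "sz P \<subseteq> lker P M p"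
proof -
  note fP = addcatD(1)[OF P]
  note lP = fmD[OF fP]
  note Z = smod_sz[OF lP]
  let ?Z = "sub P (sz P)" and ?K = "lker P M p"
  have fZ: "fm ?Z" by (rule fm_sub(1)[OF fP Z])
  have lZ: "lm ?Z" by (rule fmD[OF fZ])
  have K: "smod ?K P" by (rule smod_lker[OF p])
  have KZ: "smod (?K \<inter> sz P) ?Z" using smod_sub_iff[OF lP Z] smod_Int[OF lP K Z] by simp
  have ssZ: "sz ?Z = carrier ?Z" by (rule sub_sz_semisimple[OF lP Z]) simp
  obtain r where r: "lh ?Z (sub ?Z (?K \<inter> sz P)) r" "\<And>x. x \<in> ?K \<inter> sz P \<Longrightarrow> r x = x"
    using semisimple_retraction[OF fZ ssZ KZ] by blast
  \<comment> \<open>A complement, within the socle, of the part that \<open>p\<close> kills; so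
    \<open>p\<close> is injective on it.\<close>
  define L where "L = lker ?Z (sub ?Z (?K \<inter> sz P)) r"
  have LZ: "smod L ?Z" unfolding L_def by (rule smod_lker[OF r(1)])
  have L: "smod L P" "L \<subseteq> sz P" using LZ smod_sub_iff[OF lP Z] by simp_all
  have rL: "r x = \<zero>\<^bsub>P\<^esub>" if "x \<in> L" for x using that by (simp add: L_def lker_def)
  have lpL: "lh (sub P L) M p" by (rule lh_sub_dom[OF p L(1)])
  have "x = \<zero>\<^bsub>P\<^esub>" if "x \<in> L" "p x = \<zero>\<^bsub>M\<^esub>" for x
  proof -
    have "x \<in> ?K \<inter> sz P" using that L(2) smodD(2)[OF L(1)] by (auto simp: lker_def)
    from r(2)[OF this] show ?thesis using rL[OF that(1)] by simp
  qed
  then have inj: "inj_on p (carrier (sub P L))" by (intro inj_onI_lh[OF lpL]) simp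
  obtain \<psi> where \<psi>: "lh M P \<psi>" "\<And>x. x \<in> carrier (sub P L) \<Longrightarrow> \<psi> (p x) = x"
    using injective_extend[OF addcatD(3)[OF P] M(1) lpL inj lh_incl[OF lP L(1)]] by blast
  define g where "g = (\<lambda>x. \<psi> (p x))"
  have g: "lh P P g" unfolding g_def by (rule lh_comp[OF p \<psi>(1)])
  obtain n where n: "sub P ((g ^^ Suc n) ` carrier P) \<in> addcat \<Lambda>" "smod ((g ^^ Suc n) ` carrier P) P"
    "inj_on (g ^^ Suc n) ((g ^^ Suc n) ` carrier P)" by (rule addcat_fitting[OF P g])
  define U where "U = (g ^^ Suc n) ` carrier P"
  note n = n[folded U_def]
  have gz: "(g ^^ k) \<zero>\<^bsub>P\<^esub> = \<zero>\<^bsub>P\<^esub>" for k by (rule lh_zero[OF lh_funpow[OF g]])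
  \<comment> \<open>\<open>p x = 0\<close> forces \<open>g x = 0\<close>, and a positive power of
    \<open>g\<close> is injective on \<open>U\<close>.\<close>
  have UK: "x = \<zero>\<^bsub>P\<^esub>" if x: "x \<in> U" "p x = \<zero>\<^bsub>M\<^esub>" for x
  proof -
    have "g x = \<zero>\<^bsub>P\<^esub>" using x(2) lh_zero[OF \<psi>(1)] by (simp add: g_def)
    then have "(g ^^ Suc n) x = (g ^^ Suc n) \<zero>\<^bsub>P\<^esub>" using gz[of n] gz[of "Suc n"] by (simp add: funpow_swap1)
    from inj_onD[OF n(3) this x(1) smodD(3)[OF n(2)]] show ?thesis .
  qed
  have lpU: "lh (sub P U) M p" by (rule lh_sub_dom[OF p n(2)])
  have pU: "smod (p ` U) M" by (rule smod_image[OF p n(2)])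
  have "inj_on p (carrier (sub P U))" by (rule inj_onI_lh[OF lpU]) (use UK in simp)
  then have "liso (sub P U) (sub M (p ` U)) p"
    unfolding liso_def bij_betw_def using lh_sub_cod[OF lpU pU] by simp
  from liso_retr(2)[OF this] have "sub M (p ` U) \<in> addcat \<Lambda>"
    by (rule addcat_retr[OF n(1) fm_sub(1)[OF M(1) pU]])
  then have pU0: "p ` U = {\<zero>\<^bsub>M\<^esub>}" using M(2) pU by (simp add: proj_free_def)
  \<comment> \<open>\<open>g\<close> is the identity on \<open>L\<close>, hence \<open>L\<close>
    lies in \<open>U\<close>, where \<open>p\<close> is injective and, since \<open>M\<close> has no
    projective submodules, also zero.\<close>
  have L0: "x = \<zero>\<^bsub>P\<^esub>" if x: "x \<in> L" for x
  proof -
    have "g x = x" using \<psi>(2)[of x] x by (simp add: g_def)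
    then have "(g ^^ k) x = x" for k by (induction k) simp_all
    then have "x \<in> U" unfolding U_def using smodD(2)[OF L(1) x] by (metis image_eqI)
    then show ?thesis using UK pU0 by blast
  qed
  show ?thesis
  proof
    fix x assume x: "x \<in> sz P"
    have xZ: "x \<in> carrier ?Z" using x by simp
    have rx: "r x \<in> ?K \<inter> sz P" using lhD(3)[OF r(1) xZ] by simp
    have rxZ: "r x \<in> carrier ?Z" using rx by simp
    have "r x = r (r x)" using r(2)[OF rx] by simp
    then have "x \<ominus>\<^bsub>?Z\<^esub> r x \<in> L" unfolding L_def using lker_eq[OF r(1) xZ rxZ] by blast
    then have "x \<ominus>\<^bsub>?Z\<^esub> r x = \<zero>\<^bsub>?Z\<^esub>" using L0 by simp
    then have "x = r x" using lm_rules(10)[OF lZ xZ rxZ] by blast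
    then show "x \<in> ?K" using rx by simp
  qed
qed


section \<open>The inequality between consecutive syzygies and its contradiction\<close>

context
  fixes r S assumes reps: "simple_reps \<Lambda> r S"
begin

lemma repsD: "i < r \<Longrightarrow> S i \<in> modcat \<Lambda>" "i < r \<Longrightarrow> fm (S i)" "i < r \<Longrightarrow> simp_mod (S i)"
  using reps by (simp_all add: simple_reps_def modcat_iff)

lemma quotient_rep:
  assumes M: "fm M" "carrier M \<noteq> {\<zero>\<^bsub>M\<^esub>}"
  obtains i g where "i < r" "lh M (S i) g" "g ` carrier M = carrier (S i)"
proof -
  have ne: "{\<zero>\<^bsub>M\<^esub>} \<noteq> carrier M" using M(2) by simp
  from simple_quotient_exists[OF M(1) smod_zero[OF fmD[OF M(1)]] ne]
  obtain X :: "('a, 'k vec) module" and g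
    where X: "X \<in> modcat \<Lambda>" "simp_mod X" "lh M X g" "g ` carrier M = carrier X"
    "{\<zero>\<^bsub>M\<^esub>} \<subseteq> lker M X g" .
  obtain i where i: "i < r" "lmod_iso \<Lambda> X (S i)" using reps X(1,2) by (auto simp: simple_reps_def)
  have lX: "lm X" using X(1) by (simp add: modcat_iff fm_def)
  obtain f where f: "liso X (S i) f" using i(2) lmod_iso_iff[OF lX fmD[OF repsD(2)[OF i(1)]]] by blast
  show ?thesis
  proof (rule that[OF i(1)])
    show "lh M (S i) (\<lambda>x. f (g x))" by (rule lh_comp[OF X(3) liso_lh(1)[OF f]])
    show "(\<lambda>x. f (g x)) ` carrier M = carrier (S i)"
      using liso_lh(3)[OF f] unfolding X(4)[symmetric] image_image .
  qed
qed

lemma simple_surj_nonzero: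
  assumes i: "i < r" and g: "lh M (S i) g" "g ` carrier M = carrier (S i)"
  obtains x where "x \<in> carrier M" "g x \<noteq> \<zero>\<^bsub>S i\<^esub>"
proof -
  obtain y where y: "y \<in> carrier (S i)" "y \<noteq> \<zero>\<^bsub>S i\<^esub>"
    using simple_nonzero[OF repsD(3)[OF i] fmD[OF repsD(2)[OF i]]] by blast
  then have "y \<in> g ` carrier M" using g(2) by simp
  then obtain x where "x \<in> carrier M" "y = g x" by blast
  then show ?thesis using that y(2) by blast
qed

text \<open>The source of the strict decrease: the constant \<open>-1\<close> in the inequality for
  the weights gets multiplied by this sum.\<close>

lemma sum_h_pos:
  assumes M: "fm M" "carrier M \<noteq> {\<zero>\<^bsub>M\<^esub>}"
  shows "1 \<le> (\<Sum>i<r. h M (S i))"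
proof -
  obtain i g where g: "i < r" "lh M (S i) g" "g ` carrier M = carrier (S i)" by (rule quotient_rep[OF M])
  obtain x where "x \<in> carrier M" "g x \<noteq> \<zero>\<^bsub>S i\<^esub>" by (rule simple_surj_nonzero[OF g])
  then have "1 \<le> h M (S i)" by (rule h_pos[OF M(1) repsD(2)[OF g(1)] g(2)])
  also have "\<dots> \<le> (\<Sum>i<r. h M (S i))" by (rule member_le_sum) (use g(1) in auto)
  finally show ?thesis .
qed

definition ext_dim :: "nat \<Rightarrow> nat \<Rightarrow> nat" where "ext_dim i j = vdim (Ext \<Lambda> 1 (S i) (S j))"

text \<open>Induction on dimension: \<open>P\<close> splits off the cover \<open>C\<close> of one of
  its simple quotients \<open>S i\<close>. For \<open>C\<close> the bound is
  \<open>h_rj_le_Ext\<close>, and both sides are compatible with the splitting.\<close>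

lemma h_rj_projective:
  assumes "P \<in> addcat \<Lambda>" and j: "j < r"
  shows "h (sub P (rj P)) (S j) \<le> (\<Sum>i<r. h P (S i) * ext_dim i j)"
  using assms(1)
proof (induction "dm P" arbitrary: P rule: less_induct)
  case less
  note P = less.prems
  note fP = addcatD(1)[OF P]
  note lP = fmD[OF fP]
  note Sj = repsD[OF j]
  note fJ = fm_sub(1)[OF fP rj(1)[OF lP]]
  show ?case
  proof (cases "carrier P = {\<zero>\<^bsub>P\<^esub>}")
    case True
    have "rj P = {\<zero>\<^bsub>P\<^esub>}" using smodD(1,3)[OF rj(1)[OF lP]] True by auto
    then show ?thesis using h_zero[OF fJ _ Sj(2)] by simp
  next
    case False
    obtain i q where i: "i < r" and q: "lh P (S i) q" "q ` carrier P = carrier (S i)"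
      by (rule quotient_rep[OF fP False])
    obtain C p where C: "C \<in> addcat \<Lambda>"
      and p: "lh C (S i) p" "p ` carrier C = carrier (S i)" "lker C (S i) p \<subseteq> rj C"
      by (rule projective_cover_exists[OF repsD(2)[OF i]])
    note kp = cover_simple(1)[OF repsD(3)[OF i] C p]
    note fC = addcatD(1)[OF C]
    \<comment> \<open>The lift of \<open>q\<close> to the cover \<open>C\<close> of the same simple
      module is onto, and projectivity of \<open>C\<close> splits it.\<close>
    obtain u where u: "lh P C u" "\<And>x. x \<in> carrier P \<Longrightarrow> p (u x) = q x"
      using projective_lift[OF addcatD(2)[OF P] fC p(1,2) q(1)] by blast
    have us: "u ` carrier P = carrier C"
      by (rule cover_surj[OF p(1,3) u(1)]) (use u(2) q(2) p(2) in \<open>simp cong: image_cong\<close>)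
    obtain s where s: "lh C P s" "\<And>x. x \<in> carrier C \<Longrightarrow> u (s x) = x"
      using projective_section[OF addcatD(2)[OF C] fP u(1) us] by blast
    define k where "k = (\<lambda>x. x \<ominus>\<^bsub>P\<^esub> s (u x))"
    define K where "K = lker P C u"
    have b: "bip C (sub P K) P s (\<lambda>x. x) u k" unfolding K_def k_def
      by (rule bip_retraction[OF s(1) u(1) s(2)])
    note b' = bipD[OF b]
    have K: "smod K P" unfolding K_def by (rule smod_lker[OF u(1)])
    have fK: "fm (sub P K)" by (rule fm_sub(1)[OF fP K])
    have KA: "sub P K \<in> addcat \<Lambda>" by (rule addcat_retr[OF P fK bip_retr(2)[OF b]])
    obtain x where x: "x \<in> carrier C" "p x \<noteq> \<zero>\<^bsub>S i\<^esub>" by (rule simple_surj_nonzero[OF i p(1,2)])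
    have "K \<noteq> carrier P"
    proof
      assume "K = carrier P"
      then have "s x \<in> K" using lhD(3)[OF s(1) x(1)] by simp
      then have "x = \<zero>\<^bsub>C\<^esub>" using s(2)[OF x(1)] by (simp add: K_def lker_def)
      then show False using x(2) lh_zero[OF p(1)] by simp
    qed
    then have "dm (sub P K) < dm P" by (rule dm_less[OF fP K])
    from less.hyps[OF this KA] have IH: "h (sub P (rj (sub P K))) (S j) \<le> (\<Sum>i<r. h (sub P K) (S i) * ext_dim
      i j)" by simp
    have hP: "h P (S m) = h (sub P K) (S m) + h C (S m)" if m: "m < r" for m
    proof (rule h_exact(2)[OF b'(2) u(1) us _ fK fP repsD(2)[OF m]])
      show "(\<lambda>x. x) ` carrier (sub P K) = lker P C u" by (simp add: K_def)
      fix g assume g: "lh (sub P K) (S m) g"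
      have "lh P (S m) (\<lambda>x. g (k x))" by (rule lh_comp[OF b'(4) g])
      moreover have "g (k y) = g y" if "y \<in> carrier (sub P K)" for y using b'(7)[OF that] by simp
      ultimately show "\<exists>g'. lh P (S m) g' \<and> (\<forall>x\<in>carrier (sub P K). g' x = g x)" by blast
    qed
    have rK: "rj (sub P K) \<subseteq> rj P" "rj (sub P K) \<subseteq> K" by (rule rj_sub[OF lP K])+
    have RK: "smod (rj (sub P K)) P" using rj(1)[OF fmD[OF fK]] smod_sub_iff[OF lP K] by simp
    note RP = rj(1)[OF lP]
    note RC = rj(1)[OF fmD[OF fC]]
    have uR: "u ` rj P = rj C" by (rule rj_image_surj[OF u(1) us])
    have RKP: "smod (rj (sub P K)) (sub P (rj P))" using smod_sub_iff[OF lP RP] RK rK(1) by simp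
    have "h (sub P (rj P)) (S j) \<le> h (sub P (rj (sub P K))) (S j) + h (sub C (rj C)) (S j)"
    proof (rule h_exact(1)[OF _ _ _ _ _ fJ Sj(2)])
      show "lh (sub P (rj (sub P K))) (sub P (rj P)) (\<lambda>x. x)" using lh_incl[OF fmD[OF fJ] RKP] by simp
      show "lh (sub P (rj P)) (sub C (rj C)) u"
        by (rule lh_sub_cod[OF lh_sub_dom[OF u(1) RP] RC]) (use uR in auto)
      show "u ` carrier (sub P (rj P)) = carrier (sub C (rj C))" using uR by simp
      show "fm (sub P (rj (sub P K)))" by (rule fm_sub(1)[OF fP RK])
      have "y \<in> rj (sub P K)" if y: "y \<in> rj P" "u y = \<zero>\<^bsub>C\<^esub>" for y
      proof -
        have "y \<in> K" using y smodD(2)[OF RP y(1)] by (simp add: K_def lker_def)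
        then have "k y = y" using b'(7)[of y] by simp
        then show ?thesis using rj_image[OF b'(4) y(1)] by simp
      qed
      then show "(\<lambda>x. x) ` carrier (sub P (rj (sub P K))) = lker (sub P (rj P)) (sub C (rj C)) u"
        using rK by (auto simp: lker_def K_def)
    qed
    also have "h (sub C (rj C)) (S j) \<le> ext_dim i j"
      unfolding ext_dim_def by (rule h_rj_le_Ext[OF repsD(1)[OF i] Sj(1,3) C p(1,2) kp])
    \<comment> \<open>The numbers \<open>h C (S m)\<close> are not computed: the term
      \<open>m = i\<close> alone is large enough, as its factor is at least
      \<open>1\<close>.\<close>
    also have "ext_dim i j \<le> (\<Sum>m<r. h C (S m) * ext_dim m j)"
    proof -
      have "1 \<le> h C (S i)" by (rule h_pos[OF fC repsD(2)[OF i] p(1) x])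
      then have "ext_dim i j \<le> h C (S i) * ext_dim i j" by simp
      also have "\<dots> \<le> (\<Sum>m<r. h C (S m) * ext_dim m j)" by (rule member_le_sum) (use i in auto)
      finally show ?thesis .
    qed
    also note IH
    also have "(\<Sum>m<r. h (sub P K) (S m) * ext_dim m j) + (\<Sum>m<r. h C (S m) * ext_dim m j) = (\<Sum>m<r. h P (S m)
      * ext_dim m j)"
      unfolding sum.distrib[symmetric] by (rule sum.cong) (simp_all add: hP add_mult_distrib)
    finally show ?thesis by simp
  qed
qed

text \<open>\<open>K\<close> is the kernel of a projective cover of \<open>M\<close>. The two bounds
  are kept apart because they are combined across steps: the first bound, from the step before,
  estimates the term with \<open>rad M\<close> in the second one.\<close>

lemma syzygy_step:
  assumes T: "thick \<Lambda> T" "contains_regular \<Lambda> T"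
    and none: "\<And>S. S \<in> modcat \<Lambda> \<Longrightarrow> simp_mod S \<Longrightarrow> S \<notin> T"
    and M: "M \<in> T" "carrier M \<noteq> {\<zero>\<^bsub>M\<^esub>}" "proj_free M"
  obtains K where "K \<in> T" "carrier K \<noteq> {\<zero>\<^bsub>K\<^esub>}" "proj_free K"
    "\<And>j. j < r \<Longrightarrow> h M (S j) \<le> h (sub K (rj K)) (S j)"
    "\<And>j. j < r \<Longrightarrow> h K (S j) + h (sub M (rj M)) (S j) \<le> (\<Sum>i<r. h M (S i) * ext_dim i j)"
proof -
  have fM: "fm M" by (rule thick_fm[OF T(1) M(1)])
  obtain P p where P: "P \<in> addcat \<Lambda>" and p: "lh P M p" "p ` carrier P = carrier M" "lker P M p \<subseteq> rj P"
    by (rule projective_cover_exists[OF fM])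
  note fP = addcatD(1)[OF P]
  note lP = fmD[OF fP]
  define N where "N = lker P M p"
  have N: "smod N P" unfolding N_def by (rule smod_lker[OF p(1)])
  have Nr: "N \<subseteq> rj P" using p(3) by (simp add: N_def)
  let ?K = "sub P N"
  have fK: "fm ?K" by (rule fm_sub(1)[OF fP N])
  have KT: "?K \<in> T" unfolding N_def by (rule thick_kernel(3)[OF T(1) p(1,2) fP addcatD(4)[OF P T] M(1)])
  have pf: "proj_free ?K" by (rule kernel_proj_free[OF P N Nr])
  have szN: "sz P \<subseteq> N" unfolding N_def by (rule sz_le_kernel[OF P p(1) fM M(3)])
  have szK: "sz ?K = sz P" using sz_sub[OF N] szN by auto
  note RP = rj(1)[OF lP]
  note RM = rj(1)[OF fmD[OF fM]]
  have fJ: "fm (sub P (rj P))" by (rule fm_sub(1)[OF fP RP])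
  have NJ: "smod N (sub P (rj P))" using smod_sub_iff[OF lP RP] N Nr by simp
  have "rj ?K \<subseteq> rj (sub P (rj P))" using rj_sub(1)[OF fmD[OF fJ] NJ] by simp
  also have rrz: "rj (sub P (rj P)) \<subseteq> sz P" by (rule rj_rj_sz[OF lP])
  \<comment> \<open>The chain closes up: \<open>soc K\<close> is \<open>soc P\<close>, and
    \<open>sz_le_rj\<close> puts it into the radical of \<open>K\<close>.\<close>
  finally have rjK: "rj ?K = sz P" using sz_le_rj[OF T(1) KT none] szK by auto
  \<comment> \<open>With zero kernel \<open>M\<close> would be projective, and so a nonzero
    projective submodule of itself.\<close>
  have nz: "carrier ?K \<noteq> {\<zero>\<^bsub>?K\<^esub>}"
  proof
    assume "carrier ?K = {\<zero>\<^bsub>?K\<^esub>}"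
    then have "lker P M p = {\<zero>\<^bsub>P\<^esub>}" by (simp add: N_def)
    then have "liso P M p" unfolding liso_def bij_betw_def using lh_inj_iff[OF p(1)] p(1,2) by simp
    from liso_retr(2)[OF this] have "M \<in> addcat \<Lambda>" by (rule addcat_retr[OF P fM])
    then have "sub M (carrier M) \<in> addcat \<Lambda>" by simp
    from M(3)[unfolded proj_free_def, rule_format, OF smod_carrier[OF fmD[OF fM]] this] show False
      using M(2) by simp
  qed
  have hM: "h M (S j) = h P (S j)" if j: "j < r" for j
  proof (rule h_eq[OF p(1,2) fP repsD(2)[OF j]])
    fix g x assume g: "lh P (S j) g" and "x \<in> lker P M p"
    then have "x \<in> rj P" using p(3) by blast
    then show "g x = \<zero>\<^bsub>S j\<^esub>" by (rule rj_simple_hom[OF repsD(3)[OF j] g])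
  qed
  show ?thesis
  proof (rule that[OF KT nz pf])
    fix j assume j: "j < r"
    note Sj = repsD[OF j]
    obtain t where t: "lh P (sub P (sz P)) t" "t ` carrier P = sz P" "lker P (sub P (sz P)) t = rj P"
      by (rule soc_top[OF P])
    have "h (sub P (sz P)) (S j) = h P (S j)"
    proof (rule h_eq[OF t(1) _ fP Sj(2)])
      show "t ` carrier P = carrier (sub P (sz P))" using t(2) by simp
      show "g x = \<zero>\<^bsub>S j\<^esub>" if "lh P (S j) g" "x \<in> lker P (sub P (sz P)) t" for g x
        using rj_simple_hom[OF Sj(3) that(1)] that(2) unfolding t(3) .
    qed
    then show "h M (S j) \<le> h (sub ?K (rj ?K)) (S j)" using hM[OF j] rjK by simp
    have pR: "p ` rj P = rj M" by (rule rj_image_surj[OF p(1,2)])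
    have "h ?K (S j) + h (sub M (rj M)) (S j) = h (sub P (rj P)) (S j)"
    proof (rule h_exact(2)[symmetric, OF _ _ _ _ fK fJ Sj(2)])
      show "lh ?K (sub P (rj P)) (\<lambda>x. x)" using lh_incl[OF fmD[OF fJ] NJ] by simp
      show "lh (sub P (rj P)) (sub M (rj M)) p"
        by (rule lh_sub_cod[OF lh_sub_dom[OF p(1) RP] RM]) (use pR in auto)
      show "p ` carrier (sub P (rj P)) = carrier (sub M (rj M))" using pR by simp
      show "(\<lambda>x. x) ` carrier ?K = lker (sub P (rj P)) (sub M (rj M)) p"
        using Nr smodD(2)[OF RP] by (auto simp: lker_def N_def)
      fix g assume g: "lh ?K (S j) g"
      have g': "lh (sub (sub P (rj P)) N) (S j) g" using g by simp
      \<comment> \<open>Maps to simple modules kill the radical of \<open>K\<close>. It equals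
        \<open>soc P\<close> and contains \<open>rad(rad P)\<close>, which is what the extension to
        \<open>rad P\<close> needs.\<close>
      have "\<exists>g'. lh (sub P (rj P)) (S j) g' \<and> (\<forall>x\<in>N. g' x = g x)"
      proof (rule extend_to_simple[OF fJ NJ g'])
        fix x assume "x \<in> N" "x \<in> rj (sub P (rj P))"
        then have "x \<in> rj ?K" using rrz rjK by blast
        then show "g x = \<zero>\<^bsub>S j\<^esub>" by (rule rj_simple_hom[OF Sj(3) g])
      qed
      then show "\<exists>g'. lh (sub P (rj P)) (S j) g' \<and> (\<forall>x\<in>carrier ?K. g' x = g x)" by simp
    qed
    also have "h (sub P (rj P)) (S j) \<le> (\<Sum>i<r. h P (S i) * ext_dim i j)" by (rule h_rj_projective[OF P j])
    also have "\<dots> = (\<Sum>i<r. h M (S i) * ext_dim i j)" by (rule sum.cong) (simp_all add: hM)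
    finally show "h ?K (S j) + h (sub M (rj M)) (S j) \<le> (\<Sum>i<r. h M (S i) * ext_dim i j)" by simp
  qed
qed

lemma full_thick:
  assumes T: "thick \<Lambda> T" "contains_regular \<Lambda> T" and ind: "indecomposable_alg \<Lambda>"
    and sr: "spectral_radius (ext_matrix \<Lambda> r S) < 2" and X: "X \<in> T" "X \<notin> addcat \<Lambda>"
  shows "T = modcat \<Lambda>"
proof -
  have fX: "fm X" by (rule thick_fm[OF T(1) X(1)])
  have "\<exists>S\<in>T. simp_mod S"
  proof (rule ccontr)
    assume "\<not> (\<exists>S\<in>T. simp_mod S)"
    then have none: "\<And>S. S \<in> modcat \<Lambda> \<Longrightarrow> simp_mod S \<Longrightarrow> S \<notin> T" by blast
    define I where "I = (\<lambda>M. M \<in> T \<and> carrier M \<noteq> {\<zero>\<^bsub>M\<^esub>} \<and> proj_free M)"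
    \<comment> \<open>The sequence starts with the first syzygy of \<open>X\<close>: a kernel inside
      the radical has no projective submodules, whereas \<open>X\<close> may have some.\<close>
    obtain P p where P: "P \<in> addcat \<Lambda>" and p: "lh P X p" "p ` carrier P = carrier X" "lker P X p \<subseteq> rj P"
      by (rule projective_cover_exists[OF fX])
    let ?K = "sub P (lker P X p)"
    have "I ?K" unfolding I_def
    proof (intro conjI)
      show "?K \<in> T" by (rule thick_kernel(3)[OF T(1) p(1,2) addcatD(1)[OF P] addcatD(4)[OF P T] X(1)])
      show "proj_free ?K" by (rule kernel_proj_free[OF P smod_lker[OF p(1)] p(3)])
      show "carrier ?K \<noteq> {\<zero>\<^bsub>?K\<^esub>}"
      proof
        assume "carrier ?K = {\<zero>\<^bsub>?K\<^esub>}"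
        then have "liso P X p" unfolding liso_def bij_betw_def using lh_inj_iff[OF p(1)] p(1,2) by simp
        from addcat_retr[OF P fX liso_retr(2)[OF this]] show False using X(2) by simp
      qed
    qed
    then have start: "\<exists>M. I M" by blast
    define R where "R = (\<lambda>(M :: ('a, 'k vec) module) (K :: ('a, 'k vec) module). (\<forall>j<r. h M (S j) \<le> h (sub K
      (rj K)) (S j)) \<and>
      (\<forall>j<r. h K (S j) + h (sub M (rj M)) (S j) \<le> (\<Sum>i<r. h M (S i) * ext_dim i j)))"
    have step: "\<exists>K. I K \<and> R M K" if "I M" for M
    proof -
      from that have M: "M \<in> T" "carrier M \<noteq> {\<zero>\<^bsub>M\<^esub>}" "proj_free M" by (simp_all add: I_def)
      from syzygy_step[OF T none M] obtain K where "K \<in> T" "carrier K \<noteq> {\<zero>\<^bsub>K\<^esub>}" "proj_free K"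
        "\<And>j. j < r \<Longrightarrow> h M (S j) \<le> h (sub K (rj K)) (S j)"
        "\<And>j. j < r \<Longrightarrow> h K (S j) + h (sub M (rj M)) (S j) \<le> (\<Sum>i<r. h M (S i) * ext_dim i j)" by blast
      then have "I K \<and> R M K" by (simp add: I_def R_def)
      then show ?thesis by blast
    qed
    from dependent_nat_choice[of "\<lambda>n M. I M" "\<lambda>n M K. R M K", OF start step]
    obtain f where f: "\<And>n. I (f n)" "\<And>n. R (f n) (f (Suc n))" by blast
    have ff: "fm (f n)" for n using f(1)[of n] thick_fm[OF T(1)] by (simp add: I_def)
    have hr: "1 \<le> (\<Sum>i<r. h (f n) (S i))" for n
      by (rule sum_h_pos[OF ff]) (use f(1)[of n] in \<open>simp add: I_def\<close>)
    have r: "0 < r" using hr[of 0] by (cases r) auto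
    have "ext_matrix \<Lambda> r S = mat r r (\<lambda>(i, j). of_nat (ext_dim i j))"
      by (simp add: ext_matrix_def ext_dim_def)
    with sr have "spectral_radius (mat r r (\<lambda>(i, j). of_nat (ext_dim i j) :: complex)) < 2" by simp
    from spectral_radius_weights[OF this r] obtain v :: "nat \<Rightarrow> real"
      where v: "\<And>i. 0 \<le> v i" "\<And>i. i < r \<Longrightarrow> (\<Sum>j<r. ext_dim i j * v j) \<le> 2 * v i - 1" by blast
    define a where "a = (\<lambda>n. \<Sum>j<r. h (f n) (S j) * v j)"
    have "a (Suc (Suc n)) + a n \<le> 2 * a (Suc n) - 1" for n
    proof -
      let ?M = "f (Suc n)"
      have "a (Suc (Suc n)) + a n = (\<Sum>j<r. (h (f (Suc (Suc n))) (S j) + h (f n) (S j)) * v j)"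
        by (simp add: a_def sum.distrib distrib_right)
      also have "\<dots> \<le> (\<Sum>j<r. (\<Sum>i<r. h ?M (S i) * ext_dim i j) * v j)"
      proof (rule sum_mono)
        fix j assume "j \<in> {..<r}"
        then have j: "j < r" by simp
        \<comment> \<open>The first bound is used at step \<open>n\<close>, the second at step
          \<open>n + 1\<close>.\<close>
        have "h (f n) (S j) \<le> h (sub ?M (rj ?M)) (S j)" using f(2)[of n] j by (simp add: R_def)
        moreover have "h (f (Suc (Suc n))) (S j) + h (sub ?M (rj ?M)) (S j) \<le> (\<Sum>i<r. h ?M (S i) * ext_dim i
          j)"
          using f(2)[of "Suc n"] j by (simp add: R_def)
        ultimately have "h (f (Suc (Suc n))) (S j) + h (f n) (S j) \<le> (\<Sum>i<r. h ?M (S i) * ext_dim i j)"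
          by linarith
        then have "real (h (f (Suc (Suc n))) (S j) + h (f n) (S j)) \<le> real (\<Sum>i<r. h ?M (S i) * ext_dim i j)"
          by (simp only: of_nat_le_iff)
        then show "(h (f (Suc (Suc n))) (S j) + h (f n) (S j)) * v j \<le> (\<Sum>i<r. h ?M (S i) * ext_dim i j) * v
          j"
          by (rule mult_right_mono[OF _ v(1)])
      qed
      \<comment> \<open>The identity \<open>(h E) v = h (E v)\<close>; afterwards the weights act on
        each row of \<open>E\<close>.\<close>
      also have "\<dots> = (\<Sum>i<r. h ?M (S i) * (\<Sum>j<r. ext_dim i j * v j))"
      proof -
        have "(\<Sum>j<r. real (\<Sum>i<r. h ?M (S i) * ext_dim i j) * v j) = (\<Sum>j<r. \<Sum>i<r. h ?M (S i) * (ext_dim i j *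
          v j))"
          by (simp add: sum_distrib_right mult.assoc)
        also have "\<dots> = (\<Sum>i<r. \<Sum>j<r. h ?M (S i) * (ext_dim i j * v j))" by (rule sum.swap)
        finally show ?thesis by (simp add: sum_distrib_left)
      qed
      also have "\<dots> \<le> (\<Sum>i<r. h ?M (S i) * (2 * v i - 1))"
        by (rule sum_mono, rule mult_left_mono) (use v(2) in auto)
      also have "\<dots> = 2 * a (Suc n) - real (\<Sum>i<r. h ?M (S i))"
      proof -
        have "h ?M (S i) * (2 * v i - 1) = 2 * (h ?M (S i) * v i) - h ?M (S i)" for i
          by (simp add: algebra_simps)
        then show ?thesis by (simp add: a_def sum_subtractf sum_distrib_left)
      qed
      also have "\<dots> \<le> 2 * a (Suc n) - 1" using hr[of "Suc n"] by linarith
      finally show ?thesis .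
    qed
    moreover have "0 \<le> a n" for n unfolding a_def by (intro sum_nonneg mult_nonneg_nonneg v(1)) simp
    ultimately show False by (rule no_nonneg_concave[rotated])
  qed
  then obtain S0 where S0: "S0 \<in> T" "simp_mod S0" by blast
  have "M \<in> T" if "M \<in> modcat \<Lambda>" for M
    by (rule full_of_simples[OF T all_simples[OF T ind S0] that])
  moreover have "T \<subseteq> modcat \<Lambda>" using T(1) by (simp add: thick_def)
  ultimately show ?thesis by blast
qed

end

lemma thick_modcat: "thick \<Lambda> (modcat \<Lambda>)"
  unfolding thick_def by blast

end

theorem proposition4p4:
  fixes \<Lambda> :: "('k::field, 'a) module"
    and r :: nat
    and S :: "nat \<Rightarrow> ('a, 'k vec) module"
  assumes "fd_algebra \<Lambda>"
    and "split_alg \<Lambda>"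
    and "indecomposable_alg \<Lambda>"
    and "weakly_symmetric \<Lambda>"
    and "radical_cube_zero \<Lambda>"
    and "simple_reps \<Lambda> r S"
    and "spectral_radius (ext_matrix \<Lambda> r S) < 2"
  shows "{T. thick \<Lambda> T \<and> contains_regular \<Lambda> T} = {addcat \<Lambda>, modcat \<Lambda>}"
proof -
  have k: "k_algebra \<Lambda>" and fd: "vectorspace.fin_dim class_ring \<Lambda>" using assms(1)
    by (simp_all add: fd_algebra_def)
  interpret k_algebra \<Lambda> by (rule k)
  interpret wsalg \<Lambda>
    by unfold_locales (use k fd assms(4,5) vectorspace_axioms in \<open>simp_all add: fin_vs_def\<close>)
  have "T = addcat \<Lambda> \<or> T = modcat \<Lambda>" if T: "thick \<Lambda> T" "contains_regular \<Lambda> T" for T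
  \<comment> \<open>All projective modules belong to \<open>T\<close>, so either \<open>T\<close>
    consists of them or it has an object to which \<open>full_thick\<close> applies.\<close>
  proof (cases "T \<subseteq> addcat \<Lambda>")
    case True
    moreover have "addcat \<Lambda> \<subseteq> T" using addcatD(4)[OF _ T] by blast
    ultimately show ?thesis by blast
  next
    case False
    then obtain X where "X \<in> T" "X \<notin> addcat \<Lambda>" by blast
    then show ?thesis using full_thick[OF assms(6) T assms(3,7)] by blast
  qed
  moreover have "contains_regular \<Lambda> (modcat \<Lambda>)"
    using contains_regular_addcat by (auto simp: contains_regular_def addcat_def)
  ultimately show ?thesis using thick_addcat contains_regular_addcat thick_modcat by blast
qed

end
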